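(* Let $\mathcal{M}$ be a model category and let $T$ be a monad on $\mathcal{M}$ preserving weak equivalences and cofibrant objects. Let $f$ be a map in $\mathcal{M}$ between cofibrant objects such that $L_f$ and $L_{Tf}$ exist. If $T$ preserves $f$-equivalences between cofibrant objects and $Tf$-equivalences between cofibrant objects, then $$L_fX\simeq L_{Tf}X$$ whenever $X$ underlies a $T$-algebra up to homotopy.
   Context: Model categories are assumed to have functorial factorizations. $\mathrm{map}_{\mathcal{M}}(-,-)$ denotes a homotopy function complex in $\mathcal{M}$. For a map $f$, an object $X$ is $f$-local if $\mathrm{map}_{\mathcal{M}}(f,X)$ is a weak equivalence of simplicial sets ($f$-local objects need not be fibrant); a map $g$ is an $f$-equivalence if $\mathrm{map}_{\mathcal{M}}(g,X)$ is a weak equivalence for every $f$-local $X$. An $f$-localization of $X$ is a map $l_X\colon X\to L_fX$ that is a trivial cofibration, with $L_fX$ fibrant, in the left Bousfield localization $\mathcal{M}_f$ (same underlying category and cofibrations as $\mathcal{M}$, weak equivalences the $f$-equivalences, fibrant objects those that are fibrant in $\mathcal{M}$ and $f$-local); thus $L_f$ is a fibrant replacement functor on $\mathcal{M}_f$ and induces a localization on $\mathrm{Ho}(\mathcal{M})$. Since $T$ preserves weak equivalences, it descends to a monad on $\mathrm{Ho}(\mathcal{M})$. A $T$-algebra up to homotopy is an algebra over this monad, i.e. an object of the Eilenberg--Moore category $\mathrm{Ho}(\mathcal{M})^T$. *)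

theory Defs
  imports "HOL-Homology.Simplices" "HOL-Analysis.Sum_Topology"
begin

unbundle cardinal_syntax

section \<open>Categories, functors, limits\<close>

record ('o, 'm) cat =
  Ob :: "'o set"
  Ar :: "'m set"
  Dom :: "'m \<Rightarrow> 'o"
  Cod :: "'m \<Rightarrow> 'o"
  Ide :: "'o \<Rightarrow> 'm"
  Comp :: "'m \<Rightarrow> 'm \<Rightarrow> 'm" (infixl \<open>\<cdot>\<index>\<close> 70)

definition Hom :: "('o, 'm, 'z) cat_scheme \<Rightarrow> 'o \<Rightarrow> 'o \<Rightarrow> 'm set" where
  "Hom C X Y = {f \<in> Ar C. Dom C f = X \<and> Cod C f = Y}"

locale category =
  fixes C :: "('o, 'm, 'z) cat_scheme" (structure)
  assumes Dom_Ob: "f \<in> Ar C \<Longrightarrow> Dom C f \<in> Ob C"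
    and Cod_Ob: "f \<in> Ar C \<Longrightarrow> Cod C f \<in> Ob C"
    and Ide_Hom: "X \<in> Ob C \<Longrightarrow> Ide C X \<in> Hom C X X"
    and Comp_Hom: "\<lbrakk>f \<in> Hom C X Y; g \<in> Hom C Y Z\<rbrakk> \<Longrightarrow> g \<cdot> f \<in> Hom C X Z"
    and Comp_assoc: "\<lbrakk>f \<in> Hom C W X; g \<in> Hom C X Y; h \<in> Hom C Y Z\<rbrakk>
      \<Longrightarrow> (h \<cdot> g) \<cdot> f = h \<cdot> (g \<cdot> f)"
    and Comp_Ide: "f \<in> Hom C X Y \<Longrightarrow> f \<cdot> Ide C X = f"
    and Ide_Comp: "f \<in> Hom C X Y \<Longrightarrow> Ide C Y \<cdot> f = f"

record ('o, 'm, 'p, 'n) functr =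
  onOb :: "'o \<Rightarrow> 'p"
  onAr :: "'m \<Rightarrow> 'n"

definition is_functor ::
  "('o, 'm, 'z) cat_scheme \<Rightarrow> ('p, 'n, 'w) cat_scheme \<Rightarrow> ('o, 'm, 'p, 'n) functr \<Rightarrow> bool" where
  "is_functor C D F \<longleftrightarrow>
     (\<forall>X\<in>Ob C. onOb F X \<in> Ob D) \<and>
     (\<forall>f\<in>Ar C. onAr F f \<in> Hom D (onOb F (Dom C f)) (onOb F (Cod C f))) \<and>
     (\<forall>X\<in>Ob C. onAr F (Ide C X) = Ide D (onOb F X)) \<and>
     (\<forall>f\<in>Ar C. \<forall>g\<in>Ar C. Cod C f = Dom C g \<longrightarrow>
        onAr F (g \<cdot>\<^bsub>C\<^esub> f) = onAr F g \<cdot>\<^bsub>D\<^esub> onAr F f)"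

definition id_functor :: "('o, 'm, 'o, 'm) functr" where
  "id_functor = \<lparr>onOb = (\<lambda>X. X), onAr = (\<lambda>f. f)\<rparr>"

definition comp_functor ::
  "('p, 'n, 'q, 'l) functr \<Rightarrow> ('o, 'm, 'p, 'n) functr \<Rightarrow> ('o, 'm, 'q, 'l) functr" where
  "comp_functor G F = \<lparr>onOb = onOb G \<circ> onOb F, onAr = onAr G \<circ> onAr F\<rparr>"

definition const_functor :: "('p, 'n, 'w) cat_scheme \<Rightarrow> 'p \<Rightarrow> ('o, 'm, 'p, 'n) functr" where
  "const_functor D X = \<lparr>onOb = (\<lambda>_. X), onAr = (\<lambda>_. Ide D X)\<rparr>"

definition nat_trans ::
  "('o, 'm, 'z) cat_scheme \<Rightarrow> ('p, 'n, 'w) cat_scheme \<Rightarrow>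
   ('o, 'm, 'p, 'n) functr \<Rightarrow> ('o, 'm, 'p, 'n) functr \<Rightarrow> ('o \<Rightarrow> 'n) \<Rightarrow> bool" where
  "nat_trans C D F G \<alpha> \<longleftrightarrow>
     (\<forall>X\<in>Ob C. \<alpha> X \<in> Hom D (onOb F X) (onOb G X)) \<and>
     (\<forall>f\<in>Ar C. \<alpha> (Cod C f) \<cdot>\<^bsub>D\<^esub> onAr F f = onAr G f \<cdot>\<^bsub>D\<^esub> \<alpha> (Dom C f))"

definition is_cone where
  "is_cone J C D L \<pi> \<longleftrightarrow> L \<in> Ob C \<and>
     (\<forall>j\<in>Ob J. \<pi> j \<in> Hom C L (onOb D j)) \<and>
     (\<forall>u\<in>Ar J. onAr D u \<cdot>\<^bsub>C\<^esub> \<pi> (Dom J u) = \<pi> (Cod J u))"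

definition is_limit ::
  "('i, 'j, 'z) cat_scheme \<Rightarrow> ('o, 'm, 'w) cat_scheme \<Rightarrow> ('i, 'j, 'o, 'm) functr \<Rightarrow>
   'o \<Rightarrow> ('i \<Rightarrow> 'm) \<Rightarrow> bool" where
  "is_limit J C D L \<pi> \<longleftrightarrow> is_cone J C D L \<pi> \<and>
     (\<forall>L' \<pi>'. is_cone J C D L' \<pi>' \<longrightarrow>
        (\<exists>!h. h \<in> Hom C L' L \<and> (\<forall>j\<in>Ob J. \<pi> j \<cdot>\<^bsub>C\<^esub> h = \<pi>' j)))"

definition is_cocone where
  "is_cocone J C D L \<iota> \<longleftrightarrow> L \<in> Ob C \<and>
     (\<forall>j\<in>Ob J. \<iota> j \<in> Hom C (onOb D j) L) \<and>
     (\<forall>u\<in>Ar J. \<iota> (Cod J u) \<cdot>\<^bsub>C\<^esub> onAr D u = \<iota> (Dom J u))"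

definition is_colimit ::
  "('i, 'j, 'z) cat_scheme \<Rightarrow> ('o, 'm, 'w) cat_scheme \<Rightarrow> ('i, 'j, 'o, 'm) functr \<Rightarrow>
   'o \<Rightarrow> ('i \<Rightarrow> 'm) \<Rightarrow> bool" where
  "is_colimit J C D L \<iota> \<longleftrightarrow> is_cocone J C D L \<iota> \<and>
     (\<forall>L' \<iota>'. is_cocone J C D L' \<iota>' \<longrightarrow>
        (\<exists>!h. h \<in> Hom C L L' \<and> (\<forall>j\<in>Ob J. h \<cdot>\<^bsub>C\<^esub> \<iota> j = \<iota>' j)))"

definition initial :: "('o, 'm, 'z) cat_scheme \<Rightarrow> 'o \<Rightarrow> bool" where
  "initial C I \<longleftrightarrow> I \<in> Ob C \<and> (\<forall>X\<in>Ob C. \<exists>!f. f \<in> Hom C I X)"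

definition terminal :: "('o, 'm, 'z) cat_scheme \<Rightarrow> 'o \<Rightarrow> bool" where
  "terminal C I \<longleftrightarrow> I \<in> Ob C \<and> (\<forall>X\<in>Ob C. \<exists>!f. f \<in> Hom C X I)"

section \<open>Monads and their algebras\<close>

locale monad = category C for C :: "('o, 'm, 'z) cat_scheme" +
  fixes T :: "('o, 'm, 'o, 'm) functr" and \<eta> \<mu> :: "'o \<Rightarrow> 'm"
  assumes functor_T: "is_functor C C T"
    and unit: "nat_trans C C id_functor T \<eta>"
    and mult: "nat_trans C C (comp_functor T T) T \<mu>"
    and mult_assoc: "X \<in> Ob C \<Longrightarrow> \<mu> X \<cdot>\<^bsub>C\<^esub> onAr T (\<mu> X) = \<mu> X \<cdot>\<^bsub>C\<^esub> \<mu> (onOb T X)"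
    and unit_left: "X \<in> Ob C \<Longrightarrow> \<mu> X \<cdot>\<^bsub>C\<^esub> \<eta> (onOb T X) = Ide C (onOb T X)"
    and unit_right: "X \<in> Ob C \<Longrightarrow> \<mu> X \<cdot>\<^bsub>C\<^esub> onAr T (\<eta> X) = Ide C (onOb T X)"

text \<open>\<open>(X, a)\<close> is an object of the Eilenberg--Moore category of the monad \<open>(T, \<eta>, \<mu>)\<close>.\<close>

definition EM_algebra ::
  "('o, 'm, 'z) cat_scheme \<Rightarrow> ('o, 'm, 'o, 'm) functr \<Rightarrow> ('o \<Rightarrow> 'm) \<Rightarrow> ('o \<Rightarrow> 'm) \<Rightarrow>
   'o \<Rightarrow> 'm \<Rightarrow> bool" where
  "EM_algebra C T \<eta> \<mu> X a \<longleftrightarrow> X \<in> Ob C \<and> a \<in> Hom C (onOb T X) X \<and>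
     a \<cdot>\<^bsub>C\<^esub> \<eta> X = Ide C X \<and>
     a \<cdot>\<^bsub>C\<^esub> onAr T a = a \<cdot>\<^bsub>C\<^esub> \<mu> X"

section \<open>Model categories\<close>

record ('o, 'm) mcat = "('o, 'm) cat" +
  weq :: "'m set"
  fib :: "'m set"
  cof :: "'m set"

definition square :: "('o, 'm, 'z) cat_scheme \<Rightarrow> 'm \<Rightarrow> 'm \<Rightarrow> 'm \<Rightarrow> 'm \<Rightarrow> bool" where
  "square C f g u v \<longleftrightarrow> f \<in> Ar C \<and> g \<in> Ar C \<and>
     u \<in> Hom C (Dom C f) (Dom C g) \<and> v \<in> Hom C (Cod C f) (Cod C g) \<and>
     g \<cdot>\<^bsub>C\<^esub> u = v \<cdot>\<^bsub>C\<^esub> f"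

definition retract_of_arrow :: "('o, 'm, 'z) cat_scheme \<Rightarrow> 'm \<Rightarrow> 'm \<Rightarrow> bool" where
  "retract_of_arrow C g f \<longleftrightarrow>
     (\<exists>i j r s. square C g f i j \<and> square C f g r s \<and>
        r \<cdot>\<^bsub>C\<^esub> i = Ide C (Dom C g) \<and> s \<cdot>\<^bsub>C\<^esub> j = Ide C (Cod C g))"

definition has_lifting :: "('o, 'm, 'z) cat_scheme \<Rightarrow> 'm \<Rightarrow> 'm \<Rightarrow> bool" where
  "has_lifting C i p \<longleftrightarrow>
     (\<forall>u v. square C i p u v \<longrightarrow>
        (\<exists>h \<in> Hom C (Cod C i) (Dom C p). h \<cdot>\<^bsub>C\<^esub> i = u \<and> p \<cdot>\<^bsub>C\<^esub> h = v))"

definition has_functorial_factorization ::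
  "('o, 'm, 'z) cat_scheme \<Rightarrow> 'm set \<Rightarrow> 'm set \<Rightarrow> bool" where
  "has_functorial_factorization C \<L> \<R> \<longleftrightarrow>
     (\<exists>E a b k.
        (\<forall>f\<in>Ar C. a f \<in> \<L> \<inter> Hom C (Dom C f) (E f) \<and> b f \<in> \<R> \<inter> Hom C (E f) (Cod C f) \<and>
           b f \<cdot>\<^bsub>C\<^esub> a f = f) \<and>
        (\<forall>f g u v. square C f g u v \<longrightarrow>
           k f g u v \<in> Hom C (E f) (E g) \<and>
           k f g u v \<cdot>\<^bsub>C\<^esub> a f = a g \<cdot>\<^bsub>C\<^esub> u \<and> b g \<cdot>\<^bsub>C\<^esub> k f g u v = v \<cdot>\<^bsub>C\<^esub> b f) \<and>
        (\<forall>f\<in>Ar C. k f f (Ide C (Dom C f)) (Ide C (Cod C f)) = Ide C (E f)) \<and>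
        (\<forall>f g h u v u' v'. square C f g u v \<longrightarrow> square C g h u' v' \<longrightarrow>
           k f h (u' \<cdot>\<^bsub>C\<^esub> u) (v' \<cdot>\<^bsub>C\<^esub> v) = k g h u' v' \<cdot>\<^bsub>C\<^esub> k f g u v))"

text \<open>
  Completeness and cocompleteness depend on a notion of smallness. Here a set is small if its
  cardinality is below a fixed infinite cardinal \<open>\<kappa>\<close> (for instance an inaccessible one, which is
  the usual convention relative to a universe). Index categories may be taken to live on the type
  of \<open>\<kappa>\<close> itself. Since \<open>\<kappa>\<close> is infinite, all finite diagrams are small.
\<close>

locale model_category = category M
  for \<kappa> :: "'k rel" and M :: "('o, 'm) mcat" +
  assumes kappa: "Cinfinite \<kappa>"
    and limits: "\<And>(J :: ('k, 'k) cat) D. \<lbrakk>category J; |Ar J| <o \<kappa>; is_functor J M D\<rbrakk>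
      \<Longrightarrow> \<exists>L \<pi>. is_limit J M D L \<pi>"
    and colimits: "\<And>(J :: ('k, 'k) cat) D. \<lbrakk>category J; |Ar J| <o \<kappa>; is_functor J M D\<rbrakk>
      \<Longrightarrow> \<exists>L \<iota>. is_colimit J M D L \<iota>"
    and weq_Ar: "weq M \<subseteq> Ar M" and fib_Ar: "fib M \<subseteq> Ar M" and cof_Ar: "cof M \<subseteq> Ar M"
    and two_of_three: "\<lbrakk>f \<in> Hom M X Y; g \<in> Hom M Y Z\<rbrakk> \<Longrightarrow>
      (f \<in> weq M \<and> g \<in> weq M \<longrightarrow> g \<cdot>\<^bsub>M\<^esub> f \<in> weq M) \<and>
      (f \<in> weq M \<and> g \<cdot>\<^bsub>M\<^esub> f \<in> weq M \<longrightarrow> g \<in> weq M) \<and>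
      (g \<in> weq M \<and> g \<cdot>\<^bsub>M\<^esub> f \<in> weq M \<longrightarrow> f \<in> weq M)"
    and weq_retract: "\<lbrakk>retract_of_arrow M g f; f \<in> weq M\<rbrakk> \<Longrightarrow> g \<in> weq M"
    and fib_retract: "\<lbrakk>retract_of_arrow M g f; f \<in> fib M\<rbrakk> \<Longrightarrow> g \<in> fib M"
    and cof_retract: "\<lbrakk>retract_of_arrow M g f; f \<in> cof M\<rbrakk> \<Longrightarrow> g \<in> cof M"
    and lift_cof: "\<lbrakk>i \<in> cof M; p \<in> fib M \<inter> weq M\<rbrakk> \<Longrightarrow> has_lifting M i p"
    and lift_tcof: "\<lbrakk>i \<in> cof M \<inter> weq M; p \<in> fib M\<rbrakk> \<Longrightarrow> has_lifting M i p"
    and factor_cof: "has_functorial_factorization M (cof M) (fib M \<inter> weq M)"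
    and factor_tcof: "has_functorial_factorization M (cof M \<inter> weq M) (fib M)"

definition cofibrant :: "('o, 'm) mcat \<Rightarrow> 'o \<Rightarrow> bool" where
  "cofibrant M X \<longleftrightarrow> X \<in> Ob M \<and> (\<exists>I i. initial M I \<and> i \<in> Hom M I X \<and> i \<in> cof M)"

definition fibrant :: "('o, 'm) mcat \<Rightarrow> 'o \<Rightarrow> bool" where
  "fibrant M X \<longleftrightarrow> X \<in> Ob M \<and> (\<exists>I p. terminal M I \<and> p \<in> Hom M X I \<and> p \<in> fib M)"

definition weakly_equivalent :: "('o, 'm) mcat \<Rightarrow> 'o \<Rightarrow> 'o \<Rightarrow> bool" where
  "weakly_equivalent M X Y \<longleftrightarrow> X \<in> Ob M \<and> Y \<in> Ob M \<and>
     equivclp (\<lambda>A B. \<exists>w. w \<in> Hom M A B \<and> w \<in> weq M) X Y"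

section \<open>The homotopy category\<close>

text \<open>
  \<open>Ho M\<close> is the localization of \<open>M\<close> at its weak equivalences: the free category on the arrows of
  \<open>M\<close> and formal inverses \<open>Bwd w\<close> of the weak equivalences, modulo the usual relations. A zigzag
  \<open>(X, zs, Y)\<close> is a path from \<open>X\<close> to \<open>Y\<close>; the steps \<open>zs\<close> are listed in the order in which they are
  traversed, so that \<open>[Fwd f, Fwd g]\<close> stands for the composite of \<open>f\<close> followed by \<open>g\<close>.
\<close>

datatype 'm step = Fwd 'm | Bwd 'm

fun is_path :: "('o, 'm) mcat \<Rightarrow> 'o \<Rightarrow> 'm step list \<Rightarrow> 'o \<Rightarrow> bool" where
  "is_path M X [] Y \<longleftrightarrow> X \<in> Ob M \<and> Y = X"
| "is_path M X (Fwd f # zs) Y \<longleftrightarrow> f \<in> Ar M \<and> Dom M f = X \<and> is_path M (Cod M f) zs Y"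
| "is_path M X (Bwd w # zs) Y \<longleftrightarrow> w \<in> weq M \<and> Cod M w = X \<and> is_path M (Dom M w) zs Y"

type_synonym ('o, 'm) zigzag = "'o \<times> 'm step list \<times> 'o"

inductive basic_rel :: "('o, 'm) mcat \<Rightarrow> 'm step list \<Rightarrow> 'm step list \<Rightarrow> bool" for M where
  "X \<in> Ob M \<Longrightarrow> basic_rel M [Fwd (Ide M X)] []"
| "\<lbrakk>f \<in> Hom M X Y; g \<in> Hom M Y Z\<rbrakk> \<Longrightarrow> basic_rel M [Fwd f, Fwd g] [Fwd (g \<cdot>\<^bsub>M\<^esub> f)]"
| "w \<in> weq M \<Longrightarrow> basic_rel M [Fwd w, Bwd w] []"
| "w \<in> weq M \<Longrightarrow> basic_rel M [Bwd w, Fwd w] []"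

inductive zigzag_rel :: "('o, 'm) mcat \<Rightarrow> ('o, 'm) zigzag \<Rightarrow> ('o, 'm) zigzag \<Rightarrow> bool" for M where
  "\<lbrakk>basic_rel M r s; is_path M X (p @ r @ q) Y; is_path M X (p @ s @ q) Y\<rbrakk>
   \<Longrightarrow> zigzag_rel M (X, p @ r @ q, Y) (X, p @ s @ q, Y)"

definition Ho_class :: "('o, 'm) mcat \<Rightarrow> ('o, 'm) zigzag \<Rightarrow> ('o, 'm) zigzag set" where
  "Ho_class M z = {z'. equivclp (zigzag_rel M) z z'}"

definition rep :: "'a set \<Rightarrow> 'a" where
  "rep c = (SOME z. z \<in> c)"

definition Ho :: "('o, 'm) mcat \<Rightarrow> ('o, ('o, 'm) zigzag set) cat" where
  "Ho M = \<lparr>Ob = Ob M,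
           Ar = {Ho_class M (X, zs, Y) |X zs Y. is_path M X zs Y},
           Dom = (\<lambda>c. fst (rep c)),
           Cod = (\<lambda>c. snd (snd (rep c))),
           Ide = (\<lambda>X. Ho_class M (X, [], X)),
           Comp = (\<lambda>d c. Ho_class M
             (fst (rep c), fst (snd (rep c)) @ fst (snd (rep d)), snd (snd (rep d))))\<rparr>"

definition gamma :: "('o, 'm) mcat \<Rightarrow> 'm \<Rightarrow> ('o, 'm) zigzag set" where
  "gamma M f = Ho_class M (Dom M f, [Fwd f], Cod M f)"

text \<open>The functor on \<open>Ho M\<close> induced by an endofunctor of \<open>M\<close> preserving weak equivalences.\<close>

definition Ho_functor :: "('o, 'm) mcat \<Rightarrow> ('o, 'm, 'o, 'm) functr \<Rightarrow>
   ('o, ('o, 'm) zigzag set, 'o, ('o, 'm) zigzag set) functr" where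
  "Ho_functor M T = \<lparr>onOb = onOb T,
     onAr = (\<lambda>c. Ho_class M
       (onOb T (fst (rep c)), map (map_step (onAr T)) (fst (snd (rep c))),
        onOb T (snd (snd (rep c)))))\<rparr>"

definition algebra_up_to_homotopy ::
  "('o, 'm) mcat \<Rightarrow> ('o, 'm, 'o, 'm) functr \<Rightarrow> ('o \<Rightarrow> 'm) \<Rightarrow> ('o \<Rightarrow> 'm) \<Rightarrow>
   'o \<Rightarrow> ('o, 'm) zigzag set \<Rightarrow> bool" where
  "algebra_up_to_homotopy M T \<eta> \<mu> X a \<longleftrightarrow>
     EM_algebra (Ho M) (Ho_functor M T) (\<lambda>Y. gamma M (\<eta> Y)) (\<lambda>Y. gamma M (\<mu> Y)) X a"

section \<open>The simplex category and simplicial sets\<close>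

text \<open>
  The arrow \<open>(m, \<phi>, n)\<close> is the monotone map \<open>\<phi>\<close> from \<open>{0..m}\<close> to \<open>{0..n}\<close>, made extensional so that
  equality of arrows is equality of maps.
\<close>

type_synonym simplex_map = "nat \<times> (nat \<Rightarrow> nat) \<times> nat"

definition Simplex :: "(nat, simplex_map) cat" where
  "Simplex = \<lparr>Ob = UNIV,
     Ar = {(m, \<phi>, n) |m \<phi> n. \<phi> \<in> {0..m} \<rightarrow>\<^sub>E {0..n} \<and> mono_on {0..m} \<phi>},
     Dom = (\<lambda>(m, \<phi>, n). m),
     Cod = (\<lambda>(m, \<phi>, n). n),
     Ide = (\<lambda>n. (n, restrict id {0..n}, n)),
     Comp = (\<lambda>(_, \<psi>, n) (l, \<phi>, _). (l, compose {0..l} \<psi> \<phi>, n))\<rparr>"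

record 'a sset =
  simp :: "nat \<Rightarrow> 'a set"
  act :: "simplex_map \<Rightarrow> 'a \<Rightarrow> 'a"

locale simplicial_set =
  fixes K :: "'a sset"
  assumes act_simp: "\<lbrakk>\<alpha> \<in> Hom Simplex m n; x \<in> simp K n\<rbrakk> \<Longrightarrow> act K \<alpha> x \<in> simp K m"
    and act_Ide: "x \<in> simp K n \<Longrightarrow> act K (Ide Simplex n) x = x"
    and act_Comp: "\<lbrakk>\<alpha> \<in> Hom Simplex l m; \<beta> \<in> Hom Simplex m n; x \<in> simp K n\<rbrakk>
      \<Longrightarrow> act K (\<beta> \<cdot>\<^bsub>Simplex\<^esub> \<alpha>) x = act K \<alpha> (act K \<beta> x)"

definition simplicial_map :: "'a sset \<Rightarrow> 'b sset \<Rightarrow> (nat \<Rightarrow> 'a \<Rightarrow> 'b) \<Rightarrow> bool" where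
  "simplicial_map K L \<theta> \<longleftrightarrow>
     (\<forall>n. \<forall>x\<in>simp K n. \<theta> n x \<in> simp L n) \<and>
     (\<forall>m n \<alpha>. \<forall>x\<in>simp K n. \<alpha> \<in> Hom Simplex m n \<longrightarrow> \<theta> m (act K \<alpha> x) = act L \<alpha> (\<theta> n x))"

section \<open>Geometric realization and weak equivalences of simplicial sets\<close>

definition quotient_topology :: "'a topology \<Rightarrow> ('a \<Rightarrow> 'b) \<Rightarrow> 'b topology" where
  "quotient_topology X q =
     topology (\<lambda>U. U \<subseteq> q ` topspace X \<and> openin X {x \<in> topspace X. q x \<in> U})"

lemma openin_quotient_topology:
  "openin (quotient_topology X q) U \<longleftrightarrow>
     U \<subseteq> q ` topspace X \<and> openin X {x \<in> topspace X. q x \<in> U}"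
proof -
  have Int: "{x \<in> topspace X. q x \<in> S \<inter> T}
      = {x \<in> topspace X. q x \<in> S} \<inter> {x \<in> topspace X. q x \<in> T}" for S T
    by auto
  have Un: "{x \<in> topspace X. q x \<in> \<Union>\<K>} = (\<Union>S\<in>\<K>. {x \<in> topspace X. q x \<in> S})" for \<K>
    by auto
  have "istopology (\<lambda>U. U \<subseteq> q ` topspace X \<and> openin X {x \<in> topspace X. q x \<in> U})"
    unfolding istopology_def
  proof (intro conjI allI impI)
    fix S T
    assume S: "S \<subseteq> q ` topspace X \<and> openin X {x \<in> topspace X. q x \<in> S}"
      and T: "T \<subseteq> q ` topspace X \<and> openin X {x \<in> topspace X. q x \<in> T}"
    show "S \<inter> T \<subseteq> q ` topspace X" using S by blast
    show "openin X {x \<in> topspace X. q x \<in> S \<inter> T}"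
      unfolding Int using S T by (intro openin_Int) simp_all
  next
    fix \<K>
    assume *: "\<forall>S\<in>\<K>. S \<subseteq> q ` topspace X \<and> openin X {x \<in> topspace X. q x \<in> S}"
    show "\<Union>\<K> \<subseteq> q ` topspace X" using * by (intro Union_least) simp
    show "openin X {x \<in> topspace X. q x \<in> \<Union>\<K>}"
      unfolding Un using * by (intro openin_Union) auto
  qed
  from topology_inverse'[OF this] show ?thesis
    unfolding quotient_topology_def by (rule fun_cong)
qed

lemma quotient_map_quotient_topology: "quotient_map X (quotient_topology X q) q"
proof -
  have "{x \<in> topspace X. q x \<in> q ` topspace X} = topspace X"
    by auto
  then have "openin (quotient_topology X q) (q ` topspace X)"
    by (simp add: openin_quotient_topology)
  moreover have "topspace (quotient_topology X q) \<subseteq> q ` topspace X"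
    using openin_topspace[of "quotient_topology X q"]
    unfolding openin_quotient_topology by (rule conjunct1)
  ultimately have "topspace (quotient_topology X q) = q ` topspace X"
    by (intro subset_antisym openin_subset)
  then show ?thesis
    unfolding quotient_map_def openin_quotient_topology by simp
qed

text \<open>The disjoint union, over all \<open>n\<close> and all \<open>n\<close>-simplices \<open>x\<close>, of a topological \<open>n\<close>-simplex.\<close>

definition cells :: "'a sset \<Rightarrow> ((nat \<times> 'a) \<times> (nat \<Rightarrow> real)) topology" where
  "cells K = sum_topology
     (\<lambda>(n, x). subtopology (powertop_real UNIV) (standard_simplex n)) (Sigma UNIV (simp K))"

definition push :: "simplex_map \<Rightarrow> (nat \<Rightarrow> real) \<Rightarrow> (nat \<Rightarrow> real)" where
  "push = (\<lambda>(m, \<phi>, n) t j. \<Sum>i | i \<le> m \<and> \<phi> i = j. t i)"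

inductive glue :: "'a sset \<Rightarrow> (nat \<times> 'a) \<times> (nat \<Rightarrow> real) \<Rightarrow> (nat \<times> 'a) \<times> (nat \<Rightarrow> real) \<Rightarrow> bool"
  for K where
  "\<lbrakk>\<alpha> \<in> Hom Simplex m n; x \<in> simp K n; t \<in> standard_simplex m\<rbrakk>
   \<Longrightarrow> glue K ((m, act K \<alpha> x), t) ((n, x), push \<alpha> t)"

definition point_class where
  "point_class K p = {q. equivclp (glue K) p q}"

definition realization :: "'a sset \<Rightarrow> ((nat \<times> 'a) \<times> (nat \<Rightarrow> real)) set topology" where
  "realization K = quotient_topology (cells K) (point_class K)"

definition realization_map :: "'b sset \<Rightarrow> (nat \<Rightarrow> 'a \<Rightarrow> 'b) \<Rightarrow>
   ((nat \<times> 'a) \<times> (nat \<Rightarrow> real)) set \<Rightarrow> ((nat \<times> 'b) \<times> (nat \<Rightarrow> real)) set" where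
  "realization_map L \<theta> c = (case rep c of ((n, x), t) \<Rightarrow> point_class L ((n, \<theta> n x), t))"

definition homotopy_equivalence :: "'a topology \<Rightarrow> 'b topology \<Rightarrow> ('a \<Rightarrow> 'b) \<Rightarrow> bool" where
  "homotopy_equivalence X Y f \<longleftrightarrow> continuous_map X Y f \<and>
     (\<exists>g. continuous_map Y X g \<and>
        homotopic_with (\<lambda>_. True) X X (g \<circ> f) id \<and>
        homotopic_with (\<lambda>_. True) Y Y (f \<circ> g) id)"

text \<open>
  Quillen's definition: a simplicial map is a weak equivalence if its realization is a homotopy
  equivalence (realizations are CW complexes, so one may equally ask for a weak one).
\<close>

definition sset_weq :: "'a sset \<Rightarrow> 'b sset \<Rightarrow> (nat \<Rightarrow> 'a \<Rightarrow> 'b) \<Rightarrow> bool" where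
  "sset_weq K L \<theta> \<longleftrightarrow> simplicial_set K \<and> simplicial_set L \<and> simplicial_map K L \<theta> \<and>
     homotopy_equivalence (realization K) (realization L) (realization_map L \<theta>)"

section \<open>Cosimplicial resolutions and homotopy function complexes\<close>

type_synonym ('o, 'm) cosimp = "(nat, simplex_map, 'o, 'm) functr"

text \<open>
  The \<open>n\<close>-th latching category: objects are the non-identity injections \<open>\<alpha>\<close> into \<open>{0..n}\<close>, and
  \<open>(\<alpha>, \<gamma>, \<beta>)\<close> is an arrow from \<open>\<alpha>\<close> to \<open>\<beta>\<close> if \<open>\<gamma>\<close> is an injection with \<open>\<beta> \<cdot> \<gamma> = \<alpha>\<close>.
\<close>

definition injective_arrows :: "simplex_map set" where
  "injective_arrows = {(m, \<phi>, n). (m, \<phi>, n) \<in> Ar Simplex \<and> inj_on \<phi> {0..m}}"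

definition Latching :: "nat \<Rightarrow> (simplex_map, simplex_map \<times> simplex_map \<times> simplex_map) cat" where
  "Latching n = (let Obs = {\<alpha> \<in> injective_arrows. Cod Simplex \<alpha> = n \<and> \<alpha> \<noteq> Ide Simplex n} in
     \<lparr>Ob = Obs,
      Ar = {(\<alpha>, \<gamma>, \<beta>). \<alpha> \<in> Obs \<and> \<beta> \<in> Obs \<and> \<gamma> \<in> injective_arrows \<and>
              \<gamma> \<in> Hom Simplex (Dom Simplex \<alpha>) (Dom Simplex \<beta>) \<and> \<beta> \<cdot>\<^bsub>Simplex\<^esub> \<gamma> = \<alpha>},
      Dom = (\<lambda>(\<alpha>, \<gamma>, \<beta>). \<alpha>),
      Cod = (\<lambda>(\<alpha>, \<gamma>, \<beta>). \<beta>),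
      Ide = (\<lambda>\<alpha>. (\<alpha>, Ide Simplex (Dom Simplex \<alpha>), \<alpha>)),
      Comp = (\<lambda>(_, \<gamma>', \<beta>') (\<alpha>, \<gamma>, _). (\<alpha>, \<gamma>' \<cdot>\<^bsub>Simplex\<^esub> \<gamma>, \<beta>'))\<rparr>)"

definition latching_diagram :: "('o, 'm) cosimp \<Rightarrow>
   (simplex_map, simplex_map \<times> simplex_map \<times> simplex_map, 'o, 'm) functr" where
  "latching_diagram A = \<lparr>onOb = (\<lambda>\<alpha>. onOb A (Dom Simplex \<alpha>)), onAr = (\<lambda>(\<alpha>, \<gamma>, \<beta>). onAr A \<gamma>)\<rparr>"

definition Reedy_cofibrant :: "('o, 'm) mcat \<Rightarrow> ('o, 'm) cosimp \<Rightarrow> bool" where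
  "Reedy_cofibrant M A \<longleftrightarrow> is_functor Simplex M A \<and>
     (\<forall>n L \<iota> h. is_colimit (Latching n) M (latching_diagram A) L \<iota> \<longrightarrow>
        h \<in> Hom M L (onOb A n) \<longrightarrow>
        (\<forall>\<alpha>\<in>Ob (Latching n). h \<cdot>\<^bsub>M\<^esub> \<iota> \<alpha> = onAr A \<alpha>) \<longrightarrow> h \<in> cof M)"

definition cosimplicial_resolution ::
  "('o, 'm) mcat \<Rightarrow> 'o \<Rightarrow> ('o, 'm) cosimp \<Rightarrow> (nat \<Rightarrow> 'm) \<Rightarrow> bool" where
  "cosimplicial_resolution M X A \<epsilon> \<longleftrightarrow> X \<in> Ob M \<and> Reedy_cofibrant M A \<and>
     nat_trans Simplex M A (const_functor M X) \<epsilon> \<and> (\<forall>n. \<epsilon> n \<in> weq M)"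

definition fibrant_approximation :: "('o, 'm) mcat \<Rightarrow> 'o \<Rightarrow> 'o \<Rightarrow> 'm \<Rightarrow> bool" where
  "fibrant_approximation M X R r \<longleftrightarrow> r \<in> Hom M X R \<and> r \<in> weq M \<and> fibrant M R"

text \<open>
  If \<open>A\<close> is a cosimplicial resolution of \<open>X\<close> and \<open>R\<close> is a fibrant approximation to \<open>Y\<close>, then
  \<open>map_complex M A R\<close> is a (left) homotopy function complex from \<open>X\<close> to \<open>Y\<close>.
\<close>

definition map_complex :: "('o, 'm) mcat \<Rightarrow> ('o, 'm) cosimp \<Rightarrow> 'o \<Rightarrow> 'm sset" where
  "map_complex M A R = \<lparr>simp = (\<lambda>n. Hom M (onOb A n) R), act = (\<lambda>\<alpha> x. x \<cdot>\<^bsub>M\<^esub> onAr A \<alpha>)\<rparr>"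

definition resolution_of_map ::
  "('o, 'm) mcat \<Rightarrow> 'm \<Rightarrow> ('o, 'm) cosimp \<Rightarrow> ('o, 'm) cosimp \<Rightarrow> (nat \<Rightarrow> 'm) \<Rightarrow> bool" where
  "resolution_of_map M g A B G \<longleftrightarrow>
     (\<exists>\<epsilon> \<delta>. cosimplicial_resolution M (Dom M g) A \<epsilon> \<and> cosimplicial_resolution M (Cod M g) B \<delta> \<and>
        nat_trans Simplex M A B G \<and> (\<forall>n. \<delta> n \<cdot>\<^bsub>M\<^esub> G n = g \<cdot>\<^bsub>M\<^esub> \<epsilon> n))"

text \<open>
  The map \<open>map(g, X)\<close> is a weak equivalence. Up to weak equivalence it does not depend on the
  resolutions and approximations, so the quantifier over them could be existential as well.
\<close>

definition map_weq :: "('o, 'm) mcat \<Rightarrow> 'm \<Rightarrow> 'o \<Rightarrow> bool" where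
  "map_weq M g X \<longleftrightarrow>
     (\<forall>A B G R r. resolution_of_map M g A B G \<longrightarrow> fibrant_approximation M X R r \<longrightarrow>
        sset_weq (map_complex M B R) (map_complex M A R) (\<lambda>n x. x \<cdot>\<^bsub>M\<^esub> G n))"

section \<open>Localization with respect to a map\<close>

definition f_local :: "('o, 'm) mcat \<Rightarrow> 'm \<Rightarrow> 'o \<Rightarrow> bool" where
  "f_local M f X \<longleftrightarrow> X \<in> Ob M \<and> map_weq M f X"

definition f_equivalences :: "('o, 'm) mcat \<Rightarrow> 'm \<Rightarrow> 'm set" where
  "f_equivalences M f = {g \<in> Ar M. \<forall>X. f_local M f X \<longrightarrow> map_weq M g X}"

definition Bousfield :: "('o, 'm) mcat \<Rightarrow> 'm \<Rightarrow> ('o, 'm) mcat" where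
  "Bousfield M f = M\<lparr>weq := f_equivalences M f,
     fib := {p \<in> Ar M. \<forall>i \<in> cof M \<inter> f_equivalences M f. has_lifting M i p}\<rparr>"

definition localization_exists :: "'k rel \<Rightarrow> ('o, 'm) mcat \<Rightarrow> 'm \<Rightarrow> bool" where
  "localization_exists \<kappa> M f \<longleftrightarrow> model_category \<kappa> (Bousfield M f) \<and>
     (\<forall>X. fibrant (Bousfield M f) X \<longleftrightarrow> fibrant M X \<and> f_local M f X)"

definition f_localization :: "('o, 'm) mcat \<Rightarrow> 'm \<Rightarrow> 'o \<Rightarrow> 'o \<Rightarrow> 'm \<Rightarrow> bool" where
  "f_localization M f X L l \<longleftrightarrow> l \<in> Hom M X L \<and>
     l \<in> cof (Bousfield M f) \<inter> weq (Bousfield M f) \<and> fibrant (Bousfield M f) L"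

definition preserves_equivalences_between_cofibrants ::
  "('o, 'm) mcat \<Rightarrow> ('o, 'm, 'o, 'm) functr \<Rightarrow> 'm \<Rightarrow> bool" where
  "preserves_equivalences_between_cofibrants M T f \<longleftrightarrow>
     (\<forall>g \<in> f_equivalences M f. cofibrant M (Dom M g) \<longrightarrow> cofibrant M (Cod M g) \<longrightarrow>
        onAr T g \<in> f_equivalences M f)"

end

theory Submission
  imports Defs "HOL-Analysis.Abstract_Topological_Spaces"
begin

text \<open>
  Replace \<open>X\<close> by a cofibrant \<open>Q\<close>, and the composite of \<open>Q \<rightarrow> X\<close> with the \<open>Tf\<close>-localization of \<open>X\<close> by
  a cofibration \<open>j: Q \<rightarrow> N\<close>, where \<open>N\<close> is weakly equivalent to the localization. Since \<open>T\<close> preserves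
  the \<open>Tf\<close>-equivalence \<open>j\<close>, the composite \<open>TQ \<rightarrow> TX \<rightarrow> X \<rightarrow> N\<close> involving the algebra structure extends
  up to homotopy to a map \<open>\<alpha>: TN \<rightarrow> N\<close>. The unit law shows that \<open>\<alpha> \<cdot> \<eta> \<cdot> j\<close> is homotopic to \<open>j\<close>, so \<open>\<alpha> \<cdot> \<eta>\<close>
  is a \<open>Tf\<close>-equivalence between \<open>Tf\<close>-local fibrant objects, hence a weak equivalence. Therefore
  \<open>map(f, N)\<close> is a homotopy retract of \<open>map(Tf, N)\<close> and \<open>N\<close> is \<open>f\<close>-local.

  As \<open>T\<close> preserves the \<open>f\<close>-equivalence \<open>f\<close>, every \<open>f\<close>-local object is \<open>Tf\<close>-local, so \<open>Tf\<close>-equivalences are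
  \<open>f\<close>-equivalences. Thus \<open>j\<close> is an \<open>f\<close>-equivalence into an \<open>f\<close>-local fibrant object, and \<open>N\<close> is weakly
  equivalent to the \<open>f\<close>-localization of \<open>X\<close> as well.
\<close>

section \<open>The simplex category\<close>

text \<open>A weak equivalence of mapping complexes is a homotopy equivalence of realizations, so
  statements about \<open>N\<close> have to be carried down to spaces. The link is that a trivial
  fibration of \<open>M\<close> induces a trivial fibration of mapping complexes, which realizes to
  a homotopy equivalence; weak equivalences between fibrant objects are reduced to this case by
  mapping path objects. \<open>map_weq\<close> quantifies over all resolutions. Given resolutions
  \<open>A\<close>, \<open>B\<close> of a map \<open>g\<close>, resolutions of \<open>T g\<close>
  must be built from them. Applying \<open>T\<close> to \<open>A\<close> gives the right object in
  each degree, but it need not be Reedy cofibrant; a Reedy factorization of the unit repairs this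
  and keeps a map from \<open>A\<close>. The algebra structure lives in the homotopy category, where
  arrows are classes of zigzags. Returning to honest maps takes two facts: a zigzag from a cofibrant
  to a fibrant object is represented by an arrow, and of two arrows from a cofibrant object with
  equal classes both or neither are weak equivalences of the localization. For the second, zigzags
  are made to act on homotopy classes.\<close>

abbreviation simplex_comp (infixl "\<star>" 70) where
  "\<beta> \<star> \<alpha> \<equiv> \<beta> \<cdot>\<^bsub>Simplex\<^esub> \<alpha>"

definition ap :: "simplex_map \<Rightarrow> nat \<Rightarrow> nat" where
  "ap \<alpha> = fst (snd \<alpha>)"

definition mk :: "nat \<Rightarrow> (nat \<Rightarrow> nat) \<Rightarrow> nat \<Rightarrow> simplex_map" where
  "mk m \<phi> n = (m, restrict \<phi> {0..m}, n)"

lemma Ob_Simplex [simp]: "Ob Simplex = UNIV"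
  by (simp add: Simplex_def)

lemma Hom_Simplex: "\<alpha> \<in> Hom Simplex m n \<longleftrightarrow>
   (\<exists>\<phi>. \<alpha> = (m, \<phi>, n) \<and> \<phi> \<in> {0..m} \<rightarrow>\<^sub>E {0..n} \<and> mono_on {0..m} \<phi>)"
  by (auto simp: Hom_def Simplex_def)

lemma mk_Hom:
  assumes "\<And>i. i \<le> m \<Longrightarrow> \<phi> i \<le> n" "\<And>i j. i \<le> j \<Longrightarrow> j \<le> m \<Longrightarrow> \<phi> i \<le> \<phi> j"
  shows "mk m \<phi> n \<in> Hom Simplex m n"
  using assms by (auto simp: Hom_Simplex mk_def mono_on_def)

lemma ap_mk [simp]: "i \<le> m \<Longrightarrow> ap (mk m \<phi> n) i = \<phi> i"
  by (simp add: ap_def mk_def)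

lemma ap_le: "\<lbrakk>\<alpha> \<in> Hom Simplex m n; i \<le> m\<rbrakk> \<Longrightarrow> ap \<alpha> i \<le> n"
  by (auto simp: Hom_Simplex ap_def PiE_iff)

lemma ap_mono: "\<lbrakk>\<alpha> \<in> Hom Simplex m n; i \<le> j; j \<le> m\<rbrakk> \<Longrightarrow> ap \<alpha> i \<le> ap \<alpha> j"
  by (auto simp: Hom_Simplex ap_def mono_on_def)

lemma simplex_map_eqI:
  assumes "\<alpha> \<in> Hom Simplex m n" "\<beta> \<in> Hom Simplex m n" "\<And>i. i \<le> m \<Longrightarrow> ap \<alpha> i = ap \<beta> i"
  shows "\<alpha> = \<beta>"
proof -
  obtain \<phi> \<psi> where *: "\<alpha> = (m, \<phi>, n)" "\<beta> = (m, \<psi>, n)"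
    "\<phi> \<in> {0..m} \<rightarrow>\<^sub>E {0..n}" "\<psi> \<in> {0..m} \<rightarrow>\<^sub>E {0..n}"
    using assms(1,2) by (auto simp: Hom_Simplex)
  then have "\<phi> = \<psi>" using assms(3) by (intro PiE_ext[OF *(3,4)]) (simp add: ap_def)
  then show ?thesis by (simp add: *)
qed

lemma Comp_Simplex:
  assumes "\<alpha> \<in> Hom Simplex l m" "\<beta> \<in> Hom Simplex m n"
  shows "\<beta> \<star> \<alpha> = mk l (\<lambda>i. ap \<beta> (ap \<alpha> i)) n"
proof -
  obtain \<phi> \<psi> where "\<alpha> = (l, \<phi>, m)" "\<beta> = (m, \<psi>, n)"
    using assms by (auto simp: Hom_Simplex)
  then show ?thesis by (simp add: Simplex_def ap_def mk_def compose_def)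
qed

lemma Comp_Simplex_Hom:
  assumes "\<alpha> \<in> Hom Simplex l m" "\<beta> \<in> Hom Simplex m n"
  shows "\<beta> \<star> \<alpha> \<in> Hom Simplex l n"
  unfolding Comp_Simplex[OF assms]
proof (rule mk_Hom)
  show "ap \<beta> (ap \<alpha> i) \<le> n" if "i \<le> l" for i
    by (rule ap_le[OF assms(2) ap_le[OF assms(1) that]])
  show "ap \<beta> (ap \<alpha> i) \<le> ap \<beta> (ap \<alpha> j)" if "i \<le> j" "j \<le> l" for i j
    by (rule ap_mono[OF assms(2) ap_mono[OF assms(1) that] ap_le[OF assms(1) that(2)]])
qed

lemma ap_Comp:
  assumes "\<alpha> \<in> Hom Simplex l m" "\<beta> \<in> Hom Simplex m n" "i \<le> l"
  shows "ap (\<beta> \<star> \<alpha>) i = ap \<beta> (ap \<alpha> i)"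
  using assms by (simp add: Comp_Simplex)

lemma Ide_Simplex: "Ide Simplex n = mk n id n"
  by (simp add: Simplex_def mk_def)

lemma Ide_Simplex_Hom: "Ide Simplex n \<in> Hom Simplex n n"
  unfolding Ide_Simplex by (rule mk_Hom) auto

lemma ap_Ide: "i \<le> n \<Longrightarrow> ap (Ide Simplex n) i = i"
  by (simp add: Ide_Simplex)

interpretation Simplex: category Simplex
proof
  show "Comp Simplex (Comp Simplex h g) f = Comp Simplex h (Comp Simplex g f)"
    if "f \<in> Hom Simplex W X" "g \<in> Hom Simplex X Y" "h \<in> Hom Simplex Y Z" for f g h W X Y Z
  proof -
    note fg = Comp_Simplex_Hom[OF that(1,2)] and gh = Comp_Simplex_Hom[OF that(2,3)]
    show ?thesis
      by (rule simplex_map_eqI[OF Comp_Simplex_Hom[OF that(1) gh] Comp_Simplex_Hom[OF fg that(3)]])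
        (simp add: ap_Comp[OF that(1) gh] ap_Comp[OF fg that(3)] ap_Comp[OF that(1,2)]
          ap_Comp[OF that(2,3)] ap_le[OF that(1)])
  qed
  show "Comp Simplex f (Ide Simplex X) = f" if "f \<in> Hom Simplex X Y" for f X Y
    using that Ide_Simplex_Hom by (intro simplex_map_eqI[of _ X Y])
      (auto intro: Comp_Simplex_Hom simp: ap_Comp[OF Ide_Simplex_Hom] ap_Ide)
  show "Comp Simplex (Ide Simplex Y) f = f" if "f \<in> Hom Simplex X Y" for f X Y
    using that Ide_Simplex_Hom by (intro simplex_map_eqI[of _ X Y])
      (auto intro: Comp_Simplex_Hom simp: ap_Comp[OF _ Ide_Simplex_Hom] ap_Ide ap_le)
  show "Comp Simplex g f \<in> Hom Simplex X Z" if "f \<in> Hom Simplex X Y" "g \<in> Hom Simplex Y Z" for f g X Y Z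
    using that by (rule Comp_Simplex_Hom)
qed (simp_all add: Ide_Simplex_Hom)

section \<open>Collapsed edges and the idempotents of a simplex\<close>

text \<open>If no edge were collapsed, induction would give \<open>i \<le> ap \<alpha> i\<close> for
  all \<open>i\<close>, contradicting \<open>n < m\<close> at \<open>i = m\<close>.\<close>

lemma not_injective_cases:
  assumes "\<alpha> \<in> Hom Simplex m n" "n < m"
  obtains i where "i < m" "ap \<alpha> i = ap \<alpha> (Suc i)"
proof -
  have "\<not> (\<forall>i<m. ap \<alpha> i < ap \<alpha> (Suc i))"
  proof
    assume *: "\<forall>i<m. ap \<alpha> i < ap \<alpha> (Suc i)"
    have "i \<le> m \<Longrightarrow> i \<le> ap \<alpha> i" for i
    proof (induction i)
      case (Suc i)
      with *[rule_format, of i] show ?case by simp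
    qed simp
    from this[of m] ap_le[OF assms(1), of m] assms(2) show False by simp
  qed
  then obtain i where i: "i < m" "\<not> ap \<alpha> i < ap \<alpha> (Suc i)" by blast
  with ap_mono[OF assms(1), of i "Suc i"] that[of i] show thesis by simp
qed

text \<open>A strictly increasing endomorphism is squeezed onto the identity: counting from below
  its values are at least \<open>i\<close>, counting from above they are at most
  \<open>m - k\<close>.\<close>

lemma endo_cases:
  assumes "\<alpha> \<in> Hom Simplex m m"
  obtains "\<alpha> = Ide Simplex m" | i where "i < m" "ap \<alpha> i = ap \<alpha> (Suc i)"
proof (cases "\<forall>i<m. ap \<alpha> i < ap \<alpha> (Suc i)")
  case True
  have 1: "i \<le> m \<Longrightarrow> i \<le> ap \<alpha> i" for i
  proof (induction i)
    case (Suc i)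
    with True[rule_format, of i] show ?case by simp
  qed simp
  have 2: "k \<le> m \<Longrightarrow> ap \<alpha> (m - k) \<le> m - k" for k
  proof (induction k)
    case 0
    show ?case using ap_le[OF assms, of m] by simp
  next
    case (Suc k)
    then have "Suc (m - Suc k) = m - k" by simp
    with True[rule_format, of "m - Suc k"] Suc show ?case by simp
  qed
  have "ap \<alpha> i = i" if "i \<le> m" for i
    using 1[OF that] 2[of "m - i"] that by simp
  then have "\<alpha> = Ide Simplex m"
    by (intro simplex_map_eqI[OF assms Ide_Simplex_Hom]) (simp add: ap_Ide)
  then show thesis by (rule that(1))
next
  case False
  then obtain i where i: "i < m" "\<not> ap \<alpha> i < ap \<alpha> (Suc i)" by blast
  with ap_mono[OF assms(1), of i "Suc i"] that(2)[of i] show thesis by simp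
qed

lemma collapse_factor:
  assumes \<alpha>: "\<alpha> \<in> Hom Simplex m n" and i: "i < m" "ap \<alpha> i = ap \<alpha> (Suc i)"
  obtains \<beta> \<sigma> \<delta> where "\<sigma> \<in> Hom Simplex m (m - 1)" "\<beta> \<in> Hom Simplex (m - 1) n"
    "\<alpha> = \<beta> \<star> \<sigma>" "\<delta> \<in> Hom Simplex (m - 1) m" "\<sigma> \<star> \<delta> = Ide Simplex (m - 1)"
proof -
  \<comment> \<open>\<open>?d\<close> omits the vertex \<open>Suc i\<close> and \<open>?s\<close>
    merges it with \<open>i\<close>. Restricting \<open>\<alpha>\<close> along \<open>?d\<close>
    loses only the value at \<open>Suc i\<close>, which equals the one at \<open>i\<close>.\<close>
  let ?d = "mk (m - 1) (\<lambda>k. if k \<le> i then k else Suc k) m"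
  let ?s = "mk m (\<lambda>k. if k \<le> i then k else k - 1) (m - 1)"
  have d: "?d \<in> Hom Simplex (m - 1) m" by (rule mk_Hom) (use i in auto)
  have s: "?s \<in> Hom Simplex m (m - 1)" by (rule mk_Hom) (use i in auto)
  note ds = Comp_Simplex_Hom[OF d \<alpha>]
  have "\<alpha> = (\<alpha> \<star> ?d) \<star> ?s"
  proof (rule simplex_map_eqI[OF \<alpha> Comp_Simplex_Hom[OF s ds]])
    fix k assume k: "k \<le> m"
    have "k \<le> i \<or> k = Suc i \<or> Suc i < k" by auto
    then show "ap \<alpha> k = ap ((\<alpha> \<star> ?d) \<star> ?s) k"
      using k i by (auto simp: ap_Comp[OF s ds] ap_Comp[OF d \<alpha>] simp del: One_nat_def)
  qed
  moreover have "?s \<star> ?d = Ide Simplex (m - 1)"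
    by (rule simplex_map_eqI[OF Comp_Simplex_Hom[OF d s] Ide_Simplex_Hom])
      (use i in \<open>auto simp: ap_Comp[OF d s] ap_Ide simp del: One_nat_def\<close>)
  ultimately show thesis using that[OF s ds _ d] by blast
qed

text \<open>\<open>up\<close> and \<open>down\<close> collapse the same edge from \<open>i\<close>
  to \<open>Suc i\<close> and differ in the end point that survives. Having the choice is what makes
  idempotents of two different edges commute.\<close>

definition up :: "nat \<Rightarrow> nat \<Rightarrow> simplex_map" where
  "up n i = mk n (\<lambda>k. if k = i then Suc i else k) n"

definition down :: "nat \<Rightarrow> nat \<Rightarrow> simplex_map" where
  "down n i = mk n (\<lambda>k. if k = Suc i then i else k) n"

lemma up_down_Hom:
  assumes "i < n" shows "up n i \<in> Hom Simplex n n" "down n i \<in> Hom Simplex n n"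
  unfolding up_def down_def by (rule mk_Hom; use assms in \<open>auto split: if_splits\<close>)+

lemma Comp_up_down:
  assumes "\<alpha> \<in> Hom Simplex n m" "i < n" "ap \<alpha> i = ap \<alpha> (Suc i)"
  shows "\<alpha> \<star> up n i = \<alpha>" "\<alpha> \<star> down n i = \<alpha>"
proof -
  note u = up_down_Hom(1)[OF assms(2)] and d = up_down_Hom(2)[OF assms(2)]
  show "\<alpha> \<star> up n i = \<alpha>"
    by (rule simplex_map_eqI[OF Comp_Simplex_Hom[OF u assms(1)] assms(1)])
      (use assms(3) in \<open>simp add: ap_Comp[OF u assms(1)], simp add: up_def\<close>)
  show "\<alpha> \<star> down n i = \<alpha>"
    by (rule simplex_map_eqI[OF Comp_Simplex_Hom[OF d assms(1)] assms(1)])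
      (use assms(3) in \<open>simp add: ap_Comp[OF d assms(1)], simp add: down_def\<close>)
qed

text \<open>\<open>up n i\<close> moves only \<open>i\<close>, \<open>down n j\<close> moves only
  \<open>Suc j\<close>, and neither image vertex is moved by the other map, even for adjacent edges
  \<open>j = Suc i\<close>. Two maps of the kind \<open>down\<close> would fail to commute in that
  case.\<close>

lemma up_down_commute:
  assumes "i < j" "j < n"
  shows "up n i \<star> down n j = down n j \<star> up n i"
proof -
  have i: "i < n" using assms by simp
  note u = up_down_Hom(1)[OF i] and d = up_down_Hom(2)[OF assms(2)]
  show ?thesis
    by (rule simplex_map_eqI[OF Comp_Simplex_Hom[OF d u] Comp_Simplex_Hom[OF u d]])
      (use assms in \<open>simp add: ap_Comp[OF d u] ap_Comp[OF u d], simp add: up_def down_def\<close>)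
qed

section \<open>Simplicial sets and trivial fibrations\<close>

lemma (in simplicial_set) degenerate_fixed:
  assumes "\<theta> \<in> Hom Simplex n m" "i < n" "ap \<theta> i = ap \<theta> (Suc i)" "a \<in> simp K m"
  shows "act K (up n i) (act K \<theta> a) = act K \<theta> a" "act K (down n i) (act K \<theta> a) = act K \<theta> a"
  using Comp_up_down[OF assms(1-3)] act_Comp[OF up_down_Hom(1)[OF assms(2)] assms(1,4)]
    act_Comp[OF up_down_Hom(2)[OF assms(2)] assms(1,4)] by simp_all

text \<open>A collapsing \<open>e\<close> factors through dimension \<open>n - 1\<close>, where
  \<open>a\<close> and \<open>b\<close> have the same faces.\<close>

lemma (in simplicial_set) collapse_boundary:
  assumes ab: "a \<in> simp K n" "b \<in> simp K n"
    and bd: "\<And>l \<gamma>. \<lbrakk>l < n; \<gamma> \<in> Hom Simplex l n\<rbrakk> \<Longrightarrow> act K \<gamma> a = act K \<gamma> b"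
    and e: "e \<in> Hom Simplex n n" "i < n" "ap e i = ap e (Suc i)"
  shows "act K e a = act K e b"
proof -
  obtain \<beta> \<sigma> where s: "\<sigma> \<in> Hom Simplex n (n - 1)" "\<beta> \<in> Hom Simplex (n - 1) n"
    "e = \<beta> \<star> \<sigma>"
    by (rule collapse_factor[OF e]) (rule that)
  with bd[of "n - 1" \<beta>] e ab show ?thesis
    by (simp add: act_Comp[OF s(1,2)])
qed

text \<open>
  A degenerate simplex is fixed by two idempotents of \<open>[n]\<close>, and the ones belonging to different
  collapsed edges can be chosen to commute.
\<close>

lemma (in simplicial_set) degenerate_eqI:
  assumes ab: "a \<in> simp K n" "b \<in> simp K n"
    and bd: "\<And>l \<gamma>. \<lbrakk>l < n; \<gamma> \<in> Hom Simplex l n\<rbrakk> \<Longrightarrow> act K \<gamma> a = act K \<gamma> b"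
    and a: "i < n" "act K (up n i) a = a" "act K (down n i) a = a"
    and b: "j < n" "act K (up n j) b = b" "act K (down n j) b = b"
  shows "a = b"
proof -
  have main: "a = b" if ab: "a \<in> simp K n" "b \<in> simp K n"
    and bd: "\<And>l \<gamma>. \<lbrakk>l < n; \<gamma> \<in> Hom Simplex l n\<rbrakk> \<Longrightarrow> act K \<gamma> a = act K \<gamma> b"
    and ij: "i \<le> j" "j < n" and a: "act K (up n i) a = a" and b: "act K (down n j) b = b"
      "act K (up n j) b = b" for a b i j
  proof -
    have i: "i < n" using ij by simp
    note u = up_down_Hom(1)[OF i] and d = up_down_Hom(2)[OF ij(2)]
    have eu: "act K (up n i) a = act K (up n i) b"
      by (rule collapse_boundary[OF ab bd u i]) (use i in \<open>auto simp: up_def\<close>)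
    show ?thesis
    proof (cases "i = j")
      case True
      with a b eu show ?thesis by simp
    next
      case False
      then have ij': "i < j" using ij by simp
      have ed: "act K (down n j) a = act K (down n j) b"
        by (rule collapse_boundary[OF ab bd d ij(2)]) (use ij in \<open>auto simp: down_def\<close>)
      \<comment> \<open>\<open>eu\<close> and \<open>ed\<close> exchange \<open>a\<close> and
        \<open>b\<close> under either idempotent, and commuting the two passes from one exchange to
        the other. This takes the place of the uniqueness part of the Eilenberg-Zilber
        lemma.\<close>
      have "a = act K (up n i) (act K (down n j) b)" using eu a b by simp
      also have "\<dots> = act K (down n j \<star> up n i) b"
        by (rule act_Comp[OF u d ab(2), symmetric])
      also have "\<dots> = act K (up n i \<star> down n j) b"
        by (simp only: up_down_commute[OF ij' ij(2)])
      also have "\<dots> = act K (down n j) (act K (up n i) b)"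
        by (rule act_Comp[OF d u ab(2)])
      also have "\<dots> = act K (down n j) a" using eu a by simp
      finally show ?thesis using ed b by simp
    qed
  qed
  show ?thesis
  proof (cases "i \<le> j")
    case True
    show ?thesis by (rule main[OF ab bd True b(1) a(2) b(3) b(2)])
  next
    case False
    then have "j \<le> i" by simp
    from main[OF ab(2,1) bd[symmetric] this a(1) b(2) a(3) a(2)] show ?thesis by simp
  qed
qed

section \<open>Skeletal induction and lifting against inclusions\<close>

text \<open>Dependent choice produces stages that agree below their index, so the value in degree
  \<open>k\<close> is final from stage \<open>Suc k\<close> on; the limit reads it off there.
  \<open>cong\<close> says that \<open>P n\<close> looks only at degrees below \<open>n\<close>. The
  extension of simplicial maps, the Reedy factorization and the Reedy lifting all follow this
  pattern.\<close>

lemma stage_glue: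
  assumes zero: "P 0 h0"
    and step: "\<And>n h. P n h \<Longrightarrow> \<exists>h'. P (Suc n) h' \<and> (\<forall>k<n. h' k = h k)"
    and cong: "\<And>n h h'. \<lbrakk>P n h; \<And>k. k < n \<Longrightarrow> h' k = h k\<rbrakk> \<Longrightarrow> P n h'"
  shows "\<exists>H :: nat \<Rightarrow> 'x. \<forall>n. P n H"
proof -
  obtain f where f: "\<And>n. P n (f n)" "\<And>n. \<forall>k<n. f (Suc n) k = f n k"
    using dependent_nat_choice[of P "\<lambda>n h h'. \<forall>k<n. h' k = h k"] zero step by metis
  have eq: "f (Suc k) k = f n k" if "k < n" for n k
    using that
  proof (induction n)
    case (Suc n)
    then show ?case using f(2)[of n] by (cases "k = n") auto
  qed simp
  have "P n (\<lambda>k. f (Suc k) k)" for n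
    by (rule cong[OF f(1) eq])
  then show ?thesis by blast
qed

text \<open>The right lifting property against the boundary inclusions. A map from the boundary of
  the standard \<open>n\<close>-simplex is a compatible family \<open>y\<close> over all maps to
  \<open>[n]\<close> from smaller \<open>[m]\<close>, degenerate ones included, so no simplicial
  identities have to be spelled out.\<close>

definition trivial_fibration :: "'a sset \<Rightarrow> 'b sset \<Rightarrow> (nat \<Rightarrow> 'a \<Rightarrow> 'b) \<Rightarrow> bool" where
  "trivial_fibration K L p \<longleftrightarrow> simplicial_set K \<and> simplicial_set L \<and> simplicial_map K L p \<and>
     (\<forall>n. \<forall>v\<in>simp L n. \<forall>y.
        (\<forall>m<n. \<forall>\<theta>\<in>Hom Simplex m n. y \<theta> \<in> simp K m \<and> p m (y \<theta>) = act L \<theta> v \<and>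
           (\<forall>l<n. \<forall>\<gamma>\<in>Hom Simplex l m. act K \<gamma> (y \<theta>) = y (\<theta> \<star> \<gamma>))) \<longrightarrow>
        (\<exists>z\<in>simp K n. p n z = v \<and> (\<forall>m<n. \<forall>\<theta>\<in>Hom Simplex m n. act K \<theta> z = y \<theta>)))"

text \<open>In degree \<open>n\<close> a simplex of the subcomplex \<open>X\<close> has its value
  prescribed, a degenerate one inherits it from lower degrees, and any other is filled in by the
  lifting property. The work lies in showing that the first two prescriptions agree and depend on no
  choice.\<close>

lemma trivial_fibration_extension:
  fixes K :: "'a sset" and L :: "'b sset" and Y :: "'c sset"
  assumes tf: "trivial_fibration K L p" and Y: "simplicial_set Y" and v: "simplicial_map Y L v"
    and X: "\<And>n. X n \<subseteq> simp Y n"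
      "\<And>m n x \<alpha>. \<lbrakk>x \<in> X n; \<alpha> \<in> Hom Simplex m n\<rbrakk> \<Longrightarrow> act Y \<alpha> x \<in> X m"
    and g: "\<And>n x. x \<in> X n \<Longrightarrow> g n x \<in> simp K n" "\<And>n x. x \<in> X n \<Longrightarrow> p n (g n x) = v n x"
      "\<And>m n x \<alpha>. \<lbrakk>x \<in> X n; \<alpha> \<in> Hom Simplex m n\<rbrakk> \<Longrightarrow> g m (act Y \<alpha> x) = act K \<alpha> (g n x)"
  shows "\<exists>h. simplicial_map Y K h \<and> (\<forall>n. \<forall>x\<in>simp Y n. p n (h n x) = v n x) \<and>
    (\<forall>n. \<forall>x\<in>X n. h n x = g n x)"
proof -
  have K: "simplicial_set K" and L: "simplicial_set L" and p: "simplicial_map K L p"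
    and lift: "\<And>n v y. \<lbrakk>v \<in> simp L n; \<And>m \<theta>. \<lbrakk>m < n; \<theta> \<in> Hom Simplex m n\<rbrakk> \<Longrightarrow> y \<theta> \<in> simp K m
        \<and> p m (y \<theta>) = act L \<theta> v \<and>
           (\<forall>l<n. \<forall>\<gamma>\<in>Hom Simplex l m. act K \<gamma> (y \<theta>) = y (\<theta> \<star> \<gamma>))\<rbrakk> \<Longrightarrow>
        (\<exists>z\<in>simp K n. p n z = v \<and> (\<forall>m<n. \<forall>\<theta>\<in>Hom Simplex m n. act K \<theta> z = y \<theta>))"
    using tf unfolding trivial_fibration_def by blast+
  interpret K: simplicial_set K by (rule K)
  interpret L: simplicial_set L by (rule L)
  interpret Y: simplicial_set Y by (rule Y)
  have p1: "p m (act K \<alpha> x) = act L \<alpha> (p n x)" if "x \<in> simp K n" "\<alpha> \<in> Hom Simplex m n" for m n \<alpha> x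
    using p that unfolding simplicial_map_def by blast
  have v1: "v m (act Y \<alpha> x) = act L \<alpha> (v n x)" if "x \<in> simp Y n" "\<alpha> \<in> Hom Simplex m n" for m n \<alpha> x
    using v that unfolding simplicial_map_def by blast
  have v2: "v n x \<in> simp L n" if "x \<in> simp Y n" for n x
    using v that unfolding simplicial_map_def by blast
  define P where "P N h \<longleftrightarrow> (\<forall>n<N. \<forall>x\<in>simp Y n. h n x \<in> simp K n \<and> p n (h n x) = v n x) \<and>
    (\<forall>n<N. \<forall>x\<in>X n. h n x = g n x) \<and>
    (\<forall>m<N. \<forall>n<N. \<forall>x\<in>simp Y n. \<forall>\<alpha>\<in>Hom Simplex m n. h m (act Y \<alpha> x) = act K \<alpha> (h n x))"
    for N and h :: "nat \<Rightarrow> 'c \<Rightarrow> 'a"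
  have "\<exists>H. \<forall>n. P n H"
  proof (rule stage_glue)
    show "P 0 undefined" by (simp add: P_def)
    show "P n h'" if "P n h" "\<And>k. k < n \<Longrightarrow> h' k = h k" for n h h'
      using that unfolding P_def by simp
    fix n h assume P: "P n h"
    have h1: "h k x \<in> simp K k" "p k (h k x) = v k x" if "k < n" "x \<in> simp Y k" for k x
      using P that unfolding P_def by blast+
    have h2: "h k x = g k x" if "k < n" "x \<in> X k" for k x
      using P that unfolding P_def by blast
    have h3: "h l (act Y \<alpha> x) = act K \<alpha> (h k x)"
      if "l < n" "k < n" "x \<in> simp Y k" "\<alpha> \<in> Hom Simplex l k" for l k x \<alpha>
      using P that unfolding P_def by blast
    have "\<exists>z. z \<in> simp K n \<and> p n z = v n y \<and>
        (\<forall>l<n. \<forall>\<gamma>\<in>Hom Simplex l n. act K \<gamma> z = h l (act Y \<gamma> y)) \<and> (y \<in> X n \<longrightarrow> z = g n y) \<and>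
        (\<forall>m<n. \<forall>\<theta>\<in>Hom Simplex n m. \<forall>y'\<in>simp Y m. y = act Y \<theta> y' \<longrightarrow> z = act K \<theta> (h m y'))"
      if y: "y \<in> simp Y n" for y
    proof -
      \<comment> \<open>Every way of writing \<open>y\<close> as a degeneracy yields a candidate
        value that has the correct boundary and is fixed by both idempotents of some edge. By
        \<open>degenerate_eqI\<close> all such candidates coincide.\<close>
      have deg: "act K \<theta> (h m y') \<in> simp K n" "p n (act K \<theta> (h m y')) = v n y"
        "\<lbrakk>l < n; \<gamma> \<in> Hom Simplex l n\<rbrakk> \<Longrightarrow> act K \<gamma> (act K \<theta> (h m y')) = h l (act Y \<gamma> y)"
        "\<exists>i<n. act K (up n i) (act K \<theta> (h m y')) = act K \<theta> (h m y') \<and>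
          act K (down n i) (act K \<theta> (h m y')) = act K \<theta> (h m y') \<and>
          act Y (up n i) y = y \<and> act Y (down n i) y = y"
        if m: "m < n" "\<theta> \<in> Hom Simplex n m" "y' \<in> simp Y m" "y = act Y \<theta> y'" for m \<theta> y' l \<gamma>
      proof -
        show "act K \<theta> (h m y') \<in> simp K n"
          by (rule K.act_simp[OF m(2) h1(1)[OF m(1,3)]])
        show "p n (act K \<theta> (h m y')) = v n y"
          using p1[OF h1(1)[OF m(1,3)] m(2)] v1[OF m(3,2)] h1(2)[OF m(1,3)] m(4) by simp
        show "act K \<gamma> (act K \<theta> (h m y')) = h l (act Y \<gamma> y)" if l: "l < n" "\<gamma> \<in> Hom Simplex l n"
          using h3[OF l(1) m(1,3) Comp_Simplex_Hom[OF l(2) m(2)]]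
            K.act_Comp[OF l(2) m(2) h1(1)[OF m(1,3)]] Y.act_Comp[OF l(2) m(2,3)] m(4) by simp
        obtain i where i: "i < n" "ap \<theta> i = ap \<theta> (Suc i)"
          by (rule not_injective_cases[OF m(2,1)])
        then show "\<exists>i<n. act K (up n i) (act K \<theta> (h m y')) = act K \<theta> (h m y') \<and>
          act K (down n i) (act K \<theta> (h m y')) = act K \<theta> (h m y') \<and>
          act Y (up n i) y = y \<and> act Y (down n i) y = y"
          using K.degenerate_fixed[OF m(2) i h1(1)[OF m(1,3)]] Y.degenerate_fixed[OF m(2) i m(3)] m(4)
          by blast
      qed
      have uniq: "act K \<theta> (h m y') = z"
        if m: "m < n" "\<theta> \<in> Hom Simplex n m" "y' \<in> simp Y m" "y = act Y \<theta> y'"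
          and z: "z \<in> simp K n" "\<And>l \<gamma>. \<lbrakk>l < n; \<gamma> \<in> Hom Simplex l n\<rbrakk> \<Longrightarrow> act K \<gamma> z = h l (act Y \<gamma> y)"
            "j < n" "act K (up n j) z = z" "act K (down n j) z = z"
        for m \<theta> y' z j
      proof -
        obtain i where i: "i < n" "act K (up n i) (act K \<theta> (h m y')) = act K \<theta> (h m y')"
          "act K (down n i) (act K \<theta> (h m y')) = act K \<theta> (h m y')" using deg(4)[OF m] by blast
        show ?thesis
          by (rule K.degenerate_eqI[OF deg(1)[OF m] z(1) _ i z(3-5)]) (simp add: deg(3)[OF m] z(2))
      qed
      show ?thesis
      proof (cases "y \<in> X n")
        case True
        have bd: "act K \<gamma> (g n y) = h l (act Y \<gamma> y)" if "l < n" "\<gamma> \<in> Hom Simplex l n" for l \<gamma>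
          using g(3)[OF True that(2)] h2[OF that(1) X(2)[OF True that(2)]] by simp
        have "g n y = act K \<theta> (h m y')"
          if m: "m < n" "\<theta> \<in> Hom Simplex n m" "y' \<in> simp Y m" "y = act Y \<theta> y'" for m \<theta> y'
        proof -
          obtain i where i: "i < n" "act Y (up n i) y = y" "act Y (down n i) y = y"
            using deg(4)[OF m] by blast
          have "act K (up n i) (g n y) = g n y" "act K (down n i) (g n y) = g n y"
            using g(3)[OF True up_down_Hom(1)[OF i(1)]] g(3)[OF True up_down_Hom(2)[OF i(1)]] i by auto
          from uniq[OF m g(1)[OF True] bd i(1) this] show ?thesis by simp
        qed
        then show ?thesis using g(1,2)[OF True] bd by blast
      next
        case False
        show ?thesis
        proof (cases "\<exists>m \<theta> y'. m < n \<and> \<theta> \<in> Hom Simplex n m \<and> y' \<in> simp Y m \<and> y = act Y \<theta> y'")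
          case True
          then obtain m \<theta> y' where m: "m < n" "\<theta> \<in> Hom Simplex n m" "y' \<in> simp Y m" "y = act Y \<theta> y'"
            by blast
          have "act K \<theta> (h m y') = act K \<theta>' (h m' y'')"
            if m': "m' < n" "\<theta>' \<in> Hom Simplex n m'" "y'' \<in> simp Y m'" "y = act Y \<theta>' y''" for m' \<theta>' y''
          proof -
            obtain j where j: "j < n" "act K (up n j) (act K \<theta>' (h m' y'')) = act K \<theta>' (h m' y'')"
              "act K (down n j) (act K \<theta>' (h m' y'')) = act K \<theta>' (h m' y'')" using deg(4)[OF m'] by blast
            show ?thesis by (rule uniq[OF m deg(1)[OF m'] deg(3)[OF m'] j])
          qed
          then show ?thesis
            using deg(1-3)[OF m] False by (intro exI[of _ "act K \<theta> (h m y')"]) blast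
        next
          case nd: False
          \<comment> \<open>The boundary of \<open>y\<close> is already mapped by \<open>h\<close>;
            \<open>fst \<theta>\<close> recovers the dimension of a face from the map
            \<open>\<theta>\<close> itself.\<close>
          have "\<exists>z\<in>simp K n. p n z = v n y \<and> (\<forall>m<n. \<forall>\<theta>\<in>Hom Simplex m n. act K \<theta> z =
              h (fst \<theta>) (act Y \<theta> y))"
          proof (rule lift[OF v2[OF y]], intro conjI allI impI ballI)
            fix m \<theta> assume m: "m < n" "\<theta> \<in> Hom Simplex m n"
            have [simp]: "fst \<theta> = m" using m by (auto simp: Hom_Simplex)
            note ym = Y.act_simp[OF m(2) y]
            show "h (fst \<theta>) (act Y \<theta> y) \<in> simp K m" using h1(1)[OF m(1) ym] by simp
            show "p m (h (fst \<theta>) (act Y \<theta> y)) = act L \<theta> (v n y)"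
              using h1(2)[OF m(1) ym] v1[OF y m(2)] by simp
            fix l \<gamma> assume l: "l < n" "\<gamma> \<in> Hom Simplex l m"
            have "fst (\<theta> \<star> \<gamma>) = l"
              using Comp_Simplex_Hom[OF l(2) m(2)] by (auto simp: Hom_Simplex)
            then show "act K \<gamma> (h (fst \<theta>) (act Y \<theta> y)) =
                h (fst (\<theta> \<star> \<gamma>)) (act Y (\<theta> \<star> \<gamma>) y)"
              using h3[OF l(1) m(1) ym l(2)] Y.act_Comp[OF l(2) m(2) y] by simp
          qed
          then obtain z where z: "z \<in> simp K n" "p n z = v n y"
            "\<forall>m<n. \<forall>\<theta>\<in>Hom Simplex m n. act K \<theta> z = h (fst \<theta>) (act Y \<theta> y)" by blast
          have "act K \<theta> z = h m (act Y \<theta> y)" if "m < n" "\<theta> \<in> Hom Simplex m n" for m \<theta>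
            using z(3) that by (force simp: Hom_Simplex)
          then show ?thesis using z(1,2) False nd by blast
        qed
      qed
    qed
    then obtain z where z: "\<And>y. y \<in> simp Y n \<Longrightarrow> z y \<in> simp K n"
      "\<And>y. y \<in> simp Y n \<Longrightarrow> p n (z y) = v n y"
      "\<And>y l \<gamma>. \<lbrakk>y \<in> simp Y n; l < n; \<gamma> \<in> Hom Simplex l n\<rbrakk> \<Longrightarrow> act K \<gamma> (z y) = h l (act Y \<gamma> y)"
      "\<And>y. y \<in> X n \<Longrightarrow> z y = g n y"
      "\<And>m \<theta> y'. \<lbrakk>m < n; \<theta> \<in> Hom Simplex n m; y' \<in> simp Y m\<rbrakk> \<Longrightarrow>
         z (act Y \<theta> y') = act K \<theta> (h m y')"
    proof -
      assume *: "\<And>y. y \<in> simp Y n \<Longrightarrow> \<exists>z. z \<in> simp K n \<and> p n z = v n y \<and>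
        (\<forall>l<n. \<forall>\<gamma>\<in>Hom Simplex l n. act K \<gamma> z = h l (act Y \<gamma> y)) \<and> (y \<in> X n \<longrightarrow> z = g n y) \<and>
        (\<forall>m<n. \<forall>\<theta>\<in>Hom Simplex n m. \<forall>y'\<in>simp Y m. y = act Y \<theta> y' \<longrightarrow> z = act K \<theta> (h m y'))"
      assume goal: "\<And>z. \<lbrakk>\<And>y. y \<in> simp Y n \<Longrightarrow> z y \<in> simp K n;
        \<And>y. y \<in> simp Y n \<Longrightarrow> p n (z y) = v n y;
        \<And>y l \<gamma>. \<lbrakk>y \<in> simp Y n; l < n; \<gamma> \<in> Hom Simplex l n\<rbrakk> \<Longrightarrow> act K \<gamma> (z y) = h l (act Y \<gamma> y);
        \<And>y. y \<in> X n \<Longrightarrow> z y = g n y;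
        \<And>m \<theta> y'. \<lbrakk>m < n; \<theta> \<in> Hom Simplex n m; y' \<in> simp Y m\<rbrakk> \<Longrightarrow>
         z (act Y \<theta> y') = act K \<theta> (h m y')\<rbrakk> \<Longrightarrow> thesis"
      from * have "\<exists>z. \<forall>y\<in>simp Y n. z y \<in> simp K n \<and> p n (z y) = v n y \<and>
        (\<forall>l<n. \<forall>\<gamma>\<in>Hom Simplex l n. act K \<gamma> (z y) = h l (act Y \<gamma> y)) \<and> (y \<in> X n \<longrightarrow> z y = g n y) \<and>
        (\<forall>m<n. \<forall>\<theta>\<in>Hom Simplex n m. \<forall>y'\<in>simp Y m. y = act Y \<theta> y' \<longrightarrow> z y = act K \<theta> (h m y'))"
        by (intro bchoice) blast
      then obtain z where z: "\<forall>y\<in>simp Y n. z y \<in> simp K n \<and> p n (z y) = v n y \<and>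
        (\<forall>l<n. \<forall>\<gamma>\<in>Hom Simplex l n. act K \<gamma> (z y) = h l (act Y \<gamma> y)) \<and> (y \<in> X n \<longrightarrow> z y = g n y) \<and>
        (\<forall>m<n. \<forall>\<theta>\<in>Hom Simplex n m. \<forall>y'\<in>simp Y m. y = act Y \<theta> y' \<longrightarrow> z y = act K \<theta> (h m y'))" ..
      show thesis
      proof (rule goal[of z])
        show "z (act Y \<theta> y') = act K \<theta> (h m y')"
          if "m < n" "\<theta> \<in> Hom Simplex n m" "y' \<in> simp Y m" for m \<theta> y'
          using z Y.act_simp[OF that(2,3)] that by blast
        show "z y = g n y" if "y \<in> X n" for y using z X(1) that by blast
      qed (use z in blast)+
    qed
    \<comment> \<open>Endomorphisms of \<open>[n]\<close> stay in degree \<open>n\<close> and are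
      not covered by the choice of \<open>z\<close>. A nonidentity one passes through
      \<open>[n - 1]\<close>, where both halves are known to be compatible.\<close>
    have endo: "z (act Y \<alpha> y) = act K \<alpha> (z y)" if y: "y \<in> simp Y n" and a: "\<alpha> \<in> Hom Simplex n n" for \<alpha> y
      using a
    proof (rule endo_cases)
      assume "\<alpha> = Ide Simplex n"
      then show ?thesis using y z(1)[OF y] by (simp add: Y.act_Ide K.act_Ide)
    next
      fix i assume i: "i < n" "ap \<alpha> i = ap \<alpha> (Suc i)"
      obtain \<beta> \<sigma> where s: "\<sigma> \<in> Hom Simplex n (n - 1)" "\<beta> \<in> Hom Simplex (n - 1) n"
        "\<alpha> = \<beta> \<star> \<sigma>" by (rule collapse_factor[OF a i]) (rule that)
      have n: "n - 1 < n" using i by simp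
      have "z (act Y \<alpha> y) = act K \<sigma> (h (n - 1) (act Y \<beta> y))"
        using z(5)[OF n s(1) Y.act_simp[OF s(2) y]] Y.act_Comp[OF s(1,2) y] s(3) by simp
      also have "\<dots> = act K \<alpha> (z y)"
        using z(3)[OF y n s(2)] K.act_Comp[OF s(1,2) z(1)[OF y]] s(3) by simp
      finally show ?thesis .
    qed
    have "P (Suc n) (h(n := z))"
      unfolding P_def less_Suc_eq
    proof (intro conjI allI impI ballI)
      fix m k x \<alpha> assume *: "m < n \<or> m = n" "k < n \<or> k = n" "x \<in> simp Y k" "\<alpha> \<in> Hom Simplex m k"
      then show "(h(n := z)) m (act Y \<alpha> x) = act K \<alpha> ((h(n := z)) k x)"
        using h3[of m k x \<alpha>] z(3)[of x m \<alpha>] z(5)[of k \<alpha> x] endo[of x \<alpha>] by auto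
    qed (use h1 h2 z in auto)
    then show "\<exists>h'. P (Suc n) h' \<and> (\<forall>k<n. h' k = h k)"
      by (intro exI[of _ "h(n := z)"]) simp
  qed
  then obtain H where H: "\<And>n. P n H" by blast
  show ?thesis
  proof (intro exI[of _ H] conjI allI ballI)
    show "simplicial_map Y K H"
      unfolding simplicial_map_def
    proof (intro conjI allI ballI impI)
      fix m n \<alpha> x assume "x \<in> simp Y n" "\<alpha> \<in> Hom Simplex m n"
      then show "H m (act Y \<alpha> x) = act K \<alpha> (H n x)"
        using H[of "Suc (max m n)"] unfolding P_def by (meson le_imp_less_Suc max.cobounded1 max.cobounded2)
    next
      fix n x assume "x \<in> simp Y n"
      then show "H n x \<in> simp K n" using H[of "Suc n"] unfolding P_def by blast
    qed
    show "p n (H n x) = v n x" if "x \<in> simp Y n" for n x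
      using H[of "Suc n"] that unfolding P_def by blast
    show "H n x = g n x" if "x \<in> X n" for n x
      using H[of "Suc n"] that unfolding P_def by blast
  qed
qed

section \<open>Geometric realization\<close>

lemma topspace_cells: "topspace (cells K) = {((n, x), t). x \<in> simp K n \<and> t \<in> standard_simplex n}"
  by (auto simp: cells_def)

lemma push_eq: "\<alpha> \<in> Hom Simplex m n \<Longrightarrow> push \<alpha> t j = (\<Sum>i | i \<le> m \<and> ap \<alpha> i = j. t i)"
  by (auto simp: push_def Hom_Simplex ap_def)

lemma sum_push:
  assumes \<alpha>: "\<alpha> \<in> Hom Simplex m n"
  shows "(\<Sum>j | j \<le> N \<and> P j. push \<alpha> t j) = (\<Sum>i | i \<le> m \<and> ap \<alpha> i \<le> N \<and> P (ap \<alpha> i). t i)"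
proof -
  have "(\<Sum>j | j \<le> N \<and> P j. push \<alpha> t j)
      = (\<Sum>j | j \<le> N \<and> P j. \<Sum>i | i \<in> {i. i \<le> m \<and> ap \<alpha> i \<le> N \<and> P (ap \<alpha> i)} \<and> ap \<alpha> i = j. t i)"
    unfolding push_eq[OF \<alpha>] by (intro sum.cong) (auto intro!: sum.cong)
  also have "\<dots> = (\<Sum>i | i \<le> m \<and> ap \<alpha> i \<le> N \<and> P (ap \<alpha> i). t i)"
    by (rule sum.group) auto
  finally show ?thesis .
qed

lemma push_simplex:
  assumes \<alpha>: "\<alpha> \<in> Hom Simplex m n" and t: "t \<in> standard_simplex m"
  shows "push \<alpha> t \<in> standard_simplex n"
proof -
  have nn: "0 \<le> push \<alpha> t j" for j
    unfolding push_eq[OF \<alpha>] using t by (intro sum_nonneg) (auto simp: standard_simplex_def)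
  have "(\<Sum>j\<le>n. push \<alpha> t j) = (\<Sum>j | j \<le> n \<and> True. push \<alpha> t j)"
    by (intro sum.cong) auto
  also have "\<dots> = (\<Sum>i\<le>m. t i)"
    unfolding sum_push[OF \<alpha>] by (intro sum.cong) (auto intro: ap_le[OF \<alpha>])
  also have "\<dots> = 1" using t by (simp add: standard_simplex_def)
  finally have 1: "(\<Sum>j\<le>n. push \<alpha> t j) = 1" .
  have 0: "push \<alpha> t j = 0" if "j > n" for j
    unfolding push_eq[OF \<alpha>] using that by (intro sum.neutral) (auto dest!: ap_le[OF \<alpha>])
  have "push \<alpha> t j \<le> 1" for j
  proof (cases "j \<le> n")
    case True
    then show ?thesis using member_le_sum[of j "{..n}" "push \<alpha> t"] nn 1 by simp
  qed (simp add: 0)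
  with nn 0 1 show ?thesis by (simp add: standard_simplex_def)
qed

lemma point_class_eq: "point_class K p = point_class K q \<longleftrightarrow> equivclp (glue K) p q"
proof
  assume "point_class K p = point_class K q"
  then have "q \<in> point_class K p" by (simp add: point_class_def)
  then show "equivclp (glue K) p q" by (simp add: point_class_def)
next
  assume "equivclp (glue K) p q"
  then have "equivclp (glue K) p r \<longleftrightarrow> equivclp (glue K) q r" for r
    using equivclp_trans[of "glue K"] equivclp_sym[of "glue K"] by blast
  then show "point_class K p = point_class K q"
    unfolding point_class_def by (intro arg_cong[of _ _ Collect] ext)
qed

lemma point_class_glue: "glue K p q \<Longrightarrow> point_class K p = point_class K q"
  unfolding point_class_eq by (rule r_into_equivclp)

lemma topspace_realization: "topspace (realization K) = point_class K ` topspace (cells K)"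
  using quotient_map_quotient_topology[of "cells K" "point_class K"]
  unfolding realization_def by (metis quotient_imp_surjective_map)

lemma quotient_map_point_class: "quotient_map (cells K) (realization K) (point_class K)"
  unfolding realization_def by (rule quotient_map_quotient_topology)

lemma glue_cells:
  assumes "simplicial_set K" "glue K p q"
  shows "p \<in> topspace (cells K)" "q \<in> topspace (cells K)"
  using assms(2)
proof (atomize(full), cases)
  case (1 \<alpha> m n x t)
  then show "p \<in> topspace (cells K) \<and> q \<in> topspace (cells K)"
    using simplicial_set.act_simp[OF assms(1) 1(3,4)] push_simplex by (auto simp: topspace_cells)
qed

lemma equivclp_glue_induct:
  assumes K: "simplicial_set K" and "equivclp (glue K) p q" "p \<in> topspace (cells K)"
    and f: "\<And>p q. glue K p q \<Longrightarrow> f p = f q"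
  shows "q \<in> topspace (cells K) \<and> f q = f p"
  using assms(2)
proof (induction rule: equivclp_induct)
  case (step y z)
  then show ?case using glue_cells[OF K] f by metis
qed (use assms(3) in simp)

lemma rep_point_class:
  "equivclp (glue K) p (rep (point_class K p))"
proof -
  have "p \<in> point_class K p" by (simp add: point_class_def)
  then have "rep (point_class K p) \<in> point_class K p" unfolding rep_def by (rule someI)
  then show ?thesis by (simp add: point_class_def)
qed

text \<open>\<open>realization_map\<close> evaluates at an arbitrary representative. The formula on
  representatives is invariant under \<open>glue\<close> because \<open>\<theta>\<close> commutes
  with the simplicial operators, so the choice is immaterial.\<close>

lemma realization_map_point_class:
  assumes K: "simplicial_set K" and \<theta>: "simplicial_map K L \<theta>"
    and x: "x \<in> simp K n" and t: "t \<in> standard_simplex n"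
  shows "realization_map L \<theta> (point_class K ((n, x), t)) = point_class L ((n, \<theta> n x), t)"
proof -
  let ?f = "\<lambda>((n, x), t). point_class L ((n, \<theta> n x), t)"
  have f: "?f p = ?f q" if "glue K p q" for p q
    using that
  proof cases
    case (1 \<alpha> m n x t)
    have "\<theta> m (act K \<alpha> x) = act L \<alpha> (\<theta> n x)" "\<theta> n x \<in> simp L n"
      using \<theta> 1 unfolding simplicial_map_def by blast+
    then have "glue L ((m, \<theta> m (act K \<alpha> x)), t) ((n, \<theta> n x), push \<alpha> t)"
      using 1 by (auto intro!: glue.intros)
    then show ?thesis using 1 by (simp add: point_class_glue)
  qed
  have "?f (rep (point_class K ((n, x), t))) = ?f ((n, x), t)"
    using equivclp_glue_induct[where f = ?f, OF K rep_point_class[of K "((n, x), t)"] _ f] x t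
    by (simp add: topspace_cells)
  then show ?thesis by (simp add: realization_map_def split_beta)
qed

lemma continuous_map_cell:
  assumes "x \<in> simp K n"
  shows "continuous_map (subtopology (powertop_real UNIV) (standard_simplex n)) (realization K)
    (\<lambda>t. point_class K ((n, x), t))"
proof -
  let ?X = "\<lambda>(n, x). subtopology (powertop_real UNIV) (standard_simplex n)"
  have "continuous_map (?X (n, x)) (cells K) (\<lambda>t. ((n, x), t))"
    unfolding cells_def by (rule continuous_map_component_injection) (use assms in auto)
  from continuous_map_compose[OF this quotient_imp_continuous_map[OF quotient_map_point_class]]
  show ?thesis by (simp add: o_def)
qed

text \<open>Products distribute over disjoint unions for arbitrary spaces, since every summand is
  open. This is what allows a homotopy on a realization to be checked cell by cell.\<close>

lemma openin_prod_sum_topology: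
  assumes "U \<subseteq> topspace (prod_topology Z (sum_topology X I))"
    and "\<And>i. i \<in> I \<Longrightarrow> openin (prod_topology Z (X i)) {(s, t). (s, (i, t)) \<in> U}"
  shows "openin (prod_topology Z (sum_topology X I)) U"
  unfolding openin_prod_topology_alt
proof (intro allI impI)
  fix s j assume "(s, j) \<in> U"
  moreover obtain i t where j: "j = (i, t)" by (cases j)
  moreover have i: "i \<in> I" using assms(1) calculation by auto
  ultimately have "(s, t) \<in> {(s, t). (s, (i, t)) \<in> U}" by simp
  with assms(2)[OF i] obtain V W where VW: "openin Z V" "openin (X i) W" "s \<in> V" "t \<in> W"
    "V \<times> W \<subseteq> {(s, t). (s, (i, t)) \<in> U}"
    unfolding openin_prod_topology_alt by meson
  have "openin (sum_topology X I) (Pair i ` W)"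
    using open_map_component_injection[OF i, of X] VW(2) by (simp add: open_map_def)
  with VW j show "\<exists>V W. openin Z V \<and> openin (sum_topology X I) W \<and> s \<in> V \<and> j \<in> W \<and> V \<times> W \<subseteq> U"
    by (intro exI[of _ V] exI[of _ "Pair i ` W"]) auto
qed

lemma continuous_map_prod_sum_topology:
  assumes "\<And>i. i \<in> I \<Longrightarrow> continuous_map (prod_topology Z (X i)) Y (\<lambda>(s, t). f (s, (i, t)))"
  shows "continuous_map (prod_topology Z (sum_topology X I)) Y f"
  unfolding continuous_map_def
proof (intro conjI allI impI)
  show "f \<in> topspace (prod_topology Z (sum_topology X I)) \<rightarrow> topspace Y"
    using assms by (fastforce simp: continuous_map_def Pi_iff)
  fix U assume U: "openin Y U"
  show "openin (prod_topology Z (sum_topology X I))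
    {x \<in> topspace (prod_topology Z (sum_topology X I)). f x \<in> U}"
  proof (rule openin_prod_sum_topology)
    fix i assume i: "i \<in> I"
    have "openin (prod_topology Z (X i))
      {x \<in> topspace (prod_topology Z (X i)). (case x of (s, t) \<Rightarrow> f (s, (i, t))) \<in> U}"
      by (rule openin_continuous_map_preimage[OF assms[OF i] U])
    also have "{x \<in> topspace (prod_topology Z (X i)). (case x of (s, t) \<Rightarrow> f (s, (i, t))) \<in> U}
      = {(s, t). (s, (i, t)) \<in> {x \<in> topspace (prod_topology Z (sum_topology X I)). f x \<in> U}}"
      using i by auto
    finally show "openin (prod_topology Z (X i))
      {(s, t). (s, (i, t)) \<in> {x \<in> topspace (prod_topology Z (sum_topology X I)). f x \<in> U}}" .
  qed auto
qed

lemma continuous_map_realization_map: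
  assumes K: "simplicial_set K" and \<theta>: "simplicial_map K L \<theta>"
  shows "continuous_map (realization K) (realization L) (realization_map L \<theta>)"
proof (rule continuous_compose_quotient_map[OF quotient_map_point_class])
  let ?X = "\<lambda>(n, x). subtopology (powertop_real UNIV) (standard_simplex n)"
  let ?g = "realization_map L \<theta> \<circ> point_class K"
  \<comment> \<open>A one-point factor puts a plain map on the cells into the form of
    \<open>continuous_map_prod_sum_topology\<close>.\<close>
  have cont: "continuous_map (prod_topology (top_of_set {0::real}) (cells K)) (realization L) (\<lambda>(s, p). ?g p)"
    unfolding cells_def
  proof (rule continuous_map_prod_sum_topology)
    fix i assume "i \<in> Sigma UNIV (simp K)"
    then obtain n x where i: "i = (n, x)" "x \<in> simp K n" by auto
    have "\<theta> n x \<in> simp L n" using i \<theta> unfolding simplicial_map_def by blast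
    note c = continuous_map_cell[OF this]
    have "continuous_map (prod_topology (top_of_set {0::real}) (?X i)) (realization L)
      ((\<lambda>t. point_class L ((n, \<theta> n x), t)) \<circ> snd)"
      by (rule continuous_map_compose[OF continuous_map_snd]) (use c i in simp)
    then show "continuous_map (prod_topology (top_of_set {0::real}) (?X i)) (realization L)
      (\<lambda>(s, t). case (s, i, t) of (s, p) \<Rightarrow> ?g p)"
      by (rule continuous_map_eq)
        (use i in \<open>auto simp: realization_map_point_class[OF K \<theta>] topspace_standard_simplex\<close>)
  qed
  have "continuous_map (cells K) (prod_topology (top_of_set {0::real}) (cells K)) (\<lambda>p. (0, p))"
    by (simp add: continuous_map_pairwise o_def)
  from continuous_map_compose[OF this cont]
  show "continuous_map (cells K) (realization L) ?g" by (simp add: o_def)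
qed

lemma simplicial_map_comp:
  assumes "simplicial_map K L \<theta>" "simplicial_map L N \<phi>"
  shows "simplicial_map K N (\<lambda>n x. \<phi> n (\<theta> n x))"
  using assms unfolding simplicial_map_def by metis

lemma realization_map_comp:
  assumes K: "simplicial_set K" and L: "simplicial_set L"
    and \<theta>: "simplicial_map K L \<theta>" and \<phi>: "simplicial_map L N \<phi>"
    and c: "c \<in> topspace (realization K)"
  shows "realization_map N (\<lambda>n x. \<phi> n (\<theta> n x)) c = realization_map N \<phi> (realization_map L \<theta> c)"
proof -
  obtain n x t where *: "c = point_class K ((n, x), t)" "x \<in> simp K n" "t \<in> standard_simplex n"
    using c unfolding topspace_realization topspace_cells by auto
  have "\<theta> n x \<in> simp L n" using * \<theta> unfolding simplicial_map_def by blast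
  with * show ?thesis
    by (simp add: realization_map_point_class[OF K \<theta>] realization_map_point_class[OF L \<phi>]
        realization_map_point_class[OF K simplicial_map_comp[OF \<theta> \<phi>]])
qed

lemma realization_map_cong:
  assumes K: "simplicial_set K"
    and \<theta>: "simplicial_map K L \<theta>" and eq: "\<And>n x. x \<in> simp K n \<Longrightarrow> \<theta> n x = \<phi> n x"
    and c: "c \<in> topspace (realization K)"
  shows "realization_map L \<theta> c = realization_map L \<phi> c"
proof -
  obtain n x t where *: "c = point_class K ((n, x), t)" "x \<in> simp K n" "t \<in> standard_simplex n"
    using c unfolding topspace_realization topspace_cells by auto
  have "act K \<alpha> x \<in> simp K m" if "\<alpha> \<in> Hom Simplex m n" "x \<in> simp K n" for \<alpha> m n x
    using simplicial_set.act_simp[OF K that] .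
  then have "simplicial_map K L \<phi>" using \<theta> eq unfolding simplicial_map_def by metis
  with * eq show ?thesis
    by (simp add: realization_map_point_class[OF K \<theta>] realization_map_point_class[OF K])
qed

lemma realization_map_id:
  assumes K: "simplicial_set K" and c: "c \<in> topspace (realization K)"
  shows "realization_map K (\<lambda>n x. x) c = c"
proof -
  obtain n x t where *: "c = point_class K ((n, x), t)" "x \<in> simp K n" "t \<in> standard_simplex n"
    using c unfolding topspace_realization topspace_cells by auto
  have "simplicial_map K K (\<lambda>n x. x)" by (simp add: simplicial_map_def)
  with * show ?thesis by (simp add: realization_map_point_class[OF K])
qed

subsection \<open>Simplicial homotopies\<close>

text \<open>
  \<open>cyl K\<close> is the product of \<open>K\<close> with the simplicial set \<open>E\<close> whose \<open>n\<close>-simplices are all maps from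
  \<open>{0..n}\<close> to \<open>{0, 1}\<close>, encoded as subsets of \<open>{0..n}\<close>. Since these maps need not be monotone, the
  homotopy on the realization of \<open>K\<close> is given by one formula on each cell: the simplex \<open>[n]\<close> is
  doubled and the mass of each vertex is split between its two copies.
\<close>

definition cyl :: "'a sset \<Rightarrow> ('a \<times> nat set) sset" where
  "cyl K = \<lparr>simp = (\<lambda>n. {(x, S). x \<in> simp K n \<and> S \<subseteq> {0..n}}),
     act = (\<lambda>\<alpha> (x, S). (act K \<alpha> x, {i. i \<le> fst \<alpha> \<and> ap \<alpha> i \<in> S}))\<rparr>"

lemma cyl_act: "\<alpha> \<in> Hom Simplex m n \<Longrightarrow>
  act (cyl K) \<alpha> (x, S) = (act K \<alpha> x, {i. i \<le> m \<and> ap \<alpha> i \<in> S})"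
  by (auto simp: cyl_def Hom_Simplex)

lemma cyl_simp: "(x, S) \<in> simp (cyl K) n \<longleftrightarrow> x \<in> simp K n \<and> S \<subseteq> {0..n}"
  by (simp add: cyl_def)

lemma simplicial_set_cyl:
  assumes "simplicial_set K" shows "simplicial_set (cyl K)"
proof -
  interpret simplicial_set K by (rule assms)
  show ?thesis
  proof
    fix \<alpha> m n and z :: "'a \<times> nat set"
    assume "\<alpha> \<in> Hom Simplex m n" "z \<in> simp (cyl K) n"
    then show "act (cyl K) \<alpha> z \<in> simp (cyl K) m"
      using act_simp by (cases z) (auto simp: cyl_act cyl_simp)
  next
    fix z :: "'a \<times> nat set" and n assume "z \<in> simp (cyl K) n"
    then show "act (cyl K) (Ide Simplex n) z = z"
      by (cases z) (auto simp: cyl_act[OF Ide_Simplex_Hom] cyl_simp act_Ide ap_Ide)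
  next
    fix \<alpha> \<beta> l m n and z :: "'a \<times> nat set"
    assume *: "\<alpha> \<in> Hom Simplex l m" "\<beta> \<in> Hom Simplex m n" "z \<in> simp (cyl K) n"
    then show "act (cyl K) (\<beta> \<star> \<alpha>) z = act (cyl K) \<alpha> (act (cyl K) \<beta> z)"
      using ap_le[OF *(1)]
      by (cases z) (auto simp: cyl_act[OF *(1)] cyl_act[OF *(2)] cyl_act[OF Comp_Simplex_Hom[OF *(1,2)]]
        cyl_simp act_Comp ap_Comp[OF *(1,2)])
  qed
qed

section \<open>Splitting barycentric coordinates\<close>

definition cum :: "(nat \<Rightarrow> real) \<Rightarrow> nat \<Rightarrow> real" where
  "cum t i = (\<Sum>k<i. t k)"

text \<open>Lay the vertices out as consecutive intervals of lengths \<open>t i\<close> that fill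
  the unit interval: vertex \<open>i\<close> occupies the part from \<open>cum t i\<close> to
  \<open>cum t (Suc i)\<close>. For \<open>0 \<le> s\<close>, \<open>lo s t i\<close> is the length
  of its intersection with \<open>[0, s]\<close>.\<close>

definition lo :: "real \<Rightarrow> (nat \<Rightarrow> real) \<Rightarrow> nat \<Rightarrow> real" where
  "lo s t i = min s (cum t (Suc i)) - min s (cum t i)"

text \<open>Vertex \<open>i\<close> is doubled to \<open>2 * i\<close> and
  \<open>Suc (2 * i)\<close>. The lower copy receives the mass below \<open>s\<close>, the upper
  copy the rest; as \<open>s\<close> grows, mass moves from the upper to the lower copies.\<close>

definition split_mass :: "real \<Rightarrow> (nat \<Rightarrow> real) \<Rightarrow> nat \<Rightarrow> real" where
  "split_mass s t j = (if even j then lo s t (j div 2) else t (j div 2) - lo s t (j div 2))"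

lemma simplex_nonneg: "t \<in> standard_simplex n \<Longrightarrow> 0 \<le> t i"
  by (simp add: standard_simplex_def)

lemma simplex_zero: "\<lbrakk>t \<in> standard_simplex n; n < i\<rbrakk> \<Longrightarrow> t i = 0"
  by (simp add: standard_simplex_def)

lemma cum_mono: "\<lbrakk>t \<in> standard_simplex n; i \<le> j\<rbrakk> \<Longrightarrow> cum t i \<le> cum t j"
  unfolding cum_def by (rule sum_mono2) (auto simp: simplex_nonneg)

lemma cum_Suc: "cum t (Suc i) = cum t i + t i"
  by (simp add: cum_def)

lemma cum_full: "t \<in> standard_simplex n \<Longrightarrow> cum t (Suc n) = 1"
  by (simp add: cum_def standard_simplex_def lessThan_Suc_atMost)

lemma lo_bounds:
  assumes "t \<in> standard_simplex n" shows "0 \<le> lo s t i" "lo s t i \<le> t i"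
  using simplex_nonneg[OF assms, of i] unfolding lo_def cum_Suc by auto

lemma sum_lo: "0 \<le> s \<Longrightarrow> (\<Sum>k<i. lo s t k) = min s (cum t i)"
  by (induction i) (auto simp: lo_def cum_def)

lemma sum_split_mass: "(\<Sum>j\<le>Suc (2 * n). split_mass s t j) = (\<Sum>i\<le>n. t i)"
  by (induction n) (auto simp: split_mass_def)

lemma split_mass_simplex:
  assumes t: "t \<in> standard_simplex n"
  shows "split_mass s t \<in> standard_simplex (Suc (2 * n))"
proof -
  have "split_mass s t j \<ge> 0" for j
    using lo_bounds[OF t] by (simp add: split_mass_def)
  moreover have "split_mass s t j \<le> 1" for j
    using lo_bounds[OF t, of s "j div 2"] t
    by (auto simp: split_mass_def standard_simplex_def) (smt (verit))+
  moreover have "split_mass s t j = 0" if "j > Suc (2 * n)" for j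
    using that lo_bounds[OF t, of s "j div 2"] simplex_zero[OF t, of "j div 2"]
    by (simp add: split_mass_def)
  ultimately show ?thesis
    using t sum_split_mass[of s t n] by (simp add: standard_simplex_def)
qed

text \<open>Pushing along a monotone map concatenates neighbouring intervals, so cutting at
  \<open>s\<close> commutes with it. Formally, the vertices sent below \<open>i\<close> form an
  initial segment of length \<open>cnt i\<close>, which turns both partial sums into
  \<open>cum\<close> at matching places.\<close>

lemma push_lo:
  assumes \<alpha>: "\<alpha> \<in> Hom Simplex m n" and s: "0 \<le> s"
  shows "(\<Sum>k | k \<le> m \<and> ap \<alpha> k = i. lo s t k) = lo s (push \<alpha> t) i"
proof -
  define cnt where "cnt i = card {k. k \<le> m \<and> ap \<alpha> k < i}" for i
  have initial: "{k. k \<le> m \<and> ap \<alpha> k < i} = {..<cnt i}" for i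
  proof -
    let ?A = "{k. k \<le> m \<and> ap \<alpha> k < i}"
    have "\<exists>c. ?A = {..<c}"
    proof (cases "\<exists>k\<le>m. \<not> ap \<alpha> k < i")
      case True
      define c where "c = (LEAST k. k \<le> m \<and> \<not> ap \<alpha> k < i)"
      have c: "c \<le> m" "\<not> ap \<alpha> c < i" using LeastI_ex[of "\<lambda>k. k \<le> m \<and> \<not> ap \<alpha> k < i"] True
        unfolding c_def by auto
      have "k < c" if "k \<le> m" "ap \<alpha> k < i" for k
        using ap_mono[OF \<alpha>, of c k] that c by (meson le_less_trans not_le)
      moreover have "k \<le> m \<and> ap \<alpha> k < i" if "k < c" for k
        using not_less_Least[of k "\<lambda>k. k \<le> m \<and> \<not> ap \<alpha> k < i"] that c unfolding c_def by auto
      ultimately show ?thesis by blast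
    next
      case False
      then have "?A = {..<Suc m}" by auto
      then show ?thesis by blast
    qed
    then obtain c where c: "?A = {..<c}" ..
    then have "cnt i = c" unfolding cnt_def by simp
    with c show ?thesis by simp
  qed
  have cum_push: "cum (push \<alpha> t) i = cum t (cnt i)" for i
  proof (cases i)
    case (Suc N)
    have "cum (push \<alpha> t) i = (\<Sum>j | j \<le> N \<and> True. push \<alpha> t j)"
      unfolding cum_def Suc by (intro sum.cong) auto
    also have "\<dots> = (\<Sum>k | k \<le> m \<and> ap \<alpha> k < i. t k)"
      unfolding sum_push[OF \<alpha>] Suc by (intro sum.cong) auto
    finally show ?thesis unfolding initial cum_def .
  qed (auto simp: cum_def cnt_def)
  have lo_lt: "(\<Sum>k | k \<le> m \<and> ap \<alpha> k < i. lo s t k) = min s (cum (push \<alpha> t) i)" for i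
    unfolding initial cum_push by (rule sum_lo[OF s])
  have "{k. k \<le> m \<and> ap \<alpha> k < Suc i} = {k. k \<le> m \<and> ap \<alpha> k < i} \<union> {k. k \<le> m \<and> ap \<alpha> k = i}"
    by auto
  then have "(\<Sum>k | k \<le> m \<and> ap \<alpha> k < Suc i. lo s t k)
    = (\<Sum>k | k \<le> m \<and> ap \<alpha> k < i. lo s t k) + (\<Sum>k | k \<le> m \<and> ap \<alpha> k = i. lo s t k)"
    by (simp add: sum.union_disjoint[symmetric] disjoint_iff)
  then show ?thesis unfolding lo_lt by (simp add: lo_def[of s "push \<alpha> t"])
qed

text \<open>The obvious doubling of \<open>\<alpha>\<close>, acting on lower and upper copies
  separately, is not monotone as soon as \<open>\<alpha>\<close> collapses an edge. When the cut
  falls into vertex \<open>c\<close>, however, the split mass is supported on the lower copies up to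
  \<open>c\<close> followed by the upper copies from \<open>c\<close> on. \<open>cut_mass\<close> is
  this mass on a chain of \<open>m + 2\<close> vertices, and \<open>cut_map\<close> sends the chain
  monotonically into the doubled simplex.\<close>

definition cut_mass :: "nat \<Rightarrow> real \<Rightarrow> (nat \<Rightarrow> real) \<Rightarrow> nat \<Rightarrow> real" where
  "cut_mass c s t k = (if k \<le> c then lo s t k else t (k - 1) - lo s t (k - 1))"

definition cut_map :: "nat \<Rightarrow> simplex_map \<Rightarrow> nat \<Rightarrow> nat \<Rightarrow> simplex_map" where
  "cut_map c \<alpha> m n = mk (Suc m) (\<lambda>k. if k \<le> c then 2 * ap \<alpha> k else Suc (2 * ap \<alpha> (k - 1))) (Suc (2 * n))"

lemma cut_map_Hom:
  assumes \<alpha>: "\<alpha> \<in> Hom Simplex m n" and c: "c \<le> m"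
  shows "cut_map c \<alpha> m n \<in> Hom Simplex (Suc m) (Suc (2 * n))"
  unfolding cut_map_def
proof (rule mk_Hom)
  show "(if i \<le> c then 2 * ap \<alpha> i else Suc (2 * ap \<alpha> (i - 1))) \<le> Suc (2 * n)" if "i \<le> Suc m" for i
    using ap_le[OF \<alpha>, of i] ap_le[OF \<alpha>, of "i - 1"] that c by auto
  show "(if i \<le> c then 2 * ap \<alpha> i else Suc (2 * ap \<alpha> (i - 1)))
    \<le> (if j \<le> c then 2 * ap \<alpha> j else Suc (2 * ap \<alpha> (j - 1)))" if "i \<le> j" "j \<le> Suc m" for i j
  proof (cases "i \<le> c \<and> \<not> j \<le> c")
    case True
    then have "i \<le> j - 1" "j - 1 \<le> m" using that by auto
    then have "ap \<alpha> i \<le> ap \<alpha> (j - 1)" by (rule ap_mono[OF \<alpha>])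
    with True show ?thesis by simp
  next
    case False
    then show ?thesis
      using ap_mono[OF \<alpha>, of i j] ap_mono[OF \<alpha>, of "i - 1" "j - 1"] that c by auto
  qed
qed

text \<open>At most one vertex has its mass split properly; this is the vertex \<open>c\<close>.\<close>

lemma cut_exists:
  assumes t: "t \<in> standard_simplex m" and s: "0 \<le> s" "s \<le> 1"
  obtains c where "c \<le> m" "\<And>i. i < c \<Longrightarrow> lo s t i = t i" "\<And>i. c < i \<Longrightarrow> lo s t i = 0"
proof -
  define c where "c = (LEAST c. s \<le> cum t (Suc c))"
  have m: "s \<le> cum t (Suc m)" using cum_full[OF t] s by simp
  have c: "c \<le> m" unfolding c_def by (rule Least_le[of "\<lambda>c. s \<le> cum t (Suc c)", OF m])
  have sc: "s \<le> cum t (Suc c)" unfolding c_def by (rule LeastI[of "\<lambda>c. s \<le> cum t (Suc c)", OF m])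
  have less: "cum t (Suc i) < s" if "i < c" for i
    using not_less_Least[of i "\<lambda>c. s \<le> cum t (Suc c)"] that unfolding c_def by auto
  show thesis
  proof (rule that[OF c])
    show "lo s t i = t i" if "i < c" for i
      using less[OF that] simplex_nonneg[OF t, of i] unfolding lo_def cum_Suc by simp
    show "lo s t i = 0" if "c < i" for i
      using sc cum_mono[OF t, of "Suc c" i] cum_mono[OF t, of i "Suc i"] that unfolding lo_def by simp
  qed
qed

lemma cut_mass_simplex:
  assumes t: "t \<in> standard_simplex m" and c: "c \<le> m" "\<And>i. i < c \<Longrightarrow> lo s t i = t i"
    "\<And>i. c < i \<Longrightarrow> lo s t i = 0"
  shows "cut_mass c s t \<in> standard_simplex (Suc m)"
proof -
  have "cut_mass c s t k \<ge> 0" for k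
    using lo_bounds[OF t] by (simp add: cut_mass_def)
  moreover have "cut_mass c s t k \<le> 1" for k
    using lo_bounds[OF t, of s k] lo_bounds[OF t, of s "k - 1"] t
    by (auto simp: cut_mass_def standard_simplex_def) (smt (verit))+
  moreover have "cut_mass c s t k = 0" if "k > Suc m" for k
    using that lo_bounds[OF t, of s "k - 1"] simplex_zero[OF t, of "k - 1"] c(1)
    by (simp add: cut_mass_def)
  moreover have "(\<Sum>k\<le>Suc m. cut_mass c s t k) = 1"
  proof -
    have "(\<Sum>k\<le>N. cut_mass c s t k) = (\<Sum>k\<le>N. lo s t k)" if "N \<le> c" for N
      using that by (intro sum.cong) (auto simp: cut_mass_def)
    moreover have lo_t: "(\<Sum>k<c. lo s t k) = (\<Sum>k<c. t k)"
      using c by (intro sum.cong) auto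
    have "(\<Sum>k\<le>Suc (c + N). cut_mass c s t k) = (\<Sum>k\<le>c + N. t k)" for N
    proof (induction N)
      case 0
      have "(\<Sum>k\<le>c. cut_mass c s t k) = (\<Sum>k<c. t k) + lo s t c"
        using lo_t calculation[of c] by (simp add: lessThan_Suc_atMost[symmetric])
      then show ?case by (simp add: cut_mass_def lessThan_Suc_atMost[symmetric])
    next
      case (Suc N)
      then show ?case using c(3)[of "Suc (c + N)"] by (simp add: cut_mass_def)
    qed
    from this[of "m - c"] c(1) t show ?thesis by (simp add: standard_simplex_def)
  qed
  ultimately show ?thesis by (simp add: standard_simplex_def)
qed

text \<open>Even target vertices collect lower masses from positions up to \<open>c\<close>, odd
  ones upper masses from \<open>c\<close> on. What is left out contributes nothing: above
  \<open>c\<close> the lower mass vanishes, below \<open>c\<close> the upper mass does. The sums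
  over full fibres are then given by \<open>push_lo\<close>.\<close>

lemma push_cut_map:
  assumes \<alpha>: "\<alpha> \<in> Hom Simplex m n" and s: "0 \<le> s"
    and c: "c \<le> m" "\<And>i. i < c \<Longrightarrow> lo s t i = t i" "\<And>i. c < i \<Longrightarrow> lo s t i = 0"
  shows "push (cut_map c \<alpha> m n) (cut_mass c s t) = split_mass s (push \<alpha> t)"
proof
  fix j
  have cm: "ap (cut_map c \<alpha> m n) k = (if k \<le> c then 2 * ap \<alpha> k else Suc (2 * ap \<alpha> (k - 1)))"
    if "k \<le> Suc m" for k
    using that by (simp add: cut_map_def)
  have parity: "Suc (2 * a) \<noteq> 2 * b" "2 * b \<noteq> Suc (2 * a)" for a b :: nat by presburger+
  show "push (cut_map c \<alpha> m n) (cut_mass c s t) j = split_mass s (push \<alpha> t) j"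
  proof (cases "even j")
    case True
    then obtain i where j: "j = 2 * i" by blast
    have "{k. k \<le> Suc m \<and> ap (cut_map c \<alpha> m n) k = j} = {k. k \<le> c \<and> ap \<alpha> k = i}"
      using c(1) by (auto simp: cm j parity split: if_splits)
    then have "push (cut_map c \<alpha> m n) (cut_mass c s t) j = (\<Sum>k | k \<le> c \<and> ap \<alpha> k = i. lo s t k)"
      unfolding push_eq[OF cut_map_Hom[OF \<alpha> c(1)]] by (intro sum.cong) (auto simp: cut_mass_def)
    also have "\<dots> = (\<Sum>k | k \<le> m \<and> ap \<alpha> k = i. lo s t k)"
      using c by (intro sum.mono_neutral_left) (auto, metis not_le)
    also have "\<dots> = lo s (push \<alpha> t) i" by (rule push_lo[OF \<alpha> s])
    finally show ?thesis by (simp add: split_mass_def j)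
  next
    case False
    then obtain i where j: "j = Suc (2 * i)" by (metis oddE Suc_eq_plus1)
    have "{k. k \<le> Suc m \<and> ap (cut_map c \<alpha> m n) k = j} = Suc ` {k. c \<le> k \<and> k \<le> m \<and> ap \<alpha> k = i}"
    proof (intro equalityI subsetI)
      fix k assume "k \<in> {k. k \<le> Suc m \<and> ap (cut_map c \<alpha> m n) k = j}"
      then have k: "k \<le> Suc m" "\<not> k \<le> c" "ap \<alpha> (k - 1) = i"
        using cm[of k] unfolding j by (auto simp: parity split: if_splits)
      then show "k \<in> Suc ` {k. c \<le> k \<and> k \<le> m \<and> ap \<alpha> k = i}"
        by (intro image_eqI[of _ _ "k - 1"]) auto
    qed (auto simp: cm j)
    then have "push (cut_map c \<alpha> m n) (cut_mass c s t) j
      = (\<Sum>k | c \<le> k \<and> k \<le> m \<and> ap \<alpha> k = i. cut_mass c s t (Suc k))"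
      unfolding push_eq[OF cut_map_Hom[OF \<alpha> c(1)]] by (simp add: sum.reindex)
    also have "\<dots> = (\<Sum>k | c \<le> k \<and> k \<le> m \<and> ap \<alpha> k = i. t k - lo s t k)"
      by (intro sum.cong) (auto simp: cut_mass_def)
    also have "\<dots> = (\<Sum>k | k \<le> m \<and> ap \<alpha> k = i. t k - lo s t k)"
      using c by (intro sum.mono_neutral_left) (auto, metis not_le)
    also have "\<dots> = push \<alpha> t i - lo s (push \<alpha> t) i"
      by (simp add: sum_subtractf push_eq[OF \<alpha>] push_lo[OF \<alpha> s])
    finally show ?thesis by (simp add: split_mass_def j)
  qed
qed

text \<open>The degeneracy that identifies the two copies \<open>2 * i\<close> and
  \<open>Suc (2 * i)\<close> of each vertex; \<open>odds\<close> marks the upper copies.\<close>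

definition dbl :: "nat \<Rightarrow> simplex_map" where
  "dbl n = mk (Suc (2 * n)) (\<lambda>k. k div 2) n"

lemma dbl_Hom: "dbl n \<in> Hom Simplex (Suc (2 * n)) n"
  unfolding dbl_def by (rule mk_Hom) (auto intro: div_le_mono)

definition odds :: "nat \<Rightarrow> nat set" where
  "odds n = {k. k \<le> Suc (2 * n) \<and> odd k}"

text \<open>At time \<open>s\<close> the point of the cell \<open>x\<close> with coordinates
  \<open>t\<close> is sent to the point of the doubled simplex \<open>w n x\<close> with coordinates
  \<open>split_mass s t\<close>. At \<open>s = 0\<close> all mass sits on the upper copies, which
  lie over the subset \<open>{0..n}\<close>, and at \<open>s = 1\<close> on the lower ones, over
  \<open>{}\<close>. The point to check is that the formula respects the gluing.\<close>

lemma realization_homotopy: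
  assumes K: "simplicial_set K" and L: "simplicial_set L" and F: "simplicial_map (cyl K) L F"
  shows "homotopic_with (\<lambda>_. True) (realization K) (realization L)
    (realization_map L (\<lambda>n x. F n (x, {0..n}))) (realization_map L (\<lambda>n x. F n (x, {})))"
proof -
  interpret K: simplicial_set K by (rule K)
  interpret L: simplicial_set L by (rule L)
  have F1: "F m (act (cyl K) \<alpha> z) = act L \<alpha> (F n z)" if "z \<in> simp (cyl K) n" "\<alpha> \<in> Hom Simplex m n"
    for m n z \<alpha> using F that unfolding simplicial_map_def by blast
  have F2: "F n z \<in> simp L n" if "z \<in> simp (cyl K) n" for n z
    using F that unfolding simplicial_map_def by blast
  define w where "w n x = F (Suc (2 * n)) (act K (dbl n) x, odds n)" for n x
  have dbl_cyl: "(act K (dbl n) x, odds n) \<in> simp (cyl K) (Suc (2 * n))" if "x \<in> simp K n" for n x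
    using K.act_simp[OF dbl_Hom that] by (auto simp: cyl_simp odds_def)
  have w: "w n x \<in> simp L (Suc (2 * n))" if "x \<in> simp K n" for n x
    unfolding w_def by (rule F2[OF dbl_cyl[OF that]])
  define h where "h = (\<lambda>(s, ((n, x), t)). point_class L ((Suc (2 * n), w n x), split_mass s t))"
  have act_w: "act L (cut_map c \<alpha> m n) (w n x) = F (Suc m)
      (act K (mk (Suc m) (\<lambda>k. ap \<alpha> (if k \<le> c then k else k - 1)) n) x, {k. k \<le> Suc m \<and> c < k})"
    if \<alpha>: "\<alpha> \<in> Hom Simplex m n" and c: "c \<le> m" and x: "x \<in> simp K n" for c \<alpha> m n x
  proof -
    note cm = cut_map_Hom[OF \<alpha> c]
    have eq: "dbl n \<star> cut_map c \<alpha> m n = mk (Suc m) (\<lambda>k. ap \<alpha> (if k \<le> c then k else k - 1)) n"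
    proof (rule simplex_map_eqI[OF Comp_Simplex_Hom[OF cm dbl_Hom]])
      show "mk (Suc m) (\<lambda>k. ap \<alpha> (if k \<le> c then k else k - 1)) n \<in> Hom Simplex (Suc m) n"
        by (rule mk_Hom) (use c in \<open>auto intro!: ap_le[OF \<alpha>] ap_mono[OF \<alpha>]\<close>)
      fix k assume k: "k \<le> Suc m"
      have "ap (cut_map c \<alpha> m n) k \<le> Suc (2 * n)" by (rule ap_le[OF cm k])
      with k show "ap (dbl n \<star> cut_map c \<alpha> m n) k =
          ap (mk (Suc m) (\<lambda>k. ap \<alpha> (if k \<le> c then k else k - 1)) n) k"
        by (simp add: ap_Comp[OF cm dbl_Hom k])
          (use ap_le[OF \<alpha>, of k] ap_le[OF \<alpha>, of "k - 1"] k c in \<open>auto simp: dbl_def cut_map_def\<close>)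
    qed
    have od: "{i. i \<le> Suc m \<and> ap (cut_map c \<alpha> m n) i \<in> odds n} = {k. k \<le> Suc m \<and> c < k}"
      using c by (auto simp: odds_def cut_map_def ap_le[OF \<alpha>] split: if_splits)
    have "act L (cut_map c \<alpha> m n) (w n x)
      = F (Suc m) (act (cyl K) (cut_map c \<alpha> m n) (act K (dbl n) x, odds n))"
      unfolding w_def by (rule F1[OF dbl_cyl[OF x] cm, symmetric])
    also have "act (cyl K) (cut_map c \<alpha> m n) (act K (dbl n) x, odds n)
      = (act K (dbl n \<star> cut_map c \<alpha> m n) x, {k. k \<le> Suc m \<and> c < k})"
      unfolding cyl_act[OF cm] od K.act_Comp[OF cm dbl_Hom x] ..
    finally show ?thesis unfolding eq .
  qed
  \<comment> \<open>Both values are identified with a point of the cut simplex of dimension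
    \<open>Suc m\<close>: for \<open>p\<close> through \<open>cut_map\<close> of the identity, for
    \<open>q\<close> through \<open>cut_map\<close> of \<open>\<alpha>\<close>. The two simplices
    agree by \<open>act_w\<close>.\<close>
  have glue_h: "h (s, p) = h (s, q)" if s: "0 \<le> s" "s \<le> 1" and g: "glue K p q" for s p q
    using g
  proof cases
    case (1 \<alpha> m n x t)
    note x = \<open>x \<in> simp K n\<close> and \<alpha> = \<open>\<alpha> \<in> Hom Simplex m n\<close> and t = \<open>t \<in> standard_simplex m\<close>
    obtain c where c: "c \<le> m" "\<And>i. i < c \<Longrightarrow> lo s t i = t i" "\<And>i. c < i \<Longrightarrow> lo s t i = 0"
      using cut_exists[OF t s] by blast
    have pc: "push (cut_map c \<beta> m k) (cut_mass c s t) = split_mass s (push \<beta> t)"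
      if "\<beta> \<in> Hom Simplex m k" for \<beta> k
      by (rule push_cut_map[OF that s(1) c])
    note x' = K.act_simp[OF \<alpha> x]
    have idp: "push (Ide Simplex m) t = t"
    proof
      fix j
      have "{i. i \<le> m \<and> ap (Ide Simplex m) i = j} = (if j \<le> m then {j} else {})"
        by (auto simp: ap_Ide)
      then show "push (Ide Simplex m) t j = t j"
        unfolding push_eq[OF Ide_Simplex_Hom] using simplex_zero[OF t, of j] by auto
    qed
    have "glue L ((Suc m, act L (cut_map c (Ide Simplex m) m m) (w m (act K \<alpha> x))), cut_mass c s t)
      ((Suc (2 * m), w m (act K \<alpha> x)), push (cut_map c (Ide Simplex m) m m) (cut_mass c s t))"
      by (rule glue.intros[OF cut_map_Hom[OF Ide_Simplex_Hom c(1)] w[OF x'] cut_mass_simplex[OF t c]])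
    then have "h (s, p) = point_class L
      ((Suc m, act L (cut_map c (Ide Simplex m) m m) (w m (act K \<alpha> x))), cut_mass c s t)"
      unfolding pc[OF Ide_Simplex_Hom] idp using 1 by (simp add: h_def point_class_glue)
    also have "act L (cut_map c (Ide Simplex m) m m) (w m (act K \<alpha> x)) = act L (cut_map c \<alpha> m n) (w n x)"
    proof -
      let ?i = "mk (Suc m) (\<lambda>k. ap (Ide Simplex m) (if k \<le> c then k else k - 1)) m"
      have i: "?i \<in> Hom Simplex (Suc m) m"
        by (rule mk_Hom) (use c(1) in \<open>auto simp: ap_Ide\<close>)
      have "\<alpha> \<star> ?i = mk (Suc m) (\<lambda>k. ap \<alpha> (if k \<le> c then k else k - 1)) n"
        by (rule simplex_map_eqI[OF Comp_Simplex_Hom[OF i \<alpha>]])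
          (use c(1) in \<open>auto simp: ap_Comp[OF i \<alpha>] ap_Ide intro!: mk_Hom ap_le[OF \<alpha>] ap_mono[OF \<alpha>]\<close>)
      then show ?thesis
        unfolding act_w[OF Ide_Simplex_Hom c(1) x'] act_w[OF \<alpha> c(1) x]
          K.act_Comp[OF i \<alpha> x, symmetric] by simp
    qed
    also have "point_class L ((Suc m, act L (cut_map c \<alpha> m n) (w n x)), cut_mass c s t) = h (s, q)"
    proof -
      have "glue L ((Suc m, act L (cut_map c \<alpha> m n) (w n x)), cut_mass c s t)
        ((Suc (2 * n), w n x), push (cut_map c \<alpha> m n) (cut_mass c s t))"
        by (rule glue.intros[OF cut_map_Hom[OF \<alpha> c(1)] w[OF x] cut_mass_simplex[OF t c]])
      then show ?thesis
        unfolding pc[OF \<alpha>] using 1 by (simp add: h_def point_class_glue)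
    qed
    finally show ?thesis .
  qed
  define H where "H = (\<lambda>(s, c). h (s, rep c))"
  have H: "H (s, point_class K p) = h (s, p)" if "0 \<le> s" "s \<le> 1" "p \<in> topspace (cells K)" for s p
    using equivclp_glue_induct[where f = "\<lambda>p. h (s, p)", OF K rep_point_class that(3) glue_h[OF that(1,2)]]
    by (simp add: H_def)
  have "continuous_map (prod_topology (top_of_set {0..1}) (cells K)) (realization L) h"
    unfolding cells_def
  proof (rule continuous_map_prod_sum_topology)
    let ?X = "\<lambda>(n, x). subtopology (powertop_real UNIV) (standard_simplex n)"
    fix i assume "i \<in> Sigma UNIV (simp K)"
    then obtain n x where i: "i = (n, x)" "x \<in> simp K n" by auto
    let ?S = "\<lambda>n. subtopology (powertop_real UNIV) (standard_simplex n)"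
    have proj: "continuous_map (prod_topology (top_of_set {0..1::real}) (?S n)) euclideanreal (\<lambda>z. snd z k)" for k
    proof -
      have "continuous_map (?S n) euclideanreal (\<lambda>t. t k)"
        by (intro continuous_map_from_subtopology continuous_map_product_projection) simp
      from continuous_map_compose[OF continuous_map_snd this] show ?thesis by (simp add: o_def)
    qed
    have fst: "continuous_map (prod_topology (top_of_set {0..1::real}) (?S n)) euclideanreal fst"
      using continuous_map_fst[of "top_of_set {0..1::real}" "?S n"]
      by (simp add: continuous_map_in_subtopology)
    have lo: "continuous_map (prod_topology (top_of_set {0..1::real}) (?S n)) euclideanreal
        (\<lambda>z. lo (fst z) (snd z) k)" for k
      unfolding lo_def cum_def
      by (intro continuous_map_diff continuous_map_real_min continuous_map_sum proj fst) auto
    have "continuous_map (prod_topology (top_of_set {0..1::real}) (?S n)) (?S (Suc (2 * n)))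
        (\<lambda>z. split_mass (fst z) (snd z))"
      unfolding continuous_map_in_subtopology continuous_map_componentwise_UNIV
    proof (intro conjI allI)
      fix k
      show "continuous_map (prod_topology (top_of_set {0..1::real}) (?S n)) euclideanreal
        (\<lambda>z. split_mass (fst z) (snd z) k)"
        by (cases "even k") (auto simp: split_mass_def intro!: lo continuous_map_diff proj)
    qed (auto simp: topspace_standard_simplex split_mass_simplex)
    from continuous_map_compose[OF this continuous_map_cell[OF w[OF i(2)]]]
    have "continuous_map (prod_topology (top_of_set {0..1::real}) (?S n)) (realization L)
      (\<lambda>z. point_class L ((Suc (2 * n), w n x), split_mass (fst z) (snd z)))" by (simp add: o_def)
    then show "continuous_map (prod_topology (top_of_set {0..1}) (?X i)) (realization L) (\<lambda>(s, t). h (s, i, t))"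
      using i by (simp add: h_def case_prod_unfold)
  qed
  then have "continuous_map (prod_topology (top_of_set {0..1}) (cells K)) (realization L)
      (H \<circ> (\<lambda>(s, p). (s, point_class K p)))"
    by (rule continuous_map_eq) (auto simp: H)
  \<comment> \<open>The product of a quotient map with the unit interval is again a quotient map
    because the interval is locally compact and Hausdorff. Continuity of \<open>H\<close> may
    therefore be tested on the cells.\<close>
  moreover have "quotient_map (prod_topology (top_of_set {0..1::real}) (cells K))
    (prod_topology (top_of_set {0..1}) (realization K)) (\<lambda>(s, p). (s, point_class K p))"
    by (rule quotient_map_prod_right[OF _ _ quotient_map_point_class])
      (auto intro: compact_imp_locally_compact_space Hausdorff_space_subtopology
        simp: compact_space_subtopology)
  ultimately have cont: "continuous_map (prod_topology (top_of_set {0..1}) (realization K)) (realization L) H"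
    by (metis continuous_compose_quotient_map)
  show ?thesis
  proof (subst homotopic_with)
    show "\<exists>h. continuous_map (prod_topology (top_of_set {0..1::real}) (realization K)) (realization L) h \<and>
      (\<forall>c\<in>topspace (realization K). h (0, c) = realization_map L (\<lambda>n x. F n (x, {0..n})) c) \<and>
      (\<forall>c\<in>topspace (realization K). h (1, c) = realization_map L (\<lambda>n x. F n (x, {})) c) \<and>
      (\<forall>t\<in>{0..1::real}. True)"
    proof (intro exI[of _ H] conjI cont ballI TrueI)
      fix c assume "c \<in> topspace (realization K)"
      then obtain n x t where c: "c = point_class K ((n, x), t)" "x \<in> simp K n" "t \<in> standard_simplex n"
        unfolding topspace_realization topspace_cells by auto
      have cells: "((n, x), t) \<in> topspace (cells K)" using c by (simp add: topspace_cells)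
      \<comment> \<open>\<open>?e\<close> embeds \<open>[n]\<close> as the lower copies for
        \<open>b = 0\<close> and as the upper copies for \<open>b = 1\<close>. It is a section of
        \<open>dbl n\<close>, so the corresponding face of \<open>w n x\<close> is
        \<open>F n (x, S)\<close>.\<close>
      have ends: "point_class L ((n, F n (x, S)), t) = point_class L ((Suc (2 * n), w n x), split_mass s t)"
        if b: "b \<le> 1" "S = (if b = 0 then {} else {0..n})" "\<And>i. lo s t i = (if b = 0 then t i else 0)" for b :: nat and s S
      proof -
        let ?e = "mk n (\<lambda>k. 2 * k + b) (Suc (2 * n))"
        have b': "b = 0 \<or> b = 1" using b(1) by auto
        have e: "?e \<in> Hom Simplex n (Suc (2 * n))" by (rule mk_Hom) (use b in auto)
        have de: "dbl n \<star> ?e = Ide Simplex n"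
          by (rule simplex_map_eqI[OF Comp_Simplex_Hom[OF e dbl_Hom] Ide_Simplex_Hom])
            (simp add: ap_Comp[OF e dbl_Hom] ap_Ide, use b' in \<open>auto simp: dbl_def\<close>)
        have od: "{i. i \<le> n \<and> ap ?e i \<in> odds n} = S" using b' b(2) by (auto simp: odds_def)
        have "act L ?e (w n x) = F n (act K (dbl n \<star> ?e) x, S)"
          unfolding w_def F1[OF dbl_cyl[OF c(2)] e, symmetric] cyl_act[OF e] od K.act_Comp[OF e dbl_Hom c(2)] ..
        also have "\<dots> = F n (x, S)" unfolding de K.act_Ide[OF c(2)] ..
        finally have aw: "act L ?e (w n x) = F n (x, S)" .
        have "push ?e t = split_mass s t"
        proof
          fix j
          have *: "{i. i \<le> n \<and> ap ?e i = j} = (if j mod 2 = b \<and> j div 2 \<le> n then {j div 2} else {})"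
            using b' by (auto, presburger)
          show "push ?e t j = split_mass s t j"
            unfolding push_eq[OF e] * split_mass_def b(3)
            using simplex_zero[OF c(3), of "j div 2"] b(1)
            by (auto simp: even_iff_mod_2_eq_zero odd_iff_mod_2_eq_one)
        qed
        moreover have "glue L ((n, act L ?e (w n x)), t) ((Suc (2 * n), w n x), push ?e t)"
          by (rule glue.intros[OF e w[OF c(2)] c(3)])
        ultimately show ?thesis by (metis aw point_class_glue)
      qed
      have lo0: "lo 0 t i = 0" for i
      proof -
        have "0 \<le> cum t j" for j by (simp add: cum_def sum_nonneg simplex_nonneg[OF c(3)])
        then show ?thesis by (simp add: lo_def)
      qed
      have lo1: "lo 1 t i = t i" for i
      proof -
        have "cum t j \<le> 1" for j
        proof (cases "j \<le> Suc n")
          case True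
          then show ?thesis using cum_mono[OF c(3) True] cum_full[OF c(3)] by simp
        next
          case False
          then have "cum t j = cum t (Suc n)"
            unfolding cum_def by (intro sum.mono_neutral_right) (auto simp: simplex_zero[OF c(3)])
          then show ?thesis using cum_full[OF c(3)] by simp
        qed
        then show ?thesis by (simp add: lo_def) (simp add: cum_Suc)
      qed
      have sm: "simplicial_map K L (\<lambda>n x. F n (x, {0..n}))" "simplicial_map K L (\<lambda>n x. F n (x, {}))"
      proof -
        have "F m (act K \<alpha> y, {0..m}) = act L \<alpha> (F k (y, {0..k}))"
          "F m (act K \<alpha> y, {}) = act L \<alpha> (F k (y, {}))"
          if "y \<in> simp K k" "\<alpha> \<in> Hom Simplex m k" for m k y \<alpha>
        proof -
          have "{i. i \<le> m \<and> ap \<alpha> i \<in> {0..k}} = {0..m}" using ap_le[OF that(2)] by auto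
          then show "F m (act K \<alpha> y, {0..m}) = act L \<alpha> (F k (y, {0..k}))"
            using F1[of "(y, {0..k})" k \<alpha> m] that by (simp add: cyl_simp cyl_act)
          show "F m (act K \<alpha> y, {}) = act L \<alpha> (F k (y, {}))"
            using F1[of "(y, {})" k \<alpha> m] that by (simp add: cyl_simp cyl_act)
        qed
        then show "simplicial_map K L (\<lambda>n x. F n (x, {0..n}))" "simplicial_map K L (\<lambda>n x. F n (x, {}))"
          unfolding simplicial_map_def using F2 by (auto simp: cyl_simp)
      qed
      show "H (0, c) = realization_map L (\<lambda>n x. F n (x, {0..n})) c"
        using H[OF _ _ cells, of 0] ends[of 1 "{0..n}" 0] lo0 c
        by (simp add: realization_map_point_class[OF K sm(1)] h_def)
      show "H (1, c) = realization_map L (\<lambda>n x. F n (x, {})) c"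
        using H[OF _ _ cells, of 1] ends[of 0 "{}" 1] lo1 c
        by (simp add: realization_map_point_class[OF K sm(2)] h_def)
    qed
  qed simp
qed

text \<open>A section \<open>\<sigma>\<close> arises by extension from the empty subcomplex.
  Prescribing the identity and \<open>\<sigma>\<close> after \<open>p\<close> on the two ends of
  \<open>cyl K\<close> and extending gives a homotopy between them, which
  \<open>realization_homotopy\<close> transports to spaces.\<close>

lemma trivial_fibration_sset_weq:
  assumes tf: "trivial_fibration K L p"
  shows "sset_weq K L p"
proof -
  have K: "simplicial_set K" and L: "simplicial_set L" and p: "simplicial_map K L p"
    using tf unfolding trivial_fibration_def by blast+
  have "\<exists>\<sigma>. simplicial_map L K \<sigma> \<and> (\<forall>n. \<forall>x\<in>simp L n. p n (\<sigma> n x) = x) \<and> (\<forall>n. \<forall>x\<in>{}. \<sigma> n x = undefined)"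
    by (rule trivial_fibration_extension[OF tf L, of "\<lambda>n x. x" "\<lambda>n. {}" "\<lambda>n x. undefined"])
      (auto simp: simplicial_map_def)
  then obtain \<sigma> where \<sigma>: "simplicial_map L K \<sigma>" "\<And>n x. x \<in> simp L n \<Longrightarrow> p n (\<sigma> n x) = x" by blast
  have \<sigma>p: "simplicial_map K K (\<lambda>n x. \<sigma> n (p n x))" by (rule simplicial_map_comp[OF p \<sigma>(1)])
  \<comment> \<open>The two ends of the cylinder. Since \<open>{0..n}\<close> is never empty they
    are disjoint, and \<open>snd z = {}\<close> tells them apart.\<close>
  let ?X = "\<lambda>n. {(x, S). x \<in> simp K n \<and> (S = {} \<or> S = {0..n})}"
  have "\<exists>F. simplicial_map (cyl K) K F \<and> (\<forall>n. \<forall>z\<in>simp (cyl K) n. p n (F n z) = p n (fst z)) \<and>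
    (\<forall>n. \<forall>z\<in>?X n. F n z = (if snd z = {} then fst z else \<sigma> n (p n (fst z))))"
  proof (rule trivial_fibration_extension[OF tf simplicial_set_cyl[OF K]])
    show "simplicial_map (cyl K) L (\<lambda>n z. p n (fst z))"
      using p unfolding simplicial_map_def by (auto simp: cyl_simp cyl_act)
    show "?X n \<subseteq> simp (cyl K) n" for n by (auto simp: cyl_simp)
    show "act (cyl K) \<alpha> z \<in> ?X m" if "z \<in> ?X n" "\<alpha> \<in> Hom Simplex m n" for m n z \<alpha>
      using that simplicial_set.act_simp[OF K that(2)] ap_le[OF that(2)] by (auto simp: cyl_act)
    fix n and z :: "'a \<times> nat set" assume z: "z \<in> ?X n"
    have p': "p n x \<in> simp L n" if "x \<in> simp K n" for x using p that unfolding simplicial_map_def by blast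
    show "(if snd z = {} then fst z else \<sigma> n (p n (fst z))) \<in> simp K n"
      using z \<sigma>p unfolding simplicial_map_def by auto
    show "p n (if snd z = {} then fst z else \<sigma> n (p n (fst z))) = p n (fst z)"
      using z \<sigma>(2) p' by auto
    fix m \<alpha> assume \<alpha>: "\<alpha> \<in> Hom Simplex m n"
    obtain x S where zz: "z = (x, S)" by (cases z)
    have "snd (act (cyl K) \<alpha> z) = {} \<longleftrightarrow> S = {}" "fst (act (cyl K) \<alpha> z) = act K \<alpha> x"
      using z ap_le[OF \<alpha>] zz by (auto simp: cyl_act[OF \<alpha>])
    moreover have "\<sigma> m (p m (act K \<alpha> x)) = act K \<alpha> (\<sigma> n (p n x))"
    proof -
      have "x \<in> simp K n" using z zz by auto
      then show ?thesis using \<sigma>p \<alpha> unfolding simplicial_map_def by blast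
    qed
    ultimately show "(if snd (act (cyl K) \<alpha> z) = {} then fst (act (cyl K) \<alpha> z)
        else \<sigma> m (p m (fst (act (cyl K) \<alpha> z))))
      = act K \<alpha> (if snd z = {} then fst z else \<sigma> n (p n (fst z)))" using zz by (auto simp: cyl_act[OF \<alpha>])
  qed
  then obtain F where F: "simplicial_map (cyl K) K F"
    "\<And>n z. z \<in> ?X n \<Longrightarrow> F n z = (if snd z = {} then fst z else \<sigma> n (p n (fst z)))" by blast
  have F0: "F n (x, {0..n}) = \<sigma> n (p n x)" "F n (x, {}) = x" if "x \<in> simp K n" for n x
    using F(2)[of "(x, {0..n})" n] F(2)[of "(x, {})" n] that by auto
  have idm: "simplicial_map K K (\<lambda>n x. x)" "simplicial_map L L (\<lambda>n x. x)" by (simp_all add: simplicial_map_def)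
  have hom: "homotopic_with (\<lambda>_. True) (realization K) (realization K)
      (realization_map K \<sigma> \<circ> realization_map L p) id"
  proof (rule homotopic_with_eq[OF realization_homotopy[OF K K F(1)]])
    fix c assume c: "c \<in> topspace (realization K)"
    show "(realization_map K \<sigma> \<circ> realization_map L p) c = realization_map K (\<lambda>n x. F n (x, {0..n})) c"
      using realization_map_comp[OF K L p \<sigma>(1) c] realization_map_cong[OF K \<sigma>p F0(1)[symmetric] c] by simp
    show "id c = realization_map K (\<lambda>n x. F n (x, {})) c"
      using realization_map_cong[OF K idm(1) F0(2)[symmetric] c] realization_map_id[OF K c] by simp
  qed simp
  have "homotopic_with (\<lambda>_. True) (realization L) (realization L)
      (realization_map L p \<circ> realization_map K \<sigma>) id"
  proof (rule homotopic_with_equal)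
    show "continuous_map (realization L) (realization L) (realization_map L p \<circ> realization_map K \<sigma>)"
      by (rule continuous_map_compose[OF continuous_map_realization_map[OF L \<sigma>(1)] continuous_map_realization_map[OF K p]])
    fix c assume c: "c \<in> topspace (realization L)"
    show "(realization_map L p \<circ> realization_map K \<sigma>) c = id c"
      using realization_map_comp[OF L K \<sigma>(1) p c]
        realization_map_cong[OF L idm(2) \<sigma>(2)[symmetric] c] realization_map_id[OF L c] by simp
  qed auto
  with hom show ?thesis
    unfolding sset_weq_def homotopy_equivalence_def
    using K L p continuous_map_realization_map[OF K p] continuous_map_realization_map[OF L \<sigma>(1)] by blast
qed

section \<open>Finite limits and colimits\<close>

context category begin

lemma Hom_Ob: "f \<in> Hom C X Y \<Longrightarrow> X \<in> Ob C" "f \<in> Hom C X Y \<Longrightarrow> Y \<in> Ob C"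
  using Dom_Ob Cod_Ob by (auto simp: Hom_def)

lemma Comp_Ar:
  assumes "f \<in> Ar C" "g \<in> Ar C" "Dom C g = Cod C f"
  shows "g \<cdot> f \<in> Ar C" "Dom C (g \<cdot> f) = Dom C f" "Cod C (g \<cdot> f) = Cod C g"
  using Comp_Hom[of f "Dom C f" "Cod C f" g "Cod C g"] assms by (auto simp: Hom_def)

lemma Comp_assoc':
  "\<lbrakk>f \<in> Ar C; g \<in> Ar C; h \<in> Ar C; Dom C g = Cod C f; Dom C h = Cod C g\<rbrakk> \<Longrightarrow> (h \<cdot> g) \<cdot> f = h \<cdot> (g \<cdot> f)"
  using Comp_assoc[of f "Dom C f" "Cod C f" g "Cod C g" h "Cod C h"] by (simp add: Hom_def)

lemma Ide_Ar:
  assumes "X \<in> Ob C" shows "Ide C X \<in> Ar C" "Dom C (Ide C X) = X" "Cod C (Ide C X) = X"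
  using Ide_Hom[OF assms] by (auto simp: Hom_def)

lemma Comp_Ide': "\<lbrakk>f \<in> Ar C; Dom C f = X\<rbrakk> \<Longrightarrow> f \<cdot> Ide C X = f"
  and Ide_Comp': "\<lbrakk>f \<in> Ar C; Cod C f = X\<rbrakk> \<Longrightarrow> Ide C X \<cdot> f = f"
  using Comp_Ide[of f "Dom C f" "Cod C f"] Ide_Comp[of f "Dom C f" "Cod C f"] by (auto simp: Hom_def)

lemmas cat_simps = Comp_Ar Comp_assoc' Ide_Ar Comp_Ide' Ide_Comp' Dom_Ob Cod_Ob

lemma reassoc:
  "\<lbrakk>g \<cdot> f = h; f \<in> Ar C; g \<in> Ar C; x \<in> Ar C; Dom C g = Cod C f; Dom C f = Cod C x\<rbrakk> \<Longrightarrow> g \<cdot> (f \<cdot> x) = h \<cdot> x"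
  using Comp_assoc'[of x f g] by simp

text \<open>The universal solution of finitely many equations in finitely many unknowns covers
  products, relative matching objects and, dually, latching objects. The diagram has unknowns and
  equations as objects and two arrows into each equation. Since index categories live on the type
  \<open>'k\<close>, the finite set \<open>A\<close> of arrows is injected into \<open>'k\<close> by
  \<open>c\<close>, for which \<open>'k\<close> must be infinite.\<close>

lemma finite_equation_limit:
  fixes I :: "'i set" and E :: "'e set" and s t :: "'e \<Rightarrow> 'i"
  assumes H: "\<And>(J :: ('k, 'k) cat) D. \<lbrakk>category J; finite (Ar J); is_functor J C D\<rbrakk> \<Longrightarrow> \<exists>L \<pi>. is_limit J C D L \<pi>"
    and inf: "infinite (UNIV :: 'k set)"
    and fin: "finite I" "finite E" and X: "\<And>i. i \<in> I \<Longrightarrow> X i \<in> Ob C"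
    and st: "\<And>e. e \<in> E \<Longrightarrow> s e \<in> I" "\<And>e. e \<in> E \<Longrightarrow> t e \<in> I"
    and ab: "\<And>e. e \<in> E \<Longrightarrow> a e \<in> Hom C (X (s e)) (Y e)" "\<And>e. e \<in> E \<Longrightarrow> b e \<in> Hom C (X (t e)) (Y e)"
  shows "\<exists>W w. W \<in> Ob C \<and> (\<forall>i\<in>I. w i \<in> Hom C W (X i)) \<and> (\<forall>e\<in>E. a e \<cdot> w (s e) = b e \<cdot> w (t e)) \<and>
    (\<forall>V v. V \<in> Ob C \<longrightarrow> (\<forall>i\<in>I. v i \<in> Hom C V (X i)) \<longrightarrow> (\<forall>e\<in>E. a e \<cdot> v (s e) = b e \<cdot> v (t e)) \<longrightarrow>
      (\<exists>!h. h \<in> Hom C V W \<and> (\<forall>i\<in>I. w i \<cdot> h = v i)))"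
proof -
  \<comment> \<open>\<open>Inl\<close> holds the identities of unknowns and equations,
    \<open>Inr (e, z)\<close> the two arrows into the equation \<open>e\<close>, where
    \<open>z = True\<close> is the side that starts at \<open>t e\<close>.\<close>
  define A where "A = Inl ` (I <+> E) \<union> Inr ` (E \<times> (UNIV :: bool set))"
  have A: "Inl (Inl i) \<in> A \<longleftrightarrow> i \<in> I" "Inl (Inr e) \<in> A \<longleftrightarrow> e \<in> E" "Inr (e, z) \<in> A \<longleftrightarrow> e \<in> E" for i e z
    by (auto simp: A_def)
  have finA: "finite A" using fin by (simp add: A_def)
  obtain B :: "'k set" where "finite B" "card B = card A"
    using infinite_arbitrarily_large[OF inf] by blast
  then obtain c where "bij_betw c A B" using finite_same_card_bij[OF finA] by metis
  then have inj: "inj_on c A" by (simp add: bij_betw_def)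
  define d where "d = inv_into A c"
  have d: "d (c x) = x" if "x \<in> A" for x using inv_into_f_f[OF inj that] by (simp add: d_def)
  have c_eq: "c x = c y \<longleftrightarrow> x = y" if "x \<in> A" "y \<in> A" for x y using inj that by (auto simp: inj_on_def)
  define dm :: "('i + 'e) + ('e \<times> bool) \<Rightarrow> ('i + 'e) + ('e \<times> bool)"
    where "dm x = (case x of Inl v \<Rightarrow> Inl v | Inr (e, z) \<Rightarrow> Inl (Inl (if z then t e else s e)))" for x
  define cd :: "('i + 'e) + ('e \<times> bool) \<Rightarrow> ('i + 'e) + ('e \<times> bool)"
    where "cd x = (case x of Inl v \<Rightarrow> Inl v | Inr (e, z) \<Rightarrow> Inl (Inr e))" for x
  \<comment> \<open>Of two composable arrows at least one is an identity, so composition just drops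
    it.\<close>
  define cp where "cp y x = (case y of Inl _ \<Rightarrow> x | Inr _ \<Rightarrow> y)" for x y :: "('i + 'e) + ('e \<times> bool)"
  have dcA: "dm x \<in> A" "cd x \<in> A" if "x \<in> A" for x
    using that st by (auto simp: A_def dm_def cd_def split: sum.splits)
  have cpA: "cp y x \<in> A" "dm (cp y x) = dm x" "cd (cp y x) = cd y"
    if "x \<in> A" "y \<in> A" "cd x = dm y" for x y
    using that by (auto simp: dm_def cd_def cp_def split: sum.splits prod.splits)
  define J where "J = \<lparr>Ob = c ` Inl ` (I <+> E), Ar = c ` A, Dom = (\<lambda>k. c (dm (d k))), Cod = (\<lambda>k. c (cd (d k))),
    Ide = (\<lambda>k. k), Comp = (\<lambda>g f. c (cp (d g) (d f)))\<rparr>"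
  have J: "Ob J = c ` Inl ` (I <+> E)" "Ar J = c ` A" "Ide J k = k" for k by (simp_all add: J_def)
  have JA: "Dom J (c x) = c (dm x)" "Cod J (c x) = c (cd x)" if "x \<in> A" for x
    using that by (simp_all add: J_def d)
  have JC: "Comp J (c y) (c x) = c (cp y x)" if "x \<in> A" "y \<in> A" for x y
    using that by (simp add: J_def d)
  have JHom: "f \<in> Hom J p q \<longleftrightarrow> (\<exists>x\<in>A. f = c x \<and> p = c (dm x) \<and> q = c (cd x))" for f p q
    by (auto simp: Hom_def J JA)
  have ObA: "Inl v \<in> A \<longleftrightarrow> v \<in> I <+> E" for v by (auto simp: A_def)
  have dmv: "\<exists>v\<in>I <+> E. dm x = Inl v" "\<exists>v\<in>I <+> E. cd x = Inl v" if "x \<in> A" for x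
    using that st by (auto simp: A_def dm_def cd_def)
  have ArJ: "\<exists>x\<in>A. f = c x" if "f \<in> Ar J" for f using that J(2) by blast
  have ObJ: "p \<in> Ob J \<longleftrightarrow> (\<exists>v\<in>I <+> E. p = c (Inl v))" for p unfolding J(1) by blast
  have J_cat: "category J"
  proof
    show "Dom J f \<in> Ob J" "Cod J f \<in> Ob J" if "f \<in> Ar J" for f
      using ArJ[OF that] dmv JA unfolding ObJ by metis+
    show "Ide J p \<in> Hom J p p" if p: "p \<in> Ob J" for p
    proof -
      obtain v where "v \<in> I <+> E" "p = c (Inl v)" using p unfolding ObJ by blast
      then show ?thesis unfolding JHom J(3) by (intro bexI[of _ "Inl v"]) (simp_all add: ObA dm_def cd_def)
    qed
    show "Comp J g f \<in> Hom J p r" if fg: "f \<in> Hom J p q" "g \<in> Hom J q r" for f g p q r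
    proof -
      obtain x y where "x \<in> A" "y \<in> A" "f = c x" "g = c y" "p = c (dm x)" "q = c (cd x)" "q = c (dm y)" "r = c (cd y)"
        using fg by (auto simp: JHom)
      moreover have "cd x = dm y" using calculation c_eq[of "cd x" "dm y"] dcA by auto
      ultimately show ?thesis using cpA[of x y] by (auto simp: JHom JC)
    qed
    show "Comp J (Comp J h g) f = Comp J h (Comp J g f)"
      if fgh: "f \<in> Hom J p q" "g \<in> Hom J q r" "h \<in> Hom J r u" for f g h p q r u
    proof -
      obtain x y z where *: "x \<in> A" "y \<in> A" "z \<in> A" "f = c x" "g = c y" "h = c z" "q = c (cd x)" "q = c (dm y)"
        "r = c (cd y)" "r = c (dm z)"
        using fgh by (auto simp: JHom)
      then have "cd x = dm y" "cd y = dm z"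
        using c_eq[of "cd x" "dm y"] c_eq[of "cd y" "dm z"] dcA by auto
      moreover have "cp (cp z y) x = cp z (cp y x)" by (auto simp: cp_def split: sum.splits)
      ultimately show ?thesis using * cpA by (simp add: JC)
    qed
    show "Comp J f (Ide J p) = f" if f: "f \<in> Hom J p q" for f p q
    proof -
      obtain x where x: "x \<in> A" "f = c x" "p = c (dm x)" using f by (auto simp: JHom)
      have "cp x (dm x) = x" by (auto simp: cp_def dm_def split: sum.splits)
      with x show ?thesis using dcA(1)[OF x(1)] by (simp add: J JC)
    qed
    show "Comp J (Ide J q) f = f" if f: "f \<in> Hom J p q" for f p q
    proof -
      obtain x where x: "x \<in> A" "f = c x" "q = c (cd x)" using f by (auto simp: JHom)
      have "cp (cd x) x = x" by (auto simp: cp_def cd_def split: sum.splits)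
      with x show ?thesis using dcA(2)[OF x(1)] by (simp add: J JC)
    qed
  qed
  define O' where "O' = case_sum X Y"
  define F where "F = (\<lambda>x. case x of Inl v \<Rightarrow> Ide C (O' v) | Inr (e, z) \<Rightarrow> if z then b e else a e)"
  define D where "D = \<lparr>onOb = (\<lambda>k. O' (projl (d k))), onAr = (\<lambda>k. F (d k))\<rparr>"
  have DO: "onOb D (c (Inl v)) = O' v" if "v \<in> I <+> E" for v
    using that by (simp add: D_def d ObA)
  have DA: "onAr D (c x) = F x" if "x \<in> A" for x using that by (simp add: D_def d)
  have YOb: "Y e \<in> Ob C" if "e \<in> E" for e using Hom_Ob(2)[OF ab(1)[OF that]] .
  have O': "O' v \<in> Ob C" if "v \<in> I <+> E" for v using that X YOb by (auto simp: O'_def)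
  have F: "F x \<in> Hom C (O' (projl (dm x))) (O' (projl (cd x)))" if "x \<in> A" for x
    using that ab Ide_Hom X YOb by (auto simp: A_def F_def dm_def cd_def O'_def)
  have D: "is_functor J C D"
    unfolding is_functor_def
  proof (intro conjI ballI impI)
    show "onOb D p \<in> Ob C" if "p \<in> Ob J" for p using that O' DO unfolding ObJ by metis
    show "onAr D f \<in> Hom C (onOb D (Dom J f)) (onOb D (Cod J f))" if f: "f \<in> Ar J" for f
    proof -
      obtain x where x: "x \<in> A" "f = c x" using ArJ[OF f] by blast
      obtain v u where "v \<in> I <+> E" "dm x = Inl v" "u \<in> I <+> E" "cd x = Inl u" using dmv[OF x(1)] by blast
      then show ?thesis using F[OF x(1)] x by (simp add: JA DA DO)
    qed
    show "onAr D (Ide J p) = Ide C (onOb D p)" if p: "p \<in> Ob J" for p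
    proof -
      obtain v where "v \<in> I <+> E" "p = c (Inl v)" using p unfolding ObJ by blast
      then show ?thesis by (simp add: J(3) DO DA ObA F_def)
    qed
    show "onAr D (Comp J g f) = onAr D g \<cdot> onAr D f" if fg: "f \<in> Ar J" "g \<in> Ar J" "Cod J f = Dom J g" for f g
    proof -
      obtain x y where xy: "x \<in> A" "y \<in> A" "f = c x" "g = c y" using ArJ[OF fg(1)] ArJ[OF fg(2)] by blast
      then have e: "cd x = dm y" using fg(3) c_eq[of "cd x" "dm y"] dcA by (auto simp: JA)
      have "F (cp y x) = F y \<cdot> F x"
      proof (cases y)
        case (Inl v)
        have "F x \<in> Hom C (O' (projl (dm x))) (O' v)" using F[OF xy(1)] e Inl by (simp add: dm_def)
        then show ?thesis using Inl Ide_Comp by (simp add: cp_def F_def)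
      next
        case (Inr ez)
        then obtain v where "x = Inl v" using e by (cases x) (auto simp: cd_def dm_def split: prod.splits)
        moreover have "F y \<in> Hom C (O' (projl (dm y))) (O' (projl (cd y)))" by (rule F[OF xy(2)])
        moreover have "dm y = Inl v" using e \<open>x = Inl v\<close> by (simp add: cd_def)
        ultimately show ?thesis using Inr Comp_Ide by (simp add: cp_def F_def)
      qed
      then show ?thesis using xy cpA[OF xy(1,2) e] by (simp add: JC DA)
    qed
  qed
  have "finite (Ar J)" using finA by (simp add: J)
  from H[OF J_cat this D] obtain L \<pi> where lim: "is_limit J C D L \<pi>" by blast
  define w where "w i = \<pi> (c (Inl (Inl i)))" for i
  have cone: "is_cone J C D L \<pi>" using lim by (simp add: is_limit_def)
  have w: "w i \<in> Hom C L (X i)" if "i \<in> I" for i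
  proof -
    have "c (Inl (Inl i)) \<in> Ob J" "onOb D (c (Inl (Inl i))) = X i"
      using that DO[of "Inl i"] by (auto simp: J O'_def)
    then show ?thesis using cone unfolding is_cone_def w_def by metis
  qed
  have we: "a e \<cdot> w (s e) = \<pi> (c (Inl (Inr e)))" "b e \<cdot> w (t e) = \<pi> (c (Inl (Inr e)))" if "e \<in> E" for e
  proof -
    have ar: "c (Inr (e, z)) \<in> Ar J" for z using that A(3) by (auto simp: J)
    have "onAr D (c (Inr (e, z))) \<cdot> \<pi> (Dom J (c (Inr (e, z)))) = \<pi> (Cod J (c (Inr (e, z))))" for z
      using cone ar unfolding is_cone_def by blast
    from this[of False] this[of True]
    show "a e \<cdot> w (s e) = \<pi> (c (Inl (Inr e)))" "b e \<cdot> w (t e) = \<pi> (c (Inl (Inr e)))"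
      using that by (simp_all add: DA JA A F_def dm_def cd_def w_def)
  qed
  have "\<exists>!h. h \<in> Hom C V L \<and> (\<forall>i\<in>I. w i \<cdot> h = v i)"
    if V: "V \<in> Ob C" and v: "\<forall>i\<in>I. v i \<in> Hom C V (X i)" and ve: "\<forall>e\<in>E. a e \<cdot> v (s e) = b e \<cdot> v (t e)" for V v
  proof -
    \<comment> \<open>The component at an equation is the common value of its two sides. It is
      determined by the unknowns, which is why \<open>iff\<close> can forget it.\<close>
    define \<pi>' where "\<pi>' k = (case d k of Inl (Inl i) \<Rightarrow> v i | Inl (Inr e) \<Rightarrow> a e \<cdot> v (s e) | _ \<Rightarrow> undefined)" for k
    have p1: "\<pi>' (c (Inl (Inl i))) = v i" if "i \<in> I" for i using that by (simp add: \<pi>'_def d A)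
    have p2: "\<pi>' (c (Inl (Inr e))) = a e \<cdot> v (s e)" if "e \<in> E" for e using that by (simp add: \<pi>'_def d A)
    have "is_cone J C D V \<pi>'"
      unfolding is_cone_def
    proof (intro conjI ballI V)
      show "\<pi>' j \<in> Hom C V (onOb D j)" if j: "j \<in> Ob J" for j
      proof -
        obtain y where y: "y \<in> I <+> E" "j = c (Inl y)" using j unfolding ObJ by blast
        show ?thesis
        proof (cases y)
          case (Inl i)
          then have "i \<in> I" using y by auto
          then show ?thesis using y DO[OF y(1)] v Inl by (simp add: p1 O'_def)
        next
          case (Inr e)
          then have e: "e \<in> E" using y by auto
          have "a e \<cdot> v (s e) \<in> Hom C V (Y e)" using v st(1)[OF e] ab(1)[OF e] Comp_Hom by blast
          then show ?thesis using y DO[OF y(1)] e Inr by (simp add: p2 O'_def)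
        qed
      qed
      show "onAr D u \<cdot> \<pi>' (Dom J u) = \<pi>' (Cod J u)" if u: "u \<in> Ar J" for u
      proof -
        obtain x where x: "x \<in> A" "u = c x" using ArJ[OF u] by blast
        show ?thesis
        proof (cases x)
          case (Inl y)
          show ?thesis
          proof (cases y)
            case i: (Inl i)
            then have "i \<in> I" using x Inl by (simp add: A)
            moreover have "Ide C (X i) \<cdot> v i = v i" using Ide_Comp v calculation by blast
            ultimately show ?thesis using x Inl i by (simp add: DA JA F_def dm_def cd_def p1 O'_def)
          next
            case i: (Inr e)
            then have e: "e \<in> E" using x Inl by (simp add: A)
            have "a e \<cdot> v (s e) \<in> Hom C V (Y e)" using v st(1)[OF e] ab(1)[OF e] Comp_Hom by blast
            from Ide_Comp[OF this] show ?thesis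
              using x Inl i e by (simp add: DA JA F_def dm_def cd_def p2 O'_def)
          qed
        next
          case (Inr ez)
          obtain e z where ez: "ez = (e, z)" by (cases ez)
          then have "e \<in> E" using x Inr by (simp add: A)
          then show ?thesis using x Inr ez ve st by (simp add: DA JA F_def dm_def cd_def p1 p2)
        qed
      qed
    qed
    then have ex: "\<exists>!h. h \<in> Hom C V L \<and> (\<forall>j\<in>Ob J. \<pi> j \<cdot> h = \<pi>' j)"
      using lim unfolding is_limit_def by blast
    have iff: "(\<forall>j\<in>Ob J. \<pi> j \<cdot> h = \<pi>' j) \<longleftrightarrow> (\<forall>i\<in>I. w i \<cdot> h = v i)" if h: "h \<in> Hom C V L" for h
    proof
      assume *: "\<forall>j\<in>Ob J. \<pi> j \<cdot> h = \<pi>' j"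
      show "\<forall>i\<in>I. w i \<cdot> h = v i"
      proof
        fix i assume i: "i \<in> I"
        then have "c (Inl (Inl i)) \<in> Ob J" unfolding ObJ by blast
        with * p1[OF i] show "w i \<cdot> h = v i" by (simp add: w_def)
      qed
    next
      assume *: "\<forall>i\<in>I. w i \<cdot> h = v i"
      have "\<pi> (c (Inl (Inr e))) \<cdot> h = a e \<cdot> v (s e)" if e: "e \<in> E" for e
        using Comp_assoc[OF h w[OF st(1)[OF e]] ab(1)[OF e]] we(1)[OF e] * st(1)[OF e] by simp
      then show "\<forall>j\<in>Ob J. \<pi> j \<cdot> h = \<pi>' j"
        using * p1 p2 unfolding w_def by (auto simp: ObJ)
    qed
    from ex show ?thesis using iff by (metis (no_types, lifting))
  qed
  moreover have "L \<in> Ob C" using cone by (simp add: is_cone_def)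
  ultimately show ?thesis using w we by (intro exI[of _ L] exI[of _ w]) auto
qed

end

definition opposite :: "('o, 'm, 'z) cat_scheme \<Rightarrow> ('o, 'm) cat" where
  "opposite C = \<lparr>Ob = Ob C, Ar = Ar C, Dom = Cod C, Cod = Dom C, Ide = Ide C, Comp = (\<lambda>g f. f \<cdot>\<^bsub>C\<^esub> g)\<rparr>"

lemma opposite_simps [simp]:
  "Ob (opposite C) = Ob C" "Ar (opposite C) = Ar C" "Dom (opposite C) = Cod C" "Cod (opposite C) = Dom C"
  "Ide (opposite C) = Ide C" "g \<cdot>\<^bsub>opposite C\<^esub> f = f \<cdot>\<^bsub>C\<^esub> g"
  by (simp_all add: opposite_def)

lemma Hom_opposite [simp]: "Hom (opposite C) X Y = Hom C Y X"
  by (auto simp: Hom_def)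

lemma category_opposite:
  assumes "category C" shows "category (opposite C)"
proof -
  interpret category C by (rule assms)
  show ?thesis
  proof
    show "Comp (opposite C) (Comp (opposite C) h g) f = Comp (opposite C) h (Comp (opposite C) g f)"
      if "f \<in> Hom (opposite C) W X" "g \<in> Hom (opposite C) X Y" "h \<in> Hom (opposite C) Y Z" for f g h W X Y Z
      using that Comp_assoc[of h Z Y g X f W] by simp
  qed (auto intro: Dom_Ob Cod_Ob Ide_Hom Comp_Hom Comp_Ide Ide_Comp)
qed

context model_category begin

abbreviation mcomp (infixl "\<odot>" 70) where "g \<odot> f \<equiv> Comp M g f"

lemma infinite_kappa: "infinite (UNIV :: 'k set)"
  using kappa unfolding cinfinite_def using finite_subset[OF subset_UNIV] by blast

lemma finite_less_kappa: "finite A \<Longrightarrow> |A| <o \<kappa>"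
  using kappa finite_ordLess_infinite[OF card_of_Well_order card_order_on_well_order_on, of \<kappa> A]
  by (simp add: cinfinite_def Field_card_of)

lemma equation_limit:
  fixes I :: "'i set" and E :: "'e set"
  assumes "finite I" "finite E" "\<And>i. i \<in> I \<Longrightarrow> X i \<in> Ob M"
    "\<And>e. e \<in> E \<Longrightarrow> s e \<in> I" "\<And>e. e \<in> E \<Longrightarrow> t e \<in> I"
    "\<And>e. e \<in> E \<Longrightarrow> a e \<in> Hom M (X (s e)) (Y e)" "\<And>e. e \<in> E \<Longrightarrow> b e \<in> Hom M (X (t e)) (Y e)"
  shows "\<exists>W w. W \<in> Ob M \<and> (\<forall>i\<in>I. w i \<in> Hom M W (X i)) \<and> (\<forall>e\<in>E. a e \<odot> w (s e) = b e \<odot> w (t e)) \<and>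
    (\<forall>V v. V \<in> Ob M \<longrightarrow> (\<forall>i\<in>I. v i \<in> Hom M V (X i)) \<longrightarrow> (\<forall>e\<in>E. a e \<odot> v (s e) = b e \<odot> v (t e)) \<longrightarrow>
      (\<exists>!h. h \<in> Hom M V W \<and> (\<forall>i\<in>I. w i \<odot> h = v i)))"
proof -
  have H: "\<exists>L \<pi>. is_limit J M D L \<pi>" if "category J" "finite (Ar J)" "is_functor J M D" for J :: "('k, 'k) cat" and D
    using limits[OF that(1) finite_less_kappa[OF that(2)] that(3)] .
  show ?thesis
    by (rule finite_equation_limit[where I = I and E = E and X = X and s = s and t = t and a = a
        and b = b and Y = Y and 'k = 'k]) (fact H infinite_kappa assms)+
qed

lemma equation_colimit:
  fixes I :: "'i set" and E :: "'e set"
  assumes "finite I" "finite E" "\<And>i. i \<in> I \<Longrightarrow> X i \<in> Ob M"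
    "\<And>e. e \<in> E \<Longrightarrow> s e \<in> I" "\<And>e. e \<in> E \<Longrightarrow> t e \<in> I"
    "\<And>e. e \<in> E \<Longrightarrow> a e \<in> Hom M (Y e) (X (s e))" "\<And>e. e \<in> E \<Longrightarrow> b e \<in> Hom M (Y e) (X (t e))"
  shows "\<exists>W w. W \<in> Ob M \<and> (\<forall>i\<in>I. w i \<in> Hom M (X i) W) \<and> (\<forall>e\<in>E. w (s e) \<odot> a e = w (t e) \<odot> b e) \<and>
    (\<forall>V v. V \<in> Ob M \<longrightarrow> (\<forall>i\<in>I. v i \<in> Hom M (X i) V) \<longrightarrow> (\<forall>e\<in>E. v (s e) \<odot> a e = v (t e) \<odot> b e) \<longrightarrow>
      (\<exists>!h. h \<in> Hom M W V \<and> (\<forall>i\<in>I. h \<odot> w i = v i)))"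
proof -
  interpret op: category "opposite M" by (rule category_opposite) (rule category_axioms)
  have H: "\<exists>L \<pi>. is_limit J (opposite M) D L \<pi>"
    if J: "category J" "finite (Ar J)" "is_functor J (opposite M) D" for J :: "('k, 'k) cat" and D
  proof -
    have "is_functor (opposite J) M D" using J(3) by (simp add: is_functor_def)
    then have "\<exists>L \<iota>. is_colimit (opposite J) M D L \<iota>"
      by (intro colimits category_opposite[OF J(1)]) (simp_all add: finite_less_kappa J(2))
    then obtain L \<iota> where "is_colimit (opposite J) M D L \<iota>" by blast
    then have "is_limit J (opposite M) D L \<iota>"
      by (simp add: is_colimit_def is_limit_def is_cocone_def is_cone_def)
    then show ?thesis by blast
  qed
  show ?thesis
    by (rule op.finite_equation_limit[where I = I and E = E and X = X and s = s and t = t and a = a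
        and b = b and Y = Y and 'k = 'k, unfolded opposite_simps Hom_opposite]) (fact H infinite_kappa assms)+
qed

lemma discrete_limit:
  fixes X :: "'i \<Rightarrow> 'o"
  assumes "finite I" "\<And>i. i \<in> I \<Longrightarrow> X i \<in> Ob M"
  shows "\<exists>W w. W \<in> Ob M \<and> (\<forall>i\<in>I. w i \<in> Hom M W (X i)) \<and>
    (\<forall>V v. V \<in> Ob M \<longrightarrow> (\<forall>i\<in>I. v i \<in> Hom M V (X i)) \<longrightarrow> (\<exists>!h. h \<in> Hom M V W \<and> (\<forall>i\<in>I. w i \<odot> h = v i)))"
  using equation_limit[where I = I and E = "{} :: 'i set" and X = X and s = "\<lambda>i. i" and t = "\<lambda>i. i"
      and a = "\<lambda>i. Ide M (X i)" and b = "\<lambda>i. Ide M (X i)" and Y = X] assms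
  by simp

lemma binary_product:
  assumes "X \<in> Ob M" "Y \<in> Ob M"
  obtains P p q where "p \<in> Hom M P X" "q \<in> Hom M P Y"
    "\<And>V u v. \<lbrakk>u \<in> Hom M V X; v \<in> Hom M V Y\<rbrakk> \<Longrightarrow> \<exists>!h. h \<in> Hom M V P \<and> p \<odot> h = u \<and> q \<odot> h = v"
proof -
  define Z where "Z i = (if i then X else Y)" for i
  have Z: "Z True = X" "Z False = Y" "Z i \<in> Ob M" for i using assms by (simp_all add: Z_def)
  obtain P w where P: "\<forall>i\<in>UNIV. w i \<in> Hom M P (Z i)"
    "\<forall>V v. V \<in> Ob M \<longrightarrow> (\<forall>i\<in>UNIV. v i \<in> Hom M V (Z i)) \<longrightarrow> (\<exists>!h. h \<in> Hom M V P \<and> (\<forall>i\<in>UNIV. w i \<odot> h = v i))"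
    using discrete_limit[of UNIV Z, OF finite Z(3)] by (elim exE conjE) (rule that)
  show thesis
  proof (rule that[of "w True" P "w False"])
    fix V u v assume uv: "u \<in> Hom M V X" "v \<in> Hom M V Y"
    have "\<forall>i\<in>UNIV. (if i then u else v) \<in> Hom M V (Z i)" using uv by (simp add: Z_def)
    from P(2)[rule_format, OF Hom_Ob(1)[OF uv(1)] this[rule_format]]
    show "\<exists>!h. h \<in> Hom M V P \<and> w True \<odot> h = u \<and> w False \<odot> h = v"
      by (simp add: all_bool_eq conj_commute)
  qed (use P(1)[rule_format, of True] P(1)[rule_format, of False] in \<open>simp_all add: Z\<close>)
qed

lemma discrete_colimit:
  fixes X :: "'i \<Rightarrow> 'o"
  assumes "finite I" "\<And>i. i \<in> I \<Longrightarrow> X i \<in> Ob M"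
  shows "\<exists>W w. W \<in> Ob M \<and> (\<forall>i\<in>I. w i \<in> Hom M (X i) W) \<and>
    (\<forall>V v. V \<in> Ob M \<longrightarrow> (\<forall>i\<in>I. v i \<in> Hom M (X i) V) \<longrightarrow> (\<exists>!h. h \<in> Hom M W V \<and> (\<forall>i\<in>I. h \<odot> w i = v i)))"
  using equation_colimit[where I = I and E = "{} :: 'i set" and X = X and s = "\<lambda>i. i" and t = "\<lambda>i. i"
      and a = "\<lambda>i. Ide M (X i)" and b = "\<lambda>i. Ide M (X i)" and Y = X] assms
  by simp

lemma binary_coproduct:
  assumes "X \<in> Ob M" "Y \<in> Ob M"
  obtains P p q where "p \<in> Hom M X P" "q \<in> Hom M Y P"
    "\<And>V u v. \<lbrakk>u \<in> Hom M X V; v \<in> Hom M Y V\<rbrakk> \<Longrightarrow> \<exists>!h. h \<in> Hom M P V \<and> h \<odot> p = u \<and> h \<odot> q = v"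
proof -
  define Z where "Z i = (if i then X else Y)" for i
  have Z: "Z True = X" "Z False = Y" "Z i \<in> Ob M" for i using assms by (simp_all add: Z_def)
  obtain P w where P: "\<forall>i\<in>UNIV. w i \<in> Hom M (Z i) P"
    "\<forall>V v. V \<in> Ob M \<longrightarrow> (\<forall>i\<in>UNIV. v i \<in> Hom M (Z i) V) \<longrightarrow> (\<exists>!h. h \<in> Hom M P V \<and> (\<forall>i\<in>UNIV. h \<odot> w i = v i))"
    using discrete_colimit[of UNIV Z, OF finite Z(3)] by (elim exE conjE) (rule that)
  show thesis
  proof (rule that[of "w True" P "w False"])
    fix V u v assume uv: "u \<in> Hom M X V" "v \<in> Hom M Y V"
    have "\<forall>i\<in>UNIV. (if i then u else v) \<in> Hom M (Z i) V" using uv by (simp add: Z_def)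
    from P(2)[rule_format, OF Hom_Ob(2)[OF uv(1)] this[rule_format]]
    show "\<exists>!h. h \<in> Hom M P V \<and> h \<odot> w True = u \<and> h \<odot> w False = v"
      by (simp add: all_bool_eq conj_commute)
  qed (use P(1)[rule_format, of True] P(1)[rule_format, of False] in \<open>simp_all add: Z\<close>)
qed

lemma terminal_exists: obtains I where "terminal M I"
proof -
  have "\<exists>W. W \<in> Ob M \<and> (\<forall>V. V \<in> Ob M \<longrightarrow> (\<exists>!h. h \<in> Hom M V W))"
    using discrete_limit[where I = "{} :: nat set" and X = "\<lambda>_. undefined"] by simp
  then show thesis using that unfolding terminal_def by blast
qed

lemma initial_exists: obtains I where "initial M I"
proof -
  have "\<exists>W. W \<in> Ob M \<and> (\<forall>V. V \<in> Ob M \<longrightarrow> (\<exists>!h. h \<in> Hom M W V))"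
    using discrete_colimit[where I = "{} :: nat set" and X = "\<lambda>_. undefined"] by simp
  then show thesis using that unfolding initial_def by blast
qed

section \<open>Elementary model category theory\<close>

abbreviation tfib where "tfib \<equiv> fib M \<inter> weq M"
abbreviation tcof where "tcof \<equiv> cof M \<inter> weq M"

lemma factor_cof_obtain:
  assumes "f \<in> Hom M X Y"
  obtains E a b where "a \<in> Hom M X E" "b \<in> Hom M E Y" "a \<in> cof M" "b \<in> tfib" "b \<odot> a = f"
proof -
  obtain E a b where *: "\<forall>f\<in>Ar M. a f \<in> cof M \<inter> Hom M (Dom M f) (E f) \<and>
      b f \<in> (fib M \<inter> weq M) \<inter> Hom M (E f) (Cod M f) \<and> b f \<odot> a f = f"
    using factor_cof unfolding has_functorial_factorization_def by (elim exE conjE) (rule that)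
  show thesis
    by (rule that[of "a f" "E f" "b f"]) (use * assms in \<open>auto simp: Hom_def\<close>)
qed

lemma factor_tcof_obtain:
  assumes "f \<in> Hom M X Y"
  obtains E a b where "a \<in> Hom M X E" "b \<in> Hom M E Y" "a \<in> tcof" "b \<in> fib M" "b \<odot> a = f"
proof -
  obtain E a b where *: "\<forall>f\<in>Ar M. a f \<in> cof M \<inter> weq M \<inter> Hom M (Dom M f) (E f) \<and>
      b f \<in> fib M \<inter> Hom M (E f) (Cod M f) \<and> b f \<odot> a f = f"
    using factor_tcof unfolding has_functorial_factorization_def by (elim exE conjE) (rule that)
  show thesis
    by (rule that[of "a f" "E f" "b f"]) (use * assms in \<open>auto simp: Hom_def\<close>)
qed

lemma lift:
  assumes "has_lifting M i p" "i \<in> Hom M A B" "p \<in> Hom M X Y" "u \<in> Hom M A X" "v \<in> Hom M B Y" "p \<odot> u = v \<odot> i"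
  obtains h where "h \<in> Hom M B X" "h \<odot> i = u" "p \<odot> h = v"
  using assms unfolding has_lifting_def square_def by (force simp: Hom_def)

lemma has_liftingI:
  assumes "i \<in> Hom M A B" "p \<in> Hom M X Y"
    and "\<And>u v. \<lbrakk>u \<in> Hom M A X; v \<in> Hom M B Y; p \<odot> u = v \<odot> i\<rbrakk> \<Longrightarrow> \<exists>h. h \<in> Hom M B X \<and> h \<odot> i = u \<and> p \<odot> h = v"
  shows "has_lifting M i p"
  using assms unfolding has_lifting_def square_def by (auto simp: Hom_def Bex_def)

text \<open>The retract argument, which turns a lifting property into membership, since all three
  classes are closed under retracts. The lift is a retraction of \<open>a\<close>.\<close>

lemma retract_right:
  assumes a: "a \<in> Hom M X E" and b: "b \<in> Hom M E Y" and p: "p = b \<odot> a" and l: "has_lifting M a p"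
  shows "retract_of_arrow M p b"
proof -
  have pH: "p \<in> Hom M X Y" using Comp_Hom[OF a b] p by simp
  note Ob = Hom_Ob[OF a] Hom_Ob[OF b]
  obtain h where h: "h \<in> Hom M E X" "h \<odot> a = Ide M X" "p \<odot> h = b"
    by (rule lift[OF l a pH Ide_Hom[OF Ob(1)] b]) (use Comp_Ide[OF pH] p in simp)
  show ?thesis
    unfolding retract_of_arrow_def square_def
    by (rule exI[of _ a], rule exI[of _ "Ide M Y"], rule exI[of _ h], rule exI[of _ "Ide M Y"])
      (use a b pH h p Ob in \<open>auto simp: Hom_def cat_simps\<close>)
qed

lemma retract_left:
  assumes a: "a \<in> Hom M X E" and b: "b \<in> Hom M E Y" and i: "i = b \<odot> a" and l: "has_lifting M i b"
  shows "retract_of_arrow M i a"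
proof -
  have iH: "i \<in> Hom M X Y" using Comp_Hom[OF a b] i by simp
  note Ob = Hom_Ob[OF a] Hom_Ob[OF b]
  obtain h where h: "h \<in> Hom M Y E" "h \<odot> i = a" "b \<odot> h = Ide M Y"
    by (rule lift[OF l iH b a Ide_Hom[OF Ob(4)]]) (use Ide_Comp[OF iH] i in simp)
  show ?thesis
    unfolding retract_of_arrow_def square_def
    by (rule exI[of _ "Ide M X"], rule exI[of _ h], rule exI[of _ "Ide M X"], rule exI[of _ b])
      (use a b iH h i Ob in \<open>auto simp: Hom_def cat_simps\<close>)
qed

lemma tfib_retract: "\<lbrakk>retract_of_arrow M g f; f \<in> tfib\<rbrakk> \<Longrightarrow> g \<in> tfib"
  using weq_retract fib_retract by blast

text \<open>The cofibrations alone pin down the trivial fibrations. A Bousfield localization has the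
  same cofibrations and hence the same trivial fibrations.\<close>

lemma tfib_iff: "p \<in> tfib \<longleftrightarrow> p \<in> Ar M \<and> (\<forall>i\<in>cof M. has_lifting M i p)"
proof
  assume "p \<in> tfib" then show "p \<in> Ar M \<and> (\<forall>i\<in>cof M. has_lifting M i p)"
    using lift_cof weq_Ar by blast
next
  assume *: "p \<in> Ar M \<and> (\<forall>i\<in>cof M. has_lifting M i p)"
  then have "p \<in> Hom M (Dom M p) (Cod M p)" by (simp add: Hom_def)
  then obtain E a b where "a \<in> Hom M (Dom M p) E" "b \<in> Hom M E (Cod M p)" "a \<in> cof M" "b \<in> tfib" "b \<odot> a = p"
    by (rule factor_cof_obtain)
  with * retract_right tfib_retract show "p \<in> tfib" by metis
qed

lemma fib_iff: "p \<in> fib M \<longleftrightarrow> p \<in> Ar M \<and> (\<forall>i\<in>tcof. has_lifting M i p)"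
proof
  assume "p \<in> fib M" then show "p \<in> Ar M \<and> (\<forall>i\<in>tcof. has_lifting M i p)"
    using lift_tcof fib_Ar by blast
next
  assume *: "p \<in> Ar M \<and> (\<forall>i\<in>tcof. has_lifting M i p)"
  then have "p \<in> Hom M (Dom M p) (Cod M p)" by (simp add: Hom_def)
  then obtain E a b where "a \<in> Hom M (Dom M p) E" "b \<in> Hom M E (Cod M p)" "a \<in> tcof" "b \<in> fib M" "b \<odot> a = p"
    by (rule factor_tcof_obtain)
  with * retract_right fib_retract show "p \<in> fib M" by metis
qed

lemma cof_iff: "i \<in> cof M \<longleftrightarrow> i \<in> Ar M \<and> (\<forall>p\<in>tfib. has_lifting M i p)"
proof
  assume "i \<in> cof M" then show "i \<in> Ar M \<and> (\<forall>p\<in>tfib. has_lifting M i p)"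
    using lift_cof cof_Ar by blast
next
  assume *: "i \<in> Ar M \<and> (\<forall>p\<in>tfib. has_lifting M i p)"
  then have "i \<in> Hom M (Dom M i) (Cod M i)" by (simp add: Hom_def)
  then obtain E a b where "a \<in> Hom M (Dom M i) E" "b \<in> Hom M E (Cod M i)" "a \<in> cof M" "b \<in> tfib" "b \<odot> a = i"
    by (rule factor_cof_obtain)
  with * retract_left cof_retract show "i \<in> cof M" by metis
qed

text \<open>The identity is a retract of the trivial fibration \<open>b\<close> in its own
  factorization, because \<open>b\<close> after \<open>a\<close> is the identity.\<close>

lemma Ide_weq: "X \<in> Ob M \<Longrightarrow> Ide M X \<in> weq M"
proof -
  assume X: "X \<in> Ob M"
  obtain E a b where *: "a \<in> Hom M X E" "b \<in> Hom M E X" "a \<in> cof M" "b \<in> tfib" "b \<odot> a = Ide M X"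
    using factor_cof_obtain[OF Ide_Hom[OF X]] by blast
  have "retract_of_arrow M (Ide M X) b"
    unfolding retract_of_arrow_def square_def
    by (rule exI[of _ a], rule exI[of _ "Ide M X"], rule exI[of _ b], rule exI[of _ "Ide M X"])
      (use * X Hom_Ob[OF *(1)] in \<open>auto simp: Hom_def cat_simps\<close>)
  then show ?thesis using weq_retract * by blast
qed

lemma weq_comp: "\<lbrakk>f \<in> Hom M X Y; g \<in> Hom M Y Z; f \<in> weq M; g \<in> weq M\<rbrakk> \<Longrightarrow> g \<odot> f \<in> weq M"
  and weq_left: "\<lbrakk>f \<in> Hom M X Y; g \<in> Hom M Y Z; f \<in> weq M; g \<odot> f \<in> weq M\<rbrakk> \<Longrightarrow> g \<in> weq M"
  and weq_right: "\<lbrakk>f \<in> Hom M X Y; g \<in> Hom M Y Z; g \<in> weq M; g \<odot> f \<in> weq M\<rbrakk> \<Longrightarrow> f \<in> weq M"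
  using two_of_three by blast+

text \<open>Maps into a terminal object are unique, so the bottom of every lifting square is
  determined and only extension along trivial cofibrations remains.\<close>

lemma fibrant_iff: "fibrant M X \<longleftrightarrow> X \<in> Ob M \<and>
  (\<forall>A B. \<forall>i\<in>tcof \<inter> Hom M A B. \<forall>u\<in>Hom M A X. \<exists>h\<in>Hom M B X. h \<odot> i = u)"
proof
  assume "fibrant M X"
  then obtain I p where X: "X \<in> Ob M" and I: "terminal M I" and p: "p \<in> Hom M X I" "p \<in> fib M"
    unfolding fibrant_def by blast
  have "\<exists>h\<in>Hom M B X. h \<odot> i = u" if i: "i \<in> tcof \<inter> Hom M A B" and u: "u \<in> Hom M A X" for A B i u
  proof -
    have iH: "i \<in> Hom M A B" using i by simp
    obtain v where v: "v \<in> Hom M B I" using I Hom_Ob(2)[OF iH] unfolding terminal_def by blast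
    have "p \<odot> u = v \<odot> i"
      using I Hom_Ob(1)[OF iH] Comp_Hom[OF u p(1)] Comp_Hom[OF iH v] unfolding terminal_def by blast
    then obtain h where "h \<in> Hom M B X" "h \<odot> i = u"
      using lift[OF lift_tcof[of i p] iH p(1) u v] i p(2) by blast
    then show ?thesis by blast
  qed
  with X show "X \<in> Ob M \<and> (\<forall>A B. \<forall>i\<in>tcof \<inter> Hom M A B. \<forall>u\<in>Hom M A X. \<exists>h\<in>Hom M B X. h \<odot> i = u)" by blast
next
  assume *: "X \<in> Ob M \<and> (\<forall>A B. \<forall>i\<in>tcof \<inter> Hom M A B. \<forall>u\<in>Hom M A X. \<exists>h\<in>Hom M B X. h \<odot> i = u)"
  obtain I where I: "terminal M I" by (rule terminal_exists)
  then obtain p where p: "p \<in> Hom M X I" using * unfolding terminal_def by blast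
  have "has_lifting M i p" if i: "i \<in> tcof" for i
  proof (rule has_liftingI[OF _ p])
    show iH: "i \<in> Hom M (Dom M i) (Cod M i)" using i weq_Ar by (auto simp: Hom_def)
    fix u v assume u: "u \<in> Hom M (Dom M i) X" and v: "v \<in> Hom M (Cod M i) I"
    obtain h where h: "h \<in> Hom M (Cod M i) X" "h \<odot> i = u" using * i iH u by blast
    moreover have "p \<odot> h = v"
      using I Comp_Hom[OF h(1) p] v Hom_Ob(1)[OF v] unfolding terminal_def by blast
    ultimately show "\<exists>h. h \<in> Hom M (Cod M i) X \<and> h \<odot> i = u \<and> p \<odot> h = v" by blast
  qed
  then have "p \<in> fib M" using fib_iff p by (auto simp: Hom_def)
  with * I p show "fibrant M X" unfolding fibrant_def by blast
qed

lemma cofibrant_lift: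
  assumes "cofibrant M X" and p: "p \<in> tfib" "p \<in> Hom M E Y" and v: "v \<in> Hom M X Y"
  obtains h where "h \<in> Hom M X E" "p \<odot> h = v"
proof -
  obtain I i where I: "initial M I" and i: "i \<in> Hom M I X" "i \<in> cof M"
    using assms unfolding cofibrant_def by blast
  obtain u where u: "u \<in> Hom M I E" using I Hom_Ob(1)[OF p(2)] unfolding initial_def by blast
  have "p \<odot> u = v \<odot> i"
    using I Hom_Ob(2)[OF p(2)] Comp_Hom[OF u p(2)] Comp_Hom[OF i(1) v] unfolding initial_def by blast
  then show thesis using lift[OF lift_cof[OF i(2) p(1)] i(1) p(2) u v] that by blast
qed

lemma cof_comp:
  assumes "f \<in> Hom M X Y" "g \<in> Hom M Y Z" "f \<in> cof M" "g \<in> cof M"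
  shows "g \<odot> f \<in> cof M"
proof -
  have "has_lifting M (g \<odot> f) p" if p: "p \<in> tfib" for p
  proof (rule has_liftingI[OF Comp_Hom[OF assms(1,2)]])
    show pH: "p \<in> Hom M (Dom M p) (Cod M p)" using p weq_Ar by (auto simp: Hom_def)
    fix u v assume uv: "u \<in> Hom M X (Dom M p)" "v \<in> Hom M Z (Cod M p)" "p \<odot> u = v \<odot> (g \<odot> f)"
    obtain h where h: "h \<in> Hom M Y (Dom M p)" "h \<odot> f = u" "p \<odot> h = v \<odot> g"
      by (rule lift[OF lift_cof[OF assms(3) p] assms(1) pH uv(1) Comp_Hom[OF assms(2) uv(2)]])
        (use Comp_assoc[OF assms(1,2) uv(2)] uv(3) in simp)
    obtain k where k: "k \<in> Hom M Z (Dom M p)" "k \<odot> g = h" "p \<odot> k = v"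
      by (rule lift[OF lift_cof[OF assms(4) p] assms(2) pH h(1) uv(2) h(3)])
    then show "\<exists>k. k \<in> Hom M Z (Dom M p) \<and> k \<odot> (g \<odot> f) = u \<and> p \<odot> k = v"
      using h(2) Comp_assoc[OF assms(1,2) k(1)] by (intro exI[of _ k]) auto
  qed
  then show ?thesis using cof_iff Comp_Hom[OF assms(1,2)] by (auto simp: Hom_def)
qed

lemma cofibrant_cof:
  assumes "cofibrant M X" "j \<in> cof M" "j \<in> Hom M X Y"
  shows "cofibrant M Y"
  using assms cof_comp Comp_Hom Hom_Ob(2)[OF assms(3)] unfolding cofibrant_def by metis

lemma cofibrant_replacement:
  assumes "X \<in> Ob M"
  obtains Q q where "q \<in> Hom M Q X" "q \<in> tfib" "cofibrant M Q"
proof -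
  obtain I where I: "initial M I" by (rule initial_exists)
  then obtain u where "u \<in> Hom M I X" using assms unfolding initial_def by blast
  then obtain E a b where "a \<in> Hom M I E" "b \<in> Hom M E X" "a \<in> cof M" "b \<in> tfib" "b \<odot> a = u"
    by (rule factor_cof_obtain)
  with I that[of b E] Hom_Ob(2)[of a] show thesis unfolding cofibrant_def by blast
qed

lemma fibrant_fib:
  assumes "fibrant M Y" "p \<in> fib M" "p \<in> Hom M X Y"
  shows "fibrant M X"
  unfolding fibrant_iff
proof (intro conjI allI ballI)
  show "X \<in> Ob M" using Hom_Ob(1)[OF assms(3)] .
  fix A B i u assume i: "i \<in> tcof \<inter> Hom M A B" and u: "u \<in> Hom M A X"
  obtain v where v: "v \<in> Hom M B Y" "v \<odot> i = p \<odot> u"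
    using assms(1) i Comp_Hom[OF u assms(3)] unfolding fibrant_iff by blast
  have "has_lifting M i p" using lift_tcof i assms(2) by blast
  then show "\<exists>h\<in>Hom M B X. h \<odot> i = u"
    using lift[of i p A B X Y u v] i u v assms(3) by (metis IntE)
qed

section \<open>Path objects and maps between fibrant objects\<close>

text \<open>The graph of \<open>e\<close> is factored into a trivial cofibration \<open>s\<close>
  and a fibration onto the product of \<open>Q\<close> and \<open>R\<close>. The last clause is the
  lifting property of that fibration, written in coordinates so that the product need not appear.
  \<open>p0\<close> and \<open>p1\<close> are fibrations because the missing coordinate can be
  extended along a trivial cofibration when \<open>R\<close> or \<open>Q\<close> is fibrant.\<close>

lemma mapping_path:
  assumes e: "e \<in> Hom M Q R" and fibr: "fibrant M Q" "fibrant M R"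
  obtains P s p0 p1 q where "s \<in> Hom M Q P" "s \<in> tcof" "p0 \<in> Hom M P Q" "p1 \<in> Hom M P R"
    "p0 \<odot> s = Ide M Q" "p1 \<odot> s = e" "p0 \<in> tfib" "p1 \<in> fib M"
    "\<And>A B i u v w. \<lbrakk>i \<in> tcof; i \<in> Hom M A B; u \<in> Hom M A P; v \<in> Hom M B Q; w \<in> Hom M B R;
      p0 \<odot> u = v \<odot> i; p1 \<odot> u = w \<odot> i\<rbrakk> \<Longrightarrow> \<exists>h. h \<in> Hom M B P \<and> h \<odot> i = u \<and> p0 \<odot> h = v \<and> p1 \<odot> h = w"
proof -
  note Q = Hom_Ob(1)[OF e] and R = Hom_Ob(2)[OF e]
  obtain Z \<pi>0 \<pi>1 where Z: "\<pi>0 \<in> Hom M Z Q" "\<pi>1 \<in> Hom M Z R"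
    and U: "\<And>V u v. \<lbrakk>u \<in> Hom M V Q; v \<in> Hom M V R\<rbrakk> \<Longrightarrow> \<exists>!h. h \<in> Hom M V Z \<and> \<pi>0 \<odot> h = u \<and> \<pi>1 \<odot> h = v"
    by (rule binary_product[OF Q R]) (rule that; (assumption | blast))
  obtain d where d: "d \<in> Hom M Q Z" "\<pi>0 \<odot> d = Ide M Q" "\<pi>1 \<odot> d = e" using U[OF Ide_Hom[OF Q] e] by blast
  obtain P s q where s: "s \<in> Hom M Q P" "q \<in> Hom M P Z" "s \<in> tcof" "q \<in> fib M" "q \<odot> s = d"
    by (rule factor_tcof_obtain[OF d(1)])
  define p0 where "p0 = \<pi>0 \<odot> q"
  define p1 where "p1 = \<pi>1 \<odot> q"
  have p0: "p0 \<in> Hom M P Q" and p1: "p1 \<in> Hom M P R"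
    unfolding p0_def p1_def using Comp_Hom s Z by blast+
  have p0s: "p0 \<odot> s = Ide M Q" "p1 \<odot> s = e"
    unfolding p0_def p1_def using Comp_assoc[OF s(1,2) Z(1)] Comp_assoc[OF s(1,2) Z(2)] s(5) d by simp_all
  have L: "\<exists>h. h \<in> Hom M B P \<and> h \<odot> i = u \<and> p0 \<odot> h = v \<and> p1 \<odot> h = w"
    if i: "i \<in> tcof" "i \<in> Hom M A B" and u: "u \<in> Hom M A P" and v: "v \<in> Hom M B Q" and w: "w \<in> Hom M B R"
      and eq: "p0 \<odot> u = v \<odot> i" "p1 \<odot> u = w \<odot> i" for A B i u v w
  proof -
    obtain z where z: "z \<in> Hom M B Z" "\<pi>0 \<odot> z = v" "\<pi>1 \<odot> z = w" using U[OF v w] by blast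
    have "\<pi>0 \<odot> (q \<odot> u) = v \<odot> i" "\<pi>1 \<odot> (q \<odot> u) = w \<odot> i"
      using Comp_assoc[OF u s(2) Z(1)] Comp_assoc[OF u s(2) Z(2)] eq by (simp_all add: p0_def p1_def)
    moreover have "\<pi>0 \<odot> (z \<odot> i) = v \<odot> i" "\<pi>1 \<odot> (z \<odot> i) = w \<odot> i"
      using Comp_assoc[OF i(2) z(1) Z(1)] Comp_assoc[OF i(2) z(1) Z(2)] z by simp_all
    ultimately have "q \<odot> u = z \<odot> i"
      using U[OF Comp_Hom[OF i(2) v] Comp_Hom[OF i(2) w]] Comp_Hom[OF u s(2)] Comp_Hom[OF i(2) z(1)] by blast
    then obtain h where h: "h \<in> Hom M B P" "h \<odot> i = u" "q \<odot> h = z"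
      using lift[OF lift_tcof[OF i(1) s(4)] i(2) s(2) u z(1)] by blast
    moreover have "p0 \<odot> h = v" "p1 \<odot> h = w"
      using Comp_assoc[OF h(1) s(2) Z(1)] Comp_assoc[OF h(1) s(2) Z(2)] h z by (simp_all add: p0_def p1_def)
    ultimately show ?thesis by blast
  qed
  have "p0 \<in> fib M"
    unfolding fib_iff
  proof (intro conjI ballI)
    show "p0 \<in> Ar M" using p0 by (simp add: Hom_def)
    fix i assume i: "i \<in> tcof"
    show "has_lifting M i p0"
    proof (rule has_liftingI[OF _ p0])
      show iH: "i \<in> Hom M (Dom M i) (Cod M i)" using i weq_Ar by (auto simp: Hom_def)
      fix u v assume uv: "u \<in> Hom M (Dom M i) P" "v \<in> Hom M (Cod M i) Q" "p0 \<odot> u = v \<odot> i"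
      obtain w where "w \<in> Hom M (Cod M i) R" "w \<odot> i = p1 \<odot> u"
        using fibr(2) i iH Comp_Hom[OF uv(1) p1] unfolding fibrant_iff by blast
      with L[OF i iH uv(1,2) _ uv(3)] show "\<exists>h. h \<in> Hom M (Cod M i) P \<and> h \<odot> i = u \<and> p0 \<odot> h = v" by metis
    qed
  qed
  moreover have "p1 \<in> fib M"
    unfolding fib_iff
  proof (intro conjI ballI)
    show "p1 \<in> Ar M" using p1 by (simp add: Hom_def)
    fix i assume i: "i \<in> tcof"
    show "has_lifting M i p1"
    proof (rule has_liftingI[OF _ p1])
      show iH: "i \<in> Hom M (Dom M i) (Cod M i)" using i weq_Ar by (auto simp: Hom_def)
      fix u w assume uv: "u \<in> Hom M (Dom M i) P" "w \<in> Hom M (Cod M i) R" "p1 \<odot> u = w \<odot> i"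
      obtain v where "v \<in> Hom M (Cod M i) Q" "v \<odot> i = p0 \<odot> u"
        using fibr(1) i iH Comp_Hom[OF uv(1) p0] unfolding fibrant_iff by blast
      with L[OF i iH uv(1) _ uv(2) _ uv(3)] show "\<exists>h. h \<in> Hom M (Cod M i) P \<and> h \<odot> i = u \<and> p1 \<odot> h = w" by metis
    qed
  qed
  moreover have "p0 \<in> weq M" using weq_left[OF s(1) p0] s(3) p0s Ide_weq[OF Q] by simp
  ultimately have f: "p0 \<in> tfib" "p1 \<in> fib M" by auto
  show thesis by (rule that[OF s(1,3) p0 p1 p0s f]) (rule L)
qed

text \<open>Such a \<open>j\<close> is a deformation retract: \<open>r\<close> extends the identity
  of \<open>L\<close>, and the right homotopy \<open>H\<close> extends the constant homotopy
  \<open>s \<odot> j\<close> with prescribed ends.\<close>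

lemma tcof_between_fibrant:
  assumes j: "j \<in> tcof" "j \<in> Hom M L E" and fibr: "fibrant M L" "fibrant M E"
  obtains r P p0 p1 H where "r \<in> Hom M E L" "r \<odot> j = Ide M L" "H \<in> Hom M E P"
    "p0 \<in> Hom M P E" "p0 \<in> tfib" "p1 \<in> Hom M P E" "p1 \<in> tfib" "p0 \<odot> H = j \<odot> r" "p1 \<odot> H = Ide M E"
proof -
  note L = Hom_Ob(1)[OF j(2)] and E = Hom_Ob(2)[OF j(2)]
  obtain r where r: "r \<in> Hom M E L" "r \<odot> j = Ide M L"
    using fibr(1) j Ide_Hom[OF L] unfolding fibrant_iff by blast
  obtain P s p0 p1 where P: "s \<in> Hom M E P" "s \<in> tcof" "p0 \<in> Hom M P E" "p1 \<in> Hom M P E"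
    "p0 \<odot> s = Ide M E" "p1 \<odot> s = Ide M E" "p0 \<in> tfib" "p1 \<in> fib M"
    and L: "\<And>A B i u v w. \<lbrakk>i \<in> tcof; i \<in> Hom M A B; u \<in> Hom M A P; v \<in> Hom M B E; w \<in> Hom M B E;
      p0 \<odot> u = v \<odot> i; p1 \<odot> u = w \<odot> i\<rbrakk> \<Longrightarrow> \<exists>h. h \<in> Hom M B P \<and> h \<odot> i = u \<and> p0 \<odot> h = v \<and> p1 \<odot> h = w"
    by (rule mapping_path[OF Ide_Hom[OF E] fibr(2,2)]) (rule that; (assumption | blast))
  have "p1 \<in> weq M" using weq_left[OF P(1,4)] P(2,6) Ide_weq[OF E] by simp
  have sj: "s \<odot> j \<in> Hom M L P" by (rule Comp_Hom[OF j(2) P(1)])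
  have 0: "p0 \<odot> (s \<odot> j) = (j \<odot> r) \<odot> j"
    using Comp_assoc[OF j(2) P(1,3)] Comp_assoc[OF j(2) r(1) j(2)] P(5) r(2) Comp_Ide[OF j(2)] Ide_Comp[OF j(2)] by simp
  have 1: "p1 \<odot> (s \<odot> j) = Ide M E \<odot> j" using Comp_assoc[OF j(2) P(1,4)] P(6) by simp
  obtain H where "H \<in> Hom M E P" "p0 \<odot> H = j \<odot> r" "p1 \<odot> H = Ide M E"
    using L[OF j sj Comp_Hom[OF r(1) j(2)] Ide_Hom[OF E] 0 1] by blast
  then show thesis using that[OF r _ P(3,7,4)] P(8) \<open>p1 \<in> weq M\<close> by blast
qed

end

lemma same_tfib:
  assumes "model_category \<kappa> M" and "model_category \<kappa> M'"
    and "M' = M\<lparr>weq := W', fib := F'\<rparr>"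
  shows "fib M' \<inter> weq M' = fib M \<inter> weq M"
proof -
  have *: "has_lifting M' = has_lifting M" "Ar M' = Ar M" "cof M' = cof M"
    by (simp_all add: assms(3) has_lifting_def[abs_def] square_def Hom_def)
  show ?thesis
    unfolding set_eq_iff
    by (simp only: model_category.tfib_iff[OF assms(1)] model_category.tfib_iff[OF assms(2)] *) simp
qed

text \<open>The local Whitehead theorem. In the localized structure \<open>h\<close> factors into a
  trivial cofibration \<open>j\<close> and a trivial fibration, and both structures have the same
  trivial fibrations. The homotopy from \<open>j\<close> after \<open>r\<close> to the identity only
  involves trivial fibrations, so this composite is a weak equivalence of \<open>M\<close>; finally
  \<open>j\<close> is a retract of it.\<close>

lemma weq_between_local:
  assumes M: "model_category \<kappa> M" and M': "model_category \<kappa> M'"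
    and M'_eq: "M' = M\<lparr>weq := W', fib := F'\<rparr>"
    and h: "h \<in> Hom M X Y" "h \<in> weq M'" and fibr: "fibrant M' X" "fibrant M' Y"
  shows "h \<in> weq M"
proof -
  interpret M: model_category \<kappa> M by (rule M)
  interpret M': model_category \<kappa> M' by (rule M')
  have H: "Hom M' = Hom M" "Comp M' = Comp M" "Ide M' = Ide M" "cof M' = cof M" "Ob M' = Ob M"
    by (simp_all add: M'_eq Hom_def[abs_def])
  note tf = same_tfib[OF M M' M'_eq]
  obtain E j p where j: "j \<in> Hom M X E" "p \<in> Hom M E Y" "j \<in> cof M'" "p \<in> fib M' \<inter> weq M'" "Comp M p j = h"
    using M'.factor_cof_obtain[of h X Y] h(1) unfolding H by metis
  have "j \<in> weq M'" using M'.weq_right[of j X E p Y] j h(2) unfolding H by simp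
  then have jt: "j \<in> cof M' \<inter> weq M'" using j by simp
  have "fibrant M' E" using M'.fibrant_fib[OF fibr(2), of p E] j(2,4) by (simp add: H)
  then obtain r P p0 p1 K where r: "r \<in> Hom M E X" "Comp M r j = Ide M X" and K: "K \<in> Hom M E P"
    "p0 \<in> Hom M P E" "p0 \<in> fib M' \<inter> weq M'" "p1 \<in> Hom M P E" "p1 \<in> fib M' \<inter> weq M'"
    "Comp M p0 K = Comp M j r" "Comp M p1 K = Ide M E"
    using M'.tcof_between_fibrant[OF jt _ fibr(1), of E] j(1) unfolding H by metis
  note XE = M.Hom_Ob[OF j(1)]
  have "K \<in> weq M" using M.weq_right[OF K(1,4)] K(5,7) M.Ide_weq[OF XE(2)] unfolding tf by simp
  then have jr: "Comp M j r \<in> weq M" using M.weq_comp[OF K(1,2)] K(3,6) unfolding tf by simp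
  have "retract_of_arrow M j (Comp M j r)"
    unfolding retract_of_arrow_def square_def
    by (rule exI[of _ j], rule exI[of _ "Ide M E"], rule exI[of _ r], rule exI[of _ "Ide M E"])
      (use j(1) r XE M.reassoc[OF r(2)] in \<open>auto simp: Hom_def M.cat_simps\<close>)
  then have "j \<in> weq M" using M.weq_retract jr by blast
  then show ?thesis using M.weq_comp[OF j(1,2)] j(4,5) unfolding tf by simp
qed

section \<open>Epi-mono factorizations in the simplex category\<close>

text \<open>Surjections of the simplex category all split, and the section is the form in which
  surjectivity is used.\<close>

definition split_epi :: "simplex_map \<Rightarrow> nat \<Rightarrow> nat \<Rightarrow> bool" where
  "split_epi \<epsilon> m k \<longleftrightarrow> \<epsilon> \<in> Hom Simplex m k \<and> (\<exists>s\<in>Hom Simplex k m. \<epsilon> \<star> s = Ide Simplex k)"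

definition injective :: "simplex_map \<Rightarrow> nat \<Rightarrow> nat \<Rightarrow> bool" where
  "injective \<iota> k n \<longleftrightarrow> \<iota> \<in> Hom Simplex k n \<and> inj_on (ap \<iota>) {0..k}"

lemma injective_Hom: "injective \<iota> k n \<Longrightarrow> \<iota> \<in> Hom Simplex k n"
  and split_epi_Hom: "split_epi \<epsilon> m k \<Longrightarrow> \<epsilon> \<in> Hom Simplex m k"
  by (simp_all add: injective_def split_epi_def)

lemma injectiveI:
  assumes "\<iota> \<in> Hom Simplex k n" "\<And>i. i < k \<Longrightarrow> ap \<iota> i \<noteq> ap \<iota> (Suc i)"
  shows "injective \<iota> k n"
proof -
  have less: "ap \<iota> i < ap \<iota> (Suc i)" if "i < k" for i
    using ap_mono[OF assms(1), of i "Suc i"] assms(2)[OF that] that by simp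
  have "ap \<iota> i < ap \<iota> j" if "i < j" "j \<le> k" for i j
    using that
  proof (induction j)
    case (Suc j)
    then show ?case using less[of j] by (cases "i = j") auto
  qed simp
  then have "inj_on (ap \<iota>) {0..k}"
    by (intro inj_onI) (metis atLeastAtMost_iff less_irrefl linorder_neqE_nat)
  with assms(1) show ?thesis by (simp add: injective_def)
qed

lemma injective_le:
  assumes "injective \<iota> k n" shows "k \<le> n"
proof (rule ccontr)
  assume "\<not> k \<le> n"
  then have "n < k" by simp
  obtain i where "i < k" "ap \<iota> i = ap \<iota> (Suc i)"
    by (rule not_injective_cases[OF injective_Hom[OF assms] \<open>n < k\<close>])
  then show False using assms unfolding injective_def inj_on_def by fastforce
qed

lemma injective_endo:
  assumes "injective \<iota> k k" shows "\<iota> = Ide Simplex k"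
  using injective_Hom[OF assms]
proof (rule endo_cases)
  fix i assume "i < k" "ap \<iota> i = ap \<iota> (Suc i)"
  then show ?thesis using assms unfolding injective_def inj_on_def by fastforce
qed

lemma injective_comp:
  assumes "injective \<alpha> l m" "injective \<beta> m n"
  shows "injective (\<beta> \<star> \<alpha>) l n"
proof -
  note a = injective_Hom[OF assms(1)] and b = injective_Hom[OF assms(2)]
  have "inj_on (ap (\<beta> \<star> \<alpha>)) {0..l}"
  proof (rule inj_onI)
    fix i j assume ij: "i \<in> {0..l}" "j \<in> {0..l}" "ap (\<beta> \<star> \<alpha>) i = ap (\<beta> \<star> \<alpha>) j"
    then have "ap \<beta> (ap \<alpha> i) = ap \<beta> (ap \<alpha> j)" by (simp add: ap_Comp[OF a b])
    then have "ap \<alpha> i = ap \<alpha> j"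
      using assms(2) ap_le[OF a] ij unfolding injective_def inj_on_def by simp
    then show "i = j" using assms(1) ij unfolding injective_def inj_on_def by simp
  qed
  with Comp_Simplex_Hom[OF a b] show ?thesis by (simp add: injective_def)
qed

lemma injective_comp_right:
  assumes "\<alpha> \<in> Hom Simplex l m" "\<beta> \<in> Hom Simplex m n" "injective (\<beta> \<star> \<alpha>) l n"
  shows "injective \<alpha> l m"
  using assms unfolding injective_def inj_on_def by (simp add: ap_Comp[OF assms(1,2)])

lemma Ide_injective: "injective (Ide Simplex n) n n"
  by (simp add: injective_def Ide_Simplex_Hom inj_on_def ap_Ide)

lemma split_epi_le:
  assumes "split_epi \<epsilon> m k" shows "k \<le> m"
proof -
  obtain s where s: "s \<in> Hom Simplex k m" "\<epsilon> \<star> s = Ide Simplex k"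
    using assms unfolding split_epi_def by blast
  have "injective s k m"
    by (rule injective_comp_right[OF s(1) split_epi_Hom[OF assms]]) (simp add: s(2) Ide_injective)
  then show ?thesis by (rule injective_le)
qed

lemma split_epi_endo:
  assumes "split_epi \<epsilon> k k" shows "\<epsilon> = Ide Simplex k"
proof -
  obtain s where s: "s \<in> Hom Simplex k k" "\<epsilon> \<star> s = Ide Simplex k"
    using assms unfolding split_epi_def by blast
  have "injective s k k"
    by (rule injective_comp_right[OF s(1) split_epi_Hom[OF assms]]) (simp add: s(2) Ide_injective)
  then have "s = Ide Simplex k" by (rule injective_endo)
  with s(2) show ?thesis using Simplex.Comp_Ide[OF split_epi_Hom[OF assms]] by simp
qed

lemma Ide_split_epi: "split_epi (Ide Simplex n) n n"
  unfolding split_epi_def using Ide_Simplex_Hom Simplex.Comp_Ide[OF Ide_Simplex_Hom] by blast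

lemma split_epi_comp:
  assumes "split_epi \<alpha> l m" "split_epi \<beta> m n"
  shows "split_epi (\<beta> \<star> \<alpha>) l n"
proof -
  note a = split_epi_Hom[OF assms(1)] and b = split_epi_Hom[OF assms(2)]
  obtain s where s: "s \<in> Hom Simplex m l" "\<alpha> \<star> s = Ide Simplex m"
    using assms(1) unfolding split_epi_def by blast
  obtain t where t: "t \<in> Hom Simplex n m" "\<beta> \<star> t = Ide Simplex n"
    using assms(2) unfolding split_epi_def by blast
  have st: "s \<star> t \<in> Hom Simplex n l" by (rule Comp_Simplex_Hom[OF t(1) s(1)])
  have "\<beta> \<star> \<alpha> \<star> (s \<star> t) = \<beta> \<star> (\<alpha> \<star> (s \<star> t))"
    by (rule Simplex.Comp_assoc[OF st a b])
  also have "\<alpha> \<star> (s \<star> t) = t"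
    using Simplex.Comp_assoc[OF t(1) s(1) a] s(2) Simplex.Ide_Comp[OF t(1)] by simp
  finally show ?thesis
    using Comp_Simplex_Hom[OF a b] st t(2) unfolding split_epi_def by auto
qed

text \<open>Induction on the dimension of the source: a collapsed edge is split off by
  \<open>collapse_factor\<close>, and a map without collapsed edges is injective.\<close>

lemma epi_mono_exists:
  "\<alpha> \<in> Hom Simplex m n \<Longrightarrow> \<exists>k \<epsilon> \<iota>. split_epi \<epsilon> m k \<and> injective \<iota> k n \<and> \<alpha> = \<iota> \<star> \<epsilon>"
proof (induction m arbitrary: \<alpha> rule: less_induct)
  case (less m)
  show ?case
  proof (cases "\<exists>i<m. ap \<alpha> i = ap \<alpha> (Suc i)")
    case True
    then obtain i where i: "i < m" "ap \<alpha> i = ap \<alpha> (Suc i)" by blast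
    obtain \<beta> \<sigma> \<delta> where s: "\<sigma> \<in> Hom Simplex m (m - 1)" "\<beta> \<in> Hom Simplex (m - 1) n"
      "\<alpha> = \<beta> \<star> \<sigma>" "\<delta> \<in> Hom Simplex (m - 1) m" "\<sigma> \<star> \<delta> = Ide Simplex (m - 1)"
      by (rule collapse_factor[OF less.prems i])
    have \<sigma>: "split_epi \<sigma> m (m - 1)" using s unfolding split_epi_def by blast
    have "m - 1 < m" using i by simp
    then obtain k \<epsilon> \<iota> where k: "split_epi \<epsilon> (m - 1) k" "injective \<iota> k n" "\<beta> = \<iota> \<star> \<epsilon>"
      using less.IH s(2) by blast
    have "\<alpha> = \<iota> \<star> (\<epsilon> \<star> \<sigma>)"
      using Simplex.Comp_assoc[OF s(1) split_epi_Hom[OF k(1)] injective_Hom[OF k(2)]] s(3) k(3) by simp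
    then show ?thesis using split_epi_comp[OF \<sigma> k(1)] k(2) by blast
  next
    case False
    then have "injective \<alpha> m n" using injectiveI[OF less.prems] by blast
    then show ?thesis using Ide_split_epi Simplex.Comp_Ide[OF less.prems] by metis
  qed
qed

text \<open>A section \<open>s\<close> of \<open>\<epsilon>\<close> produces the comparison map
  \<open>\<epsilon>' \<star> s\<close>, which is injective. Doing this in both directions forces
  \<open>k = k'\<close>, and then the comparison is an injective endomorphism, hence the
  identity.\<close>

lemma epi_mono_unique:
  assumes e: "split_epi \<epsilon> m k" "split_epi \<epsilon>' m k'" and i: "injective \<iota> k n" "injective \<iota>' k' n"
    and eq: "\<iota> \<star> \<epsilon> = \<iota>' \<star> \<epsilon>'"
  shows "k = k'" "\<epsilon> = \<epsilon>'" "\<iota> = \<iota>'"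
proof -
  have main: "\<exists>\<phi>. injective \<phi> k k' \<and> \<iota> = \<iota>' \<star> \<phi>"
    if "split_epi \<epsilon> m k" "split_epi \<epsilon>' m k'" and i: "injective \<iota> k n" "injective \<iota>' k' n"
    and eq: "\<iota> \<star> \<epsilon> = \<iota>' \<star> \<epsilon>'" for \<epsilon> \<epsilon>' \<iota> \<iota>' k k'
  proof -
    obtain s where s: "s \<in> Hom Simplex k m" "\<epsilon> \<star> s = Ide Simplex k"
      using \<open>split_epi \<epsilon> m k\<close> unfolding split_epi_def by blast
    note \<epsilon> = split_epi_Hom[OF \<open>split_epi \<epsilon> m k\<close>] and \<epsilon>' = split_epi_Hom[OF \<open>split_epi \<epsilon>' m k'\<close>]
    note \<iota> = injective_Hom[OF i(1)] and \<iota>' = injective_Hom[OF i(2)]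
    note \<phi> = Comp_Simplex_Hom[OF s(1) \<epsilon>']
    have "\<iota> = \<iota> \<star> (\<epsilon> \<star> s)" using s(2) Simplex.Comp_Ide[OF \<iota>] by simp
    also have "\<dots> = \<iota>' \<star> (\<epsilon>' \<star> s)"
      using Simplex.Comp_assoc[OF s(1) \<epsilon> \<iota>] Simplex.Comp_assoc[OF s(1) \<epsilon>' \<iota>'] eq by simp
    finally have "\<iota> = \<iota>' \<star> (\<epsilon>' \<star> s)" .
    with injective_comp_right[OF \<phi> \<iota>'] i(1) show ?thesis by metis
  qed
  obtain \<phi> where \<phi>: "injective \<phi> k k'" "\<iota> = \<iota>' \<star> \<phi>" using main[OF e i eq] by blast
  obtain \<psi> where "injective \<psi> k' k" using main[OF e(2,1) i(2,1) eq[symmetric]] by blast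
  with \<phi>(1) show k: "k = k'" using injective_le by (metis le_antisym)
  then show \<iota>: "\<iota> = \<iota>'" using \<phi> injective_endo Simplex.Comp_Ide[OF injective_Hom[OF i(2)]] by simp
  show "\<epsilon> = \<epsilon>'"
  proof (rule simplex_map_eqI[OF split_epi_Hom[OF e(1)]])
    show "\<epsilon>' \<in> Hom Simplex m k" using split_epi_Hom[OF e(2)] k by simp
    fix j assume j: "j \<le> m"
    have "ap \<iota> (ap \<epsilon> j) = ap \<iota> (ap \<epsilon>' j)"
      using ap_Comp[OF split_epi_Hom[OF e(1)] injective_Hom[OF i(1)] j]
        ap_Comp[OF split_epi_Hom[OF e(2)] injective_Hom[OF i(2)] j] eq \<iota> by simp
    then show "ap \<epsilon> j = ap \<epsilon>' j"
      using i(1) ap_le[OF split_epi_Hom[OF e(1)] j] ap_le[OF split_epi_Hom[OF e(2)] j] k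
      unfolding injective_def inj_on_def by simp
  qed
qed

definition epi_mono :: "simplex_map \<Rightarrow> nat \<times> simplex_map \<times> simplex_map" where
  "epi_mono \<alpha> = (SOME z. split_epi (fst (snd z)) (Dom Simplex \<alpha>) (fst z) \<and>
     injective (snd (snd z)) (fst z) (Cod Simplex \<alpha>) \<and> \<alpha> = snd (snd z) \<star> fst (snd z))"

definition mid where "mid \<alpha> = fst (epi_mono \<alpha>)"
definition epi_part where "epi_part \<alpha> = fst (snd (epi_mono \<alpha>))"
definition mono_part where "mono_part \<alpha> = snd (snd (epi_mono \<alpha>))"

lemma epi_mono_parts:
  assumes "\<alpha> \<in> Hom Simplex m n"
  shows "split_epi (epi_part \<alpha>) m (mid \<alpha>)" "injective (mono_part \<alpha>) (mid \<alpha>) n"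
    "mono_part \<alpha> \<star> epi_part \<alpha> = \<alpha>" "mid \<alpha> \<le> m" "mid \<alpha> \<le> n"
    "epi_part \<alpha> \<in> Hom Simplex m (mid \<alpha>)" "mono_part \<alpha> \<in> Hom Simplex (mid \<alpha>) n"
proof -
  have d: "Dom Simplex \<alpha> = m" "Cod Simplex \<alpha> = n" using assms by (auto simp: Hom_def)
  obtain k \<epsilon> \<iota> where "split_epi \<epsilon> m k \<and> injective \<iota> k n \<and> \<alpha> = \<iota> \<star> \<epsilon>"
    using epi_mono_exists[OF assms] by blast
  then have ex: "\<exists>z. split_epi (fst (snd z)) m (fst z) \<and> injective (snd (snd z)) (fst z) n \<and>
      \<alpha> = snd (snd z) \<star> fst (snd z)"
    by (intro exI[of _ "(k, \<epsilon>, \<iota>)"]) simp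
  have *: "split_epi (epi_part \<alpha>) m (mid \<alpha>) \<and> injective (mono_part \<alpha>) (mid \<alpha>) n \<and>
    \<alpha> = mono_part \<alpha> \<star> epi_part \<alpha>"
    using someI_ex[OF ex] unfolding mid_def epi_part_def mono_part_def epi_mono_def d .
  then show "split_epi (epi_part \<alpha>) m (mid \<alpha>)" "injective (mono_part \<alpha>) (mid \<alpha>) n"
    "mono_part \<alpha> \<star> epi_part \<alpha> = \<alpha>" by simp_all
  then show "mid \<alpha> \<le> m" "mid \<alpha> \<le> n" "epi_part \<alpha> \<in> Hom Simplex m (mid \<alpha>)"
    "mono_part \<alpha> \<in> Hom Simplex (mid \<alpha>) n"
    using split_epi_le injective_le split_epi_Hom injective_Hom by blast+
qed

lemma epi_mono_eqI:
  assumes "split_epi \<epsilon> m k" "injective \<iota> k n" "\<iota> \<star> \<epsilon> = \<alpha>"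
  shows "mid \<alpha> = k" "epi_part \<alpha> = \<epsilon>" "mono_part \<alpha> = \<iota>"
proof -
  have "\<alpha> \<in> Hom Simplex m n"
    using Comp_Simplex_Hom[OF split_epi_Hom[OF assms(1)] injective_Hom[OF assms(2)]] assms(3) by simp
  note p = epi_mono_parts[OF this]
  from epi_mono_unique[OF p(1) assms(1) p(2) assms(2)] p(3) assms(3)
  show "mid \<alpha> = k" "epi_part \<alpha> = \<epsilon>" "mono_part \<alpha> = \<iota>" by simp_all
qed

lemma parts_precomp:
  assumes \<alpha>: "\<alpha> \<in> Hom Simplex m n" and \<gamma>: "\<gamma> \<in> Hom Simplex l m"
  defines "\<delta> \<equiv> epi_part \<alpha> \<star> \<gamma>"
  shows "\<delta> \<in> Hom Simplex l (mid \<alpha>)" "mid (\<alpha> \<star> \<gamma>) = mid \<delta>"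
    "epi_part (\<alpha> \<star> \<gamma>) = epi_part \<delta>" "mono_part (\<alpha> \<star> \<gamma>) = mono_part \<alpha> \<star> mono_part \<delta>"
proof -
  note a = epi_mono_parts[OF \<alpha>]
  show \<delta>: "\<delta> \<in> Hom Simplex l (mid \<alpha>)" unfolding \<delta>_def by (rule Comp_Simplex_Hom[OF \<gamma> a(6)])
  note d = epi_mono_parts[OF \<delta>]
  have "mono_part \<alpha> \<star> mono_part \<delta> \<star> epi_part \<delta> = \<alpha> \<star> \<gamma>"
    using Simplex.Comp_assoc[OF d(6,7) a(7)] d(3) Simplex.Comp_assoc[OF \<gamma> a(6,7)] a(3) by (simp add: \<delta>_def)
  from epi_mono_eqI[OF d(1) injective_comp[OF d(2) a(2)] this]
  show "mid (\<alpha> \<star> \<gamma>) = mid \<delta>" "epi_part (\<alpha> \<star> \<gamma>) = epi_part \<delta>"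
    "mono_part (\<alpha> \<star> \<gamma>) = mono_part \<alpha> \<star> mono_part \<delta>" by simp_all
qed

lemma parts_postcomp:
  assumes \<alpha>: "\<alpha> \<in> Hom Simplex m n" and \<gamma>: "\<gamma> \<in> Hom Simplex n l"
  defines "\<delta> \<equiv> \<gamma> \<star> mono_part \<alpha>"
  shows "\<delta> \<in> Hom Simplex (mid \<alpha>) l" "mid (\<gamma> \<star> \<alpha>) = mid \<delta>"
    "epi_part (\<gamma> \<star> \<alpha>) = epi_part \<delta> \<star> epi_part \<alpha>" "mono_part (\<gamma> \<star> \<alpha>) = mono_part \<delta>"
proof -
  note a = epi_mono_parts[OF \<alpha>]
  show \<delta>: "\<delta> \<in> Hom Simplex (mid \<alpha>) l" unfolding \<delta>_def by (rule Comp_Simplex_Hom[OF a(7) \<gamma>])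
  note d = epi_mono_parts[OF \<delta>]
  have "mono_part \<delta> \<star> (epi_part \<delta> \<star> epi_part \<alpha>) = \<gamma> \<star> \<alpha>"
    using Simplex.Comp_assoc[OF a(6) d(6,7)] d(3) Simplex.Comp_assoc[OF a(6,7) \<gamma>] a(3) by (simp add: \<delta>_def)
  from epi_mono_eqI[OF split_epi_comp[OF a(1) d(1)] d(2) this]
  show "mid (\<gamma> \<star> \<alpha>) = mid \<delta>" "epi_part (\<gamma> \<star> \<alpha>) = epi_part \<delta> \<star> epi_part \<alpha>"
    "mono_part (\<gamma> \<star> \<alpha>) = mono_part \<delta>" by simp_all
qed

lemma parts_injective: "injective \<alpha> m n \<Longrightarrow> mid \<alpha> = m \<and> epi_part \<alpha> = Ide Simplex m \<and> mono_part \<alpha> = \<alpha>"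
  using epi_mono_eqI[OF Ide_split_epi _ Simplex.Comp_Ide[OF injective_Hom]] by blast

lemma parts_split_epi: "split_epi \<alpha> m n \<Longrightarrow> mid \<alpha> = n \<and> epi_part \<alpha> = \<alpha> \<and> mono_part \<alpha> = Ide Simplex n"
  using epi_mono_eqI[OF _ Ide_injective Simplex.Ide_Comp[OF split_epi_Hom]] by blast

lemma finite_Hom_Simplex: "finite (Hom Simplex m n)"
proof -
  have "Hom Simplex m n \<subseteq> (\<lambda>\<phi>. (m, \<phi>, n)) ` ({0..m} \<rightarrow>\<^sub>E {0..n})" by (auto simp: Hom_Simplex)
  then show ?thesis by (rule finite_subset) (simp add: finite_PiE)
qed

lemma Dom_Cod_Simplex: "\<alpha> \<in> Hom Simplex m n \<Longrightarrow> Dom Simplex \<alpha> = m \<and> Cod Simplex \<alpha> = n"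
  by (simp add: Hom_def)

lemma injective_arrows_iff: "\<alpha> \<in> injective_arrows \<longleftrightarrow> injective \<alpha> (Dom Simplex \<alpha>) (Cod Simplex \<alpha>)"
  by (cases \<alpha>) (auto simp: injective_arrows_def injective_def ap_def Hom_def Simplex_def)

lemma Latching_Ob: "\<alpha> \<in> Ob (Latching n) \<longleftrightarrow> (\<exists>m<n. injective \<alpha> m n)"
proof -
  have "\<alpha> \<in> Ob (Latching n) \<longleftrightarrow> (\<exists>m. injective \<alpha> m n \<and> \<alpha> \<noteq> Ide Simplex n)"
    unfolding Latching_def Let_def by (auto simp: injective_arrows_iff dest: injective_Hom Dom_Cod_Simplex)
  also have "\<dots> \<longleftrightarrow> (\<exists>m<n. injective \<alpha> m n)"
  proof
    assume "\<exists>m. injective \<alpha> m n \<and> \<alpha> \<noteq> Ide Simplex n"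
    then obtain m where "injective \<alpha> m n" "\<alpha> \<noteq> Ide Simplex n" by blast
    then show "\<exists>m<n. injective \<alpha> m n" using injective_le[of \<alpha> m n] injective_endo[of \<alpha> n] by (metis le_neq_implies_less)
  next
    assume "\<exists>m<n. injective \<alpha> m n"
    then show "\<exists>m. injective \<alpha> m n \<and> \<alpha> \<noteq> Ide Simplex n"
      by (metis Dom_Cod_Simplex Ide_Simplex_Hom injective_Hom less_irrefl)
  qed
  finally show ?thesis .
qed

lemma Latching_Ar: "(\<alpha>, \<gamma>, \<beta>) \<in> Ar (Latching n) \<longleftrightarrow>
  (\<exists>l m. l < n \<and> m < n \<and> injective \<beta> m n \<and> injective \<gamma> l m \<and> \<alpha> = \<beta> \<star> \<gamma>)"
proof
  assume "(\<alpha>, \<gamma>, \<beta>) \<in> Ar (Latching n)"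
  then have *: "\<alpha> \<in> Ob (Latching n)" "\<beta> \<in> Ob (Latching n)" "\<gamma> \<in> injective_arrows"
    "\<gamma> \<in> Hom Simplex (Dom Simplex \<alpha>) (Dom Simplex \<beta>)" "\<beta> \<star> \<gamma> = \<alpha>"
    by (simp_all add: Latching_def Let_def)
  obtain l m where "l < n" "injective \<alpha> l n" "m < n" "injective \<beta> m n" using *(1,2) unfolding Latching_Ob by blast
  moreover have "Dom Simplex \<alpha> = l" "Dom Simplex \<beta> = m" using calculation injective_Hom Dom_Cod_Simplex by blast+
  moreover have "injective \<gamma> l m" using *(3,4) calculation(5,6) Dom_Cod_Simplex unfolding injective_arrows_iff by metis
  ultimately show "\<exists>l m. l < n \<and> m < n \<and> injective \<beta> m n \<and> injective \<gamma> l m \<and> \<alpha> = \<beta> \<star> \<gamma>" using *(5) by blast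
next
  assume "\<exists>l m. l < n \<and> m < n \<and> injective \<beta> m n \<and> injective \<gamma> l m \<and> \<alpha> = \<beta> \<star> \<gamma>"
  then obtain l m where *: "l < n" "m < n" "injective \<beta> m n" "injective \<gamma> l m" "\<alpha> = \<beta> \<star> \<gamma>" by blast
  have a: "injective \<alpha> l n" using injective_comp[OF *(4,3)] *(5) by simp
  have "Dom Simplex \<alpha> = l" "Dom Simplex \<beta> = m" "Dom Simplex \<gamma> = l" "Cod Simplex \<gamma> = m"
    using a * injective_Hom Dom_Cod_Simplex by blast+
  moreover have "\<alpha> \<in> Ob (Latching n)" "\<beta> \<in> Ob (Latching n)" using a * unfolding Latching_Ob by blast+
  ultimately show "(\<alpha>, \<gamma>, \<beta>) \<in> Ar (Latching n)"
    using a * injective_Hom[OF *(4)] by (simp add: Latching_def Let_def injective_arrows_iff)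
qed

lemma finite_Latching: "finite (Ob (Latching n))" "finite (Ar (Latching n))"
proof -
  have "Ob (Latching n) \<subseteq> (\<Union>m<n. Hom Simplex m n)" 
  proof
    fix \<alpha> assume "\<alpha> \<in> Ob (Latching n)"
    then obtain m where "m < n" "injective \<alpha> m n" unfolding Latching_Ob by blast
    then show "\<alpha> \<in> (\<Union>m<n. Hom Simplex m n)" using injective_Hom by blast
  qed
  then show ob: "finite (Ob (Latching n))" by (rule finite_subset) (simp add: finite_Hom_Simplex)
  have "Ar (Latching n) \<subseteq> Ob (Latching n) \<times> (\<Union>m<n. \<Union>l<n. Hom Simplex l m) \<times> Ob (Latching n)"
  proof
    fix u assume "u \<in> Ar (Latching n)"
    then obtain \<alpha> \<gamma> \<beta> where u: "u = (\<alpha>, \<gamma>, \<beta>)" "(\<alpha>, \<gamma>, \<beta>) \<in> Ar (Latching n)" by (metis prod_cases3)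
    then have "\<alpha> \<in> Ob (Latching n)" "\<beta> \<in> Ob (Latching n)" by (simp_all add: Latching_def Let_def)
    then show "u \<in> Ob (Latching n) \<times> (\<Union>m<n. \<Union>l<n. Hom Simplex l m) \<times> Ob (Latching n)"
      using u injective_Hom unfolding Latching_Ar by blast
  qed
  then show "finite (Ar (Latching n))"
    by (rule finite_subset) (simp add: finite_Hom_Simplex ob)
qed

lemma Latching_Dom_Cod [simp]: "Dom (Latching n) (\<alpha>, \<gamma>, \<beta>) = \<alpha>" "Cod (Latching n) (\<alpha>, \<gamma>, \<beta>) = \<beta>"
  by (simp_all add: Latching_def Let_def)

section \<open>Reedy cofibrant cosimplicial objects\<close>

context model_category begin

text \<open>Cosimplicial objects truncated below degree \<open>N\<close>. Higher degrees are left
  unconstrained, so that a stage of an inductive construction is an ordinary total record.\<close>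

definition functor_upto :: "nat \<Rightarrow> ('o, 'm) cosimp \<Rightarrow> bool" where
  "functor_upto N A \<longleftrightarrow> (\<forall>n<N. onOb A n \<in> Ob M) \<and>
    (\<forall>m<N. \<forall>n<N. \<forall>\<alpha>\<in>Hom Simplex m n. onAr A \<alpha> \<in> Hom M (onOb A m) (onOb A n)) \<and>
    (\<forall>n<N. onAr A (Ide Simplex n) = Ide M (onOb A n)) \<and>
    (\<forall>l<N. \<forall>m<N. \<forall>n<N. \<forall>\<alpha>\<in>Hom Simplex l m. \<forall>\<beta>\<in>Hom Simplex m n.
      onAr A (\<beta> \<star> \<alpha>) = onAr A \<beta> \<odot> onAr A \<alpha>)"

lemma functor_uptoD:
  assumes "functor_upto N A"
  shows "n < N \<Longrightarrow> onOb A n \<in> Ob M"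
    "\<lbrakk>\<alpha> \<in> Hom Simplex m n; m < N; n < N\<rbrakk> \<Longrightarrow> onAr A \<alpha> \<in> Hom M (onOb A m) (onOb A n)"
    "n < N \<Longrightarrow> onAr A (Ide Simplex n) = Ide M (onOb A n)"
    "\<lbrakk>\<alpha> \<in> Hom Simplex l m; \<beta> \<in> Hom Simplex m n; l < N; m < N; n < N\<rbrakk> \<Longrightarrow>
      onAr A (\<beta> \<star> \<alpha>) = onAr A \<beta> \<odot> onAr A \<alpha>"
  using assms unfolding functor_upto_def by blast+

lemma functor_upto_iff: "is_functor Simplex M A \<longleftrightarrow> (\<forall>N. functor_upto N A)"
proof
  assume A: "is_functor Simplex M A"
  show "\<forall>N. functor_upto N A"
    unfolding functor_upto_def
  proof (intro allI conjI impI ballI)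
    fix m n \<alpha> assume "\<alpha> \<in> Hom Simplex m n"
    then show "onAr A \<alpha> \<in> Hom M (onOb A m) (onOb A n)"
      using A unfolding is_functor_def Hom_def[of Simplex] by blast
    fix l \<beta> assume "\<beta> \<in> Hom Simplex n l"
    with \<open>\<alpha> \<in> Hom Simplex m n\<close> show "onAr A (\<beta> \<star> \<alpha>) = onAr A \<beta> \<odot> onAr A \<alpha>"
      using A unfolding is_functor_def Hom_def[of Simplex] by simp
  qed (use A in \<open>auto simp: is_functor_def\<close>)
next
  assume A: "\<forall>N. functor_upto N A"
  show "is_functor Simplex M A"
    unfolding is_functor_def
  proof (intro conjI ballI impI)
    fix n show "onOb A n \<in> Ob M" "onAr A (Ide Simplex n) = Ide M (onOb A n)"
      using A functor_uptoD(1,3)[of "Suc n" A n] by simp_all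
  next
    fix \<alpha> assume a: "\<alpha> \<in> Ar Simplex"
    then have aH: "\<alpha> \<in> Hom Simplex (Dom Simplex \<alpha>) (Cod Simplex \<alpha>)" by (simp add: Hom_def)
    show "onAr A \<alpha> \<in> Hom M (onOb A (Dom Simplex \<alpha>)) (onOb A (Cod Simplex \<alpha>))"
      using functor_uptoD(2)[OF A[rule_format, of "Suc (max (Dom Simplex \<alpha>) (Cod Simplex \<alpha>))"] aH] by simp
    fix \<beta> assume b: "\<beta> \<in> Ar Simplex" "Cod Simplex \<alpha> = Dom Simplex \<beta>"
    then have bH: "\<beta> \<in> Hom Simplex (Cod Simplex \<alpha>) (Cod Simplex \<beta>)" by (simp add: Hom_def)
    show "onAr A (\<beta> \<star> \<alpha>) = onAr A \<beta> \<odot> onAr A \<alpha>"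
      using functor_uptoD(4)[OF A[rule_format, of "Suc (Dom Simplex \<alpha> + Cod Simplex \<alpha> + Cod Simplex \<beta>)"] aH bH]
      by simp
  qed
qed

lemma functorD:
  assumes "is_functor Simplex M A"
  shows "onOb A n \<in> Ob M"
    "\<alpha> \<in> Hom Simplex m n \<Longrightarrow> onAr A \<alpha> \<in> Hom M (onOb A m) (onOb A n)"
    "onAr A (Ide Simplex n) = Ide M (onOb A n)"
    "\<lbrakk>\<alpha> \<in> Hom Simplex l m; \<beta> \<in> Hom Simplex m n\<rbrakk> \<Longrightarrow> onAr A (\<beta> \<star> \<alpha>) = onAr A \<beta> \<odot> onAr A \<alpha>"
proof -
  have *: "functor_upto N A" for N using assms functor_upto_iff by blast
  show "onOb A n \<in> Ob M" "onAr A (Ide Simplex n) = Ide M (onOb A n)"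
    using functor_uptoD(1,3)[OF *[of "Suc n"]] by simp_all
  show "\<alpha> \<in> Hom Simplex m n \<Longrightarrow> onAr A \<alpha> \<in> Hom M (onOb A m) (onOb A n)"
    using functor_uptoD(2)[OF *[of "Suc (m + n)"]] by simp
  show "\<lbrakk>\<alpha> \<in> Hom Simplex l m; \<beta> \<in> Hom Simplex m n\<rbrakk> \<Longrightarrow> onAr A (\<beta> \<star> \<alpha>) = onAr A \<beta> \<odot> onAr A \<alpha>"
    using functor_uptoD(4)[OF *[of "Suc (l + m + n)"]] by simp
qed

text \<open>The left lifting property of the \<open>n\<close>-th latching map against \<open>p\<close>, without the latching object.\<close>

definition extends_boundary :: "('o, 'm) cosimp \<Rightarrow> nat \<Rightarrow> bool" where
  "extends_boundary A n \<longleftrightarrow> (\<forall>p\<in>tfib. \<forall>v\<in>Hom M (onOb A n) (Cod M p). \<forall>y.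
     (\<forall>m<n. \<forall>\<theta>\<in>Hom Simplex m n. y \<theta> \<in> Hom M (onOb A m) (Dom M p) \<and> p \<odot> y \<theta> = v \<odot> onAr A \<theta> \<and>
        (\<forall>l<n. \<forall>\<gamma>\<in>Hom Simplex l m. y \<theta> \<odot> onAr A \<gamma> = y (\<theta> \<star> \<gamma>))) \<longrightarrow>
     (\<exists>z\<in>Hom M (onOb A n) (Dom M p). p \<odot> z = v \<and> (\<forall>m<n. \<forall>\<theta>\<in>Hom Simplex m n. z \<odot> onAr A \<theta> = y \<theta>)))"

text \<open>The latching object exists as a finite colimit over the injections into
  \<open>[n]\<close>. The family \<open>y\<close> on injections is a map out of it, and the lift
  along the latching map restricts to \<open>y \<theta>\<close> for arbitrary
  \<open>\<theta>\<close> by the epi-mono factorization.\<close>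

lemma Reedy_cofibrant_extends:
  assumes "Reedy_cofibrant M A"
  shows "extends_boundary A n"
proof -
  have A: "is_functor Simplex M A" using assms by (simp add: Reedy_cofibrant_def)
  note F = functorD[OF A]
  define s :: "simplex_map \<times> simplex_map \<times> simplex_map \<Rightarrow> simplex_map" where "s = (\<lambda>(\<alpha>, \<gamma>, \<beta>). \<beta>)"
  define t :: "simplex_map \<times> simplex_map \<times> simplex_map \<Rightarrow> simplex_map" where "t = (\<lambda>(\<alpha>, \<gamma>, \<beta>). \<alpha>)"
  define a where "a = (\<lambda>(\<alpha> :: simplex_map, \<gamma>, \<beta> :: simplex_map). onAr A \<gamma>)"
  define X where "X \<alpha> = onOb A (Dom Simplex \<alpha>)" for \<alpha>
  have st: "s e \<in> Ob (Latching n)" "t e \<in> Ob (Latching n)" "a e \<in> Hom M (X (t e)) (X (s e))"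
    if e: "e \<in> Ar (Latching n)" for e
  proof -
    obtain \<alpha> \<gamma> \<beta> where abc: "e = (\<alpha>, \<gamma>, \<beta>)" by (metis prod_cases3)
    then obtain l m where *: "l < n" "m < n" "injective \<beta> m n" "injective \<gamma> l m" "\<alpha> = \<beta> \<star> \<gamma>"
      using e unfolding abc Latching_Ar by blast
    have al: "injective \<alpha> l n" using injective_comp[OF *(4,3)] *(5) by simp
    show "s e \<in> Ob (Latching n)" "t e \<in> Ob (Latching n)"
      unfolding abc s_def t_def Latching_Ob using * al by auto
    have "Dom Simplex \<alpha> = l" "Dom Simplex \<beta> = m" using al * injective_Hom Dom_Cod_Simplex by blast+
    then show "a e \<in> Hom M (X (t e)) (X (s e))"
      unfolding abc a_def s_def t_def X_def using F(2)[OF injective_Hom[OF *(4)]] by simp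
  qed
  have "\<exists>W w. W \<in> Ob M \<and> (\<forall>i\<in>Ob (Latching n). w i \<in> Hom M (X i) W) \<and>
    (\<forall>e\<in>Ar (Latching n). w (s e) \<odot> a e = w (t e) \<odot> Ide M (X (t e))) \<and>
    (\<forall>V v. V \<in> Ob M \<longrightarrow> (\<forall>i\<in>Ob (Latching n). v i \<in> Hom M (X i) V) \<longrightarrow>
      (\<forall>e\<in>Ar (Latching n). v (s e) \<odot> a e = v (t e) \<odot> Ide M (X (t e))) \<longrightarrow>
      (\<exists>!h. h \<in> Hom M W V \<and> (\<forall>i\<in>Ob (Latching n). h \<odot> w i = v i)))"
    by (rule equation_colimit[where Y = "\<lambda>e. X (t e)", OF finite_Latching])
      (use st F(1) in \<open>auto simp: X_def intro!: Ide_Hom\<close>)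
  then obtain L \<iota> where L: "L \<in> Ob M" and \<iota>0: "\<forall>i\<in>Ob (Latching n). \<iota> i \<in> Hom M (X i) L"
    and \<iota>1: "\<forall>e\<in>Ar (Latching n). \<iota> (s e) \<odot> a e = \<iota> (t e) \<odot> Ide M (X (t e))"
    and U: "\<forall>V v. V \<in> Ob M \<longrightarrow> (\<forall>i\<in>Ob (Latching n). v i \<in> Hom M (X i) V) \<longrightarrow>
      (\<forall>e\<in>Ar (Latching n). v (s e) \<odot> a e = v (t e) \<odot> Ide M (X (t e))) \<longrightarrow>
      (\<exists>!h. h \<in> Hom M L V \<and> (\<forall>i\<in>Ob (Latching n). h \<odot> \<iota> i = v i))"
    by (elim exE conjE) (rule that)
  have cocone: "is_cocone (Latching n) M (latching_diagram A) V v \<longleftrightarrow> V \<in> Ob M \<and>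
    (\<forall>i\<in>Ob (Latching n). v i \<in> Hom M (X i) V) \<and>
    (\<forall>e\<in>Ar (Latching n). v (s e) \<odot> a e = v (t e) \<odot> Ide M (X (t e)))" for V v
  proof -
    have "v (Cod (Latching n) e) \<odot> onAr (latching_diagram A) e = v (Dom (Latching n) e) \<longleftrightarrow>
      v (s e) \<odot> a e = v (t e) \<odot> Ide M (X (t e))"
      if e: "e \<in> Ar (Latching n)" and v: "\<forall>i\<in>Ob (Latching n). v i \<in> Hom M (X i) V" for e
    proof -
      obtain \<alpha> \<gamma> \<beta> where abc: "e = (\<alpha>, \<gamma>, \<beta>)" by (metis prod_cases3)
      have "v (t e) \<odot> Ide M (X (t e)) = v (t e)" using Comp_Ide v st(2)[OF e] by blast
      then show ?thesis by (simp add: abc s_def t_def a_def latching_diagram_def)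
    qed
    then show ?thesis
      unfolding is_cocone_def by (auto simp: latching_diagram_def X_def)
  qed
  have col: "is_colimit (Latching n) M (latching_diagram A) L \<iota>"
    unfolding is_colimit_def cocone using L \<iota>0 \<iota>1 U by blast
  have inj_Ob: "\<theta> \<in> Ob (Latching n)" if "injective \<theta> m n" "m < n" for \<theta> m
    using that unfolding Latching_Ob by blast
  have univ: "\<exists>!h. h \<in> Hom M L V \<and> (\<forall>i\<in>Ob (Latching n). h \<odot> \<iota> i = v i)"
    if V: "V \<in> Ob M" and v: "\<And>m \<theta>. \<lbrakk>m < n; injective \<theta> m n\<rbrakk> \<Longrightarrow> v \<theta> \<in> Hom M (onOb A m) V"
      "\<And>l m \<theta> \<gamma>. \<lbrakk>m < n; injective \<theta> m n; l < n; injective \<gamma> l m\<rbrakk> \<Longrightarrow> v \<theta> \<odot> onAr A \<gamma> = v (\<theta> \<star> \<gamma>)"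
    for V v
  proof (rule U[rule_format, OF V])
    show vi: "v i \<in> Hom M (X i) V" if i: "i \<in> Ob (Latching n)" for i
    proof -
      obtain m where m: "m < n" "injective i m n" using i unfolding Latching_Ob by blast
      then show ?thesis using v(1)[OF m] Dom_Cod_Simplex[OF injective_Hom[OF m(2)]] by (simp add: X_def)
    qed
    show "v (s e) \<odot> a e = v (t e) \<odot> Ide M (X (t e))" if e: "e \<in> Ar (Latching n)" for e
    proof -
      obtain \<alpha> \<gamma> \<beta> where abc: "e = (\<alpha>, \<gamma>, \<beta>)" by (metis prod_cases3)
      then obtain l m where *: "l < n" "m < n" "injective \<beta> m n" "injective \<gamma> l m" "\<alpha> = \<beta> \<star> \<gamma>"
        using e unfolding abc Latching_Ar by blast
      show ?thesis
        using v(2)[OF *(2,3,1,4)] *(5) Comp_Ide[OF vi[OF st(2)[OF e]]] by (simp add: abc s_def t_def a_def)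
    qed
  qed
  have "\<exists>!h. h \<in> Hom M L (onOb A n) \<and> (\<forall>\<alpha>\<in>Ob (Latching n). h \<odot> \<iota> \<alpha> = onAr A \<alpha>)"
    by (rule univ[OF F(1)]) (simp_all add: F(2)[OF injective_Hom] F(4)[OF injective_Hom injective_Hom])
  then obtain h where h: "h \<in> Hom M L (onOb A n)" "\<forall>\<alpha>\<in>Ob (Latching n). h \<odot> \<iota> \<alpha> = onAr A \<alpha>" by blast
  have "h \<in> cof M" using assms col h unfolding Reedy_cofibrant_def by blast
  note lift_h = lift_cof[OF this]
  have h\<iota>: "h \<odot> \<iota> \<theta> = onAr A \<theta>" "\<iota> \<theta> \<in> Hom M (onOb A m) L" if "m < n" "injective \<theta> m n" for m \<theta>
    using h(2) \<iota>0 inj_Ob[OF that(2,1)] Dom_Cod_Simplex[OF injective_Hom[OF that(2)]] by (auto simp: X_def)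
  show ?thesis
    unfolding extends_boundary_def
  proof (intro ballI allI impI)
    fix p v y
    assume p: "p \<in> tfib" and v: "v \<in> Hom M (onOb A n) (Cod M p)"
      and "\<forall>m<n. \<forall>\<theta>\<in>Hom Simplex m n. y \<theta> \<in> Hom M (onOb A m) (Dom M p) \<and> p \<odot> y \<theta> = v \<odot> onAr A \<theta> \<and>
        (\<forall>l<n. \<forall>\<gamma>\<in>Hom Simplex l m. y \<theta> \<odot> onAr A \<gamma> = y (\<theta> \<star> \<gamma>))"
    then have y: "\<And>m \<theta>. \<lbrakk>m < n; \<theta> \<in> Hom Simplex m n\<rbrakk> \<Longrightarrow> y \<theta> \<in> Hom M (onOb A m) (Dom M p)"
      "\<And>m \<theta>. \<lbrakk>m < n; \<theta> \<in> Hom Simplex m n\<rbrakk> \<Longrightarrow> p \<odot> y \<theta> = v \<odot> onAr A \<theta>"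
      "\<And>l m \<theta> \<gamma>. \<lbrakk>m < n; \<theta> \<in> Hom Simplex m n; l < n; \<gamma> \<in> Hom Simplex l m\<rbrakk> \<Longrightarrow> y \<theta> \<odot> onAr A \<gamma> = y (\<theta> \<star> \<gamma>)"
      by blast+
    have pH: "p \<in> Hom M (Dom M p) (Cod M p)" using p weq_Ar by (auto simp: Hom_def)
    have "\<exists>!k. k \<in> Hom M L (Dom M p) \<and> (\<forall>i\<in>Ob (Latching n). k \<odot> \<iota> i = y i)"
      by (rule univ[OF Hom_Ob(1)[OF pH]]) (use y(1,3) injective_Hom in blast)+
    then obtain u where u: "u \<in> Hom M L (Dom M p)" "\<forall>i\<in>Ob (Latching n). u \<odot> \<iota> i = y i" by blast
    have pu: "p \<odot> u \<in> Hom M L (Cod M p)" and vh: "v \<odot> h \<in> Hom M L (Cod M p)"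
      using Comp_Hom u pH h v by blast+
    have "\<exists>!k. k \<in> Hom M L (Cod M p) \<and> (\<forall>i\<in>Ob (Latching n). k \<odot> \<iota> i = p \<odot> y i)"
    proof (rule univ[OF Hom_Ob(2)[OF pH]])
      show "p \<odot> y \<theta> \<in> Hom M (onOb A m) (Cod M p)" if "m < n" "injective \<theta> m n" for m \<theta>
        using Comp_Hom[OF y(1)[OF that(1) injective_Hom[OF that(2)]] pH] .
      show "p \<odot> y \<theta> \<odot> onAr A \<gamma> = p \<odot> y (\<theta> \<star> \<gamma>)"
        if "m < n" "injective \<theta> m n" "l < n" "injective \<gamma> l m" for l m \<theta> \<gamma>
        using Comp_assoc[OF F(2)[OF injective_Hom[OF that(4)]] y(1)[OF that(1) injective_Hom[OF that(2)]] pH]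
          y(3)[OF that(1) injective_Hom[OF that(2)] that(3) injective_Hom[OF that(4)]] by simp
    qed
    moreover have "\<forall>i\<in>Ob (Latching n). p \<odot> u \<odot> \<iota> i = p \<odot> y i"
    proof
      fix i assume i: "i \<in> Ob (Latching n)"
      show "p \<odot> u \<odot> \<iota> i = p \<odot> y i" using Comp_assoc[OF bspec[OF \<iota>0 i] u(1) pH] u(2) i by simp
    qed
    moreover have "\<forall>i\<in>Ob (Latching n). v \<odot> h \<odot> \<iota> i = p \<odot> y i"
    proof
      fix i assume i: "i \<in> Ob (Latching n)"
      then obtain m where m: "m < n" "injective i m n" unfolding Latching_Ob by blast
      show "v \<odot> h \<odot> \<iota> i = p \<odot> y i"
        using Comp_assoc[OF bspec[OF \<iota>0 i] h(1) v] h(2) i y(2)[OF m(1) injective_Hom[OF m(2)]] by simp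
    qed
    ultimately have "p \<odot> u = v \<odot> h" using pu vh by blast
    then obtain z where z: "z \<in> Hom M (onOb A n) (Dom M p)" "z \<odot> h = u" "p \<odot> z = v"
      using lift[OF lift_h[OF p] h(1) pH u(1) v] by blast
    have "z \<odot> onAr A \<theta> = y \<theta>" if \<theta>: "m < n" "\<theta> \<in> Hom Simplex m n" for m \<theta>
    proof -
      note e = epi_mono_parts[OF \<theta>(2)]
      have k: "mid \<theta> < n" using e(4) \<theta>(1) by simp
      note hm = h\<iota>[OF k e(2)]
      have "z \<odot> onAr A (mono_part \<theta>) = y (mono_part \<theta>)"
        using Comp_assoc[OF hm(2) h(1) z(1)] hm(1) z(2) u(2) inj_Ob[OF e(2) k] by simp
      then have "z \<odot> onAr A \<theta> = y (mono_part \<theta>) \<odot> onAr A (epi_part \<theta>)"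
        using F(4)[OF e(6,7)] e(3) Comp_assoc[OF F(2)[OF e(6)] F(2)[OF e(7)] z(1)] by simp
      then show ?thesis using y(3)[OF k e(7) \<theta>(1) e(6)] e(3) by simp
    qed
    with z show "\<exists>z\<in>Hom M (onOb A n) (Dom M p). p \<odot> z = v \<and> (\<forall>m<n. \<forall>\<theta>\<in>Hom Simplex m n. z \<odot> onAr A \<theta> = y \<theta>)"
      by blast
  qed
qed

lemma Reedy_cofibrantI:
  assumes A: "is_functor Simplex M A" and ext: "\<And>n. extends_boundary A n"
  shows "Reedy_cofibrant M A"
  unfolding Reedy_cofibrant_def
proof (intro conjI A allI impI)
  note F = functorD[OF A]
  fix n L \<iota> h
  assume col: "is_colimit (Latching n) M (latching_diagram A) L \<iota>" and h: "h \<in> Hom M L (onOb A n)"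
    and h\<iota>: "\<forall>\<alpha>\<in>Ob (Latching n). h \<odot> \<iota> \<alpha> = onAr A \<alpha>"
  have inj_Ob: "\<theta> \<in> Ob (Latching n)" if "injective \<theta> m n" "m < n" for \<theta> m
    using that unfolding Latching_Ob by blast
  have cocone: "is_cocone (Latching n) M (latching_diagram A) L \<iota>" using col by (simp add: is_colimit_def)
  have \<iota>: "\<iota> \<theta> \<in> Hom M (onOb A m) L" if "injective \<theta> m n" "m < n" for \<theta> m
    using cocone inj_Ob[OF that] Dom_Cod_Simplex[OF injective_Hom[OF that(1)]]
    unfolding is_cocone_def by (auto simp: latching_diagram_def)
  have \<iota>': "\<iota> \<theta> \<odot> onAr A \<gamma> = \<iota> (\<theta> \<star> \<gamma>)" if "injective \<theta> m n" "m < n" "injective \<gamma> l m" for \<theta> m l \<gamma>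
  proof -
    have "l < n" using injective_le[OF that(3)] that(2) by simp
    then have ar: "(\<theta> \<star> \<gamma>, \<gamma>, \<theta>) \<in> Ar (Latching n)" using that unfolding Latching_Ar by blast
    then show ?thesis using cocone unfolding is_cocone_def by (force simp: latching_diagram_def)
  qed
  have "has_lifting M h p" if p: "p \<in> tfib" for p
  proof (rule has_liftingI[OF h])
    show pH: "p \<in> Hom M (Dom M p) (Cod M p)" using p weq_Ar by (auto simp: Hom_def)
    fix u v assume u: "u \<in> Hom M L (Dom M p)" and v: "v \<in> Hom M (onOb A n) (Cod M p)" and uv: "p \<odot> u = v \<odot> h"
    \<comment> \<open>A map on the latching object knows only injections; it is extended to every
      \<open>\<theta>\<close> through the epimorphic part.\<close>
    define y where "y \<theta> = u \<odot> \<iota> (mono_part \<theta>) \<odot> onAr A (epi_part \<theta>)" for \<theta>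
    have um: "u \<odot> \<iota> (mono_part \<theta>) \<in> Hom M (onOb A (mid \<theta>)) (Dom M p)" "mid \<theta> < n"
      if \<theta>: "m < n" "\<theta> \<in> Hom Simplex m n" for m \<theta>
    proof -
      note e = epi_mono_parts[OF \<theta>(2)]
      show k: "mid \<theta> < n" using e(4) \<theta>(1) by simp
      show "u \<odot> \<iota> (mono_part \<theta>) \<in> Hom M (onOb A (mid \<theta>)) (Dom M p)" by (rule Comp_Hom[OF \<iota>[OF e(2) k] u])
    qed
    have "\<exists>z\<in>Hom M (onOb A n) (Dom M p). p \<odot> z = v \<and> (\<forall>m<n. \<forall>\<theta>\<in>Hom Simplex m n. z \<odot> onAr A \<theta> = y \<theta>)"
    proof (rule ext[unfolded extends_boundary_def, rule_format, OF p v], intro conjI allI impI ballI)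
      fix m \<theta> assume \<theta>: "m < n" "\<theta> \<in> Hom Simplex m n"
      note e = epi_mono_parts[OF \<theta>(2)] and k = um[OF \<theta>]
      note \<iota>m = \<iota>[OF e(2) k(2)]
      show "y \<theta> \<in> Hom M (onOb A m) (Dom M p)" unfolding y_def by (rule Comp_Hom[OF F(2)[OF e(6)] k(1)])
      have "p \<odot> y \<theta> = p \<odot> (u \<odot> \<iota> (mono_part \<theta>)) \<odot> onAr A (epi_part \<theta>)"
        unfolding y_def using Comp_assoc[OF F(2)[OF e(6)] k(1) pH] by simp
      also have "p \<odot> (u \<odot> \<iota> (mono_part \<theta>)) = v \<odot> onAr A (mono_part \<theta>)"
        using Comp_assoc[OF \<iota>m u pH] Comp_assoc[OF \<iota>m h v] uv h\<iota> inj_Ob[OF e(2) k(2)] by simp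
      also have "v \<odot> onAr A (mono_part \<theta>) \<odot> onAr A (epi_part \<theta>) = v \<odot> onAr A \<theta>"
        using Comp_assoc[OF F(2)[OF e(6)] F(2)[OF e(7)] v] F(4)[OF e(6,7)] e(3) by simp
      finally show "p \<odot> y \<theta> = v \<odot> onAr A \<theta>" .
      fix l \<gamma> assume \<gamma>: "l < n" "\<gamma> \<in> Hom Simplex l m"
      note pr = parts_precomp[OF \<theta>(2) \<gamma>(2)]
      let ?\<delta> = "epi_part \<theta> \<star> \<gamma>"
      note d = epi_mono_parts[OF pr(1)]
      have "y \<theta> \<odot> onAr A \<gamma> = u \<odot> \<iota> (mono_part \<theta>) \<odot> onAr A ?\<delta>"
        unfolding y_def using Comp_assoc[OF F(2)[OF \<gamma>(2)] F(2)[OF e(6)] k(1)] F(4)[OF \<gamma>(2) e(6)] by simp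
      also have "\<dots> = u \<odot> \<iota> (mono_part \<theta>) \<odot> (onAr A (mono_part ?\<delta>) \<odot> onAr A (epi_part ?\<delta>))"
        using F(4)[OF d(6,7)] d(3) by simp
      also have "\<dots> = u \<odot> (\<iota> (mono_part \<theta>) \<odot> onAr A (mono_part ?\<delta>)) \<odot> onAr A (epi_part ?\<delta>)"
        using Comp_assoc[OF F(2)[OF d(6)] F(2)[OF d(7)] k(1)] Comp_assoc[OF F(2)[OF d(7)] \<iota>m u] by simp
      also have "\<dots> = y (\<theta> \<star> \<gamma>)"
        unfolding \<iota>'[OF e(2) k(2) d(2)] y_def pr(3,4) ..
      finally show "y \<theta> \<odot> onAr A \<gamma> = y (\<theta> \<star> \<gamma>)" .
    qed
    then obtain z where z: "z \<in> Hom M (onOb A n) (Dom M p)" "p \<odot> z = v"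
      "\<And>m \<theta>. \<lbrakk>m < n; \<theta> \<in> Hom Simplex m n\<rbrakk> \<Longrightarrow> z \<odot> onAr A \<theta> = y \<theta>" by blast
    have zh: "z \<odot> h \<odot> \<iota> i = u \<odot> \<iota> i" if i: "i \<in> Ob (Latching n)" for i
    proof -
      obtain m where m: "m < n" "injective i m n" using i unfolding Latching_Ob by blast
      note \<iota>i = \<iota>[OF m(2,1)]
      have "u \<odot> \<iota> i \<odot> Ide M (onOb A m) = u \<odot> \<iota> i" by (rule Comp_Ide[OF Comp_Hom[OF \<iota>i u]])
      then have "y i = u \<odot> \<iota> i" using parts_injective[OF m(2)] F(3) by (simp add: y_def)
      then show ?thesis
        using Comp_assoc[OF \<iota>i h z(1)] h\<iota> i z(3)[OF m(1) injective_Hom[OF m(2)]] by simp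
    qed
    have zhH: "z \<odot> h \<in> Hom M L (Dom M p)" by (rule Comp_Hom[OF h z(1)])
    have "is_cocone (Latching n) M (latching_diagram A) (Dom M p) (\<lambda>i. u \<odot> \<iota> i)"
      unfolding is_cocone_def
    proof (intro conjI ballI)
      show "Dom M p \<in> Ob M" using Hom_Ob(1)[OF pH] .
      show "u \<odot> \<iota> j \<in> Hom M (onOb (latching_diagram A) j) (Dom M p)" if "j \<in> Ob (Latching n)" for j
        using cocone that Comp_Hom[OF _ u] unfolding is_cocone_def by blast
      fix e assume e: "e \<in> Ar (Latching n)"
      obtain \<alpha> \<gamma> \<beta> where abc: "e = (\<alpha>, \<gamma>, \<beta>)" by (metis prod_cases3)
      then obtain l m where *: "l < n" "m < n" "injective \<beta> m n" "injective \<gamma> l m" "\<alpha> = \<beta> \<star> \<gamma>"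
        using e unfolding abc Latching_Ar by blast
      show "u \<odot> \<iota> (Cod (Latching n) e) \<odot> onAr (latching_diagram A) e = u \<odot> \<iota> (Dom (Latching n) e)"
        using Comp_assoc[OF F(2)[OF injective_Hom[OF *(4)]] \<iota>[OF *(3,2)] u] \<iota>'[OF *(3,2,4)] *(5)
        by (simp add: abc latching_diagram_def)
    qed
    then have "\<exists>!k. k \<in> Hom M L (Dom M p) \<and> (\<forall>j\<in>Ob (Latching n). k \<odot> \<iota> j = u \<odot> \<iota> j)"
      using col unfolding is_colimit_def by blast
    then have "z \<odot> h = u" using zh zhH u by blast
    then show "\<exists>z. z \<in> Hom M (onOb A n) (Dom M p) \<and> z \<odot> h = u \<and> p \<odot> z = v" using z by blast
  qed
  then show "h \<in> cof M" using cof_iff h by (auto simp: Hom_def)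
qed

lemma simplicial_set_map_complex:
  assumes "is_functor Simplex M A"
  shows "simplicial_set (map_complex M A R)"
proof -
  note F = functorD[OF assms]
  show ?thesis
  proof
    fix \<alpha> m n x assume \<alpha>: "\<alpha> \<in> Hom Simplex m n" and "x \<in> simp (map_complex M A R) n"
    then show "act (map_complex M A R) \<alpha> x \<in> simp (map_complex M A R) m"
      using Comp_Hom[OF F(2)[OF \<alpha>]] by (simp add: map_complex_def)
  next
    fix x n assume "x \<in> simp (map_complex M A R) n"
    then show "act (map_complex M A R) (Ide Simplex n) x = x"
      using Comp_Ide F(3) by (auto simp: map_complex_def)
  next
    fix \<alpha> \<beta> l m n x assume *: "\<alpha> \<in> Hom Simplex l m" "\<beta> \<in> Hom Simplex m n" "x \<in> simp (map_complex M A R) n"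
    then have "x \<in> Hom M (onOb A n) R" by (simp add: map_complex_def)
    with * show "act (map_complex M A R) (\<beta> \<star> \<alpha>) x = act (map_complex M A R) \<alpha> (act (map_complex M A R) \<beta> x)"
      using Comp_assoc[OF F(2)[OF *(1)] F(2)[OF *(2)]] F(4)[OF *(1,2)] by (simp add: map_complex_def)
  qed
qed

lemma simplicial_map_postcomp:
  assumes A: "is_functor Simplex M A" and e: "e \<in> Hom M Q R"
  shows "simplicial_map (map_complex M A Q) (map_complex M A R) (\<lambda>n x. e \<odot> x)"
  unfolding simplicial_map_def
proof (intro conjI allI ballI impI)
  note F = functorD[OF A]
  fix n x assume "x \<in> simp (map_complex M A Q) n"
  then have x: "x \<in> Hom M (onOb A n) Q" by (simp add: map_complex_def)
  show "e \<odot> x \<in> simp (map_complex M A R) n" using Comp_Hom[OF x e] by (simp add: map_complex_def)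
  fix m \<alpha> assume \<alpha>: "\<alpha> \<in> Hom Simplex m n"
  show "e \<odot> act (map_complex M A Q) \<alpha> x = act (map_complex M A R) \<alpha> (e \<odot> x)"
    using Comp_assoc[OF F(2)[OF \<alpha>] x e] by (simp add: map_complex_def)
qed

text \<open>A boundary problem in the mapping complexes is an extension problem for \<open>A\<close>
  against \<open>p\<close>, which \<open>Reedy_cofibrant_extends\<close> solves.\<close>

lemma trivial_fibration_map_complex:
  assumes A: "Reedy_cofibrant M A" and p: "p \<in> tfib" "p \<in> Hom M Q R"
  shows "trivial_fibration (map_complex M A Q) (map_complex M A R) (\<lambda>n x. p \<odot> x)"
  unfolding trivial_fibration_def
proof (intro conjI allI ballI impI)
  have fA: "is_functor Simplex M A" using A by (simp add: Reedy_cofibrant_def)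
  show "simplicial_set (map_complex M A Q)" "simplicial_set (map_complex M A R)"
    by (rule simplicial_set_map_complex[OF fA])+
  show "simplicial_map (map_complex M A Q) (map_complex M A R) (\<lambda>n x. p \<odot> x)"
    by (rule simplicial_map_postcomp[OF fA p(2)])
  have d: "Dom M p = Q" "Cod M p = R" using p(2) by (auto simp: Hom_def)
  fix n v y assume "v \<in> simp (map_complex M A R) n"
    "\<forall>m<n. \<forall>\<theta>\<in>Hom Simplex m n. y \<theta> \<in> simp (map_complex M A Q) m \<and> p \<odot> y \<theta> = act (map_complex M A R) \<theta> v \<and>
      (\<forall>l<n. \<forall>\<gamma>\<in>Hom Simplex l m. act (map_complex M A Q) \<gamma> (y \<theta>) = y (\<theta> \<star> \<gamma>))"
  then show "\<exists>z\<in>simp (map_complex M A Q) n. p \<odot> z = v \<and>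
      (\<forall>m<n. \<forall>\<theta>\<in>Hom Simplex m n. act (map_complex M A Q) \<theta> z = y \<theta>)"
    using bspec[OF Reedy_cofibrant_extends[OF A, of n, unfolded extends_boundary_def] p(1)]
    by (simp add: map_complex_def d)
qed

end

section \<open>Reedy factorizations and liftings\<close>

context model_category begin

definition nat_upto :: "nat \<Rightarrow> ('o, 'm) cosimp \<Rightarrow> ('o, 'm) cosimp \<Rightarrow> (nat \<Rightarrow> 'm) \<Rightarrow> bool" where
  "nat_upto N A C j \<longleftrightarrow> (\<forall>n<N. j n \<in> Hom M (onOb A n) (onOb C n)) \<and>
    (\<forall>m<N. \<forall>n<N. \<forall>\<alpha>\<in>Hom Simplex m n. onAr C \<alpha> \<odot> j m = j n \<odot> onAr A \<alpha>)"

lemma nat_uptoD: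
  assumes "nat_upto N A C j"
  shows "n < N \<Longrightarrow> j n \<in> Hom M (onOb A n) (onOb C n)"
    "\<lbrakk>\<alpha> \<in> Hom Simplex m n; m < N; n < N\<rbrakk> \<Longrightarrow> onAr C \<alpha> \<odot> j m = j n \<odot> onAr A \<alpha>"
  using assms unfolding nat_upto_def by blast+

lemma nat_upto_iff: "nat_trans Simplex M A C j \<longleftrightarrow> (\<forall>N. nat_upto N A C j)"
proof
  assume "nat_trans Simplex M A C j"
  then show "\<forall>N. nat_upto N A C j"
  proof (intro allI)
    fix N assume *: "nat_trans Simplex M A C j"
    show "nat_upto N A C j"
      unfolding nat_upto_def
    proof (intro conjI allI impI ballI)
      show "j n \<in> Hom M (onOb A n) (onOb C n)" for n using * by (simp add: nat_trans_def)
      fix m n \<alpha> assume "\<alpha> \<in> Hom Simplex m n"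
      then have "\<alpha> \<in> Ar Simplex" "Dom Simplex \<alpha> = m" "Cod Simplex \<alpha> = n" by (simp_all add: Hom_def)
      then show "onAr C \<alpha> \<odot> j m = j n \<odot> onAr A \<alpha>" using * unfolding nat_trans_def by metis
    qed
  qed
next
  assume *: "\<forall>N. nat_upto N A C j"
  show "nat_trans Simplex M A C j"
    unfolding nat_trans_def
  proof (intro conjI ballI)
    show "j n \<in> Hom M (onOb A n) (onOb C n)" for n
      using nat_uptoD(1)[OF *[rule_format, of "Suc n"]] by simp
    fix \<alpha> assume "\<alpha> \<in> Ar Simplex"
    then have "\<alpha> \<in> Hom Simplex (Dom Simplex \<alpha>) (Cod Simplex \<alpha>)" by (simp add: Hom_def)
    from nat_uptoD(2)[OF *[rule_format, of "Suc (Dom Simplex \<alpha> + Cod Simplex \<alpha>)"] this]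
    show "j (Cod Simplex \<alpha>) \<odot> onAr A \<alpha> = onAr C \<alpha> \<odot> j (Dom Simplex \<alpha>)" by simp
  qed
qed

lemma natD:
  assumes "nat_trans Simplex M A C j"
  shows "j n \<in> Hom M (onOb A n) (onOb C n)"
    "\<alpha> \<in> Hom Simplex m n \<Longrightarrow> onAr C \<alpha> \<odot> j m = j n \<odot> onAr A \<alpha>"
proof -
  have *: "nat_upto N A C j" for N using assms nat_upto_iff by blast
  show "j n \<in> Hom M (onOb A n) (onOb C n)" using nat_uptoD(1)[OF *[of "Suc n"]] by simp
  show "\<alpha> \<in> Hom Simplex m n \<Longrightarrow> onAr C \<alpha> \<odot> j m = j n \<odot> onAr A \<alpha>"
    using nat_uptoD(2)[OF *[of "Suc (m + n)"]] by simp
qed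

lemma endo_factor:
  assumes "\<alpha> \<in> Hom Simplex N N" "\<alpha> \<noteq> Ide Simplex N"
  obtains k \<theta> \<tau> where "k < N" "\<theta> \<in> Hom Simplex N k" "\<tau> \<in> Hom Simplex k N" "\<alpha> = \<tau> \<star> \<theta>"
proof -
  note e = epi_mono_parts[OF assms(1)]
  have "mid \<alpha> \<noteq> N"
  proof
    assume "mid \<alpha> = N"
    then have "split_epi (epi_part \<alpha>) N N" "injective (mono_part \<alpha>) N N" using e(1,2) by simp_all
    then have "epi_part \<alpha> = Ide Simplex N" "mono_part \<alpha> = Ide Simplex N"
      using split_epi_endo injective_endo by blast+
    then show False using e(3) assms(2) Simplex.Comp_Ide[OF Ide_Simplex_Hom] by simp
  qed
  with e that[of "mid \<alpha>" "epi_part \<alpha>" "mono_part \<alpha>"] show thesis by simp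
qed

text \<open>Naturality against endomorphisms of \<open>[N]\<close> comes for free, since a
  nonidentity one passes through a lower degree.\<close>

lemma nat_upto_Suc:
  assumes A: "functor_upto (Suc N) A" and C: "functor_upto (Suc N) C" and j: "nat_upto N A C j"
    and N: "j N \<in> Hom M (onOb A N) (onOb C N)"
    and \<tau>: "\<And>m \<tau>. \<lbrakk>m < N; \<tau> \<in> Hom Simplex m N\<rbrakk> \<Longrightarrow> onAr C \<tau> \<odot> j m = j N \<odot> onAr A \<tau>"
    and \<theta>: "\<And>m \<theta>. \<lbrakk>m < N; \<theta> \<in> Hom Simplex N m\<rbrakk> \<Longrightarrow> onAr C \<theta> \<odot> j N = j m \<odot> onAr A \<theta>"
  shows "nat_upto (Suc N) A C j"
proof -
  note AF = functor_uptoD[OF A] and CF = functor_uptoD[OF C]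
  have "onAr C \<alpha> \<odot> j N = j N \<odot> onAr A \<alpha>" if \<alpha>: "\<alpha> \<in> Hom Simplex N N" for \<alpha>
  proof (cases "\<alpha> = Ide Simplex N")
    case True
    then show ?thesis using AF(3)[of N] CF(3)[of N] Comp_Ide[OF N] Ide_Comp[OF N] by simp
  next
    case False
    obtain k x y where k: "k < N" "x \<in> Hom Simplex N k" "y \<in> Hom Simplex k N" "\<alpha> = y \<star> x"
      by (rule endo_factor[OF \<alpha> False])
    have H: "onAr A x \<in> Hom M (onOb A N) (onOb A k)" "onAr A y \<in> Hom M (onOb A k) (onOb A N)"
      "onAr C x \<in> Hom M (onOb C N) (onOb C k)" "onAr C y \<in> Hom M (onOb C k) (onOb C N)"
      using AF(2) CF(2) k by auto
    have jk: "j k \<in> Hom M (onOb A k) (onOb C k)" using nat_uptoD(1)[OF j k(1)] .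
    have "onAr C \<alpha> \<odot> j N = onAr C y \<odot> (onAr C x \<odot> j N)"
      using CF(4)[OF k(2,3)] k(1,4) Comp_assoc[OF N H(3,4)] by simp
    also have "\<dots> = onAr C y \<odot> j k \<odot> onAr A x"
      using \<theta>[OF k(1,2)] Comp_assoc[OF H(1) jk H(4)] by simp
    also have "\<dots> = j N \<odot> (onAr A y \<odot> onAr A x)"
      using \<tau>[OF k(1,3)] Comp_assoc[OF H(1,2) N] by simp
    also have "\<dots> = j N \<odot> onAr A \<alpha>" using AF(4)[OF k(2,3)] k(1,4) by simp
    finally show ?thesis .
  qed
  then show ?thesis
    using nat_uptoD[OF j] N \<tau> \<theta> unfolding nat_upto_def less_Suc_eq by blast
qed

text \<open>Reedy's description of one more degree: an object \<open>E\<close> with compatible maps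
  \<open>u\<close> from and \<open>d\<close> to the lower degrees, whose composites are prescribed
  by \<open>C\<close>. Together they amount to a factorization of the canonical map from the
  latching to the matching object.\<close>

lemma functor_extend:
  assumes C: "functor_upto N C" and E: "E \<in> Ob M"
    and u: "\<And>m \<tau>. \<lbrakk>m < N; \<tau> \<in> Hom Simplex m N\<rbrakk> \<Longrightarrow> u \<tau> \<in> Hom M (onOb C m) E"
    and d: "\<And>m \<theta>. \<lbrakk>m < N; \<theta> \<in> Hom Simplex N m\<rbrakk> \<Longrightarrow> d \<theta> \<in> Hom M E (onOb C m)"
    and uC: "\<And>l m \<tau> \<gamma>. \<lbrakk>m < N; \<tau> \<in> Hom Simplex m N; l < N; \<gamma> \<in> Hom Simplex l m\<rbrakk> \<Longrightarrow>
      u \<tau> \<odot> onAr C \<gamma> = u (\<tau> \<star> \<gamma>)"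
    and Cd: "\<And>l m \<theta> \<gamma>. \<lbrakk>m < N; \<theta> \<in> Hom Simplex N m; l < N; \<gamma> \<in> Hom Simplex m l\<rbrakk> \<Longrightarrow>
      onAr C \<gamma> \<odot> d \<theta> = d (\<gamma> \<star> \<theta>)"
    and du: "\<And>l m \<theta> \<tau>. \<lbrakk>m < N; \<theta> \<in> Hom Simplex N m; l < N; \<tau> \<in> Hom Simplex l N\<rbrakk> \<Longrightarrow>
      d \<theta> \<odot> u \<tau> = onAr C (\<theta> \<star> \<tau>)"
  obtains C' where "functor_upto (Suc N) C'" "onOb C' N = E" "\<And>m. m < N \<Longrightarrow> onOb C' m = onOb C m"
    "\<And>m n \<alpha>. \<lbrakk>\<alpha> \<in> Hom Simplex m n; m < N; n < N\<rbrakk> \<Longrightarrow> onAr C' \<alpha> = onAr C \<alpha>"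
    "\<And>m \<tau>. \<lbrakk>\<tau> \<in> Hom Simplex m N; m < N\<rbrakk> \<Longrightarrow> onAr C' \<tau> = u \<tau>"
    "\<And>m \<theta>. \<lbrakk>\<theta> \<in> Hom Simplex N m; m < N\<rbrakk> \<Longrightarrow> onAr C' \<theta> = d \<theta>"
proof -
  note CF = functor_uptoD[OF C]
  \<comment> \<open>The arrows that touch degree \<open>N\<close> are \<open>u\<close>,
    \<open>d\<close>, the identity of \<open>E\<close> and, for every other endomorphism of
    \<open>[N]\<close>, the composite through its image.\<close>
  define B where "B \<alpha> = (if Dom Simplex \<alpha> < N \<and> Cod Simplex \<alpha> < N then onAr C \<alpha>
    else if Dom Simplex \<alpha> < N then u \<alpha> else if Cod Simplex \<alpha> < N then d \<alpha>
    else if \<alpha> = Ide Simplex N then Ide M E else u (mono_part \<alpha>) \<odot> d (epi_part \<alpha>))" for \<alpha>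
  define C' where "C' = \<lparr>onOb = (onOb C)(N := E), onAr = B\<rparr>"
  have B1: "B \<alpha> = onAr C \<alpha>" if "\<alpha> \<in> Hom Simplex m n" "m < N" "n < N" for m n \<alpha>
    using that Dom_Cod_Simplex[OF that(1)] by (simp add: B_def)
  have B2: "B \<alpha> = u \<alpha>" if "\<alpha> \<in> Hom Simplex m N" "m < N" for m \<alpha>
    using that Dom_Cod_Simplex[OF that(1)] by (simp add: B_def)
  have B3: "B \<alpha> = d \<alpha>" if "\<alpha> \<in> Hom Simplex N m" "m < N" for m \<alpha>
    using that Dom_Cod_Simplex[OF that(1)] by (simp add: B_def)
  have B4: "B (Ide Simplex N) = Ide M E"
    using Dom_Cod_Simplex[OF Ide_Simplex_Hom, of N] by (simp add: B_def)
  \<comment> \<open>Every factorization through a lower degree gives the same composite, not just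
    the chosen epi-mono one; the functoriality of endomorphisms rests on this.\<close>
  have B5: "B (\<tau> \<star> \<theta>) = u \<tau> \<odot> d \<theta>"
    if k: "k < N" and \<theta>: "\<theta> \<in> Hom Simplex N k" and \<tau>: "\<tau> \<in> Hom Simplex k N" for k \<theta> \<tau>
  proof -
    let ?\<alpha> = "\<tau> \<star> \<theta>"
    have \<alpha>: "?\<alpha> \<in> Hom Simplex N N" by (rule Comp_Simplex_Hom[OF \<theta> \<tau>])
    have nid: "?\<alpha> \<noteq> Ide Simplex N"
    proof
      assume "?\<alpha> = Ide Simplex N"
      then have "injective \<theta> N k" using injective_comp_right[OF \<theta> \<tau>] Ide_injective by simp
      then show False using injective_le k by fastforce
    qed
    note t = epi_mono_parts[OF \<theta>]
    have k2: "mid \<theta> < N" using t(5) k by simp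
    let ?\<delta> = "\<tau> \<star> mono_part \<theta>"
    note po = parts_postcomp[OF \<theta> \<tau>]
    note e = epi_mono_parts[OF po(1)]
    have k3: "mid ?\<delta> < N" using e(4) k2 by simp
    have "u \<tau> \<odot> d \<theta> = u \<tau> \<odot> (onAr C (mono_part \<theta>) \<odot> d (epi_part \<theta>))"
      using Cd[OF k2 t(6) k t(7)] t(3) by simp
    also have "\<dots> = u ?\<delta> \<odot> d (epi_part \<theta>)"
      using Comp_assoc[OF d[OF k2 t(6)] CF(2)[OF t(7) k2 k] u[OF k \<tau>]] uC[OF k \<tau> k2 t(7)] by simp
    also have "u ?\<delta> = u (mono_part ?\<delta>) \<odot> onAr C (epi_part ?\<delta>)"
      using uC[OF k3 e(7) k2 e(6)] e(3) by simp
    also have "u (mono_part ?\<delta>) \<odot> onAr C (epi_part ?\<delta>) \<odot> d (epi_part \<theta>)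
      = u (mono_part ?\<delta>) \<odot> d (epi_part ?\<delta> \<star> epi_part \<theta>)"
      using Comp_assoc[OF d[OF k2 t(6)] CF(2)[OF e(6) k2 k3] u[OF k3 e(7)]] Cd[OF k2 t(6) k3 e(6)] by simp
    also have "\<dots> = u (mono_part ?\<alpha>) \<odot> d (epi_part ?\<alpha>)" unfolding po(3,4) ..
    finally show ?thesis using nid Dom_Cod_Simplex[OF \<alpha>] by (simp add: B_def)
  qed
  have BH: "B \<alpha> \<in> Hom M (onOb C' m) (onOb C' n)"
    if \<alpha>: "\<alpha> \<in> Hom Simplex m n" and mn: "m < Suc N" "n < Suc N" for \<alpha> m n
  proof -
    consider "m < N" "n < N" | "m < N" "n = N" | "m = N" "n < N" | "m = N" "n = N" using mn by linarith
    then show ?thesis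
    proof cases
      case 1 then show ?thesis using B1[OF \<alpha>] CF(2)[OF \<alpha>] by (simp add: C'_def)
    next
      case 2 then show ?thesis using B2[of \<alpha> m] u[of m \<alpha>] \<alpha> by (simp add: C'_def)
    next
      case 3 then show ?thesis using B3[of \<alpha> n] d[of n \<alpha>] \<alpha> by (simp add: C'_def)
    next
      case 4
      show ?thesis
      proof (cases "\<alpha> = Ide Simplex N")
        case True then show ?thesis using 4 B4 Ide_Hom[OF E] by (simp add: C'_def)
      next
        case False
        have "\<alpha> \<in> Hom Simplex N N" using \<alpha> 4 by simp
        from endo_factor[OF this False]
        obtain k \<theta> \<tau> where k: "k < N" "\<theta> \<in> Hom Simplex N k" "\<tau> \<in> Hom Simplex k N" "\<alpha> = \<tau> \<star> \<theta>" .
        then show ?thesis using 4 B5[OF k(1-3)] Comp_Hom[OF d[OF k(1,2)] u[OF k(1,3)]] by (simp add: C'_def)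
      qed
    qed
  qed
  have comp: "B (\<beta> \<star> \<alpha>) = B \<beta> \<odot> B \<alpha>"
    if lmn: "l < Suc N" "m < Suc N" "n < Suc N" and \<alpha>: "\<alpha> \<in> Hom Simplex l m" and \<beta>: "\<beta> \<in> Hom Simplex m n"
    for l m n \<alpha> \<beta>
  proof (cases "m = N \<and> (l = N \<and> \<alpha> = Ide Simplex N \<or> n = N \<and> \<beta> = Ide Simplex N)")
    case True
    then show ?thesis
    proof (elim conjE disjE)
      assume *: "m = N" "l = N" "\<alpha> = Ide Simplex N"
      have "B \<beta> \<in> Hom M E (onOb C' n)" using BH[OF \<beta> lmn(2,3)] * by (simp add: C'_def)
      then show ?thesis using * B4 Comp_Ide Simplex.Comp_Ide[OF \<beta>] by simp
    next
      assume *: "m = N" "n = N" "\<beta> = Ide Simplex N"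
      have "B \<alpha> \<in> Hom M (onOb C' l) E" using BH[OF \<alpha> lmn(1,2)] * by (simp add: C'_def)
      then show ?thesis using * B4 Ide_Comp Simplex.Ide_Comp[OF \<alpha>] by simp
    qed
  next
    case nid: False
    note \<beta>\<alpha> = Comp_Simplex_Hom[OF \<alpha> \<beta>]
    consider "l < N" "m < N" "n < N" | "l < N" "m < N" "n = N" | "l < N" "m = N" "n < N"
      | "l < N" "m = N" "n = N" | "l = N" "m < N" "n < N" | "l = N" "m < N" "n = N"
      | "l = N" "m = N" "n < N" | "l = N" "m = N" "n = N" using lmn unfolding less_Suc_eq by blast
    then show ?thesis
    proof cases
      case 1
      then show ?thesis using B1[OF \<alpha>] B1[OF \<beta>] B1[OF \<beta>\<alpha>] CF(4)[OF \<alpha> \<beta>] by simp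
    next
      case 2
      then have \<beta>: "\<beta> \<in> Hom Simplex m N" and \<beta>\<alpha>: "\<beta> \<star> \<alpha> \<in> Hom Simplex l N" using \<beta> \<beta>\<alpha> by auto
      show ?thesis using B1[OF \<alpha> 2(1,2)] B2[OF \<beta> 2(2)] B2[OF \<beta>\<alpha> 2(1)] uC[OF 2(2) \<beta> 2(1) \<alpha>] by simp
    next
      case 3
      then have \<beta>: "\<beta> \<in> Hom Simplex N n" and \<alpha>: "\<alpha> \<in> Hom Simplex l N" using \<beta> \<alpha> by auto
      show ?thesis using B2[OF \<alpha> 3(1)] B3[OF \<beta> 3(3)] B1[OF \<beta>\<alpha> 3(1,3)] du[OF 3(3) \<beta> 3(1) \<alpha>] by simp
    next
      case 4
      then have \<beta>: "\<beta> \<in> Hom Simplex N N" and \<alpha>: "\<alpha> \<in> Hom Simplex l N" using \<beta> \<alpha> by auto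
      obtain k \<theta> \<tau> where k: "k < N" "\<theta> \<in> Hom Simplex N k" "\<tau> \<in> Hom Simplex k N" "\<beta> = \<tau> \<star> \<theta>"
        by (rule endo_factor[OF \<beta>]) (use nid 4 in auto)
      note \<theta>\<alpha> = Comp_Simplex_Hom[OF \<alpha> k(2)]
      have "B \<beta> \<odot> B \<alpha> = u \<tau> \<odot> d \<theta> \<odot> u \<alpha>" using B2[OF \<alpha> 4(1)] B5[OF k(1-3)] k(4) by simp
      also have "\<dots> = u \<tau> \<odot> onAr C (\<theta> \<star> \<alpha>)"
        using Comp_assoc[OF u[OF 4(1) \<alpha>] d[OF k(1,2)] u[OF k(1,3)]] du[OF k(1,2) 4(1) \<alpha>] by simp
      also have "\<dots> = u (\<tau> \<star> (\<theta> \<star> \<alpha>))" by (rule uC[OF k(1,3) 4(1) \<theta>\<alpha>])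
      also have "\<tau> \<star> (\<theta> \<star> \<alpha>) = \<beta> \<star> \<alpha>"
        using Simplex.Comp_assoc[OF \<alpha> k(2,3)] k(4) by simp
      also have "u (\<beta> \<star> \<alpha>) = B (\<beta> \<star> \<alpha>)"
        using B2[of "\<beta> \<star> \<alpha>" l] \<beta>\<alpha> 4 by simp
      finally show ?thesis ..
    next
      case 5
      then have \<alpha>: "\<alpha> \<in> Hom Simplex N m" and \<beta>\<alpha>: "\<beta> \<star> \<alpha> \<in> Hom Simplex N n" using \<alpha> \<beta>\<alpha> by auto
      show ?thesis using B1[OF \<beta> 5(2,3)] B3[OF \<alpha> 5(2)] B3[OF \<beta>\<alpha> 5(3)] Cd[OF 5(2) \<alpha> 5(3) \<beta>] by simp
    next
      case 6
      then have \<alpha>: "\<alpha> \<in> Hom Simplex N m" and \<beta>: "\<beta> \<in> Hom Simplex m N" using \<alpha> \<beta> by auto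
      show ?thesis using B2[OF \<beta> 6(2)] B3[OF \<alpha> 6(2)] B5[OF 6(2) \<alpha> \<beta>] by simp
    next
      case 7
      then have \<alpha>: "\<alpha> \<in> Hom Simplex N N" and \<beta>: "\<beta> \<in> Hom Simplex N n" using \<alpha> \<beta> by auto
      obtain k \<theta> \<tau> where k: "k < N" "\<theta> \<in> Hom Simplex N k" "\<tau> \<in> Hom Simplex k N" "\<alpha> = \<tau> \<star> \<theta>"
        by (rule endo_factor[OF \<alpha>]) (use nid 7 in auto)
      note \<beta>\<tau> = Comp_Simplex_Hom[OF k(3) \<beta>]
      have "B \<beta> \<odot> B \<alpha> = d \<beta> \<odot> (u \<tau> \<odot> d \<theta>)" using B3[OF \<beta> 7(3)] B5[OF k(1-3)] k(4) by simp
      also have "\<dots> = onAr C (\<beta> \<star> \<tau>) \<odot> d \<theta>"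
        using Comp_assoc[OF d[OF k(1,2)] u[OF k(1,3)] d[OF 7(3) \<beta>]] du[OF 7(3) \<beta> k(1,3)] by simp
      also have "\<dots> = d (\<beta> \<star> \<tau> \<star> \<theta>)" by (rule Cd[OF k(1,2) 7(3) \<beta>\<tau>])
      also have "\<beta> \<star> \<tau> \<star> \<theta> = \<beta> \<star> \<alpha>"
        using Simplex.Comp_assoc[OF k(2,3) \<beta>] k(4) by simp
      also have "d (\<beta> \<star> \<alpha>) = B (\<beta> \<star> \<alpha>)"
        using B3[of "\<beta> \<star> \<alpha>" n] \<beta>\<alpha> 7 by simp
      finally show ?thesis ..
    next
      case 8
      then have \<alpha>: "\<alpha> \<in> Hom Simplex N N" and \<beta>: "\<beta> \<in> Hom Simplex N N" using \<alpha> \<beta> by auto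
      obtain k \<theta> \<tau> where k: "k < N" "\<theta> \<in> Hom Simplex N k" "\<tau> \<in> Hom Simplex k N" "\<alpha> = \<tau> \<star> \<theta>"
        by (rule endo_factor[OF \<alpha>]) (use nid 8 in auto)
      obtain k' \<theta>' \<tau>' where k': "k' < N" "\<theta>' \<in> Hom Simplex N k'" "\<tau>' \<in> Hom Simplex k' N" "\<beta> = \<tau>' \<star> \<theta>'"
        by (rule endo_factor[OF \<beta>]) (use nid 8 in auto)
      note \<theta>'\<tau> = Comp_Simplex_Hom[OF k(3) k'(2)]
      note \<theta>'\<tau>\<theta> = Comp_Simplex_Hom[OF k(2) \<theta>'\<tau>]
      note ud = Comp_Hom[OF d[OF k(1,2)] u[OF k(1,3)]]
      have "B \<beta> \<odot> B \<alpha> = u \<tau>' \<odot> d \<theta>' \<odot> (u \<tau> \<odot> d \<theta>)" using B5[OF k(1-3)] B5[OF k'(1-3)] k(4) k'(4) by simp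
      also have "\<dots> = u \<tau>' \<odot> (d \<theta>' \<odot> u \<tau> \<odot> d \<theta>)"
        using Comp_assoc[OF ud d[OF k'(1,2)] u[OF k'(1,3)]]
          Comp_assoc[OF d[OF k(1,2)] u[OF k(1,3)] d[OF k'(1,2)]] by simp
      also have "\<dots> = u \<tau>' \<odot> d (\<theta>' \<star> \<tau> \<star> \<theta>)"
        using du[OF k'(1,2) k(1,3)] Cd[OF k(1,2) k'(1) \<theta>'\<tau>] by simp
      also have "\<dots> = B (\<tau>' \<star> (\<theta>' \<star> \<tau> \<star> \<theta>))"
        by (rule B5[OF k'(1) \<theta>'\<tau>\<theta> k'(3), symmetric])
      also have "\<tau>' \<star> (\<theta>' \<star> \<tau> \<star> \<theta>) = \<beta> \<star> \<alpha>"
        using Simplex.Comp_assoc[OF \<alpha> k'(2,3)] Simplex.Comp_assoc[OF k(2,3) k'(2)] k(4) k'(4) by simp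
      finally show ?thesis ..
    qed
  qed
  show thesis
  proof (rule that[of C'])
    show "functor_upto (Suc N) C'"
      unfolding functor_upto_def
    proof (intro conjI allI impI ballI)
      show "onOb C' n \<in> Ob M" if "n < Suc N" for n
        using that E CF(1) by (auto simp: C'_def less_Suc_eq)
      show "onAr C' (Ide Simplex n) = Ide M (onOb C' n)" if "n < Suc N" for n
        using that B4 B1[OF Ide_Simplex_Hom, of n] CF(3)[of n] by (auto simp: C'_def less_Suc_eq)
    qed (use BH comp in \<open>simp_all add: C'_def\<close>)
  qed (use B1 B2 B3 in \<open>simp_all add: C'_def\<close>)
qed

section \<open>Relative latching and matching objects\<close>

text \<open>A cocone consists of \<open>w\<close> on \<open>A n\<close> and of \<open>v\<close> on
  the latching object of \<open>C\<close>, spelled out over all maps to \<open>[n]\<close> from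
  smaller \<open>[m]\<close>, and both agree on the latching object of \<open>A\<close>. The
  universal one is the corresponding pushout. Matching cones are dual.\<close>

definition latch_cocone where
  "latch_cocone A C j n V v w \<longleftrightarrow> w \<in> Hom M (onOb A n) V \<and>
    (\<forall>m<n. \<forall>\<theta>\<in>Hom Simplex m n. v \<theta> \<in> Hom M (onOb C m) V \<and> v \<theta> \<odot> j m = w \<odot> onAr A \<theta> \<and>
      (\<forall>l<n. \<forall>\<gamma>\<in>Hom Simplex l m. v \<theta> \<odot> onAr C \<gamma> = v (\<theta> \<star> \<gamma>)))"

definition match_cone where
  "match_cone D C p n V v w \<longleftrightarrow> w \<in> Hom M V (onOb D n) \<and>
    (\<forall>m<n. \<forall>\<theta>\<in>Hom Simplex n m. v \<theta> \<in> Hom M V (onOb C m) \<and> p m \<odot> v \<theta> = onAr D \<theta> \<odot> w \<and>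
      (\<forall>l<n. \<forall>\<gamma>\<in>Hom Simplex m l. onAr C \<gamma> \<odot> v \<theta> = v (\<gamma> \<star> \<theta>)))"

definition latch_universal where
  "latch_universal A C j n \<Lambda> v w \<longleftrightarrow> latch_cocone A C j n \<Lambda> v w \<and>
    (\<forall>V v' w'. latch_cocone A C j n V v' w' \<longrightarrow>
      (\<exists>!h. h \<in> Hom M \<Lambda> V \<and> h \<odot> w = w' \<and> (\<forall>m<n. \<forall>\<theta>\<in>Hom Simplex m n. h \<odot> v \<theta> = v' \<theta>)))"

definition match_universal where
  "match_universal D C p n W v w \<longleftrightarrow> match_cone D C p n W v w \<and>
    (\<forall>V v' w'. match_cone D C p n V v' w' \<longrightarrow>
      (\<exists>!h. h \<in> Hom M V W \<and> w \<odot> h = w' \<and> (\<forall>m<n. \<forall>\<theta>\<in>Hom Simplex n m. v \<theta> \<odot> h = v' \<theta>)))"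

text \<open>Relative latching maps are cofibrations, relative matching maps are trivial fibrations.\<close>

definition rel_cof where
  "rel_cof A C j n \<longleftrightarrow> (\<exists>\<Lambda> v w a. latch_universal A C j n \<Lambda> v w \<and> a \<in> cof M \<and> a \<in> Hom M \<Lambda> (onOb C n) \<and>
    a \<odot> w = j n \<and> (\<forall>m<n. \<forall>\<theta>\<in>Hom Simplex m n. a \<odot> v \<theta> = onAr C \<theta>))"

definition rel_fib where
  "rel_fib D C p n \<longleftrightarrow> (\<exists>W v w b. match_universal D C p n W v w \<and> b \<in> tfib \<and> b \<in> Hom M (onOb C n) W \<and>
    w \<odot> b = p n \<and> (\<forall>m<n. \<forall>\<theta>\<in>Hom Simplex n m. v \<theta> \<odot> b = onAr C \<theta>))"

lemma latch_coconeD: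
  assumes "latch_cocone A C j n V v w"
  shows "w \<in> Hom M (onOb A n) V"
    "\<lbrakk>m < n; \<theta> \<in> Hom Simplex m n\<rbrakk> \<Longrightarrow> v \<theta> \<in> Hom M (onOb C m) V"
    "\<lbrakk>m < n; \<theta> \<in> Hom Simplex m n\<rbrakk> \<Longrightarrow> v \<theta> \<odot> j m = w \<odot> onAr A \<theta>"
    "\<lbrakk>m < n; \<theta> \<in> Hom Simplex m n; l < n; \<gamma> \<in> Hom Simplex l m\<rbrakk> \<Longrightarrow> v \<theta> \<odot> onAr C \<gamma> = v (\<theta> \<star> \<gamma>)"
  using assms unfolding latch_cocone_def by blast+

lemma match_coneD:
  assumes "match_cone D C p n V v w"
  shows "w \<in> Hom M V (onOb D n)"
    "\<lbrakk>m < n; \<theta> \<in> Hom Simplex n m\<rbrakk> \<Longrightarrow> v \<theta> \<in> Hom M V (onOb C m)"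
    "\<lbrakk>m < n; \<theta> \<in> Hom Simplex n m\<rbrakk> \<Longrightarrow> p m \<odot> v \<theta> = onAr D \<theta> \<odot> w"
    "\<lbrakk>m < n; \<theta> \<in> Hom Simplex n m; l < n; \<gamma> \<in> Hom Simplex m l\<rbrakk> \<Longrightarrow> onAr C \<gamma> \<odot> v \<theta> = v (\<gamma> \<star> \<theta>)"
  using assms unfolding match_cone_def by blast+

lemma latch_universal_obtain:
  assumes "latch_universal A C j n \<Lambda> v w" "latch_cocone A C j n V v' w'"
  obtains h where "h \<in> Hom M \<Lambda> V" "h \<odot> w = w'" "\<And>m \<theta>. \<lbrakk>m < n; \<theta> \<in> Hom Simplex m n\<rbrakk> \<Longrightarrow> h \<odot> v \<theta> = v' \<theta>"
  using assms unfolding latch_universal_def by blast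

lemma match_universal_obtain:
  assumes "match_universal D C p n W v w" "match_cone D C p n V v' w'"
  obtains h where "h \<in> Hom M V W" "w \<odot> h = w'" "\<And>m \<theta>. \<lbrakk>m < n; \<theta> \<in> Hom Simplex n m\<rbrakk> \<Longrightarrow> v \<theta> \<odot> h = v' \<theta>"
  using assms unfolding match_universal_def by blast

lemma latch_cocone_comp:
  assumes c: "latch_cocone A C j n \<Lambda> v w" and h: "h \<in> Hom M \<Lambda> V" and C: "functor_upto n C" and A: "is_functor Simplex M A"
    and j: "\<And>m. m < n \<Longrightarrow> j m \<in> Hom M (onOb A m) (onOb C m)"
  shows "latch_cocone A C j n V (\<lambda>\<theta>. h \<odot> v \<theta>) (h \<odot> w)"
  unfolding latch_cocone_def
proof (intro conjI allI impI ballI)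
  note c = latch_coconeD[OF c]
  show "h \<odot> w \<in> Hom M (onOb A n) V" by (rule Comp_Hom[OF c(1) h])
  fix m \<theta> assume \<theta>: "m < n" "\<theta> \<in> Hom Simplex m n"
  show "h \<odot> v \<theta> \<in> Hom M (onOb C m) V" by (rule Comp_Hom[OF c(2)[OF \<theta>] h])
  show "h \<odot> v \<theta> \<odot> j m = h \<odot> w \<odot> onAr A \<theta>"
    using Comp_assoc[OF j[OF \<theta>(1)] c(2)[OF \<theta>] h] Comp_assoc[OF functorD(2)[OF A \<theta>(2)] c(1) h] c(3)[OF \<theta>] by simp
  fix l \<gamma> assume \<gamma>: "l < n" "\<gamma> \<in> Hom Simplex l m"
  show "h \<odot> v \<theta> \<odot> onAr C \<gamma> = h \<odot> v (\<theta> \<star> \<gamma>)"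
    using Comp_assoc[OF functor_uptoD(2)[OF C \<gamma>(2,1) \<theta>(1)] c(2)[OF \<theta>] h] c(4)[OF \<theta> \<gamma>] by simp
qed

lemma match_cone_comp:
  assumes c: "match_cone D C p n W v w" and h: "h \<in> Hom M V W" and C: "functor_upto n C" and D: "is_functor Simplex M D"
    and p: "\<And>m. m < n \<Longrightarrow> p m \<in> Hom M (onOb C m) (onOb D m)"
  shows "match_cone D C p n V (\<lambda>\<theta>. v \<theta> \<odot> h) (w \<odot> h)"
  unfolding match_cone_def
proof (intro conjI allI impI ballI)
  note c = match_coneD[OF c]
  show "w \<odot> h \<in> Hom M V (onOb D n)" by (rule Comp_Hom[OF h c(1)])
  fix m \<theta> assume \<theta>: "m < n" "\<theta> \<in> Hom Simplex n m"
  show "v \<theta> \<odot> h \<in> Hom M V (onOb C m)" by (rule Comp_Hom[OF h c(2)[OF \<theta>]])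
  show "p m \<odot> (v \<theta> \<odot> h) = onAr D \<theta> \<odot> (w \<odot> h)"
    using Comp_assoc[OF h c(2)[OF \<theta>] p[OF \<theta>(1)]] Comp_assoc[OF h c(1) functorD(2)[OF D \<theta>(2)]] c(3)[OF \<theta>] by simp
  fix l \<gamma> assume \<gamma>: "l < n" "\<gamma> \<in> Hom Simplex m l"
  show "onAr C \<gamma> \<odot> (v \<theta> \<odot> h) = v (\<gamma> \<star> \<theta>) \<odot> h"
    using Comp_assoc[OF h c(2)[OF \<theta>] functor_uptoD(2)[OF C \<gamma>(2) \<theta>(1) \<gamma>(1)]] c(4)[OF \<theta> \<gamma>] by simp
qed

lemma latch_unique:
  assumes U: "latch_universal A C j n \<Lambda> v w" and C: "functor_upto n C" and A: "is_functor Simplex M A"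
    and j: "\<And>m. m < n \<Longrightarrow> j m \<in> Hom M (onOb A m) (onOb C m)"
    and hk: "h \<in> Hom M \<Lambda> V" "k \<in> Hom M \<Lambda> V" "h \<odot> w = k \<odot> w"
      "\<And>m \<theta>. \<lbrakk>m < n; \<theta> \<in> Hom Simplex m n\<rbrakk> \<Longrightarrow> h \<odot> v \<theta> = k \<odot> v \<theta>"
  shows "h = k"
proof -
  have "latch_cocone A C j n V (\<lambda>\<theta>. h \<odot> v \<theta>) (h \<odot> w)"
    using latch_cocone_comp[OF _ hk(1) C A j] U unfolding latch_universal_def by blast
  then have "\<exists>!k. k \<in> Hom M \<Lambda> V \<and> k \<odot> w = h \<odot> w \<and> (\<forall>m<n. \<forall>\<theta>\<in>Hom Simplex m n. k \<odot> v \<theta> = h \<odot> v \<theta>)"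
    using U unfolding latch_universal_def by blast
  with hk show ?thesis by (metis (no_types, lifting))
qed

lemma match_unique:
  assumes U: "match_universal D C p n W v w" and C: "functor_upto n C" and D: "is_functor Simplex M D"
    and p: "\<And>m. m < n \<Longrightarrow> p m \<in> Hom M (onOb C m) (onOb D m)"
    and hk: "h \<in> Hom M V W" "k \<in> Hom M V W" "w \<odot> h = w \<odot> k"
      "\<And>m \<theta>. \<lbrakk>m < n; \<theta> \<in> Hom Simplex n m\<rbrakk> \<Longrightarrow> v \<theta> \<odot> h = v \<theta> \<odot> k"
  shows "h = k"
proof -
  have "match_cone D C p n V (\<lambda>\<theta>. v \<theta> \<odot> h) (w \<odot> h)"
    using match_cone_comp[OF _ hk(1) C D p] U unfolding match_universal_def by blast
  then have "\<exists>!k. k \<in> Hom M V W \<and> w \<odot> k = w \<odot> h \<and> (\<forall>m<n. \<forall>\<theta>\<in>Hom Simplex n m. v \<theta> \<odot> k = v \<theta> \<odot> h)"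
    using U unfolding match_universal_def by blast
  with hk show ?thesis by (metis (no_types, lifting))
qed

text \<open>An equation system in the sense of \<open>equation_colimit\<close>: the unknown
  \<open>None\<close> stands for \<open>w\<close> and \<open>Some \<theta>\<close> for
  \<open>v \<theta>\<close>; the equation \<open>Inl (\<theta>, \<gamma>)\<close> is compatibility
  with \<open>\<gamma>\<close>, and \<open>Inr \<theta>\<close> is the square with
  \<open>j\<close>.\<close>

lemma latch_exists:
  assumes C: "functor_upto n C" and A: "is_functor Simplex M A"
    and j: "\<And>m. m < n \<Longrightarrow> j m \<in> Hom M (onOb A m) (onOb C m)"
  shows "\<exists>\<Lambda> v w. latch_universal A C j n \<Lambda> v w"
proof -
  note CF = functor_uptoD[OF C] and AF = functorD[OF A]
  define dm where "dm \<theta> = Dom Simplex \<theta>" for \<theta>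
  have dm: "dm \<theta> = m" if "\<theta> \<in> Hom Simplex m k" for \<theta> m k using Dom_Cod_Simplex[OF that] by (simp add: dm_def)
  define T where "T = (\<Union>m<n. Hom Simplex m n)"
  define P where "P = (\<Union>m<n. \<Union>l<n. Hom Simplex m n \<times> Hom Simplex l m)"
  define I where "I = insert None (Some ` T)"
  define E where "E = Inl ` P \<union> Inr ` T"
  define X where "X i = (case i of None \<Rightarrow> onOb A n | Some \<theta> \<Rightarrow> onOb C (dm \<theta>))" for i
  define s :: "simplex_map \<times> simplex_map + simplex_map \<Rightarrow> simplex_map option"
    where "s e = (case e of Inl (\<theta>, \<gamma>) \<Rightarrow> Some \<theta> | Inr \<theta> \<Rightarrow> Some \<theta>)" for e
  define t :: "simplex_map \<times> simplex_map + simplex_map \<Rightarrow> simplex_map option"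
    where "t e = (case e of Inl (\<theta>, \<gamma>) \<Rightarrow> Some (\<theta> \<star> \<gamma>) | Inr \<theta> \<Rightarrow> None)" for e
  define a where "a e = (case e of Inl (\<theta> :: simplex_map, \<gamma>) \<Rightarrow> onAr C \<gamma> | Inr \<theta> \<Rightarrow> j (dm \<theta>))" for e
  define b where "b e = (case e of Inl (\<theta> :: simplex_map, \<gamma>) \<Rightarrow> Ide M (onOb C (dm \<gamma>)) | Inr \<theta> \<Rightarrow> onAr A \<theta>)" for e
  define Y where "Y e = (case e of Inl (\<theta> :: simplex_map, \<gamma>) \<Rightarrow> onOb C (dm \<gamma>) | Inr \<theta> \<Rightarrow> onOb A (dm \<theta>))" for e
  have T: "\<theta> \<in> T \<longleftrightarrow> (\<exists>m<n. \<theta> \<in> Hom Simplex m n)" for \<theta> by (auto simp: T_def)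
  have P: "(\<theta>, \<gamma>) \<in> P \<longleftrightarrow> (\<exists>m<n. \<exists>l<n. \<theta> \<in> Hom Simplex m n \<and> \<gamma> \<in> Hom Simplex l m)" for \<theta> \<gamma> by (auto simp: P_def)
  have IE: "None \<in> I" "Some \<theta> \<in> I \<longleftrightarrow> \<theta> \<in> T" "Inl z \<in> E \<longleftrightarrow> z \<in> P" "Inr \<theta> \<in> E \<longleftrightarrow> \<theta> \<in> T" for \<theta> z
    by (auto simp: I_def E_def)
  have fin: "finite I" "finite E" by (simp_all add: I_def E_def T_def P_def finite_Hom_Simplex)
  have E_cases: thesis if "e \<in> E"
    "\<And>m l \<theta> \<gamma>. \<lbrakk>e = Inl (\<theta>, \<gamma>); m < n; l < n; \<theta> \<in> Hom Simplex m n; \<gamma> \<in> Hom Simplex l m\<rbrakk> \<Longrightarrow> thesis"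
    "\<And>m \<theta>. \<lbrakk>e = Inr \<theta>; m < n; \<theta> \<in> Hom Simplex m n\<rbrakk> \<Longrightarrow> thesis" for e thesis
    using that unfolding E_def T_def P_def by blast
  have X: "X i \<in> Ob M" if i: "i \<in> I" for i
  proof (cases i)
    case None then show ?thesis using AF(1) by (simp add: X_def)
  next
    case (Some \<theta>)
    then obtain m where m: "m < n" "\<theta> \<in> Hom Simplex m n" using i unfolding Some IE T by blast
    then show ?thesis using CF(1)[OF m(1)] dm[OF m(2)] Some by (simp add: X_def)
  qed
  have TC: "\<theta> \<star> \<gamma> \<in> T" if "l < n" "\<theta> \<in> Hom Simplex m n" "\<gamma> \<in> Hom Simplex l m" for l m \<theta> \<gamma>
    using Comp_Simplex_Hom[OF that(3,2)] that(1) unfolding T by blast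
  have st: "s e \<in> I" "t e \<in> I" "a e \<in> Hom M (Y e) (X (s e))" "b e \<in> Hom M (Y e) (X (t e))" if e: "e \<in> E" for e
  proof -
    show "s e \<in> I" by (rule E_cases[OF e]) (auto simp: s_def IE T)
    show "t e \<in> I" by (rule E_cases[OF e]) (auto simp: t_def IE intro: TC)
    show "a e \<in> Hom M (Y e) (X (s e))"
      by (rule E_cases[OF e]) (use CF(2) j dm in \<open>auto simp: a_def Y_def X_def s_def\<close>)
    show "b e \<in> Hom M (Y e) (X (t e))"
    proof (rule E_cases[OF e])
      fix m l \<theta> \<gamma> assume *: "e = Inl (\<theta>, \<gamma>)" "m < n" "l < n" "\<theta> \<in> Hom Simplex m n" "\<gamma> \<in> Hom Simplex l m"
      then show ?thesis using dm[OF *(5)] dm[OF Comp_Simplex_Hom[OF *(5,4)]] Ide_Hom[OF CF(1)]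
        by (simp add: b_def Y_def X_def t_def)
    next
      fix m \<theta> assume "e = Inr \<theta>" "m < n" "\<theta> \<in> Hom Simplex m n"
      then show ?thesis using AF(2) dm by (simp add: b_def Y_def X_def t_def)
    qed
  qed
  have ex: "\<exists>W w. W \<in> Ob M \<and> (\<forall>i\<in>I. w i \<in> Hom M (X i) W) \<and> (\<forall>e\<in>E. w (s e) \<odot> a e = w (t e) \<odot> b e) \<and>
    (\<forall>V v. V \<in> Ob M \<longrightarrow> (\<forall>i\<in>I. v i \<in> Hom M (X i) V) \<longrightarrow> (\<forall>e\<in>E. v (s e) \<odot> a e = v (t e) \<odot> b e) \<longrightarrow>
      (\<exists>!h. h \<in> Hom M W V \<and> (\<forall>i\<in>I. h \<odot> w i = v i)))"
    by (rule equation_colimit[where X = X and s = s and t = t and a = a and b = b and Y = Y]) (fact fin X st)+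
  obtain W w where W: "W \<in> Ob M" "\<forall>i\<in>I. w i \<in> Hom M (X i) W"
    "\<forall>e\<in>E. w (s e) \<odot> a e = w (t e) \<odot> b e"
    "\<forall>V v. V \<in> Ob M \<longrightarrow> (\<forall>i\<in>I. v i \<in> Hom M (X i) V) \<longrightarrow> (\<forall>e\<in>E. v (s e) \<odot> a e = v (t e) \<odot> b e) \<longrightarrow>
      (\<exists>!h. h \<in> Hom M W V \<and> (\<forall>i\<in>I. h \<odot> w i = v i))"
    using ex by (elim exE conjE) (rule that)
  have conv: "latch_cocone A C j n V (\<lambda>\<theta>. v (Some \<theta>)) (v None) \<longleftrightarrow>
      (\<forall>i\<in>I. v i \<in> Hom M (X i) V) \<and> (\<forall>e\<in>E. v (s e) \<odot> a e = v (t e) \<odot> b e)" for V v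
  proof
    assume "latch_cocone A C j n V (\<lambda>\<theta>. v (Some \<theta>)) (v None)"
    note c = latch_coconeD[OF this]
    have "v i \<in> Hom M (X i) V" if i: "i \<in> I" for i
    proof (cases i)
      case None then show ?thesis using c(1) by (simp add: X_def)
    next
      case (Some \<theta>)
      then obtain m where m: "m < n" "\<theta> \<in> Hom Simplex m n" using i unfolding Some IE T by blast
      then show ?thesis using c(2)[OF m] dm[OF m(2)] Some by (simp add: X_def)
    qed
    moreover have "v (s e) \<odot> a e = v (t e) \<odot> b e" if e: "e \<in> E" for e
    proof (rule E_cases[OF e])
      fix m l \<theta> \<gamma> assume *: "e = Inl (\<theta>, \<gamma>)" "m < n" "l < n" "\<theta> \<in> Hom Simplex m n" "\<gamma> \<in> Hom Simplex l m"
      then show ?thesis using dm[OF *(5)] c(4)[OF *(2,4,3,5)] Comp_Ide[OF c(2)[OF *(3) Comp_Simplex_Hom[OF *(5,4)]]]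
        by (simp add: b_def a_def s_def t_def)
    next
      fix m \<theta> assume *: "e = Inr \<theta>" "m < n" "\<theta> \<in> Hom Simplex m n"
      then show ?thesis using c(3)[OF *(2,3)] dm[OF *(3)] by (simp add: b_def a_def s_def t_def)
    qed
    ultimately show "(\<forall>i\<in>I. v i \<in> Hom M (X i) V) \<and> (\<forall>e\<in>E. v (s e) \<odot> a e = v (t e) \<odot> b e)" by blast
  next
    assume *: "(\<forall>i\<in>I. v i \<in> Hom M (X i) V) \<and> (\<forall>e\<in>E. v (s e) \<odot> a e = v (t e) \<odot> b e)"
    show "latch_cocone A C j n V (\<lambda>\<theta>. v (Some \<theta>)) (v None)"
      unfolding latch_cocone_def
    proof (intro conjI allI impI ballI)
      show "v None \<in> Hom M (onOb A n) V" using * IE(1) by (force simp: X_def)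
      have H: "v (Some \<theta>) \<in> Hom M (onOb C m) V" if "m < n" "\<theta> \<in> Hom Simplex m n" for m \<theta>
      proof -
        have "Some \<theta> \<in> I" using that by (auto simp: IE T)
        then show ?thesis using * dm[OF that(2)] by (force simp: X_def)
      qed
      fix m \<theta> assume \<theta>: "m < n" "\<theta> \<in> Hom Simplex m n"
      show "v (Some \<theta>) \<in> Hom M (onOb C m) V" by (rule H[OF \<theta>])
      have "Inr \<theta> \<in> E" using \<theta> by (auto simp: IE T)
      then have "v (s (Inr \<theta>)) \<odot> a (Inr \<theta>) = v (t (Inr \<theta>)) \<odot> b (Inr \<theta>)" using * by blast
      then show "v (Some \<theta>) \<odot> j m = v None \<odot> onAr A \<theta>"
        using dm[OF \<theta>(2)] by (simp add: s_def t_def a_def b_def)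
      fix l \<gamma> assume \<gamma>: "l < n" "\<gamma> \<in> Hom Simplex l m"
      then have "Inl (\<theta>, \<gamma>) \<in> E" using \<theta> by (auto simp: IE P)
      then have "v (s (Inl (\<theta>, \<gamma>))) \<odot> a (Inl (\<theta>, \<gamma>)) = v (t (Inl (\<theta>, \<gamma>))) \<odot> b (Inl (\<theta>, \<gamma>))" using * by blast
      then show "v (Some \<theta>) \<odot> onAr C \<gamma> = v (Some (\<theta> \<star> \<gamma>))"
        using dm[OF \<gamma>(2)] Comp_Ide[OF H[OF \<gamma>(1) Comp_Simplex_Hom[OF \<gamma>(2) \<theta>(2)]]]
        by (simp add: s_def t_def a_def b_def)
    qed
  qed
  have "latch_universal A C j n W (\<lambda>\<theta>. w (Some \<theta>)) (w None)"
    unfolding latch_universal_def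
  proof (intro conjI allI impI)
    show "latch_cocone A C j n W (\<lambda>\<theta>. w (Some \<theta>)) (w None)" using conv W(2,3) by blast
    fix V v' w' assume c: "latch_cocone A C j n V v' w'"
    define v where "v = case_option w' v'"
    have v: "latch_cocone A C j n V (\<lambda>\<theta>. v (Some \<theta>)) (v None)" using c by (simp add: v_def)
    have V: "V \<in> Ob M" using Hom_Ob(2)[OF latch_coconeD(1)[OF c]] .
    have "(\<forall>i\<in>I. h \<odot> w i = v i) \<longleftrightarrow> h \<odot> w None = w' \<and> (\<forall>m<n. \<forall>\<theta>\<in>Hom Simplex m n. h \<odot> w (Some \<theta>) = v' \<theta>)" for h
      by (auto simp: I_def T v_def)
    moreover have "\<exists>!h. h \<in> Hom M W V \<and> (\<forall>i\<in>I. h \<odot> w i = v i)"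
      using W(4) V v unfolding conv by blast
    ultimately show "\<exists>!h. h \<in> Hom M W V \<and> h \<odot> w None = w' \<and> (\<forall>m<n. \<forall>\<theta>\<in>Hom Simplex m n. h \<odot> w (Some \<theta>) = v' \<theta>)"
      by simp
  qed
  then show ?thesis by blast
qed

lemma match_exists:
  assumes C: "functor_upto n C" and D: "is_functor Simplex M D"
    and p: "\<And>m. m < n \<Longrightarrow> p m \<in> Hom M (onOb C m) (onOb D m)"
  shows "\<exists>W v w. match_universal D C p n W v w"
proof -
  note CF = functor_uptoD[OF C] and DF = functorD[OF D]
  define cd where "cd \<theta> = Cod Simplex \<theta>" for \<theta>
  have cd: "cd \<theta> = m" if "\<theta> \<in> Hom Simplex k m" for \<theta> m k using Dom_Cod_Simplex[OF that] by (simp add: cd_def)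
  define T where "T = (\<Union>m<n. Hom Simplex n m)"
  define P where "P = (\<Union>m<n. \<Union>l<n. Hom Simplex n m \<times> Hom Simplex m l)"
  define I where "I = insert None (Some ` T)"
  define E where "E = Inl ` P \<union> Inr ` T"
  define X where "X i = (case i of None \<Rightarrow> onOb D n | Some \<theta> \<Rightarrow> onOb C (cd \<theta>))" for i
  define s :: "simplex_map \<times> simplex_map + simplex_map \<Rightarrow> simplex_map option"
    where "s e = (case e of Inl (\<theta>, \<gamma>) \<Rightarrow> Some \<theta> | Inr \<theta> \<Rightarrow> Some \<theta>)" for e
  define t :: "simplex_map \<times> simplex_map + simplex_map \<Rightarrow> simplex_map option"
    where "t e = (case e of Inl (\<theta>, \<gamma>) \<Rightarrow> Some (\<gamma> \<star> \<theta>) | Inr \<theta> \<Rightarrow> None)" for e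
  define a where "a e = (case e of Inl (\<theta> :: simplex_map, \<gamma>) \<Rightarrow> onAr C \<gamma> | Inr \<theta> \<Rightarrow> p (cd \<theta>))" for e
  define b where "b e = (case e of Inl (\<theta> :: simplex_map, \<gamma>) \<Rightarrow> Ide M (onOb C (cd \<gamma>)) | Inr \<theta> \<Rightarrow> onAr D \<theta>)" for e
  define Y where "Y e = (case e of Inl (\<theta> :: simplex_map, \<gamma>) \<Rightarrow> onOb C (cd \<gamma>) | Inr \<theta> \<Rightarrow> onOb D (cd \<theta>))" for e
  have T: "\<theta> \<in> T \<longleftrightarrow> (\<exists>m<n. \<theta> \<in> Hom Simplex n m)" for \<theta> by (auto simp: T_def)
  have P: "(\<theta>, \<gamma>) \<in> P \<longleftrightarrow> (\<exists>m<n. \<exists>l<n. \<theta> \<in> Hom Simplex n m \<and> \<gamma> \<in> Hom Simplex m l)" for \<theta> \<gamma> by (auto simp: P_def)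
  have IE: "None \<in> I" "Some \<theta> \<in> I \<longleftrightarrow> \<theta> \<in> T" "Inl z \<in> E \<longleftrightarrow> z \<in> P" "Inr \<theta> \<in> E \<longleftrightarrow> \<theta> \<in> T" for \<theta> z
    by (auto simp: I_def E_def)
  have fin: "finite I" "finite E" by (simp_all add: I_def E_def T_def P_def finite_Hom_Simplex)
  have E_cases: thesis if "e \<in> E"
    "\<And>m l \<theta> \<gamma>. \<lbrakk>e = Inl (\<theta>, \<gamma>); m < n; l < n; \<theta> \<in> Hom Simplex n m; \<gamma> \<in> Hom Simplex m l\<rbrakk> \<Longrightarrow> thesis"
    "\<And>m \<theta>. \<lbrakk>e = Inr \<theta>; m < n; \<theta> \<in> Hom Simplex n m\<rbrakk> \<Longrightarrow> thesis" for e thesis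
    using that unfolding E_def T_def P_def by blast
  have X: "X i \<in> Ob M" if i: "i \<in> I" for i
  proof (cases i)
    case None then show ?thesis using DF(1) by (simp add: X_def)
  next
    case (Some \<theta>)
    then obtain m where m: "m < n" "\<theta> \<in> Hom Simplex n m" using i unfolding Some IE T by blast
    then show ?thesis using CF(1)[OF m(1)] cd[OF m(2)] Some by (simp add: X_def)
  qed
  have TC: "\<gamma> \<star> \<theta> \<in> T" if "l < n" "\<theta> \<in> Hom Simplex n m" "\<gamma> \<in> Hom Simplex m l" for l m \<theta> \<gamma>
    using Comp_Simplex_Hom[OF that(2,3)] that(1) unfolding T by blast
  have st: "s e \<in> I" "t e \<in> I" "a e \<in> Hom M (X (s e)) (Y e)" "b e \<in> Hom M (X (t e)) (Y e)" if e: "e \<in> E" for e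
  proof -
    show "s e \<in> I" by (rule E_cases[OF e]) (auto simp: s_def IE T)
    show "t e \<in> I" by (rule E_cases[OF e]) (auto simp: t_def IE intro: TC)
    show "a e \<in> Hom M (X (s e)) (Y e)"
      by (rule E_cases[OF e]) (use CF(2) p cd in \<open>auto simp: a_def Y_def X_def s_def\<close>)
    show "b e \<in> Hom M (X (t e)) (Y e)"
    proof (rule E_cases[OF e])
      fix m l \<theta> \<gamma> assume *: "e = Inl (\<theta>, \<gamma>)" "m < n" "l < n" "\<theta> \<in> Hom Simplex n m" "\<gamma> \<in> Hom Simplex m l"
      then show ?thesis using cd[OF *(5)] cd[OF Comp_Simplex_Hom[OF *(4,5)]] Ide_Hom[OF CF(1)]
        by (simp add: b_def Y_def X_def t_def)
    next
      fix m \<theta> assume "e = Inr \<theta>" "m < n" "\<theta> \<in> Hom Simplex n m"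
      then show ?thesis using DF(2) cd by (simp add: b_def Y_def X_def t_def)
    qed
  qed
  have ex: "\<exists>W w. W \<in> Ob M \<and> (\<forall>i\<in>I. w i \<in> Hom M W (X i)) \<and> (\<forall>e\<in>E. a e \<odot> w (s e) = b e \<odot> w (t e)) \<and>
    (\<forall>V v. V \<in> Ob M \<longrightarrow> (\<forall>i\<in>I. v i \<in> Hom M V (X i)) \<longrightarrow> (\<forall>e\<in>E. a e \<odot> v (s e) = b e \<odot> v (t e)) \<longrightarrow>
      (\<exists>!h. h \<in> Hom M V W \<and> (\<forall>i\<in>I. w i \<odot> h = v i)))"
    by (rule equation_limit[where X = X and s = s and t = t and a = a and b = b and Y = Y]) (fact fin X st)+
  obtain W w where W: "W \<in> Ob M" "\<forall>i\<in>I. w i \<in> Hom M W (X i)"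
    "\<forall>e\<in>E. a e \<odot> w (s e) = b e \<odot> w (t e)"
    "\<forall>V v. V \<in> Ob M \<longrightarrow> (\<forall>i\<in>I. v i \<in> Hom M V (X i)) \<longrightarrow> (\<forall>e\<in>E. a e \<odot> v (s e) = b e \<odot> v (t e)) \<longrightarrow>
      (\<exists>!h. h \<in> Hom M V W \<and> (\<forall>i\<in>I. w i \<odot> h = v i))"
    using ex by (elim exE conjE) (rule that)
  have conv: "match_cone D C p n V (\<lambda>\<theta>. v (Some \<theta>)) (v None) \<longleftrightarrow>
      (\<forall>i\<in>I. v i \<in> Hom M V (X i)) \<and> (\<forall>e\<in>E. a e \<odot> v (s e) = b e \<odot> v (t e))" for V v
  proof
    assume "match_cone D C p n V (\<lambda>\<theta>. v (Some \<theta>)) (v None)"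
    note c = match_coneD[OF this]
    have "v i \<in> Hom M V (X i)" if i: "i \<in> I" for i
    proof (cases i)
      case None then show ?thesis using c(1) by (simp add: X_def)
    next
      case (Some \<theta>)
      then obtain m where m: "m < n" "\<theta> \<in> Hom Simplex n m" using i unfolding Some IE T by blast
      then show ?thesis using c(2)[OF m] cd[OF m(2)] Some by (simp add: X_def)
    qed
    moreover have "a e \<odot> v (s e) = b e \<odot> v (t e)" if e: "e \<in> E" for e
    proof (rule E_cases[OF e])
      fix m l \<theta> \<gamma> assume *: "e = Inl (\<theta>, \<gamma>)" "m < n" "l < n" "\<theta> \<in> Hom Simplex n m" "\<gamma> \<in> Hom Simplex m l"
      then show ?thesis using cd[OF *(5)] c(4)[OF *(2,4,3,5)] Ide_Comp[OF c(2)[OF *(3) Comp_Simplex_Hom[OF *(4,5)]]]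
        by (simp add: b_def a_def s_def t_def)
    next
      fix m \<theta> assume *: "e = Inr \<theta>" "m < n" "\<theta> \<in> Hom Simplex n m"
      then show ?thesis using c(3)[OF *(2,3)] cd[OF *(3)] by (simp add: b_def a_def s_def t_def)
    qed
    ultimately show "(\<forall>i\<in>I. v i \<in> Hom M V (X i)) \<and> (\<forall>e\<in>E. a e \<odot> v (s e) = b e \<odot> v (t e))" by blast
  next
    assume *: "(\<forall>i\<in>I. v i \<in> Hom M V (X i)) \<and> (\<forall>e\<in>E. a e \<odot> v (s e) = b e \<odot> v (t e))"
    show "match_cone D C p n V (\<lambda>\<theta>. v (Some \<theta>)) (v None)"
      unfolding match_cone_def
    proof (intro conjI allI impI ballI)
      show "v None \<in> Hom M V (onOb D n)" using * IE(1) by (force simp: X_def)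
      have H: "v (Some \<theta>) \<in> Hom M V (onOb C m)" if "m < n" "\<theta> \<in> Hom Simplex n m" for m \<theta>
      proof -
        have "Some \<theta> \<in> I" using that by (auto simp: IE T)
        then show ?thesis using * cd[OF that(2)] by (force simp: X_def)
      qed
      fix m \<theta> assume \<theta>: "m < n" "\<theta> \<in> Hom Simplex n m"
      show "v (Some \<theta>) \<in> Hom M V (onOb C m)" by (rule H[OF \<theta>])
      have "Inr \<theta> \<in> E" using \<theta> by (auto simp: IE T)
      then have "a (Inr \<theta>) \<odot> v (s (Inr \<theta>)) = b (Inr \<theta>) \<odot> v (t (Inr \<theta>))" using * by blast
      then show "p m \<odot> v (Some \<theta>) = onAr D \<theta> \<odot> v None"
        using cd[OF \<theta>(2)] by (simp add: s_def t_def a_def b_def)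
      fix l \<gamma> assume \<gamma>: "l < n" "\<gamma> \<in> Hom Simplex m l"
      then have "Inl (\<theta>, \<gamma>) \<in> E" using \<theta> by (auto simp: IE P)
      then have "a (Inl (\<theta>, \<gamma>)) \<odot> v (s (Inl (\<theta>, \<gamma>))) = b (Inl (\<theta>, \<gamma>)) \<odot> v (t (Inl (\<theta>, \<gamma>)))" using * by blast
      then show "onAr C \<gamma> \<odot> v (Some \<theta>) = v (Some (\<gamma> \<star> \<theta>))"
        using cd[OF \<gamma>(2)] Ide_Comp[OF H[OF \<gamma>(1) Comp_Simplex_Hom[OF \<theta>(2) \<gamma>(2)]]]
        by (simp add: s_def t_def a_def b_def)
    qed
  qed
  have "match_universal D C p n W (\<lambda>\<theta>. w (Some \<theta>)) (w None)"
    unfolding match_universal_def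
  proof (intro conjI allI impI)
    show "match_cone D C p n W (\<lambda>\<theta>. w (Some \<theta>)) (w None)" using conv W(2,3) by blast
    fix V v' w' assume c: "match_cone D C p n V v' w'"
    define v where "v = case_option w' v'"
    have v: "match_cone D C p n V (\<lambda>\<theta>. v (Some \<theta>)) (v None)" using c by (simp add: v_def)
    have V: "V \<in> Ob M" using Hom_Ob(1)[OF match_coneD(1)[OF c]] .
    have "(\<forall>i\<in>I. w i \<odot> h = v i) \<longleftrightarrow> w None \<odot> h = w' \<and> (\<forall>m<n. \<forall>\<theta>\<in>Hom Simplex n m. w (Some \<theta>) \<odot> h = v' \<theta>)" for h
      by (auto simp: I_def T v_def)
    moreover have "\<exists>!h. h \<in> Hom M V W \<and> (\<forall>i\<in>I. w i \<odot> h = v i)"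
      using W(4) V v unfolding conv by blast
    ultimately show "\<exists>!h. h \<in> Hom M V W \<and> w None \<odot> h = w' \<and> (\<forall>m<n. \<forall>\<theta>\<in>Hom Simplex n m. w (Some \<theta>) \<odot> h = v' \<theta>)"
      by simp
  qed
  then show ?thesis by blast
qed

lemma latch_cocone_cong:
  assumes ob: "\<And>m. m < n \<Longrightarrow> onOb C' m = onOb C m"
    and ar: "\<And>l m \<gamma>. \<lbrakk>\<gamma> \<in> Hom Simplex l m; l < n; m < n\<rbrakk> \<Longrightarrow> onAr C' \<gamma> = onAr C \<gamma>"
    and j: "\<And>m. m < n \<Longrightarrow> j' m = j m"
  shows "latch_cocone A C' j' n = latch_cocone A C j n"
proof -
  have "latch_cocone A C j n V v w \<Longrightarrow> latch_cocone A C' j' n V v w"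
    if "\<And>m. m < n \<Longrightarrow> onOb C' m = onOb C m"
      "\<And>l m \<gamma>. \<lbrakk>\<gamma> \<in> Hom Simplex l m; l < n; m < n\<rbrakk> \<Longrightarrow> onAr C' \<gamma> = onAr C \<gamma>"
      "\<And>m. m < n \<Longrightarrow> j' m = j m" for C C' j j' V v w
    unfolding latch_cocone_def[of A C'] using that
    by (intro conjI allI impI ballI) (simp_all add: latch_coconeD)
  from this[of C' C j' j] this[of C C' j j'] assms show ?thesis by (intro ext) (metis (no_types, lifting))
qed

lemma match_cone_cong:
  assumes ob: "\<And>m. m < n \<Longrightarrow> onOb C' m = onOb C m"
    and ar: "\<And>l m \<gamma>. \<lbrakk>\<gamma> \<in> Hom Simplex l m; l < n; m < n\<rbrakk> \<Longrightarrow> onAr C' \<gamma> = onAr C \<gamma>"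
    and p: "\<And>m. m < n \<Longrightarrow> p' m = p m"
  shows "match_cone D C' p' n = match_cone D C p n"
proof -
  have "match_cone D C p n V v w \<Longrightarrow> match_cone D C' p' n V v w"
    if "\<And>m. m < n \<Longrightarrow> onOb C' m = onOb C m"
      "\<And>l m \<gamma>. \<lbrakk>\<gamma> \<in> Hom Simplex l m; l < n; m < n\<rbrakk> \<Longrightarrow> onAr C' \<gamma> = onAr C \<gamma>"
      "\<And>m. m < n \<Longrightarrow> p' m = p m" for C C' p p' V v w
    unfolding match_cone_def[of D C'] using that
    by (intro conjI allI impI ballI) (simp_all add: match_coneD)
  from this[of C' C p' p] this[of C C' p p'] assms show ?thesis by (intro ext) (metis (no_types, lifting))
qed

lemma rel_cof_cong:
  assumes ob: "\<And>m. m \<le> n \<Longrightarrow> onOb C' m = onOb C m"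
    and ar: "\<And>l m \<gamma>. \<lbrakk>\<gamma> \<in> Hom Simplex l m; l \<le> n; m \<le> n\<rbrakk> \<Longrightarrow> onAr C' \<gamma> = onAr C \<gamma>"
    and j: "\<And>m. m \<le> n \<Longrightarrow> j' m = j m" and rc: "rel_cof A C j n"
  shows "rel_cof A C' j' n"
proof -
  have c: "latch_cocone A C' j' n = latch_cocone A C j n"
    by (rule latch_cocone_cong) (simp_all add: ob j ar)
  obtain \<Lambda> v w a where *: "latch_universal A C j n \<Lambda> v w" "a \<in> cof M" "a \<in> Hom M \<Lambda> (onOb C n)" "a \<odot> w = j n"
    "\<And>m \<theta>. \<lbrakk>m < n; \<theta> \<in> Hom Simplex m n\<rbrakk> \<Longrightarrow> a \<odot> v \<theta> = onAr C \<theta>"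
    using rc unfolding rel_cof_def by blast
  then have "latch_universal A C' j' n \<Lambda> v w" "a \<in> Hom M \<Lambda> (onOb C' n)" "a \<odot> w = j' n"
    using ob[of n] j[of n] unfolding latch_universal_def c by simp_all
  moreover have "a \<odot> v \<theta> = onAr C' \<theta>" if "m < n" "\<theta> \<in> Hom Simplex m n" for m \<theta>
    using *(5)[OF that] ar[OF that(2)] that(1) by simp
  ultimately show ?thesis unfolding rel_cof_def using *(2) by blast
qed

lemma rel_fib_cong:
  assumes ob: "\<And>m. m \<le> n \<Longrightarrow> onOb C' m = onOb C m"
    and ar: "\<And>l m \<gamma>. \<lbrakk>\<gamma> \<in> Hom Simplex l m; l \<le> n; m \<le> n\<rbrakk> \<Longrightarrow> onAr C' \<gamma> = onAr C \<gamma>"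
    and p: "\<And>m. m \<le> n \<Longrightarrow> p' m = p m" and rf: "rel_fib D C p n"
  shows "rel_fib D C' p' n"
proof -
  have c: "match_cone D C' p' n = match_cone D C p n"
    by (rule match_cone_cong) (simp_all add: ob p ar)
  obtain W v w b where *: "match_universal D C p n W v w" "b \<in> tfib" "b \<in> Hom M (onOb C n) W" "w \<odot> b = p n"
    "\<And>m \<theta>. \<lbrakk>m < n; \<theta> \<in> Hom Simplex n m\<rbrakk> \<Longrightarrow> v \<theta> \<odot> b = onAr C \<theta>"
    using rf unfolding rel_fib_def by blast
  then have "match_universal D C' p' n W v w" "b \<in> Hom M (onOb C' n) W" "w \<odot> b = p' n"
    using ob[of n] p[of n] unfolding match_universal_def c by simp_all
  moreover have "v \<theta> \<odot> b = onAr C' \<theta>" if "m < n" "\<theta> \<in> Hom Simplex n m" for m \<theta>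
    using *(5)[OF that] ar[OF that(2)] that(1) by simp
  ultimately show ?thesis unfolding rel_fib_def using *(2) by blast
qed

lemma functor_upto_cong:
  assumes C: "functor_upto N C" and ob: "\<And>m. m < N \<Longrightarrow> onOb C' m = onOb C m"
    and ar: "\<And>l m \<gamma>. \<lbrakk>\<gamma> \<in> Hom Simplex l m; l < N; m < N\<rbrakk> \<Longrightarrow> onAr C' \<gamma> = onAr C \<gamma>"
  shows "functor_upto N C'"
  unfolding functor_upto_def
proof (intro conjI allI impI ballI)
  note F = functor_uptoD[OF C]
  fix l m n \<alpha> \<beta>
  assume *: "l < N" "m < N" "n < N" "\<alpha> \<in> Hom Simplex l m" "\<beta> \<in> Hom Simplex m n"
  show "onAr C' (\<beta> \<star> \<alpha>) = onAr C' \<beta> \<odot> onAr C' \<alpha>"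
    using F(4)[OF *(4,5,1-3)] ar[OF *(4,1,2)] ar[OF *(5,2,3)] ar[OF Comp_Simplex_Hom[OF *(4,5)] *(1,3)] by simp
qed (simp_all add: ob ar[OF Ide_Simplex_Hom] ar functor_uptoD[OF C])

lemma nat_upto_cong:
  assumes C: "nat_upto N A C j" and ob: "\<And>m. m < N \<Longrightarrow> onOb C' m = onOb C m \<and> onOb A' m = onOb A m \<and> j' m = j m"
    and ar: "\<And>l m \<gamma>. \<lbrakk>\<gamma> \<in> Hom Simplex l m; l < N; m < N\<rbrakk> \<Longrightarrow> onAr C' \<gamma> = onAr C \<gamma> \<and> onAr A' \<gamma> = onAr A \<gamma>"
  shows "nat_upto N A' C' j'"
  unfolding nat_upto_def
proof (intro conjI allI impI ballI)
  show "j' n \<in> Hom M (onOb A' n) (onOb C' n)" if "n < N" for n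
    using nat_uptoD(1)[OF C that] ob[OF that] by simp
  fix m n \<alpha> assume *: "m < N" "n < N" "\<alpha> \<in> Hom Simplex m n"
  show "onAr C' \<alpha> \<odot> j' m = j' n \<odot> onAr A' \<alpha>"
    using nat_uptoD(2)[OF C *(3,1,2)] ob[OF *(1)] ob[OF *(2)] ar[OF *(3,1,2)] by simp
qed

section \<open>The Reedy factorization and lifting theorems\<close>

definition Reedy_stage where
  "Reedy_stage A D q N C j p \<longleftrightarrow> functor_upto N C \<and> nat_upto N A C j \<and> nat_upto N C D p \<and>
    (\<forall>n<N. p n \<odot> j n = q n \<and> rel_cof A C j n \<and> rel_fib D C p n)"

lemma Reedy_stage_cong:
  assumes R: "Reedy_stage A D q N C j p" and ob: "\<And>m. m < N \<Longrightarrow> onOb C' m = onOb C m \<and> j' m = j m \<and> p' m = p m"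
    and ar: "\<And>l m \<gamma>. \<lbrakk>\<gamma> \<in> Hom Simplex l m; l < N; m < N\<rbrakk> \<Longrightarrow> onAr C' \<gamma> = onAr C \<gamma>"
  shows "Reedy_stage A D q N C' j' p'"
proof -
  have "functor_upto N C'" by (rule functor_upto_cong[where C = C]) (use R ob ar in \<open>auto simp: Reedy_stage_def\<close>)
  moreover have "nat_upto N A C' j'"
    by (rule nat_upto_cong[where C = C and A = A and j = j]) (use R ob ar in \<open>auto simp: Reedy_stage_def\<close>)
  moreover have "nat_upto N C' D p'"
    by (rule nat_upto_cong[where C = D and A = C and j = p]) (use R ob ar in \<open>auto simp: Reedy_stage_def\<close>)
  moreover have "p' n \<odot> j' n = q n \<and> rel_cof A C' j' n \<and> rel_fib D C' p' n" if n: "n < N" for n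
  proof (intro conjI)
    have *: "p n \<odot> j n = q n" "rel_cof A C j n" "rel_fib D C p n" using R n by (simp_all add: Reedy_stage_def)
    show "p' n \<odot> j' n = q n" using * ob[OF n] by simp
    show "rel_cof A C' j' n" by (rule rel_cof_cong[OF _ _ _ *(2)]) (use ob ar n in simp_all)
    show "rel_fib D C' p' n" by (rule rel_fib_cong[OF _ _ _ *(3)]) (use ob ar n in simp_all)
  qed
  ultimately show ?thesis by (simp add: Reedy_stage_def)
qed

text \<open>In degree \<open>N\<close> the relative latching object \<open>\<Lambda>\<close> maps
  canonically to the relative matching object \<open>W\<close>. A factorization of this map
  \<open>c\<close> into a cofibration \<open>a\<close> and a trivial fibration \<open>b\<close> has
  the new object \<open>E\<close> in the middle, and all new arrows are composites with
  \<open>a\<close> or \<open>b\<close>.\<close>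

lemma Reedy_stage_Suc:
  assumes A: "is_functor Simplex M A" and D: "is_functor Simplex M D" and q: "nat_trans Simplex M A D q"
    and R: "Reedy_stage A D q N C j p"
  shows "\<exists>C' j' p'. Reedy_stage A D q (Suc N) C' j' p' \<and>
    (\<forall>m<N. onOb C' m = onOb C m \<and> j' m = j m \<and> p' m = p m) \<and>
    (\<forall>m<N. \<forall>n<N. \<forall>\<gamma>\<in>Hom Simplex m n. onAr C' \<gamma> = onAr C \<gamma>)"
proof -
  note AF = functorD[OF A] and DF = functorD[OF D] and qN = natD[OF q]
  have C: "functor_upto N C" and j: "nat_upto N A C j" and p: "nat_upto N C D p"
    using R by (simp_all add: Reedy_stage_def)
  note CF = functor_uptoD[OF C]
  note jN = nat_uptoD[OF j] and pN = nat_uptoD[OF p]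
  have pj: "p n \<odot> j n = q n" if "n < N" for n using R that by (simp add: Reedy_stage_def)
  obtain \<Lambda> v l where \<Lambda>: "latch_universal A C j N \<Lambda> v l" using latch_exists[OF C A jN(1)] by blast
  then have cc: "latch_cocone A C j N \<Lambda> v l" by (simp add: latch_universal_def)
  note vl = latch_coconeD[OF cc]
  obtain W y w where W: "match_universal D C p N W y w" using match_exists[OF C D pN(1)] by blast
  then have cy: "match_cone D C p N W y w" by (simp add: match_universal_def)
  note yw = match_coneD[OF cy]
  \<comment> \<open>For a map \<open>\<theta>\<close> from \<open>[N]\<close> to a lower
    \<open>[m]\<close>, the universal property of \<open>\<Lambda>\<close> gives an arrow to
    \<open>onOb C m\<close>. These arrows, later called \<open>r \<theta>\<close>, and
    \<open>w'\<close> form the cone that defines \<open>c\<close>.\<close>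
  have "\<exists>h. h \<in> Hom M \<Lambda> (onOb C m) \<and> h \<odot> l = j m \<odot> onAr A \<theta> \<and>
      (\<forall>k<N. \<forall>\<tau>\<in>Hom Simplex k N. h \<odot> v \<tau> = onAr C (\<theta> \<star> \<tau>))"
    if m: "m < N" and \<theta>: "\<theta> \<in> Hom Simplex N m" for m \<theta>
  proof -
    have "latch_cocone A C j N (onOb C m) (\<lambda>\<tau>. onAr C (\<theta> \<star> \<tau>)) (j m \<odot> onAr A \<theta>)"
      unfolding latch_cocone_def
    proof (intro conjI allI impI ballI)
      show "j m \<odot> onAr A \<theta> \<in> Hom M (onOb A N) (onOb C m)" by (rule Comp_Hom[OF AF(2)[OF \<theta>] jN(1)[OF m]])
      fix k \<tau> assume k: "k < N" "\<tau> \<in> Hom Simplex k N"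
      note \<theta>\<tau> = Comp_Simplex_Hom[OF k(2) \<theta>]
      show "onAr C (\<theta> \<star> \<tau>) \<in> Hom M (onOb C k) (onOb C m)" by (rule CF(2)[OF \<theta>\<tau> k(1) m])
      show "onAr C (\<theta> \<star> \<tau>) \<odot> j k = j m \<odot> onAr A \<theta> \<odot> onAr A \<tau>"
        using jN(2)[OF \<theta>\<tau> k(1) m] AF(4)[OF k(2) \<theta>] Comp_assoc[OF AF(2)[OF k(2)] AF(2)[OF \<theta>] jN(1)[OF m]] by simp
      fix i \<gamma> assume i: "i < N" "\<gamma> \<in> Hom Simplex i k"
      show "onAr C (\<theta> \<star> \<tau>) \<odot> onAr C \<gamma> = onAr C (\<theta> \<star> (\<tau> \<star> \<gamma>))"
        using CF(4)[OF i(2) \<theta>\<tau> i(1) k(1) m] Simplex.Comp_assoc[OF i(2) k(2) \<theta>] by simp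
    qed
    from latch_universal_obtain[OF \<Lambda> this] show ?thesis by metis
  qed
  note ex = this
  define r where "r \<theta> = (SOME h. h \<in> Hom M \<Lambda> (onOb C (Cod Simplex \<theta>)) \<and> h \<odot> l = j (Cod Simplex \<theta>) \<odot> onAr A \<theta> \<and>
      (\<forall>k<N. \<forall>\<tau>\<in>Hom Simplex k N. h \<odot> v \<tau> = onAr C (\<theta> \<star> \<tau>)))" for \<theta>
  have "r \<theta> \<in> Hom M \<Lambda> (onOb C m) \<and> r \<theta> \<odot> l = j m \<odot> onAr A \<theta> \<and>
      (\<forall>k<N. \<forall>\<tau>\<in>Hom Simplex k N. r \<theta> \<odot> v \<tau> = onAr C (\<theta> \<star> \<tau>))"
    if m: "m < N" and \<theta>: "\<theta> \<in> Hom Simplex N m" for m \<theta>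
  proof -
    have "Cod Simplex \<theta> = m" using Dom_Cod_Simplex[OF \<theta>] by simp
    with someI_ex[OF ex[OF m \<theta>]] show ?thesis unfolding r_def by simp
  qed
  then have r: "\<And>m \<theta>. \<lbrakk>m < N; \<theta> \<in> Hom Simplex N m\<rbrakk> \<Longrightarrow> r \<theta> \<in> Hom M \<Lambda> (onOb C m)"
    "\<And>m \<theta>. \<lbrakk>m < N; \<theta> \<in> Hom Simplex N m\<rbrakk> \<Longrightarrow> r \<theta> \<odot> l = j m \<odot> onAr A \<theta>"
    "\<And>m \<theta> k \<tau>. \<lbrakk>m < N; \<theta> \<in> Hom Simplex N m; k < N; \<tau> \<in> Hom Simplex k N\<rbrakk> \<Longrightarrow> r \<theta> \<odot> v \<tau> = onAr C (\<theta> \<star> \<tau>)"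
    by blast+
  have "latch_cocone A C j N (onOb D N) (\<lambda>\<tau>. onAr D \<tau> \<odot> p (Dom Simplex \<tau>)) (q N)"
    unfolding latch_cocone_def
  proof (intro conjI allI impI ballI qN(1))
    fix k \<tau> assume k: "k < N" "\<tau> \<in> Hom Simplex k N"
    have [simp]: "Dom Simplex \<tau> = k" using Dom_Cod_Simplex[OF k(2)] by simp
    show "onAr D \<tau> \<odot> p (Dom Simplex \<tau>) \<in> Hom M (onOb C k) (onOb D N)"
      using Comp_Hom[OF pN(1)[OF k(1)] DF(2)[OF k(2)]] by simp
    show "onAr D \<tau> \<odot> p (Dom Simplex \<tau>) \<odot> j k = q N \<odot> onAr A \<tau>"
      using Comp_assoc[OF jN(1)[OF k(1)] pN(1)[OF k(1)] DF(2)[OF k(2)]] pj[OF k(1)] qN(2)[OF k(2)] by simp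
    fix i \<gamma> assume i: "i < N" "\<gamma> \<in> Hom Simplex i k"
    have "Dom Simplex (\<tau> \<star> \<gamma>) = i" using Dom_Cod_Simplex[OF Comp_Simplex_Hom[OF i(2) k(2)]] by simp
    then show "onAr D \<tau> \<odot> p (Dom Simplex \<tau>) \<odot> onAr C \<gamma> =
        onAr D (\<tau> \<star> \<gamma>) \<odot> p (Dom Simplex (\<tau> \<star> \<gamma>))"
      using Comp_assoc[OF CF(2)[OF i(2,1) k(1)] pN(1)[OF k(1)] DF(2)[OF k(2)]] pN(2)[OF i(2,1) k(1)]
        Comp_assoc[OF pN(1)[OF i(1)] DF(2)[OF i(2)] DF(2)[OF k(2)]] DF(4)[OF i(2) k(2)] by simp
  qed
  from latch_universal_obtain[OF \<Lambda> this]
  obtain w' where w': "w' \<in> Hom M \<Lambda> (onOb D N)" "w' \<odot> l = q N"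
    "\<And>k \<tau>. \<lbrakk>k < N; \<tau> \<in> Hom Simplex k N\<rbrakk> \<Longrightarrow> w' \<odot> v \<tau> = onAr D \<tau> \<odot> p (Dom Simplex \<tau>)" by metis
  have w'v: "w' \<odot> v \<tau> = onAr D \<tau> \<odot> p k" if "k < N" "\<tau> \<in> Hom Simplex k N" for k \<tau>
    using w'(3)[OF that] Dom_Cod_Simplex[OF that(2)] by simp
  have "match_cone D C p N \<Lambda> r w'"
    unfolding match_cone_def
  proof (intro conjI allI impI ballI w'(1))
    fix m \<theta> assume \<theta>: "m < N" "\<theta> \<in> Hom Simplex N m"
    show "r \<theta> \<in> Hom M \<Lambda> (onOb C m)" by (rule r(1)[OF \<theta>])
    note pr = Comp_Hom[OF r(1)[OF \<theta>] pN(1)[OF \<theta>(1)]] and Dw = Comp_Hom[OF w'(1) DF(2)[OF \<theta>(2)]]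
    show "p m \<odot> r \<theta> = onAr D \<theta> \<odot> w'"
    proof (rule latch_unique[OF \<Lambda> C A jN(1) pr Dw])
      show "p m \<odot> r \<theta> \<odot> l = onAr D \<theta> \<odot> w' \<odot> l"
        using Comp_assoc[OF vl(1) r(1)[OF \<theta>] pN(1)[OF \<theta>(1)]] r(2)[OF \<theta>]
          Comp_assoc[OF AF(2)[OF \<theta>(2)] jN(1)[OF \<theta>(1)] pN(1)[OF \<theta>(1)]] pj[OF \<theta>(1)]
          Comp_assoc[OF vl(1) w'(1) DF(2)[OF \<theta>(2)]] w'(2) qN(2)[OF \<theta>(2)] by simp
      fix k \<tau> assume k: "k < N" "\<tau> \<in> Hom Simplex k N"
      show "p m \<odot> r \<theta> \<odot> v \<tau> = onAr D \<theta> \<odot> w' \<odot> v \<tau>"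
        using Comp_assoc[OF vl(2)[OF k] r(1)[OF \<theta>] pN(1)[OF \<theta>(1)]] r(3)[OF \<theta> k]
          Comp_assoc[OF vl(2)[OF k] w'(1) DF(2)[OF \<theta>(2)]] w'v[OF k] pN(2)[OF Comp_Simplex_Hom[OF k(2) \<theta>(2)] k(1) \<theta>(1)]
          Comp_assoc[OF pN(1)[OF k(1)] DF(2)[OF k(2)] DF(2)[OF \<theta>(2)]] DF(4)[OF k(2) \<theta>(2)] by simp
    qed
    fix i \<gamma> assume i: "i < N" "\<gamma> \<in> Hom Simplex m i"
    note \<gamma>\<theta> = Comp_Simplex_Hom[OF \<theta>(2) i(2)]
    note C\<gamma> = CF(2)[OF i(2) \<theta>(1) i(1)]
    note Cr = Comp_Hom[OF r(1)[OF \<theta>] C\<gamma>]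
    show "onAr C \<gamma> \<odot> r \<theta> = r (\<gamma> \<star> \<theta>)"
    proof (rule latch_unique[OF \<Lambda> C A jN(1) Cr r(1)[OF i(1) \<gamma>\<theta>]])
      show "onAr C \<gamma> \<odot> r \<theta> \<odot> l = r (\<gamma> \<star> \<theta>) \<odot> l"
        using Comp_assoc[OF vl(1) r(1)[OF \<theta>] C\<gamma>] r(2)[OF \<theta>] r(2)[OF i(1) \<gamma>\<theta>] jN(2)[OF i(2) \<theta>(1) i(1)]
          Comp_assoc[OF AF(2)[OF \<theta>(2)] jN(1)[OF \<theta>(1)] C\<gamma>] AF(4)[OF \<theta>(2) i(2)]
          Comp_assoc[OF AF(2)[OF \<theta>(2)] AF(2)[OF i(2)] jN(1)[OF i(1)]] by simp
      fix k \<tau> assume k: "k < N" "\<tau> \<in> Hom Simplex k N"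
      show "onAr C \<gamma> \<odot> r \<theta> \<odot> v \<tau> = r (\<gamma> \<star> \<theta>) \<odot> v \<tau>"
        using Comp_assoc[OF vl(2)[OF k] r(1)[OF \<theta>] C\<gamma>] r(3)[OF \<theta> k] r(3)[OF i(1) \<gamma>\<theta> k]
          CF(4)[OF Comp_Simplex_Hom[OF k(2) \<theta>(2)] i(2) k(1) \<theta>(1) i(1)] Simplex.Comp_assoc[OF k(2) \<theta>(2) i(2)] by simp
    qed
  qed
  from match_universal_obtain[OF W this]
  obtain c where c: "c \<in> Hom M \<Lambda> W" "w \<odot> c = w'" "\<And>m \<theta>. \<lbrakk>m < N; \<theta> \<in> Hom Simplex N m\<rbrakk> \<Longrightarrow> y \<theta> \<odot> c = r \<theta>"
    by metis
  obtain E a b where ab: "a \<in> Hom M \<Lambda> E" "b \<in> Hom M E W" "a \<in> cof M" "b \<in> tfib" "b \<odot> a = c"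
    by (rule factor_cof_obtain[OF c(1)])
  have ba: "x \<odot> b \<odot> (a \<odot> z) = x \<odot> c \<odot> z" if "x \<in> Hom M W X" "z \<in> Hom M Z \<Lambda>" for x z X Z
    using Comp_assoc[OF Comp_Hom[OF that(2) ab(1)] ab(2) that(1)] Comp_assoc[OF that(2) ab(1,2)]
      Comp_assoc[OF that(2) c(1) that(1)] ab(5) by simp
  define u where "u \<tau> = a \<odot> v \<tau>" for \<tau>
  define d where "d \<theta> = y \<theta> \<odot> b" for \<theta>
  have u: "u \<tau> \<in> Hom M (onOb C k) E" if "k < N" "\<tau> \<in> Hom Simplex k N" for k \<tau>
    unfolding u_def by (rule Comp_Hom[OF vl(2)[OF that] ab(1)])
  have d: "d \<theta> \<in> Hom M E (onOb C m)" if "m < N" "\<theta> \<in> Hom Simplex N m" for m \<theta>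
    unfolding d_def by (rule Comp_Hom[OF ab(2) yw(2)[OF that]])
  have du: "d \<theta> \<odot> u \<tau> = onAr C (\<theta> \<star> \<tau>)"
    if "m < N" "\<theta> \<in> Hom Simplex N m" "k < N" "\<tau> \<in> Hom Simplex k N" for m \<theta> k \<tau>
    unfolding d_def u_def ba[OF yw(2)[OF that(1,2)] vl(2)[OF that(3,4)]] c(3)[OF that(1,2)] by (rule r(3)[OF that])
  have uC: "u \<tau> \<odot> onAr C \<gamma> = u (\<tau> \<star> \<gamma>)"
    if "m < N" "\<tau> \<in> Hom Simplex m N" "k < N" "\<gamma> \<in> Hom Simplex k m" for k m \<tau> \<gamma>
    unfolding u_def using Comp_assoc[OF CF(2)[OF that(4,3,1)] vl(2)[OF that(1,2)] ab(1)] vl(4)[OF that] by simp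
  have Cd: "onAr C \<gamma> \<odot> d \<theta> = d (\<gamma> \<star> \<theta>)"
    if "m < N" "\<theta> \<in> Hom Simplex N m" "k < N" "\<gamma> \<in> Hom Simplex m k" for k m \<theta> \<gamma>
    unfolding d_def using Comp_assoc[OF ab(2) yw(2)[OF that(1,2)] CF(2)[OF that(4,1,3)]] yw(4)[OF that] by simp
  obtain C' where C': "functor_upto (Suc N) C'" "onOb C' N = E" "\<And>m. m < N \<Longrightarrow> onOb C' m = onOb C m"
    "\<And>m n \<alpha>. \<lbrakk>\<alpha> \<in> Hom Simplex m n; m < N; n < N\<rbrakk> \<Longrightarrow> onAr C' \<alpha> = onAr C \<alpha>"
    "\<And>m \<tau>. \<lbrakk>\<tau> \<in> Hom Simplex m N; m < N\<rbrakk> \<Longrightarrow> onAr C' \<tau> = u \<tau>"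
    "\<And>m \<theta>. \<lbrakk>\<theta> \<in> Hom Simplex N m; m < N\<rbrakk> \<Longrightarrow> onAr C' \<theta> = d \<theta>"
    by (rule functor_extend[of N C E u d, OF C Hom_Ob(2)[OF ab(1)] u d uC Cd du]) (assumption+, rule that)
  define j' where "j' = j(N := a \<odot> l)"
  define p' where "p' = p(N := w \<odot> b)"
  have jp: "j' N = a \<odot> l" "p' N = w \<odot> b" "\<And>m. m < N \<Longrightarrow> j' m = j m" "\<And>m. m < N \<Longrightarrow> p' m = p m"
    by (simp_all add: j'_def p'_def)
  have al: "a \<odot> l \<in> Hom M (onOb A N) E" and wb: "w \<odot> b \<in> Hom M E (onOb D N)"
    using Comp_Hom[OF vl(1) ab(1)] Comp_Hom[OF ab(2) yw(1)] by auto
  have fA: "functor_upto (Suc N) A" and fD: "functor_upto (Suc N) D"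
    using A D functor_upto_iff by blast+
  have "nat_upto (Suc N) A C' j'"
  proof (rule nat_upto_Suc[OF fA C'(1)])
    show "nat_upto N A C' j'" by (rule nat_upto_cong[OF j]) (simp_all add: C'(3,4) jp)
    show "j' N \<in> Hom M (onOb A N) (onOb C' N)" using al by (simp add: jp C'(2))
    show "onAr C' \<tau> \<odot> j' k = j' N \<odot> onAr A \<tau>" if k: "k < N" "\<tau> \<in> Hom Simplex k N" for k \<tau>
      using Comp_assoc[OF jN(1)[OF k(1)] vl(2)[OF k] ab(1)] vl(3)[OF k] Comp_assoc[OF AF(2)[OF k(2)] vl(1) ab(1)]
      by (simp add: jp C'(5)[OF k(2,1)] u_def k)
    show "onAr C' \<theta> \<odot> j' N = j' m \<odot> onAr A \<theta>" if m: "m < N" "\<theta> \<in> Hom Simplex N m" for m \<theta>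
      using ba[OF yw(2)[OF m] vl(1)] c(3)[OF m] r(2)[OF m] by (simp add: jp C'(6)[OF m(2,1)] d_def m)
  qed
  moreover have "nat_upto (Suc N) C' D p'"
  proof (rule nat_upto_Suc[OF C'(1) fD])
    show "nat_upto N C' D p'" by (rule nat_upto_cong[OF p]) (simp_all add: C'(3,4) jp)
    show "p' N \<in> Hom M (onOb C' N) (onOb D N)" using wb by (simp add: jp C'(2))
    show "onAr D \<tau> \<odot> p' k = p' N \<odot> onAr C' \<tau>" if k: "k < N" "\<tau> \<in> Hom Simplex k N" for k \<tau>
      using ba[OF yw(1) vl(2)[OF k]] c(2) w'v[OF k] by (simp add: jp C'(5)[OF k(2,1)] u_def k)
    show "onAr D \<theta> \<odot> p' N = p' m \<odot> onAr C' \<theta>" if m: "m < N" "\<theta> \<in> Hom Simplex N m" for m \<theta>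
      using Comp_assoc[OF ab(2) yw(1) DF(2)[OF m(2)]] yw(3)[OF m] Comp_assoc[OF ab(2) yw(2)[OF m] pN(1)[OF m(1)]]
      by (simp add: jp C'(6)[OF m(2,1)] d_def m)
  qed
  moreover have "p' n \<odot> j' n = q n \<and> rel_cof A C' j' n \<and> rel_fib D C' p' n" if n: "n < Suc N" for n
  proof (cases "n = N")
    case True
    have "p' N \<odot> j' N = q N" using ba[OF yw(1) vl(1)] c(2) w'(2) by (simp add: jp)
    moreover have "rel_cof A C' j' N"
    proof -
      have "latch_cocone A C' j' N = latch_cocone A C j N"
        by (rule latch_cocone_cong) (simp_all add: C'(3,4) jp)
      then have "latch_universal A C' j' N \<Lambda> v l" using \<Lambda> unfolding latch_universal_def by simp
      moreover have "a \<in> Hom M \<Lambda> (onOb C' N)" using ab(1) C'(2) by simp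
      moreover have "a \<odot> v \<theta> = onAr C' \<theta>" if "m < N" "\<theta> \<in> Hom Simplex m N" for m \<theta>
        using C'(5)[OF that(2,1)] by (simp add: u_def)
      ultimately show ?thesis unfolding rel_cof_def using ab(3) jp(1)[symmetric] by blast
    qed
    moreover have "rel_fib D C' p' N"
    proof -
      have "match_cone D C' p' N = match_cone D C p N"
        by (rule match_cone_cong) (simp_all add: C'(3,4) jp)
      then have "match_universal D C' p' N W y w" using W unfolding match_universal_def by simp
      moreover have "b \<in> Hom M (onOb C' N) W" using ab(2) C'(2) by simp
      moreover have "y \<theta> \<odot> b = onAr C' \<theta>" if "m < N" "\<theta> \<in> Hom Simplex N m" for m \<theta>
        using C'(6)[OF that(2,1)] by (simp add: d_def)
      ultimately show ?thesis unfolding rel_fib_def using ab(4) jp(2)[symmetric] by blast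
    qed
    ultimately show ?thesis using True by simp
  next
    case False
    then have n: "n < N" using n by simp
    have *: "p n \<odot> j n = q n" "rel_cof A C j n" "rel_fib D C p n" using R n by (simp_all add: Reedy_stage_def)
    have "rel_cof A C' j' n" by (rule rel_cof_cong[OF _ _ _ *(2)]) (use n in \<open>simp_all add: C'(3,4) jp\<close>)
    moreover have "rel_fib D C' p' n" by (rule rel_fib_cong[OF _ _ _ *(3)]) (use n in \<open>simp_all add: C'(3,4) jp\<close>)
    ultimately show ?thesis using *(1) n by (simp add: jp)
  qed
  ultimately have "Reedy_stage A D q (Suc N) C' j' p'" using C'(1) by (simp add: Reedy_stage_def)
  then show ?thesis using C'(3,4) jp(3,4) by (intro exI[of _ C'] exI[of _ j'] exI[of _ p']) simp
qed

theorem Reedy_factorization: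
  assumes A: "is_functor Simplex M A" and D: "is_functor Simplex M D" and q: "nat_trans Simplex M A D q"
  obtains C j p where "is_functor Simplex M C" "nat_trans Simplex M A C j" "nat_trans Simplex M C D p"
    "\<And>n. p n \<odot> j n = q n" "\<And>n. rel_cof A C j n" "\<And>n. rel_fib D C p n"
proof -
  \<comment> \<open>The data of degree \<open>n\<close> are packed into a tuple. Arrows are stored
    at the larger of their two degrees, so that sequences which agree below \<open>N\<close> have
    the same truncation, as \<open>stage_glue\<close> requires.\<close>
  define Co where "Co h = \<lparr>onOb = (\<lambda>n. fst (h n)),
    onAr = (\<lambda>\<alpha>. fst (snd (h (max (Dom Simplex \<alpha>) (Cod Simplex \<alpha>)))) \<alpha>)\<rparr>"
    for h :: "nat \<Rightarrow> 'o \<times> (simplex_map \<Rightarrow> 'm) \<times> 'm \<times> 'm"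
  define jo where "jo h n = fst (snd (snd (h n)))" for h :: "nat \<Rightarrow> 'o \<times> (simplex_map \<Rightarrow> 'm) \<times> 'm \<times> 'm" and n
  define po where "po h n = snd (snd (snd (h n)))" for h :: "nat \<Rightarrow> 'o \<times> (simplex_map \<Rightarrow> 'm) \<times> 'm \<times> 'm" and n
  have Co_ar: "onAr (Co h) \<gamma> = fst (snd (h (max l m))) \<gamma>" if "\<gamma> \<in> Hom Simplex l m" for h \<gamma> l m
    using Dom_Cod_Simplex[OF that] by (simp add: Co_def)
  have "\<exists>h. \<forall>N. Reedy_stage A D q N (Co h) (jo h) (po h)"
  proof (rule stage_glue)
    show "Reedy_stage A D q 0 (Co undefined) (jo undefined) (po undefined)"
      by (simp add: Reedy_stage_def functor_upto_def nat_upto_def)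
    fix N and h h' :: "nat \<Rightarrow> 'o \<times> (simplex_map \<Rightarrow> 'm) \<times> 'm \<times> 'm"
    assume R: "Reedy_stage A D q N (Co h) (jo h) (po h)"
    show "Reedy_stage A D q N (Co h') (jo h') (po h')" if "\<And>k. k < N \<Longrightarrow> h' k = h k"
      by (rule Reedy_stage_cong[OF R]) (simp_all add: that Co_ar, simp add: Co_def jo_def po_def that)
    from Reedy_stage_Suc[OF A D q R]
    obtain C' j' p' where C': "Reedy_stage A D q (Suc N) C' j' p'"
      "\<And>m. m < N \<Longrightarrow> onOb C' m = onOb (Co h) m \<and> j' m = jo h m \<and> p' m = po h m"
      "\<And>m n \<gamma>. \<lbrakk>\<gamma> \<in> Hom Simplex m n; m < N; n < N\<rbrakk> \<Longrightarrow> onAr C' \<gamma> = onAr (Co h) \<gamma>" by blast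
    define g where "g = h(N := (onOb C' N, onAr C', j' N, p' N))"
    have "Reedy_stage A D q (Suc N) (Co g) (jo g) (po g)"
    proof (rule Reedy_stage_cong[OF C'(1)])
      show "onOb (Co g) m = onOb C' m \<and> jo g m = j' m \<and> po g m = p' m" if "m < Suc N" for m
        using that C'(2)[of m] by (cases "m = N") (auto simp: g_def Co_def jo_def po_def)
      fix l m \<gamma> assume *: "\<gamma> \<in> Hom Simplex l m" "l < Suc N" "m < Suc N"
      show "onAr (Co g) \<gamma> = onAr C' \<gamma>"
      proof (cases "l = N \<or> m = N")
        case True
        then have "max l m = N" using * by auto
        then show ?thesis unfolding Co_ar[OF *(1)] by (simp add: g_def)
      next
        case False
        then have "l < N" "m < N" using * by auto
        then show ?thesis using C'(3)[OF *(1)] unfolding Co_ar[OF *(1)] by (simp add: g_def)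
      qed
    qed
    then show "\<exists>h'. Reedy_stage A D q (Suc N) (Co h') (jo h') (po h') \<and> (\<forall>k<N. h' k = h k)"
      by (intro exI[of _ g]) (simp add: g_def)
  qed
  then obtain h where h: "\<And>N. Reedy_stage A D q N (Co h) (jo h) (po h)" by blast
  show thesis
  proof (rule that[of "Co h" "jo h" "po h"])
    show "is_functor Simplex M (Co h)" using h functor_upto_iff by (auto simp: Reedy_stage_def)
    show "nat_trans Simplex M A (Co h) (jo h)" "nat_trans Simplex M (Co h) D (po h)"
      using h nat_upto_iff by (auto simp: Reedy_stage_def)
    fix n show "po h n \<odot> jo h n = q n" "rel_cof A (Co h) (jo h) n" "rel_fib D (Co h) (po h) n"
      using h[of "Suc n"] by (auto simp: Reedy_stage_def)
  qed
qed

text \<open>Once \<open>G\<close> is known below degree \<open>N\<close>, it yields a map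
  \<open>h1\<close> from the relative latching object of \<open>j\<close> to \<open>F\<close> and a
  map \<open>h2\<close> from \<open>C\<close> to the relative matching object of \<open>p\<close>. A
  lift in the resulting square, of a cofibration against a trivial fibration, is \<open>G\<close> in
  degree \<open>N\<close>.\<close>

theorem Reedy_lifting:
  assumes A: "is_functor Simplex M A" and C: "is_functor Simplex M C" and F: "is_functor Simplex M F" and D: "is_functor Simplex M D"
    and j: "nat_trans Simplex M A C j" and p: "nat_trans Simplex M F D p"
    and u: "nat_trans Simplex M A F u" and v: "nat_trans Simplex M C D v"
    and eq: "\<And>n. p n \<odot> u n = v n \<odot> j n"
    and rc: "\<And>n. rel_cof A C j n" and rf: "\<And>n. rel_fib D F p n"
  obtains G where "nat_trans Simplex M C F G" "\<And>n. G n \<odot> j n = u n" "\<And>n. p n \<odot> G n = v n"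
proof -
  note AF = functorD[OF A] and CF = functorD[OF C] and FF = functorD[OF F] and DF = functorD[OF D]
  note jN = natD[OF j] and pN = natD[OF p] and uN = natD[OF u] and vN = natD[OF v]
  have fC: "functor_upto N C" and fF: "functor_upto N F" for N using C F functor_upto_iff by blast+
  define P where "P N G \<longleftrightarrow> nat_upto N C F G \<and> (\<forall>n<N. G n \<odot> j n = u n \<and> p n \<odot> G n = v n)" for N G
  have "\<exists>G. \<forall>N. P N G"
  proof (rule stage_glue)
    show "P 0 undefined" by (simp add: P_def nat_upto_def)
    fix N and G G' :: "nat \<Rightarrow> 'm" assume P: "P N G"
    have GN: "nat_upto N C F G" and Gj: "\<And>n. n < N \<Longrightarrow> G n \<odot> j n = u n" and pG: "\<And>n. n < N \<Longrightarrow> p n \<odot> G n = v n"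
      using P by (auto simp: P_def)
    note G = nat_uptoD[OF GN]
    show "P N G'" if G': "\<And>k. k < N \<Longrightarrow> G' k = G k"
      using nat_upto_cong[OF GN, of F C G'] G' Gj pG by (simp add: P_def)
    obtain \<Lambda> x l a where \<Lambda>: "latch_universal A C j N \<Lambda> x l" "a \<in> cof M" "a \<in> Hom M \<Lambda> (onOb C N)" "a \<odot> l = j N"
      "\<And>m \<theta>. \<lbrakk>m < N; \<theta> \<in> Hom Simplex m N\<rbrakk> \<Longrightarrow> a \<odot> x \<theta> = onAr C \<theta>"
      using rc[of N] unfolding rel_cof_def by blast
    have cc: "latch_cocone A C j N \<Lambda> x l" using \<Lambda>(1) by (simp add: latch_universal_def)
    note xl = latch_coconeD[OF cc]
    obtain W y w b where W: "match_universal D F p N W y w" "b \<in> tfib" "b \<in> Hom M (onOb F N) W" "w \<odot> b = p N"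
      "\<And>m \<theta>. \<lbrakk>m < N; \<theta> \<in> Hom Simplex N m\<rbrakk> \<Longrightarrow> y \<theta> \<odot> b = onAr F \<theta>"
      using rf[of N] unfolding rel_fib_def by blast
    have cy: "match_cone D F p N W y w" using W(1) by (simp add: match_universal_def)
    note yw = match_coneD[OF cy]
    have "latch_cocone A C j N (onOb F N) (\<lambda>\<theta>. onAr F \<theta> \<odot> G (Dom Simplex \<theta>)) (u N)"
      unfolding latch_cocone_def
    proof (intro conjI allI impI ballI uN(1))
      fix k \<tau> assume k: "k < N" "\<tau> \<in> Hom Simplex k N"
      have [simp]: "Dom Simplex \<tau> = k" using Dom_Cod_Simplex[OF k(2)] by simp
      show "onAr F \<tau> \<odot> G (Dom Simplex \<tau>) \<in> Hom M (onOb C k) (onOb F N)"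
        using Comp_Hom[OF G(1)[OF k(1)] FF(2)[OF k(2)]] by simp
      show "onAr F \<tau> \<odot> G (Dom Simplex \<tau>) \<odot> j k = u N \<odot> onAr A \<tau>"
        using Comp_assoc[OF jN(1) G(1)[OF k(1)] FF(2)[OF k(2)]] Gj[OF k(1)] uN(2)[OF k(2)] by simp
      fix i \<gamma> assume i: "i < N" "\<gamma> \<in> Hom Simplex i k"
      have "Dom Simplex (\<tau> \<star> \<gamma>) = i" using Dom_Cod_Simplex[OF Comp_Simplex_Hom[OF i(2) k(2)]] by simp
      then show "onAr F \<tau> \<odot> G (Dom Simplex \<tau>) \<odot> onAr C \<gamma> =
          onAr F (\<tau> \<star> \<gamma>) \<odot> G (Dom Simplex (\<tau> \<star> \<gamma>))"
        using Comp_assoc[OF CF(2)[OF i(2)] G(1)[OF k(1)] FF(2)[OF k(2)]] G(2)[OF i(2,1) k(1)]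
          Comp_assoc[OF G(1)[OF i(1)] FF(2)[OF i(2)] FF(2)[OF k(2)]] FF(4)[OF i(2) k(2)] by simp
    qed
    from latch_universal_obtain[OF \<Lambda>(1) this]
    obtain h1 where h1: "h1 \<in> Hom M \<Lambda> (onOb F N)" "h1 \<odot> l = u N"
      "\<And>k \<tau>. \<lbrakk>k < N; \<tau> \<in> Hom Simplex k N\<rbrakk> \<Longrightarrow> h1 \<odot> x \<tau> = onAr F \<tau> \<odot> G (Dom Simplex \<tau>)" by metis
    have h1x: "h1 \<odot> x \<tau> = onAr F \<tau> \<odot> G k" if "k < N" "\<tau> \<in> Hom Simplex k N" for k \<tau>
      using h1(3)[OF that] Dom_Cod_Simplex[OF that(2)] by simp
    have "match_cone D F p N (onOb C N) (\<lambda>\<theta>. G (Cod Simplex \<theta>) \<odot> onAr C \<theta>) (v N)"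
      unfolding match_cone_def
    proof (intro conjI allI impI ballI vN(1))
      fix m \<theta> assume m: "m < N" "\<theta> \<in> Hom Simplex N m"
      have [simp]: "Cod Simplex \<theta> = m" using Dom_Cod_Simplex[OF m(2)] by simp
      show "G (Cod Simplex \<theta>) \<odot> onAr C \<theta> \<in> Hom M (onOb C N) (onOb F m)"
        using Comp_Hom[OF CF(2)[OF m(2)] G(1)[OF m(1)]] by simp
      show "p m \<odot> (G (Cod Simplex \<theta>) \<odot> onAr C \<theta>) = onAr D \<theta> \<odot> v N"
        using Comp_assoc[OF CF(2)[OF m(2)] G(1)[OF m(1)] pN(1)] pG[OF m(1)] vN(2)[OF m(2)] by simp
      fix i \<gamma> assume i: "i < N" "\<gamma> \<in> Hom Simplex m i"
      have "Cod Simplex (\<gamma> \<star> \<theta>) = i" using Dom_Cod_Simplex[OF Comp_Simplex_Hom[OF m(2) i(2)]] by simp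
      then show "onAr F \<gamma> \<odot> (G (Cod Simplex \<theta>) \<odot> onAr C \<theta>) =
          G (Cod Simplex (\<gamma> \<star> \<theta>)) \<odot> onAr C (\<gamma> \<star> \<theta>)"
        using Comp_assoc[OF CF(2)[OF m(2)] G(1)[OF m(1)] FF(2)[OF i(2)]] G(2)[OF i(2) m(1) i(1)]
          Comp_assoc[OF CF(2)[OF m(2)] CF(2)[OF i(2)] G(1)[OF i(1)]] CF(4)[OF m(2) i(2)] by simp
    qed
    from match_universal_obtain[OF W(1) this]
    obtain h2 where h2: "h2 \<in> Hom M (onOb C N) W" "w \<odot> h2 = v N"
      "\<And>m \<theta>. \<lbrakk>m < N; \<theta> \<in> Hom Simplex N m\<rbrakk> \<Longrightarrow> y \<theta> \<odot> h2 = G (Cod Simplex \<theta>) \<odot> onAr C \<theta>" by metis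
    have h2y: "y \<theta> \<odot> h2 = G m \<odot> onAr C \<theta>" if "m < N" "\<theta> \<in> Hom Simplex N m" for m \<theta>
      using h2(3)[OF that] Dom_Cod_Simplex[OF that(2)] by simp
    note bh1 = Comp_Hom[OF h1(1) W(3)] and h2a = Comp_Hom[OF \<Lambda>(3) h2(1)]
    \<comment> \<open>Commutativity is tested first on the projections of \<open>W\<close> and then
      on the maps into \<open>\<Lambda>\<close>, which leaves four elementary cases.\<close>
    have "b \<odot> h1 = h2 \<odot> a"
    proof (rule match_unique[OF W(1) fF D pN(1) bh1 h2a])
      have e1: "w \<odot> (b \<odot> h1) = p N \<odot> h1" using Comp_assoc[OF h1(1) W(3) yw(1)] W(4) by simp
      have e2: "w \<odot> (h2 \<odot> a) = v N \<odot> a" using Comp_assoc[OF \<Lambda>(3) h2(1) yw(1)] h2(2) by simp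
      have "p N \<odot> h1 = v N \<odot> a"
      proof (rule latch_unique[OF \<Lambda>(1) fC A jN(1) Comp_Hom[OF h1(1) pN(1)] Comp_Hom[OF \<Lambda>(3) vN(1)]])
        show "p N \<odot> h1 \<odot> l = v N \<odot> a \<odot> l"
          using Comp_assoc[OF xl(1) h1(1) pN(1)] Comp_assoc[OF xl(1) \<Lambda>(3) vN(1)] h1(2) \<Lambda>(4) eq by simp
        show "p N \<odot> h1 \<odot> x \<tau> = v N \<odot> a \<odot> x \<tau>" if k: "k < N" "\<tau> \<in> Hom Simplex k N" for k \<tau>
          using Comp_assoc[OF xl(2)[OF k] h1(1) pN(1)] Comp_assoc[OF xl(2)[OF k] \<Lambda>(3) vN(1)] h1x[OF k] \<Lambda>(5)[OF k]
            Comp_assoc[OF G(1)[OF k(1)] FF(2)[OF k(2)] pN(1)] Comp_assoc[OF G(1)[OF k(1)] pN(1) DF(2)[OF k(2)]]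
            pN(2)[OF k(2)] pG[OF k(1)] vN(2)[OF k(2)] by simp
      qed
      then show "w \<odot> (b \<odot> h1) = w \<odot> (h2 \<odot> a)" using e1 e2 by simp
      fix m \<theta> assume m: "m < N" "\<theta> \<in> Hom Simplex N m"
      have e1: "y \<theta> \<odot> (b \<odot> h1) = onAr F \<theta> \<odot> h1" using Comp_assoc[OF h1(1) W(3) yw(2)[OF m]] W(5)[OF m] by simp
      have e2: "y \<theta> \<odot> (h2 \<odot> a) = G m \<odot> onAr C \<theta> \<odot> a" using Comp_assoc[OF \<Lambda>(3) h2(1) yw(2)[OF m]] h2y[OF m] by simp
      note GC = Comp_Hom[OF CF(2)[OF m(2)] G(1)[OF m(1)]]
      have "onAr F \<theta> \<odot> h1 = G m \<odot> onAr C \<theta> \<odot> a"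
      proof (rule latch_unique[OF \<Lambda>(1) fC A jN(1) Comp_Hom[OF h1(1) FF(2)[OF m(2)]] Comp_Hom[OF \<Lambda>(3) GC]])
        show "onAr F \<theta> \<odot> h1 \<odot> l = G m \<odot> onAr C \<theta> \<odot> a \<odot> l"
          using Comp_assoc[OF xl(1) h1(1) FF(2)[OF m(2)]] Comp_assoc[OF xl(1) \<Lambda>(3) GC] h1(2) \<Lambda>(4)
            Comp_assoc[OF jN(1) CF(2)[OF m(2)] G(1)[OF m(1)]] jN(2)[OF m(2)] Gj[OF m(1)] uN(2)[OF m(2)]
            Comp_assoc[OF AF(2)[OF m(2)] jN(1) G(1)[OF m(1)]] by simp
        fix k \<tau> assume k: "k < N" "\<tau> \<in> Hom Simplex k N"
        note \<theta>\<tau> = Comp_Simplex_Hom[OF k(2) m(2)]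
        have "onAr F \<theta> \<odot> h1 \<odot> x \<tau> = onAr F (\<theta> \<star> \<tau>) \<odot> G k"
          using Comp_assoc[OF xl(2)[OF k] h1(1) FF(2)[OF m(2)]] h1x[OF k]
            Comp_assoc[OF G(1)[OF k(1)] FF(2)[OF k(2)] FF(2)[OF m(2)]] FF(4)[OF k(2) m(2)] by simp
        also have "\<dots> = G m \<odot> onAr C (\<theta> \<star> \<tau>)" by (rule G(2)[OF \<theta>\<tau> k(1) m(1)])
        also have "\<dots> = G m \<odot> onAr C \<theta> \<odot> a \<odot> x \<tau>"
          using Comp_assoc[OF xl(2)[OF k] \<Lambda>(3) GC] \<Lambda>(5)[OF k] CF(4)[OF k(2) m(2)]
            Comp_assoc[OF CF(2)[OF k(2)] CF(2)[OF m(2)] G(1)[OF m(1)]] by simp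
        finally show "onAr F \<theta> \<odot> h1 \<odot> x \<tau> = G m \<odot> onAr C \<theta> \<odot> a \<odot> x \<tau>" .
      qed
      then show "y \<theta> \<odot> (b \<odot> h1) = y \<theta> \<odot> (h2 \<odot> a)" using e1 e2 by simp
    qed
    then obtain z where z: "z \<in> Hom M (onOb C N) (onOb F N)" "z \<odot> a = h1" "b \<odot> z = h2"
      using lift[OF lift_cof[OF \<Lambda>(2) W(2)] \<Lambda>(3) W(3) h1(1) h2(1)] by metis
    have "nat_upto (Suc N) C F (G(N := z))"
    proof (rule nat_upto_Suc[OF fC fF])
      show "nat_upto N C F (G(N := z))" by (rule nat_upto_cong[OF GN]) simp_all
      show "(G(N := z)) N \<in> Hom M (onOb C N) (onOb F N)" using z(1) by simp
      show "onAr F \<tau> \<odot> (G(N := z)) k = (G(N := z)) N \<odot> onAr C \<tau>" if k: "k < N" "\<tau> \<in> Hom Simplex k N" for k \<tau>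
        using Comp_assoc[OF xl(2)[OF k] \<Lambda>(3) z(1)] \<Lambda>(5)[OF k] z(2) h1x[OF k] k(1) by simp
      show "onAr F \<theta> \<odot> (G(N := z)) N = (G(N := z)) m \<odot> onAr C \<theta>" if m: "m < N" "\<theta> \<in> Hom Simplex N m" for m \<theta>
        using Comp_assoc[OF z(1) W(3) yw(2)[OF m]] W(5)[OF m] z(3) h2y[OF m] m(1) by simp
    qed
    moreover have "z \<odot> j N = u N" using Comp_assoc[OF xl(1) \<Lambda>(3) z(1)] \<Lambda>(4) z(2) h1(2) by simp
    moreover have "p N \<odot> z = v N" using Comp_assoc[OF z(1) W(3) yw(1)] W(4) z(3) h2(2) by simp
    ultimately have "P (Suc N) (G(N := z))" using Gj pG by (simp add: P_def less_Suc_eq)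
    then show "\<exists>h'. P (Suc N) h' \<and> (\<forall>k<N. h' k = G k)" by (intro exI[of _ "G(N := z)"]) simp
  qed
  then obtain G where G: "\<And>N. P N G" by blast
  show thesis
  proof (rule that[of G])
    show "nat_trans Simplex M C F G" using G nat_upto_iff by (auto simp: P_def)
    show "G n \<odot> j n = u n" "p n \<odot> G n = v n" for n using G[of "Suc n"] by (simp_all add: P_def)
  qed
qed

text \<open>This is closure of Reedy cofibrations under composition. The problem for
  \<open>C\<close> is first solved over \<open>A n\<close>; this solution and \<open>y\<close>
  define a map on the relative latching object, and a lift along \<open>a\<close> finishes.\<close>

lemma rel_cof_extends_boundary:
  assumes A: "is_functor Simplex M A" and C: "is_functor Simplex M C" and j: "nat_trans Simplex M A C j"
    and rc: "rel_cof A C j n" and ext: "extends_boundary A n"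
  shows "extends_boundary C n"
  unfolding extends_boundary_def
proof (intro ballI allI impI)
  note AF = functorD[OF A] and CF = functorD[OF C] and jN = natD[OF j]
  have fC: "functor_upto n C" using C functor_upto_iff by blast
  fix p v y
  assume p: "p \<in> tfib" and v: "v \<in> Hom M (onOb C n) (Cod M p)"
    and "\<forall>m<n. \<forall>\<theta>\<in>Hom Simplex m n. y \<theta> \<in> Hom M (onOb C m) (Dom M p) \<and> p \<odot> y \<theta> = v \<odot> onAr C \<theta> \<and>
      (\<forall>l<n. \<forall>\<gamma>\<in>Hom Simplex l m. y \<theta> \<odot> onAr C \<gamma> = y (\<theta> \<star> \<gamma>))"
  then have y: "\<And>m \<theta>. \<lbrakk>m < n; \<theta> \<in> Hom Simplex m n\<rbrakk> \<Longrightarrow> y \<theta> \<in> Hom M (onOb C m) (Dom M p)"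
    "\<And>m \<theta>. \<lbrakk>m < n; \<theta> \<in> Hom Simplex m n\<rbrakk> \<Longrightarrow> p \<odot> y \<theta> = v \<odot> onAr C \<theta>"
    "\<And>l m \<theta> \<gamma>. \<lbrakk>m < n; \<theta> \<in> Hom Simplex m n; l < n; \<gamma> \<in> Hom Simplex l m\<rbrakk> \<Longrightarrow> y \<theta> \<odot> onAr C \<gamma> = y (\<theta> \<star> \<gamma>)"
    by blast+
  have pH: "p \<in> Hom M (Dom M p) (Cod M p)" using p weq_Ar by (auto simp: Hom_def)
  have dm: "Dom Simplex \<theta> = m" if "\<theta> \<in> Hom Simplex m n" for \<theta> m using Dom_Cod_Simplex[OF that] by simp
  have "\<exists>z\<in>Hom M (onOb A n) (Dom M p). p \<odot> z = v \<odot> j n \<and>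
    (\<forall>m<n. \<forall>\<theta>\<in>Hom Simplex m n. z \<odot> onAr A \<theta> = y \<theta> \<odot> j (Dom Simplex \<theta>))"
  proof (rule ext[unfolded extends_boundary_def, rule_format, OF p Comp_Hom[OF jN(1) v]], intro conjI allI impI ballI)
    fix m \<theta> assume \<theta>: "m < n" "\<theta> \<in> Hom Simplex m n"
    show "y \<theta> \<odot> j (Dom Simplex \<theta>) \<in> Hom M (onOb A m) (Dom M p)"
      unfolding dm[OF \<theta>(2)] by (rule Comp_Hom[OF jN(1) y(1)[OF \<theta>]])
    show "p \<odot> (y \<theta> \<odot> j (Dom Simplex \<theta>)) = v \<odot> j n \<odot> onAr A \<theta>"
      unfolding dm[OF \<theta>(2)]
      using Comp_assoc[OF jN(1) y(1)[OF \<theta>] pH] y(2)[OF \<theta>] Comp_assoc[OF jN(1) CF(2)[OF \<theta>(2)] v] jN(2)[OF \<theta>(2)]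
        Comp_assoc[OF AF(2)[OF \<theta>(2)] jN(1) v] by simp
    fix l \<gamma> assume \<gamma>: "l < n" "\<gamma> \<in> Hom Simplex l m"
    show "y \<theta> \<odot> j (Dom Simplex \<theta>) \<odot> onAr A \<gamma> = y (\<theta> \<star> \<gamma>) \<odot> j (Dom Simplex (\<theta> \<star> \<gamma>))"
      unfolding dm[OF \<theta>(2)] dm[OF Comp_Simplex_Hom[OF \<gamma>(2) \<theta>(2)]]
      using Comp_assoc[OF AF(2)[OF \<gamma>(2)] jN(1) y(1)[OF \<theta>]] jN(2)[OF \<gamma>(2)]
        Comp_assoc[OF jN(1) CF(2)[OF \<gamma>(2)] y(1)[OF \<theta>]] y(3)[OF \<theta> \<gamma>] by simp
  qed
  then obtain y0 where y0: "y0 \<in> Hom M (onOb A n) (Dom M p)" "p \<odot> y0 = v \<odot> j n"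
    "\<And>m \<theta>. \<lbrakk>m < n; \<theta> \<in> Hom Simplex m n\<rbrakk> \<Longrightarrow> y0 \<odot> onAr A \<theta> = y \<theta> \<odot> j m"
    using dm by (metis (no_types, lifting))
  obtain \<Lambda> x l a where \<Lambda>: "latch_universal A C j n \<Lambda> x l" "a \<in> cof M" "a \<in> Hom M \<Lambda> (onOb C n)" "a \<odot> l = j n"
    "\<And>m \<theta>. \<lbrakk>m < n; \<theta> \<in> Hom Simplex m n\<rbrakk> \<Longrightarrow> a \<odot> x \<theta> = onAr C \<theta>"
    using rc unfolding rel_cof_def by blast
  have cc: "latch_cocone A C j n \<Lambda> x l" using \<Lambda>(1) by (simp add: latch_universal_def)
  note xl = latch_coconeD[OF cc]
  have "latch_cocone A C j n (Dom M p) y y0"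
    unfolding latch_cocone_def using y0 y(1,3) by simp
  from latch_universal_obtain[OF \<Lambda>(1) this]
  obtain h where h: "h \<in> Hom M \<Lambda> (Dom M p)" "h \<odot> l = y0"
    "\<And>m \<theta>. \<lbrakk>m < n; \<theta> \<in> Hom Simplex m n\<rbrakk> \<Longrightarrow> h \<odot> x \<theta> = y \<theta>" by metis
  have "p \<odot> h = v \<odot> a"
  proof (rule latch_unique[OF \<Lambda>(1) fC A jN(1) Comp_Hom[OF h(1) pH] Comp_Hom[OF \<Lambda>(3) v]])
    show "p \<odot> h \<odot> l = v \<odot> a \<odot> l"
      using Comp_assoc[OF xl(1) h(1) pH] Comp_assoc[OF xl(1) \<Lambda>(3) v] h(2) y0(2) \<Lambda>(4) by simp
    show "p \<odot> h \<odot> x \<theta> = v \<odot> a \<odot> x \<theta>" if \<theta>: "m < n" "\<theta> \<in> Hom Simplex m n" for m \<theta>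
      using Comp_assoc[OF xl(2)[OF \<theta>] h(1) pH] Comp_assoc[OF xl(2)[OF \<theta>] \<Lambda>(3) v] h(3)[OF \<theta>] y(2)[OF \<theta>] \<Lambda>(5)[OF \<theta>] by simp
  qed
  then obtain z where z: "z \<in> Hom M (onOb C n) (Dom M p)" "z \<odot> a = h" "p \<odot> z = v"
    using lift[OF lift_cof[OF \<Lambda>(2) p] \<Lambda>(3) pH h(1) v] by metis
  have "z \<odot> onAr C \<theta> = y \<theta>" if \<theta>: "m < n" "\<theta> \<in> Hom Simplex m n" for m \<theta>
    using Comp_assoc[OF xl(2)[OF \<theta>] \<Lambda>(3) z(1)] \<Lambda>(5)[OF \<theta>] z(2) h(3)[OF \<theta>] by simp
  with z show "\<exists>z\<in>Hom M (onOb C n) (Dom M p). p \<odot> z = v \<and> (\<forall>m<n. \<forall>\<theta>\<in>Hom Simplex m n. z \<odot> onAr C \<theta> = y \<theta>)"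
    by blast
qed

text \<open>The matching object in degree \<open>n\<close> involves the quotients of
  \<open>[n]\<close>. A lift in degree \<open>n\<close> is therefore built together with compatible
  lifts \<open>g \<epsilon>\<close> for all quotients \<open>\<epsilon>\<close> from
  \<open>[n]\<close> to \<open>[k]\<close>, by induction on the bound \<open>K\<close> for
  \<open>k\<close>. The identity of \<open>[n]\<close> gives the lift sought.\<close>

lemma rel_fib_tfib:
  assumes C: "is_functor Simplex M C" and D: "is_functor Simplex M D" and p: "nat_trans Simplex M C D p"
    and rf: "\<And>n. rel_fib D C p n"
  shows "p n \<in> tfib"
  unfolding tfib_iff
proof (intro conjI ballI)
  note CF = functorD[OF C] and DF = functorD[OF D] and pN = natD[OF p]
  have fC: "functor_upto N C" for N using C functor_upto_iff by blast
  show "p n \<in> Ar M" using pN(1) by (simp add: Hom_def)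
  fix i assume i: "i \<in> cof M"
  show "has_lifting M i (p n)"
  proof (rule has_liftingI[OF _ pN(1)])
    show iH: "i \<in> Hom M (Dom M i) (Cod M i)" using i cof_Ar by (auto simp: Hom_def)
    fix u v
    assume u: "u \<in> Hom M (Dom M i) (onOb C n)" and v: "v \<in> Hom M (Cod M i) (onOb D n)" and uv: "p n \<odot> u = v \<odot> i"
    define P where "P g \<epsilon> k \<longleftrightarrow> g \<epsilon> \<in> Hom M (Cod M i) (onOb C k) \<and> g \<epsilon> \<odot> i = onAr C \<epsilon> \<odot> u \<and>
      p k \<odot> g \<epsilon> = onAr D \<epsilon> \<odot> v" for g :: "simplex_map \<Rightarrow> 'm" and \<epsilon> k
    have "\<exists>g. (\<forall>k<K. \<forall>\<epsilon>. split_epi \<epsilon> n k \<longrightarrow> P g \<epsilon> k) \<and>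
      (\<forall>k<K. \<forall>l<K. \<forall>\<epsilon> \<gamma>. split_epi \<epsilon> n k \<longrightarrow> split_epi \<gamma> k l \<longrightarrow> onAr C \<gamma> \<odot> g \<epsilon> = g (\<gamma> \<star> \<epsilon>))" for K
    proof (induction K)
      case (Suc K)
      then obtain g where g: "\<And>k \<epsilon>. \<lbrakk>k < K; split_epi \<epsilon> n k\<rbrakk> \<Longrightarrow> P g \<epsilon> k"
        "\<And>k l \<epsilon> \<gamma>. \<lbrakk>k < K; l < K; split_epi \<epsilon> n k; split_epi \<gamma> k l\<rbrakk> \<Longrightarrow> onAr C \<gamma> \<odot> g \<epsilon> = g (\<gamma> \<star> \<epsilon>)"
        by blast
      obtain W y w b where W: "match_universal D C p K W y w" "b \<in> tfib" "b \<in> Hom M (onOb C K) W" "w \<odot> b = p K"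
        "\<And>m \<theta>. \<lbrakk>m < K; \<theta> \<in> Hom Simplex K m\<rbrakk> \<Longrightarrow> y \<theta> \<odot> b = onAr C \<theta>"
        using rf[of K] unfolding rel_fib_def by blast
      have cy: "match_cone D C p K W y w" using W(1) by (simp add: match_universal_def)
      note yw = match_coneD[OF cy]
      have "\<exists>z. z \<in> Hom M (Cod M i) (onOb C K) \<and> z \<odot> i = onAr C \<epsilon> \<odot> u \<and> p K \<odot> z = onAr D \<epsilon> \<odot> v \<and>
          (\<forall>l<K. \<forall>\<gamma>. split_epi \<gamma> K l \<longrightarrow> onAr C \<gamma> \<odot> z = g (\<gamma> \<star> \<epsilon>))"
        if e: "split_epi \<epsilon> n K" for \<epsilon>
      proof -
        note eH = split_epi_Hom[OF e]
        \<comment> \<open>Along a map \<open>\<theta>\<close> out of \<open>[K]\<close>, the cone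
          uses the lift already chosen for the quotient of \<open>[n]\<close> onto the image of
          \<open>\<theta>\<close>.\<close>
        define x where "x \<theta> = onAr C (mono_part \<theta>) \<odot> g (epi_part \<theta> \<star> \<epsilon>)" for \<theta>
        have ge: "mid \<theta> < K" "split_epi (epi_part \<theta> \<star> \<epsilon>) n (mid \<theta>)"
            "g (epi_part \<theta> \<star> \<epsilon>) \<in> Hom M (Cod M i) (onOb C (mid \<theta>))"
            "g (epi_part \<theta> \<star> \<epsilon>) \<odot> i = onAr C (epi_part \<theta> \<star> \<epsilon>) \<odot> u"
            "p (mid \<theta>) \<odot> g (epi_part \<theta> \<star> \<epsilon>) = onAr D (epi_part \<theta> \<star> \<epsilon>) \<odot> v"
          if \<theta>: "m < K" "\<theta> \<in> Hom Simplex K m" for m \<theta>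
        proof -
          note t = epi_mono_parts[OF \<theta>(2)]
          show k: "mid \<theta> < K" using t(5) \<theta>(1) by simp
          show s: "split_epi (epi_part \<theta> \<star> \<epsilon>) n (mid \<theta>)" by (rule split_epi_comp[OF e t(1)])
          show "g (epi_part \<theta> \<star> \<epsilon>) \<in> Hom M (Cod M i) (onOb C (mid \<theta>))"
            "g (epi_part \<theta> \<star> \<epsilon>) \<odot> i = onAr C (epi_part \<theta> \<star> \<epsilon>) \<odot> u"
            "p (mid \<theta>) \<odot> g (epi_part \<theta> \<star> \<epsilon>) = onAr D (epi_part \<theta> \<star> \<epsilon>) \<odot> v"
            using g(1)[OF k s] unfolding P_def by blast+
        qed
        have "match_cone D C p K (Cod M i) x (onAr D \<epsilon> \<odot> v)"
          unfolding match_cone_def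
        proof (intro conjI allI impI ballI)
          show "onAr D \<epsilon> \<odot> v \<in> Hom M (Cod M i) (onOb D K)" by (rule Comp_Hom[OF v DF(2)[OF eH]])
          fix m \<theta> assume \<theta>: "m < K" "\<theta> \<in> Hom Simplex K m"
          note t = epi_mono_parts[OF \<theta>(2)] and G = ge[OF \<theta>]
          show "x \<theta> \<in> Hom M (Cod M i) (onOb C m)" unfolding x_def by (rule Comp_Hom[OF G(3) CF(2)[OF t(7)]])
          have "p m \<odot> x \<theta> = onAr D (mono_part \<theta>) \<odot> (onAr D (epi_part \<theta> \<star> \<epsilon>) \<odot> v)"
            unfolding x_def using Comp_assoc[OF G(3) CF(2)[OF t(7)] pN(1)] pN(2)[OF t(7)]
              Comp_assoc[OF G(3) pN(1) DF(2)[OF t(7)]] G(5) by simp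
          also have "\<dots> = onAr D (mono_part \<theta> \<star> (epi_part \<theta> \<star> \<epsilon>)) \<odot> v"
            using Comp_assoc[OF v DF(2)[OF split_epi_Hom[OF G(2)]] DF(2)[OF t(7)]] DF(4)[OF split_epi_Hom[OF G(2)] t(7)] by simp
          also have "mono_part \<theta> \<star> (epi_part \<theta> \<star> \<epsilon>) = \<theta> \<star> \<epsilon>"
            using Simplex.Comp_assoc[OF eH t(6,7)] t(3) by simp
          also have "onAr D (\<theta> \<star> \<epsilon>) \<odot> v = onAr D \<theta> \<odot> (onAr D \<epsilon> \<odot> v)"
            using DF(4)[OF eH \<theta>(2)] Comp_assoc[OF v DF(2)[OF eH] DF(2)[OF \<theta>(2)]] by simp
          finally show "p m \<odot> x \<theta> = onAr D \<theta> \<odot> (onAr D \<epsilon> \<odot> v)" .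
          fix l \<gamma> assume \<gamma>: "l < K" "\<gamma> \<in> Hom Simplex m l"
          note po = parts_postcomp[OF \<theta>(2) \<gamma>(2)]
          let ?\<delta> = "\<gamma> \<star> mono_part \<theta>"
          note d = epi_mono_parts[OF po(1)]
          have k: "mid ?\<delta> < K" using d(4) G(1) by simp
          have "onAr C \<gamma> \<odot> x \<theta> = onAr C ?\<delta> \<odot> g (epi_part \<theta> \<star> \<epsilon>)"
            unfolding x_def using Comp_assoc[OF G(3) CF(2)[OF t(7)] CF(2)[OF \<gamma>(2)]] CF(4)[OF t(7) \<gamma>(2)] by simp
          also have "\<dots> = onAr C (mono_part ?\<delta>) \<odot> (onAr C (epi_part ?\<delta>) \<odot> g (epi_part \<theta> \<star> \<epsilon>))"
            using CF(4)[OF d(6,7)] d(3) Comp_assoc[OF G(3) CF(2)[OF d(6)] CF(2)[OF d(7)]] by simp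
          also have "onAr C (epi_part ?\<delta>) \<odot> g (epi_part \<theta> \<star> \<epsilon>) =
              g (epi_part ?\<delta> \<star> (epi_part \<theta> \<star> \<epsilon>))" by (rule g(2)[OF G(1) k G(2) d(1)])
          also have "epi_part ?\<delta> \<star> (epi_part \<theta> \<star> \<epsilon>) = epi_part (\<gamma> \<star> \<theta>) \<star> \<epsilon>"
            unfolding po(3) by (rule Simplex.Comp_assoc[OF eH t(6) d(6), symmetric])
          finally show "onAr C \<gamma> \<odot> x \<theta> = x (\<gamma> \<star> \<theta>)" unfolding x_def po(4) .
        qed
        from match_universal_obtain[OF W(1) this]
        obtain h where h: "h \<in> Hom M (Cod M i) W" "w \<odot> h = onAr D \<epsilon> \<odot> v"
          "\<And>m \<theta>. \<lbrakk>m < K; \<theta> \<in> Hom Simplex K m\<rbrakk> \<Longrightarrow> y \<theta> \<odot> h = x \<theta>" by metis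
        note Cu = Comp_Hom[OF u CF(2)[OF eH]]
        have "b \<odot> (onAr C \<epsilon> \<odot> u) = h \<odot> i"
        proof (rule match_unique[OF W(1) fC D pN(1) Comp_Hom[OF Cu W(3)] Comp_Hom[OF iH h(1)]])
          show "w \<odot> (b \<odot> (onAr C \<epsilon> \<odot> u)) = w \<odot> (h \<odot> i)"
            using Comp_assoc[OF Cu W(3) yw(1)] W(4) Comp_assoc[OF u CF(2)[OF eH] pN(1)] pN(2)[OF eH]
              Comp_assoc[OF u pN(1) DF(2)[OF eH]] uv Comp_assoc[OF iH h(1) yw(1)] h(2)
              Comp_assoc[OF iH v DF(2)[OF eH]] by simp
          fix m \<theta> assume \<theta>: "m < K" "\<theta> \<in> Hom Simplex K m"
          note t = epi_mono_parts[OF \<theta>(2)] and G = ge[OF \<theta>]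
          have "y \<theta> \<odot> (b \<odot> (onAr C \<epsilon> \<odot> u)) = onAr C (\<theta> \<star> \<epsilon>) \<odot> u"
            using Comp_assoc[OF Cu W(3) yw(2)[OF \<theta>]] W(5)[OF \<theta>] CF(4)[OF eH \<theta>(2)]
              Comp_assoc[OF u CF(2)[OF eH] CF(2)[OF \<theta>(2)]] by simp
          also have "\<theta> \<star> \<epsilon> = mono_part \<theta> \<star> (epi_part \<theta> \<star> \<epsilon>)"
            using Simplex.Comp_assoc[OF eH t(6,7)] t(3) by simp
          also have "onAr C \<dots> \<odot> u = onAr C (mono_part \<theta>) \<odot> (onAr C (epi_part \<theta> \<star> \<epsilon>) \<odot> u)"
            using CF(4)[OF split_epi_Hom[OF G(2)] t(7)] Comp_assoc[OF u CF(2)[OF split_epi_Hom[OF G(2)]] CF(2)[OF t(7)]] by simp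
          also have "\<dots> = x \<theta> \<odot> i"
            unfolding x_def using Comp_assoc[OF iH G(3) CF(2)[OF t(7)]] G(4) by simp
          also have "\<dots> = y \<theta> \<odot> (h \<odot> i)" using Comp_assoc[OF iH h(1) yw(2)[OF \<theta>]] h(3)[OF \<theta>] by simp
          finally show "y \<theta> \<odot> (b \<odot> (onAr C \<epsilon> \<odot> u)) = y \<theta> \<odot> (h \<odot> i)" .
        qed
        then obtain z where z: "z \<in> Hom M (Cod M i) (onOb C K)" "z \<odot> i = onAr C \<epsilon> \<odot> u" "b \<odot> z = h"
          using lift[OF lift_cof[OF i W(2)] iH W(3) Cu h(1)] by metis
        have "p K \<odot> z = onAr D \<epsilon> \<odot> v" using Comp_assoc[OF z(1) W(3) yw(1)] W(4) z(3) h(2) by simp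
        moreover have "onAr C \<gamma> \<odot> z = g (\<gamma> \<star> \<epsilon>)" if \<gamma>: "l < K" "split_epi \<gamma> K l" for l \<gamma>
        proof -
          note \<gamma>H = split_epi_Hom[OF \<gamma>(2)]
          have gH: "g (\<gamma> \<star> \<epsilon>) \<in> Hom M (Cod M i) (onOb C l)"
            using g(1)[OF \<gamma>(1) split_epi_comp[OF e \<gamma>(2)]] by (simp add: P_def)
          have "onAr C \<gamma> \<odot> z = x \<gamma>"
            using Comp_assoc[OF z(1) W(3) yw(2)[OF \<gamma>(1) \<gamma>H]] W(5)[OF \<gamma>(1) \<gamma>H] z(3) h(3)[OF \<gamma>(1) \<gamma>H] by simp
          then show ?thesis using parts_split_epi[OF \<gamma>(2)] CF(3) Ide_Comp[OF gH] by (simp add: x_def)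
        qed
        ultimately show ?thesis using z by blast
      qed
      then obtain z where z: "\<And>\<epsilon>. split_epi \<epsilon> n K \<Longrightarrow> z \<epsilon> \<in> Hom M (Cod M i) (onOb C K) \<and> z \<epsilon> \<odot> i = onAr C \<epsilon> \<odot> u \<and>
          p K \<odot> z \<epsilon> = onAr D \<epsilon> \<odot> v \<and> (\<forall>l<K. \<forall>\<gamma>. split_epi \<gamma> K l \<longrightarrow> onAr C \<gamma> \<odot> z \<epsilon> = g (\<gamma> \<star> \<epsilon>))"
        by metis
      define g' where "g' \<epsilon> = (if Cod Simplex \<epsilon> = K then z \<epsilon> else g \<epsilon>)" for \<epsilon>
      have g': "g' \<epsilon> = (if k = K then z \<epsilon> else g \<epsilon>)" if "split_epi \<epsilon> n k" for \<epsilon> k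
        using Dom_Cod_Simplex[OF split_epi_Hom[OF that]] by (simp add: g'_def)
      show ?case
      proof (intro exI[of _ g'] conjI allI impI)
        fix k \<epsilon> assume k: "k < Suc K" "split_epi \<epsilon> n k"
        show "P g' \<epsilon> k"
        proof (cases "k = K")
          case True
          then show ?thesis using g'[OF k(2)] z[of \<epsilon>] k(2) by (simp add: P_def)
        next
          case False
          then show ?thesis using g'[OF k(2)] g(1)[of k \<epsilon>] k by (simp add: P_def)
        qed
        fix l \<gamma> assume l: "l < Suc K" "split_epi \<gamma> k l"
        note \<gamma>\<epsilon> = split_epi_comp[OF k(2) l(2)]
        have lk: "l \<le> k" using split_epi_le[OF l(2)] .
        consider "k < K" | "k = K" "l < K" | "k = K" "l = K" using k(1) l(1) by (auto simp: less_Suc_eq)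
        then show "onAr C \<gamma> \<odot> g' \<epsilon> = g' (\<gamma> \<star> \<epsilon>)"
        proof cases
          case 1
          then show ?thesis using g'[OF k(2)] g'[OF \<gamma>\<epsilon>] g(2)[OF 1 _ k(2) l(2)] lk by simp
        next
          case 2
          then have "onAr C \<gamma> \<odot> z \<epsilon> = g (\<gamma> \<star> \<epsilon>)" using z[of \<epsilon>] k(2) l(2) by blast
          then show ?thesis using g'[OF k(2)] g'[OF \<gamma>\<epsilon>] 2 by simp
        next
          case 3
          then have \<gamma>: "\<gamma> = Ide Simplex K" using split_epi_endo l(2) by simp
          have "z \<epsilon> \<in> Hom M (Cod M i) (onOb C K)" using z[of \<epsilon>] k(2) 3 by simp
          then show ?thesis
            using g'[OF k(2)] 3 \<gamma> CF(3) Ide_Comp Simplex.Ide_Comp[OF split_epi_Hom[OF k(2)]] by simp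
        qed
      qed
    qed simp
    then obtain g where "P g (Ide Simplex n) n" using Ide_split_epi[of n] by (meson lessI)
    then show "\<exists>h. h \<in> Hom M (Cod M i) (onOb C n) \<and> h \<odot> i = u \<and> p n \<odot> h = v"
      using CF(3) DF(3) Ide_Comp[OF u] Ide_Comp[OF v] unfolding P_def by auto
  qed
qed

end

section \<open>Homotopy equivalences\<close>

abbreviation htpy where "htpy \<equiv> homotopic_with (\<lambda>_. True)"

lemma htpy_compose:
  assumes "htpy X Y f g" "continuous_map W X a" "continuous_map Y Z b"
  shows "htpy W Z (b \<circ> f \<circ> a) (b \<circ> g \<circ> a)"
  by (rule homotopic_with_compose_continuous_map_right[OF
        homotopic_with_compose_continuous_map_left[OF assms(1,3)] assms(2)]) auto

text \<open>Since \<open>f \<circ> l\<close> is homotopic to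
  \<open>f \<circ> l \<circ> f \<circ> r\<close> and this to \<open>f \<circ> r\<close>, the left
  inverse is a right inverse as well.\<close>

lemma homotopy_equivalenceI:
  assumes f: "continuous_map X Y f" and l: "continuous_map Y X l" and r: "continuous_map Y X r"
    and lf: "htpy X X (l \<circ> f) id" and fr: "htpy Y Y (f \<circ> r) id"
  shows "homotopy_equivalence X Y f"
proof -
  have "htpy Y Y (f \<circ> l \<circ> (f \<circ> r) \<circ> id) (f \<circ> l \<circ> id \<circ> id)"
    by (rule htpy_compose[OF fr]) (auto intro: continuous_map_compose l f)
  then have 1: "htpy Y Y (f \<circ> l) (f \<circ> l \<circ> f \<circ> r)" by (simp add: o_assoc homotopic_with_sym)
  have "htpy Y Y (f \<circ> (l \<circ> f) \<circ> r) (f \<circ> id \<circ> r)" by (rule htpy_compose[OF lf r f])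
  then have "htpy Y Y (f \<circ> l \<circ> f \<circ> r) (f \<circ> r)" by (simp add: o_assoc)
  with 1 fr have "htpy Y Y (f \<circ> l) id" by (blast intro: homotopic_with_trans)
  with f l lf show ?thesis unfolding homotopy_equivalence_def by blast
qed

lemma homotopy_equivalence_cong:
  assumes "homotopy_equivalence X Y f" "\<And>x. x \<in> topspace X \<Longrightarrow> f x = g x"
  shows "homotopy_equivalence X Y g"
proof -
  obtain k where k: "continuous_map X Y f" "continuous_map Y X k" "htpy X X (k \<circ> f) id" "htpy Y Y (f \<circ> k) id"
    using assms(1) unfolding homotopy_equivalence_def by blast
  have g: "continuous_map X Y g" using continuous_map_eq[OF k(1)] assms(2) by blast
  have eq: "htpy X Y f g" by (rule homotopic_with_equal) (use k(1) assms(2) in auto)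
  have "htpy X X (k \<circ> f \<circ> id) (k \<circ> g \<circ> id)" by (rule htpy_compose[OF eq]) (auto intro: k)
  moreover have "htpy Y Y (id \<circ> f \<circ> k) (id \<circ> g \<circ> k)" by (rule htpy_compose[OF eq]) (auto intro: k)
  ultimately have "htpy X X (k \<circ> g) id" "htpy Y Y (g \<circ> k) id"
    using k(3,4) by (simp_all, (blast intro: homotopic_with_trans homotopic_with_symD)+)
  with g k(2) show ?thesis unfolding homotopy_equivalence_def by blast
qed

lemma homotopy_equivalence_id: "homotopy_equivalence X X id"
  unfolding homotopy_equivalence_def by (intro conjI exI[of _ id]) auto

lemma homotopy_equivalence_comp:
  assumes f: "homotopy_equivalence X Y f" and g: "homotopy_equivalence Y Z g"
  shows "homotopy_equivalence X Z (g \<circ> f)"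
proof -
  obtain f' where f': "continuous_map X Y f" "continuous_map Y X f'" "htpy X X (f' \<circ> f) id" "htpy Y Y (f \<circ> f') id"
    using f unfolding homotopy_equivalence_def by blast
  obtain g' where g': "continuous_map Y Z g" "continuous_map Z Y g'" "htpy Y Y (g' \<circ> g) id" "htpy Z Z (g \<circ> g') id"
    using g unfolding homotopy_equivalence_def by blast
  have "htpy X X (f' \<circ> (g' \<circ> g) \<circ> f) (f' \<circ> id \<circ> f)" by (rule htpy_compose[OF g'(3) f'(1,2)])
  moreover have "htpy Z Z (g \<circ> (f \<circ> f') \<circ> g') (g \<circ> id \<circ> g')" by (rule htpy_compose[OF f'(4) g'(2,1)])
  ultimately have "htpy X X (f' \<circ> g' \<circ> (g \<circ> f)) id" "htpy Z Z (g \<circ> f \<circ> (f' \<circ> g')) id"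
    using f'(3) g'(4) by (simp_all add: o_assoc, (blast intro: homotopic_with_trans)+)
  moreover have "continuous_map X Z (g \<circ> f)" "continuous_map Z X (f' \<circ> g')"
    by (rule continuous_map_compose[OF f'(1) g'(1)], rule continuous_map_compose[OF g'(2) f'(2)])
  ultimately show ?thesis unfolding homotopy_equivalence_def by blast
qed

lemma homotopy_equivalence_cancel_left:
  assumes g: "homotopy_equivalence Y Z g" and gf: "homotopy_equivalence X Z (g \<circ> f)" and f: "continuous_map X Y f"
  shows "homotopy_equivalence X Y f"
proof -
  obtain g' where g': "continuous_map Y Z g" "continuous_map Z Y g'" "htpy Y Y (g' \<circ> g) id" "htpy Z Z (g \<circ> g') id"
    using g unfolding homotopy_equivalence_def by blast
  obtain k where k: "continuous_map Z X k" "htpy X X (k \<circ> (g \<circ> f)) id" "htpy Z Z (g \<circ> f \<circ> k) id"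
    using gf unfolding homotopy_equivalence_def by blast
  have kg: "continuous_map Y X (k \<circ> g)" by (rule continuous_map_compose[OF g'(1) k(1)])
  have fkg: "continuous_map Y Y (f \<circ> k \<circ> g)"
    using continuous_map_compose[OF kg f] by (simp add: o_assoc)
  have "htpy Y Y (id \<circ> (g' \<circ> g) \<circ> (f \<circ> k \<circ> g)) (id \<circ> id \<circ> (f \<circ> k \<circ> g))"
    by (rule htpy_compose[OF g'(3) fkg]) simp
  moreover have "htpy Y Y (g' \<circ> (g \<circ> f \<circ> k) \<circ> g) (g' \<circ> id \<circ> g)"
    by (rule htpy_compose[OF k(3) g'(1,2)])
  ultimately have "htpy Y Y (f \<circ> (k \<circ> g)) id"
    using g'(3) by (simp add: o_assoc) (meson homotopic_with_trans homotopic_with_symD)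
  moreover have "htpy X X (k \<circ> g \<circ> f) id" using k(2) by (simp add: o_assoc)
  ultimately show ?thesis by (intro homotopy_equivalenceI[OF f kg kg])
qed

text \<open>
  In the homotopy category, the horizontal composites of the diagram exhibit the outer vertical maps
  as a retract of the invertible map \<open>F\<close>, up to isomorphism.
\<close>

lemma homotopy_equivalence_zigzag:
  assumes fN: "continuous_map NB NA fN" and fR: "continuous_map RB RA fR"
    and \<phi>A: "continuous_map NA CA \<phi>A" and \<phi>B: "continuous_map NB CB \<phi>B"
    and \<psi>A: "continuous_map CA RA \<psi>A" and \<psi>B: "continuous_map CB RB \<psi>B"
    and F: "homotopy_equivalence CB CA F"
    and eq1: "\<And>x. x \<in> topspace NB \<Longrightarrow> F (\<phi>B x) = \<phi>A (fN x)"
    and eq2: "\<And>x. x \<in> topspace CB \<Longrightarrow> fR (\<psi>B x) = \<psi>A (F x)"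
    and eA: "homotopy_equivalence NA RA (\<psi>A \<circ> \<phi>A)" and eB: "homotopy_equivalence NB RB (\<psi>B \<circ> \<phi>B)"
  shows "homotopy_equivalence RB RA fR"
proof -
  obtain F' where F': "continuous_map CB CA F" "continuous_map CA CB F'" "htpy CB CB (F' \<circ> F) id" "htpy CA CA (F \<circ> F') id"
    using F unfolding homotopy_equivalence_def by blast
  obtain a where a: "continuous_map RA NA a" "htpy NA NA (a \<circ> (\<psi>A \<circ> \<phi>A)) id" "htpy RA RA (\<psi>A \<circ> \<phi>A \<circ> a) id"
    using eA unfolding homotopy_equivalence_def by blast
  obtain b where b: "continuous_map RB NB b" "htpy NB NB (b \<circ> (\<psi>B \<circ> \<phi>B)) id" "htpy RB RB (\<psi>B \<circ> \<phi>B \<circ> b) id"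
    using eB unfolding homotopy_equivalence_def by blast
  have h1: "htpy NB CA (F \<circ> \<phi>B) (\<phi>A \<circ> fN)"
    by (rule homotopic_with_equal) (auto intro: continuous_map_compose[OF \<phi>B F'(1)] simp: eq1)
  have h2: "htpy CB RA (fR \<circ> \<psi>B) (\<psi>A \<circ> F)"
    by (rule homotopic_with_equal) (auto intro: continuous_map_compose[OF \<psi>B fR] simp: eq2)
  note cc = continuous_map_compose
  \<comment> \<open>Return to \<open>NA\<close> by \<open>a\<close>, cross by
    \<open>\<phi>A\<close>, invert \<open>F\<close> and leave by \<open>\<psi>B\<close>. The second
    square and \<open>\<psi>A \<circ> \<phi>A \<circ> a\<close> being homotopic to the identity make
    this a right inverse of \<open>fR\<close>.\<close>
  let ?r = "\<psi>B \<circ> F' \<circ> \<phi>A \<circ> a"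
  have Fa: "continuous_map RA CB (F' \<circ> \<phi>A \<circ> a)"
    using cc[OF a(1) cc[OF \<phi>A F'(2)]] by (simp add: o_assoc)
  have r: "continuous_map RA RB ?r" using cc[OF Fa \<psi>B] by (simp add: o_assoc)
  have "htpy RA RA (id \<circ> (fR \<circ> \<psi>B) \<circ> (F' \<circ> \<phi>A \<circ> a)) (id \<circ> (\<psi>A \<circ> F) \<circ> (F' \<circ> \<phi>A \<circ> a))"
    by (rule htpy_compose[OF h2 Fa]) simp
  moreover have "htpy RA RA (\<psi>A \<circ> (F \<circ> F') \<circ> (\<phi>A \<circ> a)) (\<psi>A \<circ> id \<circ> (\<phi>A \<circ> a))"
    by (rule htpy_compose[OF F'(4) cc[OF a(1) \<phi>A] \<psi>A])
  ultimately have fr: "htpy RA RA (fR \<circ> ?r) id"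
    using a(3) by (simp add: o_assoc) (meson homotopic_with_trans)
  let ?k = "b \<circ> \<psi>B \<circ> F' \<circ> \<phi>A"
  have bF: "continuous_map CA NB (b \<circ> \<psi>B \<circ> F')"
    using cc[OF F'(2) cc[OF \<psi>B b(1)]] by (simp add: o_assoc)
  have k: "continuous_map NA NB ?k" using cc[OF \<phi>A bF] by (simp add: o_assoc)
  have "htpy NB NB ((b \<circ> \<psi>B \<circ> F') \<circ> (F \<circ> \<phi>B) \<circ> id) ((b \<circ> \<psi>B \<circ> F') \<circ> (\<phi>A \<circ> fN) \<circ> id)"
    by (rule htpy_compose[OF h1 _ bF]) simp
  moreover have "htpy NB NB ((b \<circ> \<psi>B) \<circ> (F' \<circ> F) \<circ> \<phi>B) ((b \<circ> \<psi>B) \<circ> id \<circ> \<phi>B)"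
    by (rule htpy_compose[OF F'(3) \<phi>B cc[OF \<psi>B b(1)]])
  ultimately have kf: "htpy NB NB (?k \<circ> fN) id"
    using b(2) by (simp add: o_assoc) (meson homotopic_with_trans homotopic_with_symD)
  \<comment> \<open>\<open>?k\<close> inverts \<open>fN\<close> from the left. Conjugating it with
    the equivalences between the \<open>N\<close> side and the \<open>R\<close> side gives the left
    inverse \<open>?l\<close> of \<open>fR\<close>.\<close>
  let ?e = "\<psi>B \<circ> \<phi>B"
  have e: "continuous_map NB RB ?e" by (rule cc[OF \<phi>B \<psi>B])
  let ?l = "?e \<circ> ?k \<circ> a"
  have ek: "continuous_map NA RB (?e \<circ> ?k)" by (rule cc[OF k e])
  have l: "continuous_map RA RB ?l" using cc[OF a(1) ek] by (simp add: o_assoc)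
  have lf: "continuous_map RB RB (?l \<circ> fR)" by (rule cc[OF fR l])
  have s0: "htpy RB RB (?l \<circ> fR) (?l \<circ> fR \<circ> ?e \<circ> b)"
    using htpy_compose[OF b(3) _ lf, of RB id] by (simp add: o_assoc homotopic_with_sym)
  have s1: "htpy RB RB (?l \<circ> fR \<circ> ?e \<circ> b) (?l \<circ> \<psi>A \<circ> F \<circ> \<phi>B \<circ> b)"
    using htpy_compose[OF h2 cc[OF b(1) \<phi>B] l] by (simp add: o_assoc)
  have s2: "htpy RB RB (?l \<circ> \<psi>A \<circ> F \<circ> \<phi>B \<circ> b) (?l \<circ> \<psi>A \<circ> \<phi>A \<circ> fN \<circ> b)"
    using htpy_compose[OF h1 b(1) cc[OF \<psi>A l]] by (simp add: o_assoc)
  have s3: "htpy RB RB (?l \<circ> \<psi>A \<circ> \<phi>A \<circ> fN \<circ> b) (?e \<circ> ?k \<circ> fN \<circ> b)"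
    using htpy_compose[OF a(2) cc[OF b(1) fN] ek] by (simp add: o_assoc)
  have s4: "htpy RB RB (?e \<circ> ?k \<circ> fN \<circ> b) (?e \<circ> b)"
    using htpy_compose[OF kf b(1) e] by (simp add: o_assoc)
  have "htpy RB RB (?l \<circ> fR) id"
    using s0 s1 s2 s3 s4 b(3) by (blast intro: homotopic_with_trans)
  from homotopy_equivalenceI[OF fR l r this fr] show ?thesis .
qed

section \<open>Homotopy invariance of mapping complexes\<close>

context model_category begin

lemma realization_postcomp:
  assumes A: "is_functor Simplex M A" and f: "f \<in> Hom M P Q" and g: "g \<in> Hom M Q R"
    and c: "c \<in> topspace (realization (map_complex M A P))"
  shows "realization_map (map_complex M A R) (\<lambda>n x. (g \<odot> f) \<odot> x) c =
    realization_map (map_complex M A R) (\<lambda>n x. g \<odot> x) (realization_map (map_complex M A Q) (\<lambda>n x. f \<odot> x) c)"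
proof -
  have "realization_map (map_complex M A R) (\<lambda>n x. g \<odot> (f \<odot> x)) c =
    realization_map (map_complex M A R) (\<lambda>n x. g \<odot> x) (realization_map (map_complex M A Q) (\<lambda>n x. f \<odot> x) c)"
    by (rule realization_map_comp[OF simplicial_set_map_complex[OF A] simplicial_set_map_complex[OF A]
      simplicial_map_postcomp[OF A f] simplicial_map_postcomp[OF A g] c])
  moreover have "realization_map (map_complex M A R) (\<lambda>n x. (g \<odot> f) \<odot> x) c =
      realization_map (map_complex M A R) (\<lambda>n x. g \<odot> (f \<odot> x)) c"
    by (rule realization_map_cong[OF simplicial_set_map_complex[OF A]
      simplicial_map_postcomp[OF A Comp_Hom[OF f g]] _ c])
      (use Comp_assoc[OF _ f g] in \<open>simp add: map_complex_def\<close>)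
  ultimately show ?thesis by simp
qed

text \<open>Ken Brown's argument: \<open>e = p1 \<odot> s\<close> where \<open>s\<close> is a
  section of the trivial fibration \<open>p0\<close>, and \<open>p1\<close> is a trivial fibration
  too because \<open>e\<close> is a weak equivalence.\<close>

lemma homotopy_equivalence_postcomp:
  assumes A: "Reedy_cofibrant M A" and e: "e \<in> Hom M Q R" "e \<in> weq M" and fibr: "fibrant M Q" "fibrant M R"
  shows "homotopy_equivalence (realization (map_complex M A Q)) (realization (map_complex M A R))
    (realization_map (map_complex M A R) (\<lambda>n x. e \<odot> x))"
proof -
  have fA: "is_functor Simplex M A" using A by (simp add: Reedy_cofibrant_def)
  obtain P s p0 p1 where P: "s \<in> Hom M Q P" "s \<in> tcof" "p0 \<in> Hom M P Q" "p1 \<in> Hom M P R"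
    "p0 \<odot> s = Ide M Q" "p1 \<odot> s = e" "p0 \<in> tfib" "p1 \<in> fib M"
    by (rule mapping_path[OF e(1) fibr]) (rule that)
  have p1: "p1 \<in> tfib" using weq_left[OF P(1,4)] P(2,6,8) e(2) by simp
  let ?m = "\<lambda>R f. realization_map (map_complex M A R) (\<lambda>n x. f \<odot> x)" and ?r = "\<lambda>R. realization (map_complex M A R)"
  have tf: "homotopy_equivalence (?r E) (?r Z) (?m Z p)" if "p \<in> tfib" "p \<in> Hom M E Z" for p E Z
    using trivial_fibration_sset_weq[OF trivial_fibration_map_complex[OF A that]] by (simp add: sset_weq_def)
  have "homotopy_equivalence (?r Q) (?r Q) (?m Q p0 \<circ> ?m P s)"
  proof (rule homotopy_equivalence_cong[OF homotopy_equivalence_id])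
    fix c assume c: "c \<in> topspace (?r Q)"
    have "(?m Q p0 \<circ> ?m P s) c = ?m Q (Ide M Q) c" using realization_postcomp[OF fA P(1,3) c] P(5) by simp
    also have "\<dots> = realization_map (map_complex M A Q) (\<lambda>n x. x) c"
      by (rule realization_map_cong[OF simplicial_set_map_complex[OF fA] simplicial_map_postcomp[OF fA Ide_Hom[OF Hom_Ob(1)[OF P(1)]]] _ c])
        (simp add: map_complex_def Ide_Comp)
    also have "\<dots> = c" by (rule realization_map_id[OF simplicial_set_map_complex[OF fA] c])
    finally show "id c = (?m Q p0 \<circ> ?m P s) c" by simp
  qed
  then have "homotopy_equivalence (?r Q) (?r P) (?m P s)"
    by (rule homotopy_equivalence_cancel_left[OF tf[OF P(7,3)]])
      (rule continuous_map_realization_map[OF simplicial_set_map_complex[OF fA] simplicial_map_postcomp[OF fA P(1)]])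
  from homotopy_equivalence_comp[OF this tf[OF p1 P(4)]]
  show ?thesis
    by (rule homotopy_equivalence_cong) (use realization_postcomp[OF fA P(1,4)] P(6) in simp)
qed

lemma simplicial_map_precomp:
  assumes A: "is_functor Simplex M A" and B: "is_functor Simplex M B" and G: "nat_trans Simplex M A B G"
  shows "simplicial_map (map_complex M B R) (map_complex M A R) (\<lambda>n x. x \<odot> G n)"
  unfolding simplicial_map_def
proof (intro conjI allI ballI impI)
  note AF = functorD[OF A] and BF = functorD[OF B] and GN = natD[OF G]
  fix n x assume "x \<in> simp (map_complex M B R) n"
  then have x: "x \<in> Hom M (onOb B n) R" by (simp add: map_complex_def)
  show "x \<odot> G n \<in> simp (map_complex M A R) n" using Comp_Hom[OF GN(1) x] by (simp add: map_complex_def)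
  fix m \<alpha> assume \<alpha>: "\<alpha> \<in> Hom Simplex m n"
  show "act (map_complex M B R) \<alpha> x \<odot> G m = act (map_complex M A R) \<alpha> (x \<odot> G n)"
    using Comp_assoc[OF GN(1) BF(2)[OF \<alpha>] x] Comp_assoc[OF AF(2)[OF \<alpha>] GN(1) x] GN(2)[OF \<alpha>]
    by (simp add: map_complex_def)
qed

section \<open>Zigzags\<close>

lemma is_path_Ob: "is_path M X p Y \<Longrightarrow> X \<in> Ob M \<and> Y \<in> Ob M"
proof (induction p arbitrary: X)
  case (Cons s p)
  then show ?case using Dom_Ob Cod_Ob weq_Ar by (cases s) auto
qed simp

lemma is_path_append: "is_path M X (p @ q) Y \<longleftrightarrow> (\<exists>Z. is_path M X p Z \<and> is_path M Z q Y)"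
proof (induction p arbitrary: X)
  case Nil
  then show ?case using is_path_Ob by auto
next
  case (Cons s p)
  then show ?case by (cases s) auto
qed

lemma is_path_Fwd: "is_path M X [Fwd f] Y \<longleftrightarrow> f \<in> Hom M X Y"
  using Cod_Ob by (auto simp: Hom_def)

lemma is_path_Bwd: "is_path M X [Bwd w] Y \<longleftrightarrow> w \<in> Hom M Y X \<and> w \<in> weq M"
  using Dom_Ob weq_Ar by (auto simp: Hom_def)

lemma path_Fwd: "f \<in> Hom M X Y \<Longrightarrow> is_path M X [Fwd f] Y"
  by (simp only: is_path_Fwd)

lemma path_Bwd: "\<lbrakk>w \<in> Hom M Y X; w \<in> weq M\<rbrakk> \<Longrightarrow> is_path M X [Bwd w] Y"
  by (simp only: is_path_Bwd)

definition path_eq where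
  "path_eq X Y p q \<longleftrightarrow> is_path M X p Y \<and> is_path M X q Y \<and> equivclp (zigzag_rel M) (X, p, Y) (X, q, Y)"

lemma equivclp_zigzag:
  assumes "equivclp (zigzag_rel M) (X, p, Y) z" "is_path M X p Y"
  shows "\<exists>q. z = (X, q, Y) \<and> is_path M X q Y"
  using assms(1)
proof (induction rule: equivclp_induct)
  case (step y z)
  then show ?case by (auto elim!: zigzag_rel.cases)
qed (use assms(2) in simp)

lemma path_eq_refl: "is_path M X p Y \<Longrightarrow> path_eq X Y p p"
  by (simp add: path_eq_def)

lemma path_eq_sym: "path_eq X Y p q \<Longrightarrow> path_eq X Y q p"
  using equivclp_sym[of "zigzag_rel M"] by (auto simp: path_eq_def)

lemma path_eq_trans [trans]: "\<lbrakk>path_eq X Y p q; path_eq X Y q r\<rbrakk> \<Longrightarrow> path_eq X Y p r"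
  using equivclp_trans[of "zigzag_rel M"] unfolding path_eq_def by blast

text \<open>The generating relation already applies inside a context, so its closure is a congruence
  for concatenation. The induction records that all intermediate zigzags keep their end
  points.\<close>

lemma path_eq_append:
  assumes "path_eq X Y p q" and l: "is_path M W l X" and r: "is_path M Y r Z"
  shows "path_eq W Z (l @ p @ r) (l @ q @ r)"
proof -
  have p: "is_path M X p Y" and pq: "equivclp (zigzag_rel M) (X, p, Y) (X, q, Y)"
    using assms(1) by (auto simp: path_eq_def)
  have ext: "zigzag_rel M (W, l @ p @ r, Z) (W, l @ q @ r, Z)" if "zigzag_rel M (X, p, Y) (X, q, Y)" for p q
    using that
  proof cases
    case (1 r0 s0 p1 q1)
    have "is_path M X p Y" "is_path M X q Y" using 1 by simp_all
    then have "is_path M W (l @ p @ r) Z" "is_path M W (l @ q @ r) Z"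
      using l r unfolding is_path_append by blast+
    then show ?thesis using 1 zigzag_rel.intros[of M r0 s0 W "l @ p1" "q1 @ r" Z] by simp
  qed
  have "\<exists>q. z = (X, q, Y) \<and> is_path M X q Y \<and> equivclp (zigzag_rel M) (W, l @ p @ r, Z) (W, l @ q @ r, Z)"
    if "equivclp (zigzag_rel M) (X, p, Y) z" for z
    using that
  proof (induction rule: equivclp_induct)
    case base
    show ?case using p by simp
  next
    case (step y z)
    then obtain q where q: "y = (X, q, Y)" "is_path M X q Y"
      "equivclp (zigzag_rel M) (W, l @ p @ r, Z) (W, l @ q @ r, Z)" by blast
    obtain q' where q': "z = (X, q', Y)" "is_path M X q' Y"
      using step.hyps(2) q(1) by (auto elim!: zigzag_rel.cases)
    have "equivclp (zigzag_rel M) (W, l @ q @ r, Z) (W, l @ q' @ r, Z)"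
      using step.hyps(2) ext unfolding q(1) q'(1) by (auto intro: r_into_equivclp converse_r_into_equivclp)
    then show ?case using q q' equivclp_trans[of "zigzag_rel M"] by blast
  qed
  from this[OF pq] have "equivclp (zigzag_rel M) (W, l @ p @ r, Z) (W, l @ q @ r, Z)" by simp
  moreover have "is_path M W (l @ p @ r) Z" "is_path M W (l @ q @ r) Z"
    using assms unfolding path_eq_def is_path_append by blast+
  ultimately show ?thesis by (simp add: path_eq_def)
qed

lemma path_eq_basic:
  assumes "basic_rel M r s" "is_path M X r Y" "is_path M X s Y"
  shows "path_eq X Y r s"
  using zigzag_rel.intros[of M r s X "[]" "[]" Y] assms by (simp add: path_eq_def r_into_equivclp)

lemma path_eq_comp: "\<lbrakk>f \<in> Hom M X Y; g \<in> Hom M Y Z\<rbrakk> \<Longrightarrow> path_eq X Z [Fwd f, Fwd g] [Fwd (g \<odot> f)]"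
  using path_eq_basic[OF basic_rel.intros(2)[of f M X Y g Z], of X Z] is_path_append[of X "[Fwd f]" "[Fwd g]" Z]
    Comp_Hom[of f X Y g Z] by (auto simp del: is_path.simps simp: is_path_Fwd)

lemma path_eq_Fwd_Bwd: "\<lbrakk>w \<in> Hom M X Y; w \<in> weq M\<rbrakk> \<Longrightarrow> path_eq X X [Fwd w, Bwd w] []"
  using Hom_Ob by (intro path_eq_basic basic_rel.intros(3)) (auto simp: Hom_def)

lemma path_eq_Bwd_Fwd: "\<lbrakk>w \<in> Hom M X Y; w \<in> weq M\<rbrakk> \<Longrightarrow> path_eq Y Y [Bwd w, Fwd w] []"
  using Hom_Ob by (intro path_eq_basic basic_rel.intros(4)) (auto simp: Hom_def)

text \<open>A section of a weak equivalence becomes its inverse: append \<open>w\<close> and its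
  formal inverse, cancel \<open>s\<close> against the new \<open>w\<close>, and remove the remaining
  pair.\<close>

lemma path_eq_inverse:
  assumes "s \<in> Hom M X Y" "w \<in> Hom M Y X" "w \<odot> s = Ide M X" "w \<in> weq M"
  shows "path_eq Y Y [Fwd w, Fwd s] []"
proof -
  have Ob: "X \<in> Ob M" "Y \<in> Ob M" using Hom_Ob[OF assms(1)] by auto
  have "path_eq Y Y [Fwd w, Fwd s, Fwd w, Bwd w] [Fwd w, Fwd s]"
    using path_eq_append[OF path_eq_Fwd_Bwd[OF assms(2,4)], of Y "[Fwd w, Fwd s]" "[]" Y] assms Ob
    by (auto simp: Hom_def)
  moreover have "path_eq X X [Fwd s, Fwd w] [Fwd (Ide M X)]" using path_eq_comp[OF assms(1,2)] assms(3) by simp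
  then have "path_eq Y Y [Fwd w, Fwd s, Fwd w, Bwd w] [Fwd w, Fwd (Ide M X), Bwd w]"
    using path_eq_append[of X X "[Fwd s, Fwd w]" "[Fwd (Ide M X)]" Y "[Fwd w]" "[Bwd w]" Y] assms Ob
    by (auto simp: Hom_def)
  moreover have "path_eq Y X [Fwd w, Fwd (Ide M X)] [Fwd w]"
    using path_eq_comp[OF assms(2) Ide_Hom[OF Ob(1)]] Ide_Comp[OF assms(2)] by simp
  then have "path_eq Y Y [Fwd w, Fwd (Ide M X), Bwd w] [Fwd w, Bwd w]"
    using path_eq_append[of Y X "[Fwd w, Fwd (Ide M X)]" "[Fwd w]" Y "[]" "[Bwd w]" Y] assms Ob
    by (auto simp: Hom_def)
  ultimately show ?thesis
    using path_eq_Fwd_Bwd[OF assms(2,4)] path_eq_trans path_eq_sym by meson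
qed

lemma rep_Ho_class:
  assumes "is_path M X p Y"
  obtains q where "rep (Ho_class M (X, p, Y)) = (X, q, Y)" "path_eq X Y p q"
proof -
  have "(X, p, Y) \<in> Ho_class M (X, p, Y)" by (simp add: Ho_class_def)
  then have "rep (Ho_class M (X, p, Y)) \<in> Ho_class M (X, p, Y)" unfolding rep_def by (rule someI)
  then have *: "equivclp (zigzag_rel M) (X, p, Y) (rep (Ho_class M (X, p, Y)))" by (simp add: Ho_class_def)
  from equivclp_zigzag[OF this assms] obtain q where "rep (Ho_class M (X, p, Y)) = (X, q, Y)" "is_path M X q Y" by blast
  with * assms that show thesis by (simp add: path_eq_def)
qed

text \<open>Composition in \<open>Ho M\<close> is computed on representatives chosen by
  \<open>rep\<close>. Comparing them with given zigzags turns the unit law of the algebra into an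
  equality of zigzags.\<close>

lemma algebra_path:
  assumes alg: "algebra_up_to_homotopy M T \<eta> \<mu> X a" and \<eta>: "\<eta> X \<in> Hom M X (onOb T X)"
  obtains zs where "is_path M (onOb T X) zs X" "path_eq X X (Fwd (\<eta> X) # zs) []"
proof -
  have X: "X \<in> Ob M" and a: "a \<in> Hom (Ho M) (onOb T X) X"
    and unit: "a \<cdot>\<^bsub>Ho M\<^esub> gamma M (\<eta> X) = Ide (Ho M) X"
    using alg unfolding algebra_up_to_homotopy_def EM_algebra_def by (auto simp: Ho_def Ho_functor_def)
  obtain X0 p0 Y0 where p0: "a = Ho_class M (X0, p0, Y0)" "is_path M X0 p0 Y0"
    using a unfolding Hom_def by (auto simp: Ho_def)
  obtain zs where zs: "rep a = (X0, zs, Y0)" "path_eq X0 Y0 p0 zs"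
    using rep_Ho_class[OF p0(2)] p0(1) by metis
  have "X0 = onOb T X" "Y0 = X" using a zs(1) unfolding Hom_def by (auto simp: Ho_def)
  then have rep_a: "rep a = (onOb T X, zs, X)" and zs_path: "is_path M (onOb T X) zs X"
    using zs by (auto simp: path_eq_def)
  have dc: "Dom M (\<eta> X) = X" "Cod M (\<eta> X) = onOb T X" using \<eta> by (auto simp: Hom_def)
  have \<eta>p: "is_path M X [Fwd (\<eta> X)] (onOb T X)" using \<eta> is_path_Fwd by blast
  obtain es where es: "rep (gamma M (\<eta> X)) = (X, es, onOb T X)" "path_eq X (onOb T X) [Fwd (\<eta> X)] es"
    using rep_Ho_class[OF \<eta>p] unfolding gamma_def dc by metis
  have "Ho_class M (X, es @ zs, X) = Ho_class M (X, [], X)"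
    using unit rep_a es(1) by (simp add: Ho_def)
  then have "(X, [], X) \<in> Ho_class M (X, es @ zs, X)" by (simp add: Ho_class_def)
  then have "equivclp (zigzag_rel M) (X, es @ zs, X) (X, [], X)" by (simp add: Ho_class_def)
  moreover have *: "path_eq X X ([Fwd (\<eta> X)] @ zs) (es @ zs)"
    using path_eq_append[OF es(2), of X "[]" zs X] zs_path X by simp
  moreover have "is_path M X [] X" using X by simp
  ultimately have "path_eq X X (es @ zs) []" unfolding path_eq_def by blast
  with * have "path_eq X X ([Fwd (\<eta> X)] @ zs) []" by (rule path_eq_trans)
  with zs_path that show thesis by simp
qed

section \<open>From zigzags to arrows\<close>

text \<open>Functorial factorization of the maps to a terminal object. Strict functoriality of
  \<open>Ra\<close> is what makes the action of zigzags respect identities and composites.\<close>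

lemma fibrant_replacement_functor:
  obtains Ro Ra r where "\<And>X. X \<in> Ob M \<Longrightarrow> r X \<in> Hom M X (Ro X)" "\<And>X. X \<in> Ob M \<Longrightarrow> r X \<in> tcof"
    "\<And>X. X \<in> Ob M \<Longrightarrow> fibrant M (Ro X)"
    "\<And>f X Y. f \<in> Hom M X Y \<Longrightarrow> Ra f \<in> Hom M (Ro X) (Ro Y)"
    "\<And>f X Y. f \<in> Hom M X Y \<Longrightarrow> Ra f \<odot> r X = r Y \<odot> f"
    "\<And>X. X \<in> Ob M \<Longrightarrow> Ra (Ide M X) = Ide M (Ro X)"
    "\<And>f g X Y Z. \<lbrakk>f \<in> Hom M X Y; g \<in> Hom M Y Z\<rbrakk> \<Longrightarrow> Ra (g \<odot> f) = Ra g \<odot> Ra f"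
proof -
  obtain I where I: "terminal M I" by (rule terminal_exists)
  have IOb: "I \<in> Ob M" using I by (simp add: terminal_def)
  define \<tau> where "\<tau> X = (SOME t. t \<in> Hom M X I)" for X
  have \<tau>: "\<tau> X \<in> Hom M X I" if "X \<in> Ob M" for X
  proof -
    have "\<exists>t. t \<in> Hom M X I" using I that unfolding terminal_def by blast
    then show ?thesis unfolding \<tau>_def by (rule someI_ex)
  qed
  have uniq: "f = g" if "f \<in> Hom M X I" "g \<in> Hom M X I" for f g X
    using I Hom_Ob(1)[OF that(1)] that unfolding terminal_def by blast
  obtain E a b k where
    E1: "\<forall>f\<in>Ar M. a f \<in> cof M \<inter> weq M \<inter> Hom M (Dom M f) (E f) \<and> b f \<in> fib M \<inter> Hom M (E f) (Cod M f) \<and> b f \<odot> a f = f"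
    and E2: "\<forall>f g u v. square M f g u v \<longrightarrow> k f g u v \<in> Hom M (E f) (E g) \<and> k f g u v \<odot> a f = a g \<odot> u \<and>
      b g \<odot> k f g u v = v \<odot> b f"
    and E3: "\<forall>f\<in>Ar M. k f f (Ide M (Dom M f)) (Ide M (Cod M f)) = Ide M (E f)"
    and E4: "\<forall>f g h u v u' v'. square M f g u v \<longrightarrow> square M g h u' v' \<longrightarrow>
      k f h (u' \<odot> u) (v' \<odot> v) = k g h u' v' \<odot> k f g u v"
    using factor_tcof unfolding has_functorial_factorization_def by (elim exE conjE) (rule that)
  have \<tau>': "\<tau> X \<in> Ar M" "Dom M (\<tau> X) = X" "Cod M (\<tau> X) = I" if "X \<in> Ob M" for X
    using \<tau>[OF that] by (auto simp: Hom_def)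
  have sq: "square M (\<tau> X) (\<tau> Y) f (Ide M I)" if f: "f \<in> Hom M X Y" for f X Y
  proof -
    note XY = Hom_Ob[OF f]
    have "\<tau> Y \<odot> f = Ide M I \<odot> \<tau> X"
      by (rule uniq[OF Comp_Hom[OF f \<tau>[OF XY(2)]] Comp_Hom[OF \<tau>[OF XY(1)] Ide_Hom[OF IOb]]])
    then show ?thesis using f \<tau>'[OF XY(1)] \<tau>'[OF XY(2)] Ide_Hom[OF IOb] by (simp add: square_def)
  qed
  define r where "r X = a (\<tau> X)" for X
  define Ro where "Ro X = E (\<tau> X)" for X
  define Ra where "Ra f = k (\<tau> (Dom M f)) (\<tau> (Cod M f)) f (Ide M I)" for f
  have Ra: "Ra f = k (\<tau> X) (\<tau> Y) f (Ide M I)" if "f \<in> Hom M X Y" for f X Y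
    using that by (auto simp: Ra_def Hom_def)
  show thesis
  proof (rule that[of r Ro Ra])
    fix X assume X: "X \<in> Ob M"
    show "r X \<in> Hom M X (Ro X)" "r X \<in> tcof" using E1 \<tau>'[OF X] by (auto simp: r_def Ro_def)
    have "b (\<tau> X) \<in> fib M" "b (\<tau> X) \<in> Hom M (Ro X) I" using E1 \<tau>'[OF X] by (auto simp: Ro_def)
    then show "fibrant M (Ro X)" using I Hom_Ob(1) unfolding fibrant_def by blast
    have "Ide M X \<in> Hom M X X" by (rule Ide_Hom[OF X])
    then show "Ra (Ide M X) = Ide M (Ro X)"
      using E3 \<tau>'[OF X] unfolding Ra[OF \<open>Ide M X \<in> Hom M X X\<close>] Ro_def by metis
  next
    fix f X Y assume f: "f \<in> Hom M X Y"
    show "Ra f \<in> Hom M (Ro X) (Ro Y)" "Ra f \<odot> r X = r Y \<odot> f"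
      using E2 sq[OF f] unfolding Ra[OF f] Ro_def r_def by blast+
    fix g Z assume g: "g \<in> Hom M Y Z"
    have "Ide M I \<odot> Ide M I = Ide M I" by (rule Comp_Ide[OF Ide_Hom[OF IOb]])
    then show "Ra (g \<odot> f) = Ra g \<odot> Ra f"
      using E4 sq[OF f] sq[OF g] unfolding Ra[OF f] Ra[OF g] Ra[OF Comp_Hom[OF f g]] by metis
  qed
qed

text \<open>The zigzag is followed step by step from \<open>U\<close>, the part already traversed
  being represented by an arrow \<open>u\<close> into the fibrant replacement of its end point.
  Forward steps compose with \<open>Ra f\<close>; backward steps need a lift, which is where
  cofibrancy of \<open>U\<close> enters. At the end \<open>Ro N\<close> retracts onto the fibrant
  object \<open>N\<close>.\<close>

lemma path_representable:
  assumes U: "cofibrant M U" and N: "fibrant M N" and p: "is_path M U p N"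
  obtains b where "b \<in> Hom M U N" "path_eq U N p [Fwd b]"
proof -
  obtain Ro Ra r where R: "\<And>X. X \<in> Ob M \<Longrightarrow> r X \<in> Hom M X (Ro X)" "\<And>X. X \<in> Ob M \<Longrightarrow> r X \<in> tcof"
    "\<And>X. X \<in> Ob M \<Longrightarrow> fibrant M (Ro X)" "\<And>f X Y. f \<in> Hom M X Y \<Longrightarrow> Ra f \<in> Hom M (Ro X) (Ro Y)"
    "\<And>f X Y. f \<in> Hom M X Y \<Longrightarrow> Ra f \<odot> r X = r Y \<odot> f"
    by (rule fibrant_replacement_functor) (rule that; assumption?; blast)
  have "\<exists>u. u \<in> Hom M U (Ro Y) \<and> path_eq U (Ro Y) (p @ [Fwd (r Y)]) [Fwd u]" if "is_path M U p Y" for p Y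
    using that
  proof (induction p arbitrary: Y rule: rev_induct)
    case Nil
    then have "U \<in> Ob M" "Y = U" by simp_all
    then show ?case using R(1)[of U] path_eq_refl[OF path_Fwd[OF R(1)]] by auto
  next
    case (snoc s p)
    then obtain Z where Z: "is_path M U p Z" "is_path M Z [s] Y" unfolding is_path_append by blast
    then obtain u where u: "u \<in> Hom M U (Ro Z)" "path_eq U (Ro Z) (p @ [Fwd (r Z)]) [Fwd u]" using snoc.IH by blast
    have ZOb: "Z \<in> Ob M" "Y \<in> Ob M" "U \<in> Ob M" using is_path_Ob Z by blast+
    have nil: "is_path M U [] U" using ZOb by simp
    show ?case
    proof (cases s)
      case (Fwd f)
      then have f: "f \<in> Hom M Z Y" using Z(2) is_path_Fwd by simp
      have "path_eq Z (Ro Y) [Fwd f, Fwd (r Y)] [Fwd (Ra f \<odot> r Z)]"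
        using path_eq_comp[OF f R(1)[OF ZOb(2)]] R(5)[OF f] by simp
      moreover have "path_eq Z (Ro Y) [Fwd (Ra f \<odot> r Z)] [Fwd (r Z), Fwd (Ra f)]"
        by (rule path_eq_sym[OF path_eq_comp[OF R(1)[OF ZOb(1)] R(4)[OF f]]])
      ultimately have "path_eq Z (Ro Y) [Fwd f, Fwd (r Y)] [Fwd (r Z), Fwd (Ra f)]" by (rule path_eq_trans)
      from path_eq_append[OF this Z(1), of "[]" "Ro Y"]
      have "path_eq U (Ro Y) (p @ [Fwd f, Fwd (r Y)]) (p @ [Fwd (r Z), Fwd (Ra f)])"
        using Hom_Ob(2)[OF R(4)[OF f]] by simp
      also have "path_eq U (Ro Y) (p @ [Fwd (r Z), Fwd (Ra f)]) [Fwd u, Fwd (Ra f)]"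
        using path_eq_append[OF u(2) nil path_Fwd[OF R(4)[OF f]]] by simp
      also have "path_eq U (Ro Y) [Fwd u, Fwd (Ra f)] [Fwd (Ra f \<odot> u)]" by (rule path_eq_comp[OF u(1) R(4)[OF f]])
      finally show ?thesis using Fwd Comp_Hom[OF u(1) R(4)[OF f]] by auto
    next
      case (Bwd w)
      then have w: "w \<in> Hom M Y Z" "w \<in> weq M" using Z(2) is_path_Bwd by simp_all
      note Rw = R(4)[OF w(1)]
      have rY: "r Y \<in> weq M" and rZ: "r Z \<in> weq M" using R(2) ZOb by blast+
      have Rw_weq: "Ra w \<in> weq M"
        using weq_left[OF R(1)[OF ZOb(2)] Rw rY] R(5)[OF w(1)] weq_comp[OF w(1) R(1)[OF ZOb(1)] w(2) rZ] by simp
      \<comment> \<open>To go back along \<open>Ra w\<close>, lift \<open>u\<close> through the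
        trivial fibration \<open>p1\<close> and project by \<open>p0\<close>. Since
        \<open>p0\<close> and \<open>s'\<close> are inverse to each other as zigzags, the result
        \<open>u'\<close> followed by \<open>Ra w\<close> equals \<open>u\<close> in the homotopy
        category.\<close>
      obtain P s' p0 p1 where P: "s' \<in> Hom M (Ro Y) P" "s' \<in> tcof" "p0 \<in> Hom M P (Ro Y)" "p1 \<in> Hom M P (Ro Z)"
        "p0 \<odot> s' = Ide M (Ro Y)" "p1 \<odot> s' = Ra w" "p0 \<in> tfib" "p1 \<in> fib M"
        by (rule mapping_path[OF Rw R(3)[OF ZOb(2)] R(3)[OF ZOb(1)]]) (rule that)
      have p1: "p1 \<in> tfib" using weq_left[OF P(1,4)] P(2,6,8) Rw_weq by simp
      obtain x where x: "x \<in> Hom M U P" "p1 \<odot> x = u" by (rule cofibrant_lift[OF U p1 P(4) u(1)])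
      define u' where "u' = p0 \<odot> x"
      have u': "u' \<in> Hom M U (Ro Y)" unfolding u'_def by (rule Comp_Hom[OF x(1) P(3)])
      have p0w: "p0 \<in> weq M" using P(7) by simp
      have xp: "is_path M U [Fwd x] P" "is_path M P [Fwd p1] (Ro Z)" using x(1) P(4) is_path_Fwd by blast+
      have "path_eq U (Ro Z) [Fwd u', Fwd (Ra w)] ([Fwd x] @ [Fwd p0, Fwd s'] @ [Fwd p1])"
      proof -
        have "path_eq U (Ro Y) [Fwd u'] [Fwd x, Fwd p0]" unfolding u'_def by (rule path_eq_sym[OF path_eq_comp[OF x(1) P(3)]])
        from path_eq_append[OF this nil path_Fwd[OF Rw]]
        have 1: "path_eq U (Ro Z) [Fwd u', Fwd (Ra w)] ([Fwd x, Fwd p0] @ [Fwd (Ra w)])" by simp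
        have xp0: "is_path M U [Fwd x, Fwd p0] (Ro Y)"
          using is_path_append[of U "[Fwd x]" "[Fwd p0]" "Ro Y"] xp(1) P(3) is_path_Fwd by auto
        have "path_eq (Ro Y) (Ro Z) [Fwd (Ra w)] [Fwd s', Fwd p1]"
          using path_eq_sym[OF path_eq_comp[OF P(1,4)]] P(6) by simp
        from path_eq_append[OF this xp0, of "[]" "Ro Z"] Hom_Ob(2)[OF Rw]
        have "path_eq U (Ro Z) ([Fwd x, Fwd p0] @ [Fwd (Ra w)]) ([Fwd x] @ [Fwd p0, Fwd s'] @ [Fwd p1])" by simp
        with 1 show ?thesis by (rule path_eq_trans)
      qed
      also have "path_eq U (Ro Z) ([Fwd x] @ [Fwd p0, Fwd s'] @ [Fwd p1]) ([Fwd x] @ [] @ [Fwd p1])"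
        by (rule path_eq_append[OF path_eq_inverse[OF P(1,3,5) p0w] xp])
      also have "path_eq U (Ro Z) ([Fwd x] @ [] @ [Fwd p1]) [Fwd u]"
        using path_eq_comp[OF x(1) P(4)] x(2) by simp
      finally have u'u: "path_eq U (Ro Z) [Fwd u', Fwd (Ra w)] [Fwd u]" .
      have bw: "is_path M (Ro Z) [Bwd (Ra w)] (Ro Y)" using Rw Rw_weq is_path_Bwd by blast
      have pw: "is_path M U (p @ [Bwd w]) Y" using is_path_append Z(1) w is_path_Bwd by blast
      have "is_path M U ((p @ [Bwd w]) @ [Fwd (r Y)]) (Ro Y)"
        unfolding is_path_append[of U "p @ [Bwd w]"] using pw path_Fwd[OF R(1)[OF ZOb(2)]] by blast
      then have pwr: "is_path M U (p @ [Bwd w, Fwd (r Y)]) (Ro Y)" by simp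
      have roY: "is_path M (Ro Y) [] (Ro Y)" using Hom_Ob(1)[OF Rw] by simp
      have "path_eq U (Ro Y) (p @ [Bwd w, Fwd (r Y)]) (p @ [Bwd w, Fwd (r Y), Fwd (Ra w), Bwd (Ra w)])"
        using path_eq_append[OF path_eq_sym[OF path_eq_Fwd_Bwd[OF Rw Rw_weq]] pwr roY] by simp
      also have "path_eq U (Ro Y) (p @ [Bwd w, Fwd (r Y), Fwd (Ra w), Bwd (Ra w)]) (p @ [Bwd w, Fwd w, Fwd (r Z), Bwd (Ra w)])"
      proof -
        have "path_eq Y (Ro Z) [Fwd (r Y), Fwd (Ra w)] [Fwd (r Z \<odot> w)]"
          using path_eq_comp[OF R(1)[OF ZOb(2)] Rw] R(5)[OF w(1)] by simp
        also have "path_eq Y (Ro Z) [Fwd (r Z \<odot> w)] [Fwd w, Fwd (r Z)]"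
          by (rule path_eq_sym[OF path_eq_comp[OF w(1) R(1)[OF ZOb(1)]]])
        finally show ?thesis using path_eq_append[of Y "Ro Z" _ _ U "p @ [Bwd w]" "[Bwd (Ra w)]" "Ro Y"] pw bw by force
      qed
      also have "path_eq U (Ro Y) (p @ [Bwd w, Fwd w, Fwd (r Z), Bwd (Ra w)]) (p @ [Fwd (r Z), Bwd (Ra w)])"
      proof -
        have "is_path M Z [Fwd (r Z), Bwd (Ra w)] (Ro Y)"
          using is_path_append[of Z "[Fwd (r Z)]" "[Bwd (Ra w)]" "Ro Y"] R(1)[OF ZOb(1)] bw is_path_Fwd by auto
        from path_eq_append[OF path_eq_Bwd_Fwd[OF w] Z(1) this] show ?thesis by simp
      qed
      also have "path_eq U (Ro Y) (p @ [Fwd (r Z), Bwd (Ra w)]) [Fwd u, Bwd (Ra w)]"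
        using path_eq_append[OF u(2) nil bw] by simp
      also have "path_eq U (Ro Y) [Fwd u, Bwd (Ra w)] [Fwd u', Fwd (Ra w), Bwd (Ra w)]"
        using path_eq_append[OF path_eq_sym[OF u'u] nil bw] by simp
      also have "path_eq U (Ro Y) [Fwd u', Fwd (Ra w), Bwd (Ra w)] [Fwd u']"
        using path_eq_append[OF path_eq_Fwd_Bwd[OF Rw Rw_weq] path_Fwd[OF u'] roY] by simp
      finally show ?thesis using u' Bwd by auto
    qed
  qed
  from this[OF p] obtain u where u: "u \<in> Hom M U (Ro N)" "path_eq U (Ro N) (p @ [Fwd (r N)]) [Fwd u]" by blast
  have NOb: "N \<in> Ob M" "U \<in> Ob M" using is_path_Ob[OF p] by auto
  obtain \<rho> where \<rho>: "\<rho> \<in> Hom M (Ro N) N" "\<rho> \<odot> r N = Ide M N"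
    using N R(1,2)[OF NOb(1)] Ide_Hom[OF NOb(1)] unfolding fibrant_iff by blast
  have nil: "is_path M U [] U" "is_path M N [] N" using NOb by simp_all
  have "path_eq N N [Fwd (r N), Fwd \<rho>] [Fwd (Ide M N)]" using path_eq_comp[OF R(1)[OF NOb(1)] \<rho>(1)] \<rho>(2) by simp
  also have "path_eq N N [Fwd (Ide M N)] []"
    by (rule path_eq_basic) (use NOb Ide_Hom[OF NOb(1)] is_path_Fwd in \<open>auto intro: basic_rel.intros simp: Hom_def\<close>)
  finally have "path_eq N N [Fwd (r N), Fwd \<rho>] []" .
  from path_eq_sym[OF path_eq_append[OF this p nil(2)]]
  have "path_eq U N p (p @ [Fwd (r N), Fwd \<rho>])" by simp
  also have "path_eq U N (p @ [Fwd (r N), Fwd \<rho>]) [Fwd u, Fwd \<rho>]"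
    using path_eq_append[OF u(2) nil(1) path_Fwd[OF \<rho>(1)]] by simp
  also have "path_eq U N [Fwd u, Fwd \<rho>] [Fwd (\<rho> \<odot> u)]" by (rule path_eq_comp[OF u(1) \<rho>(1)])
  finally show thesis using that Comp_Hom[OF u(1) \<rho>(1)] by blast
qed

end

text \<open>\<open>R f u\<close> is the effect of an arrow on \<open>u\<close>, \<open>h\<close> a
  homotopy relation, and \<open>H w\<close> the set of admissible values before \<open>w\<close>. A
  backward step has no canonical effect and is interpreted as the choice of a preimage up to
  homotopy.\<close>

fun path_acts :: "('m \<Rightarrow> 'm \<Rightarrow> 'm) \<Rightarrow> ('m \<Rightarrow> 'm \<Rightarrow> bool) \<Rightarrow> ('m \<Rightarrow> 'm set) \<Rightarrow> 'm step list \<Rightarrow> 'm \<Rightarrow> 'm \<Rightarrow> bool" where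
  "path_acts R h H [] u v = h u v"
| "path_acts R h H (Fwd f # zs) u v = path_acts R h H zs (R f u) v"
| "path_acts R h H (Bwd w # zs) u v = (\<exists>u'\<in>H w. h (R w u') u \<and> path_acts R h H zs u' v)"

context model_category begin

text \<open>
  Zigzags act as relations on homotopy classes of maps from \<open>U\<close> into fibrant replacements; a
  relation that is invariant under the relations defining the homotopy category.
\<close>

lemma path_eq_detects_weq:
  assumes U: "cofibrant M U" and uv: "u \<in> Hom M U N" "v \<in> Hom M U N" "path_eq U N [Fwd u] [Fwd v]"
    and M': "model_category \<kappa> M'" "M' = M\<lparr>weq := W', fib := F'\<rparr>" and W': "weq M \<subseteq> W'" and v: "v \<in> W'"
  shows "u \<in> W'"
proof -
  interpret M': model_category \<kappa> M' by (rule M'(1))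
  have W'_eq: "Hom M' = Hom M" "Comp M' = Comp M" "weq M' = W'" by (simp_all add: M'(2) Hom_def[abs_def])
  obtain Ro Ra r where R: "\<And>X. X \<in> Ob M \<Longrightarrow> r X \<in> Hom M X (Ro X)" "\<And>X. X \<in> Ob M \<Longrightarrow> r X \<in> tcof"
    "\<And>X. X \<in> Ob M \<Longrightarrow> fibrant M (Ro X)" "\<And>f X Y. f \<in> Hom M X Y \<Longrightarrow> Ra f \<in> Hom M (Ro X) (Ro Y)"
    "\<And>f X Y. f \<in> Hom M X Y \<Longrightarrow> Ra f \<odot> r X = r Y \<odot> f" "\<And>X. X \<in> Ob M \<Longrightarrow> Ra (Ide M X) = Ide M (Ro X)"
    "\<And>f g X Y Z. \<lbrakk>f \<in> Hom M X Y; g \<in> Hom M Y Z\<rbrakk> \<Longrightarrow> Ra (g \<odot> f) = Ra g \<odot> Ra f"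
    by (rule fibrant_replacement_functor) (rule that; assumption?; blast)
  have UOb: "U \<in> Ob M" "N \<in> Ob M" using Hom_Ob[OF uv(1)] by auto
  obtain C in0 in1 where C: "in0 \<in> Hom M U C" "in1 \<in> Hom M U C"
    and CU: "\<And>V u v. \<lbrakk>u \<in> Hom M U V; v \<in> Hom M U V\<rbrakk> \<Longrightarrow> \<exists>!h. h \<in> Hom M C V \<and> h \<odot> in0 = u \<and> h \<odot> in1 = v"
    by (rule binary_coproduct[OF UOb(1) UOb(1)]) (rule that; (assumption | blast))
  obtain fo where fo: "fo \<in> Hom M C U" "fo \<odot> in0 = Ide M U" "fo \<odot> in1 = Ide M U"
    using CU[OF Ide_Hom[OF UOb(1)] Ide_Hom[OF UOb(1)]] by blast
  obtain Cyl c \<sigma> where c: "c \<in> Hom M C Cyl" "\<sigma> \<in> Hom M Cyl U" "c \<in> cof M" "\<sigma> \<in> tfib" "\<sigma> \<odot> c = fo"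
    by (rule factor_cof_obtain[OF fo(1)])
  define i0 where "i0 = c \<odot> in0"
  define i1 where "i1 = c \<odot> in1"
  have i: "i0 \<in> Hom M U Cyl" "i1 \<in> Hom M U Cyl" "\<sigma> \<odot> i0 = Ide M U" "\<sigma> \<odot> i1 = Ide M U"
    unfolding i0_def i1_def using Comp_Hom[OF C(1) c(1)] Comp_Hom[OF C(2) c(1)]
      Comp_assoc[OF C(1) c(1,2)] Comp_assoc[OF C(2) c(1,2)] c(5) fo(2,3) by simp_all
  have iw: "i0 \<in> weq M" "i1 \<in> weq M"
    using weq_right[OF i(1) c(2)] weq_right[OF i(2) c(2)] c(4) i(3,4) Ide_weq[OF UOb(1)] by auto
  \<comment> \<open>Left homotopy with respect to one fixed cylinder of \<open>U\<close>. Its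
    equivalence closure \<open>h\<close> avoids proofs of symmetry and transitivity.\<close>
  define hstep where "hstep x y \<longleftrightarrow> (\<exists>Z. \<exists>K\<in>Hom M Cyl Z. K \<odot> i0 = x \<and> K \<odot> i1 = y)" for x y
  define h where "h = equivclp hstep"
  have hstep_Hom: "x \<in> Hom M U Z \<longleftrightarrow> y \<in> Hom M U Z" if "hstep x y" for x y Z
  proof -
    obtain Z' K where "K \<in> Hom M Cyl Z'" "K \<odot> i0 = x" "K \<odot> i1 = y" using \<open>hstep x y\<close> unfolding hstep_def by blast
    then have "x \<in> Hom M U Z'" "y \<in> Hom M U Z'" using Comp_Hom i(1,2) by blast+
    then show ?thesis by (auto simp: Hom_def)
  qed
  have h_refl: "h x x" for x by (simp add: h_def)
  have h_sym: "h x y \<Longrightarrow> h y x" for x y unfolding h_def by (rule equivclp_sym)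
  have h_trans: "h x y \<Longrightarrow> h y z \<Longrightarrow> h x z" for x y z unfolding h_def by (rule equivclp_trans)
  have h_Hom: "y \<in> Hom M U Z" if "h x y" "x \<in> Hom M U Z" for x y Z
    using that(1) unfolding h_def
    by (induction rule: equivclp_induct) (use that(2) hstep_Hom in auto)
  have hstep_post: "hstep (g \<odot> x) (g \<odot> y)" if xy: "hstep x y" "x \<in> Hom M U Z" "g \<in> Hom M Z Z'" for x y g Z Z'
  proof -
    obtain Z1 K where K: "K \<in> Hom M Cyl Z1" "K \<odot> i0 = x" "K \<odot> i1 = y" using xy(1) unfolding hstep_def by blast
    have "Z1 = Z" using Comp_Hom[OF i(1) K(1)] K(2) xy(2) by (simp add: Hom_def)
    with K have K: "K \<in> Hom M Cyl Z" "K \<odot> i0 = x" "K \<odot> i1 = y" by auto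
    then show ?thesis
      unfolding hstep_def using Comp_Hom[OF K(1) xy(3)] Comp_assoc[OF i(1) K(1) xy(3)] Comp_assoc[OF i(2) K(1) xy(3)] by auto
  qed
  have h_post: "h (g \<odot> x) (g \<odot> y)" if xy: "h x y" "x \<in> Hom M U Z" "g \<in> Hom M Z Z'" for x y g Z Z'
    using xy(1) unfolding h_def
  proof (induction rule: equivclp_induct)
    case (step y z)
    have y: "y \<in> Hom M U Z" using h_Hom[of x y Z] step.hyps(1) xy(2) unfolding h_def by blast
    have z: "z \<in> Hom M U Z" using step.hyps(2) y hstep_Hom by blast
    have "hstep (g \<odot> y) (g \<odot> z) \<or> hstep (g \<odot> z) (g \<odot> y)"
      using step.hyps(2) hstep_post[OF _ y xy(3)] hstep_post[OF _ z xy(3)] by blast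
    then show ?case using step.IH by (metis equivclp_into_equivclp)
  qed simp
  have lift_step: "hstep x y" if p: "p \<in> tfib" "p \<in> Hom M E Z" and xy: "x \<in> Hom M U E" "y \<in> Hom M U E"
    "hstep (p \<odot> x) (p \<odot> y)" for p E Z x y
  proof -
    obtain Z1 K where K1: "K \<in> Hom M Cyl Z1" "K \<odot> i0 = p \<odot> x" "K \<odot> i1 = p \<odot> y" using xy(3) unfolding hstep_def by blast
    have "Z1 = Z" using Comp_Hom[OF i(1) K1(1)] K1(2) Comp_Hom[OF xy(1) p(2)] by (simp add: Hom_def)
    with K1 have K: "K \<in> Hom M Cyl Z" "K \<odot> i0 = p \<odot> x" "K \<odot> i1 = p \<odot> y" by auto
    obtain k where k: "k \<in> Hom M C E" "k \<odot> in0 = x" "k \<odot> in1 = y" using CU[OF xy(1,2)] by blast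
    have "p \<odot> k = K \<odot> c"
      using CU[OF Comp_Hom[OF xy(1) p(2)] Comp_Hom[OF xy(2) p(2)]] Comp_Hom[OF k(1) p(2)] Comp_Hom[OF c(1) K(1)]
        Comp_assoc[OF C(1) k(1) p(2)] Comp_assoc[OF C(2) k(1) p(2)] Comp_assoc[OF C(1) c(1) K(1)]
        Comp_assoc[OF C(2) c(1) K(1)] k(2,3) K(2,3) unfolding i0_def i1_def by metis
    then obtain H where H: "H \<in> Hom M Cyl E" "H \<odot> c = k" "p \<odot> H = K"
      using lift[OF lift_cof[OF c(3) p(1)] c(1) p(2) k(1) K(1)] by metis
    have "H \<odot> i0 = x" "H \<odot> i1 = y"
      unfolding i0_def i1_def using Comp_assoc[OF C(1) c(1) H(1)] Comp_assoc[OF C(2) c(1) H(1)] H(2) k(2,3) by simp_all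
    then show ?thesis unfolding hstep_def using H(1) by blast
  qed
  have const: "hstep x x" if x: "x \<in> Hom M U Z" for x Z
  proof -
    have "x \<odot> \<sigma> \<in> Hom M Cyl Z" "x \<odot> \<sigma> \<odot> i0 = x" "x \<odot> \<sigma> \<odot> i1 = x"
      using Comp_Hom[OF c(2) x] Comp_assoc[OF i(1) c(2) x] Comp_assoc[OF i(2) c(2) x] i(3,4) Comp_Ide[OF x] by simp_all
    then show ?thesis unfolding hstep_def by blast
  qed
  \<comment> \<open>Trivial fibrations are injective on homotopy classes. A chain of homotopies
    downstairs is lifted link by link: the intermediate maps lift because \<open>U\<close> is
    cofibrant, and each homotopy lifts with prescribed ends by \<open>lift_step\<close>.\<close>
  have inj: "h x y" if p: "p \<in> tfib" "p \<in> Hom M E Z" and xy: "x \<in> Hom M U E" "y \<in> Hom M U E"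
    "h (p \<odot> x) (p \<odot> y)" for p E Z x y
  proof -
    have "\<forall>y\<in>Hom M U E. p \<odot> y = z \<longrightarrow> h x y" if "equivclp hstep (p \<odot> x) z" for z
      using that
    proof (induction rule: equivclp_induct)
      case base
      show ?case
      proof (intro ballI impI)
        fix y assume y: "y \<in> Hom M U E" "p \<odot> y = p \<odot> x"
        have "hstep (p \<odot> x) (p \<odot> y)" using const[OF Comp_Hom[OF xy(1) p(2)]] y(2) by simp
        then show "h x y" unfolding h_def using lift_step[OF p xy(1) y(1)] by (simp add: r_into_equivclp)
      qed
    next
      case (step z z')
      have zH: "z \<in> Hom M U Z" using h_Hom[of "p \<odot> x" z Z] step.hyps(1) Comp_Hom[OF xy(1) p(2)] unfolding h_def by blast
      obtain y0 where y0: "y0 \<in> Hom M U E" "p \<odot> y0 = z" by (rule cofibrant_lift[OF U p zH])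
      show ?case
      proof (intro ballI impI)
        fix y assume y: "y \<in> Hom M U E" "p \<odot> y = z'"
        have "hstep y0 y \<or> hstep y y0"
          using step.hyps(2) lift_step[OF p y0(1) y(1)] lift_step[OF p y(1) y0(1)] y0(2) y(2) by auto
        moreover have "h x y0" using step.IH y0 by blast
        ultimately show "h x y" unfolding h_def by (metis equivclp_into_equivclp)
      qed
    qed
    with xy show ?thesis unfolding h_def by blast
  qed
  \<comment> \<open>The mapping path object reduces \<open>Ra w\<close> to two trivial fibrations,
    so it acts bijectively on homotopy classes. \<open>Rsurj\<close> and \<open>Rinj\<close> are the
    two halves; they justify reading \<open>Bwd w\<close> as an inverse.\<close>
  have Rbij: "\<exists>P s p0 p1. s \<in> Hom M (Ro Y) P \<and> p0 \<in> Hom M P (Ro Y) \<and> p1 \<in> Hom M P (Ro Z) \<and>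
      p0 \<odot> s = Ide M (Ro Y) \<and> p1 \<odot> s = Ra w \<and> p0 \<in> tfib \<and> p1 \<in> tfib"
    if w: "w \<in> Hom M Y Z" "w \<in> weq M" for w Y Z
  proof -
    note Rw = R(4)[OF w(1)] and YZ = Hom_Ob[OF w(1)]
    have rY: "r Y \<in> weq M" and rZ: "r Z \<in> weq M" using R(2) YZ by blast+
    have Rw_weq: "Ra w \<in> weq M"
      using weq_left[OF R(1)[OF YZ(1)] Rw rY] R(5)[OF w(1)] weq_comp[OF w(1) R(1)[OF YZ(2)] w(2) rZ] by simp
    obtain P s' p0 p1 where P: "s' \<in> Hom M (Ro Y) P" "s' \<in> tcof" "p0 \<in> Hom M P (Ro Y)" "p1 \<in> Hom M P (Ro Z)"
      "p0 \<odot> s' = Ide M (Ro Y)" "p1 \<odot> s' = Ra w" "p0 \<in> tfib" "p1 \<in> fib M"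
      by (rule mapping_path[OF Rw R(3)[OF YZ(1)] R(3)[OF YZ(2)]]) (rule that)
    moreover have "p1 \<in> tfib" using weq_left[OF P(1,4)] P(2,6,8) Rw_weq by simp
    ultimately show ?thesis by blast
  qed
  have Rsurj: "\<exists>y\<in>Hom M U (Ro Y). h (Ra w \<odot> y) x" if w: "w \<in> Hom M Y Z" "w \<in> weq M" and x: "x \<in> Hom M U (Ro Z)" for w Y Z x
  proof -
    obtain P s p0 p1 where P: "s \<in> Hom M (Ro Y) P" "p0 \<in> Hom M P (Ro Y)" "p1 \<in> Hom M P (Ro Z)"
      "p0 \<odot> s = Ide M (Ro Y)" "p1 \<odot> s = Ra w" "p0 \<in> tfib" "p1 \<in> tfib" using Rbij[OF w] by blast
    obtain x' where x': "x' \<in> Hom M U P" "p1 \<odot> x' = x" by (rule cofibrant_lift[OF U P(7,3) x])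
    note y = Comp_Hom[OF x'(1) P(2)]
    have "p0 \<odot> (s \<odot> (p0 \<odot> x')) = p0 \<odot> x'" using Comp_assoc[OF y P(1,2)] P(4) Ide_Comp[OF y] by simp
    then have "h (s \<odot> (p0 \<odot> x')) x'" using inj[OF P(6,2) Comp_Hom[OF y P(1)] x'(1)] h_refl by simp
    from h_post[OF this Comp_Hom[OF y P(1)] P(3)]
    have "h (Ra w \<odot> (p0 \<odot> x')) x" using Comp_assoc[OF y P(1,3)] P(5) x'(2) by simp
    with y show ?thesis by blast
  qed
  have Rinj: "h x y" if w: "w \<in> Hom M Y Z" "w \<in> weq M" and xy: "x \<in> Hom M U (Ro Y)" "y \<in> Hom M U (Ro Y)"
    "h (Ra w \<odot> x) (Ra w \<odot> y)" for w Y Z x y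
  proof -
    obtain P s p0 p1 where P: "s \<in> Hom M (Ro Y) P" "p0 \<in> Hom M P (Ro Y)" "p1 \<in> Hom M P (Ro Z)"
      "p0 \<odot> s = Ide M (Ro Y)" "p1 \<odot> s = Ra w" "p0 \<in> tfib" "p1 \<in> tfib" using Rbij[OF w] by blast
    have "h (s \<odot> x) (s \<odot> y)"
      using inj[OF P(7,3) Comp_Hom[OF xy(1) P(1)] Comp_Hom[OF xy(2) P(1)]] xy(3)
        Comp_assoc[OF xy(1) P(1,3)] Comp_assoc[OF xy(2) P(1,3)] P(5) by simp
    from h_post[OF this Comp_Hom[OF xy(1) P(1)] P(2)] show ?thesis
      using Comp_assoc[OF xy(1) P(1,2)] Comp_assoc[OF xy(2) P(1,2)] P(4) Ide_Comp[OF xy(1)] Ide_Comp[OF xy(2)] by simp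
  qed
  define acts where "acts = path_acts (\<lambda>f x. Ra f \<odot> x) h (\<lambda>w. Hom M U (Ro (Dom M w)))"
  have acts: "acts [] x y = h x y" "acts (Fwd f # zs) x y = acts zs (Ra f \<odot> x) y"
    "acts (Bwd w # zs) x y = (\<exists>x'\<in>Hom M U (Ro (Dom M w)). h (Ra w \<odot> x') x \<and> acts zs x' y)" for f w zs x y
    by (simp_all add: acts_def)
  have acts_h: "acts zs x z" if "acts zs y z" "h x y" "x \<in> Hom M U (Ro X)" "is_path M X zs Y" for zs x y z X Y
    using that
  proof (induction zs arbitrary: x y X)
    case Nil
    then show ?case using h_trans by (simp add: acts)
  next
    case (Cons s zs)
    show ?case
    proof (cases s)
      case (Fwd f)
      then have f: "f \<in> Hom M X (Cod M f)" "is_path M (Cod M f) zs Y" using Cons.prems(4) by (auto simp: Hom_def)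
      show ?thesis
        using Cons.IH[OF _ h_post[OF Cons.prems(2,3) R(4)[OF f(1)]] Comp_Hom[OF Cons.prems(3) R(4)[OF f(1)]] f(2)]
          Cons.prems(1) Fwd by (simp add: acts)
    next
      case (Bwd w)
      then show ?thesis using Cons.prems(1,2) h_trans h_sym unfolding Bwd acts by blast
    qed
  qed
  \<comment> \<open>One case for each relation that defines the homotopy category. Functoriality of
    \<open>Ra\<close> handles the first two, injectivity and surjectivity on homotopy classes the
    two cancellations.\<close>
  have basic: "acts (r1 @ q) x z = acts (r2 @ q) x z"
    if b: "basic_rel M r1 r2" and x: "x \<in> Hom M U (Ro X)" and p: "is_path M X (r1 @ q) Y" "is_path M X (r2 @ q) Y" for r1 r2 q x z X Y
    using b
  proof cases
    case (1 X')
    then have "X' = X" using p(1) Ide_Ar by simp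
    then show ?thesis using 1 R(6) Ide_Comp[OF x] by (simp add: acts)
  next
    case (2 f X' Y' g Z')
    then have "X' = X" using p(1) by (auto simp: Hom_def)
    then show ?thesis using 2 R(7)[OF 2(3,4)] Comp_assoc[OF x, of "Ra f" "Ro Y'" "Ra g" "Ro Z'"] R(4)[OF 2(3)] R(4)[OF 2(4)]
      by (simp add: acts)
  next
    case (3 w)
    then have w: "w \<in> Hom M X (Cod M w)" "w \<in> weq M" "Dom M w = X" using p(1) by (auto simp: Hom_def)
    have "acts q x z" if "x' \<in> Hom M U (Ro X)" "h (Ra w \<odot> x') (Ra w \<odot> x)" "acts q x' z" for x'
      using acts_h[OF that(3) h_sym[OF Rinj[OF w(1,2) that(1) x that(2)]] x] p(2) 3 by simp
    then show ?thesis using 3 w(3) x h_refl by (auto simp: acts)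
  next
    case (4 w)
    then have w: "w \<in> Hom M (Dom M w) X" "w \<in> weq M" using p(1) weq_Ar by (auto simp: Hom_def)
    have q: "is_path M X q Y" using p(2) 4 by simp
    have "acts q x z" if "x' \<in> Hom M U (Ro (Dom M w))" "h (Ra w \<odot> x') x" "acts q (Ra w \<odot> x') z" for x'
      using acts_h[OF that(3) h_sym[OF that(2)] x q] .
    moreover have "\<exists>x'\<in>Hom M U (Ro (Dom M w)). h (Ra w \<odot> x') x \<and> acts q (Ra w \<odot> x') z" if "acts q x z"
    proof -
      obtain x' where x': "x' \<in> Hom M U (Ro (Dom M w))" "h (Ra w \<odot> x') x" using Rsurj[OF w x] by blast
      show ?thesis using x' acts_h[OF that x'(2) Comp_Hom[OF x'(1) R(4)[OF w(1)]] q] by blast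
    qed
    ultimately show ?thesis using 4 by (auto simp: acts)
  qed
  have append: "acts (p @ r1 @ q) x z = acts (p @ r2 @ q) x z"
    if b: "basic_rel M r1 r2" and "x \<in> Hom M U (Ro X)" "is_path M X (p @ r1 @ q) Y" "is_path M X (p @ r2 @ q) Y" for p r1 r2 q x z X Y
    using that(2-)
  proof (induction p arbitrary: x X)
    case Nil
    then show ?case using basic[OF b] by simp
  next
    case (Cons s p)
    show ?case
    proof (cases s)
      case (Fwd f)
      then have f: "f \<in> Hom M X (Cod M f)" using Cons.prems(2) by (auto simp: Hom_def)
      show ?thesis using Cons.IH[OF Comp_Hom[OF Cons.prems(1) R(4)[OF f]]] Cons.prems(2,3) Fwd by (simp add: acts)
    next
      case (Bwd w)
      then have "is_path M (Dom M w) (p @ r1 @ q) Y" "is_path M (Dom M w) (p @ r2 @ q) Y" using Cons.prems(2,3) by simp_all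
      then show ?thesis using Cons.IH Bwd by (simp add: acts)
    qed
  qed
  have invariant: "fst z = U \<and> acts (fst (snd z)) (r U) y = acts [Fwd u] (r U) y"
    if "equivclp (zigzag_rel M) (U, [Fwd u], N) z" for z y
    using that
  proof (induction rule: equivclp_induct)
    case (step z z')
    have *: "fst z1 = fst z2 \<and> (fst z1 = U \<longrightarrow> acts (fst (snd z1)) (r U) y = acts (fst (snd z2)) (r U) y)"
      if "zigzag_rel M z1 z2" for z1 z2
      using that append R(1)[OF UOb(1)] by (auto elim!: zigzag_rel.cases)
    from step.hyps(2) step.IH show ?case using *[of z z'] *[of z' z] by auto
  qed simp
  have eqv: "equivclp (zigzag_rel M) (U, [Fwd u], N) (U, [Fwd v], N)" using uv(3) unfolding path_eq_def by blast
  \<comment> \<open>The zigzag of \<open>v\<close> relates \<open>r U\<close> to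
    \<open>Ra v \<odot> r U\<close>; by invariance so does the zigzag of \<open>u\<close>.\<close>
  have "acts [Fwd v] (r U) (Ra v \<odot> r U) = acts [Fwd u] (r U) (Ra v \<odot> r U)"
    using invariant[OF eqv] by simp
  then have h: "h (r N \<odot> u) (r N \<odot> v)" using h_refl R(5)[OF uv(1)] R(5)[OF uv(2)] by (simp add: acts)
  \<comment> \<open>Both ends of the cylinder are weak equivalences, so homotopic maps lie in
    \<open>W'\<close> together by two-out-of-three in \<open>M'\<close>.\<close>
  have W'_step: "x \<in> W' \<longleftrightarrow> y \<in> W'" if xy: "hstep x y" for x y
  proof -
    obtain Z K where K: "K \<in> Hom M Cyl Z" "K \<odot> i0 = x" "K \<odot> i1 = y" using xy unfolding hstep_def by blast
    have "K \<odot> i0 \<in> W' \<longleftrightarrow> K \<in> W'" "K \<odot> i1 \<in> W' \<longleftrightarrow> K \<in> W'"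
      using M'.two_of_three[of i0 U Cyl K Z] M'.two_of_three[of i1 U Cyl K Z] i(1,2) K(1) iw W' unfolding W'_eq by blast+
    with K show ?thesis by simp
  qed
  have W'_h: "x \<in> W' \<longleftrightarrow> y \<in> W'" if "h x y" for x y
    using that unfolding h_def by (induction rule: equivclp_induct) (use W'_step in auto)
  have rN: "r N \<in> Hom M N (Ro N)" "r N \<in> W'" using R(1,2)[OF UOb(2)] W' by auto
  have "r N \<odot> v \<in> W'" using M'.weq_comp[of v U N "r N" "Ro N"] uv(2) rN v unfolding W'_eq by blast
  then have "r N \<odot> u \<in> W'" using W'_h[OF h] by simp
  then show ?thesis using M'.weq_right[of u U N "r N" "Ro N"] uv(1) rN unfolding W'_eq by blast
qed

end

section \<open>Monads on model categories\<close>

context model_category begin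

lemma natI:
  assumes "\<And>n. j n \<in> Hom M (onOb A n) (onOb C n)"
    and "\<And>m n \<alpha>. \<alpha> \<in> Hom Simplex m n \<Longrightarrow> onAr C \<alpha> \<odot> j m = j n \<odot> onAr A \<alpha>"
  shows "nat_trans Simplex M A C j"
  unfolding nat_upto_iff nat_upto_def using assms by blast

lemma functorI:
  assumes "\<And>n. onOb A n \<in> Ob M"
    and "\<And>m n \<alpha>. \<alpha> \<in> Hom Simplex m n \<Longrightarrow> onAr A \<alpha> \<in> Hom M (onOb A m) (onOb A n)"
    and "\<And>n. onAr A (Ide Simplex n) = Ide M (onOb A n)"
    and "\<And>l m n \<alpha> \<beta>. \<lbrakk>\<alpha> \<in> Hom Simplex l m; \<beta> \<in> Hom Simplex m n\<rbrakk> \<Longrightarrow>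
      onAr A (\<beta> \<star> \<alpha>) = onAr A \<beta> \<odot> onAr A \<alpha>"
  shows "is_functor Simplex M A"
  unfolding functor_upto_iff functor_upto_def using assms by blast

lemma nat_comp:
  assumes j: "nat_trans Simplex M A B j" and k: "nat_trans Simplex M B C k"
    and A: "is_functor Simplex M A" and B: "is_functor Simplex M B" and C: "is_functor Simplex M C"
  shows "nat_trans Simplex M A C (\<lambda>n. k n \<odot> j n)"
proof (rule natI)
  note J = natD[OF j] and K = natD[OF k]
  show "k n \<odot> j n \<in> Hom M (onOb A n) (onOb C n)" for n by (rule Comp_Hom[OF J(1) K(1)])
  fix m n \<alpha> assume \<alpha>: "\<alpha> \<in> Hom Simplex m n"
  show "onAr C \<alpha> \<odot> (k m \<odot> j m) = k n \<odot> j n \<odot> onAr A \<alpha>"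
    using Comp_assoc[OF J(1) K(1) functorD(2)[OF C \<alpha>]] Comp_assoc[OF J(1) functorD(2)[OF B \<alpha>] K(1)]
      Comp_assoc[OF functorD(2)[OF A \<alpha>] J(1) K(1)] J(2)[OF \<alpha>] K(2)[OF \<alpha>] by simp
qed

lemma cosimplicial_resolutionD:
  assumes "cosimplicial_resolution M Y A \<epsilon>"
  shows "Reedy_cofibrant M A" "is_functor Simplex M A" "\<epsilon> n \<in> Hom M (onOb A n) Y" "\<epsilon> n \<in> weq M"
    "\<alpha> \<in> Hom Simplex m n \<Longrightarrow> \<epsilon> m = \<epsilon> n \<odot> onAr A \<alpha>"
proof -
  have \<epsilon>: "nat_trans Simplex M A (const_functor M Y) \<epsilon>" using assms by (simp add: cosimplicial_resolution_def)
  show "Reedy_cofibrant M A" "is_functor Simplex M A" "\<epsilon> n \<in> weq M"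
    using assms by (auto simp: cosimplicial_resolution_def Reedy_cofibrant_def)
  have H: "\<epsilon> n \<in> Hom M (onOb A n) Y" for n using natD(1)[OF \<epsilon>, of n] by (simp add: const_functor_def)
  then show "\<epsilon> n \<in> Hom M (onOb A n) Y" .
  show "\<alpha> \<in> Hom Simplex m n \<Longrightarrow> \<epsilon> m = \<epsilon> n \<odot> onAr A \<alpha>"
    using natD(2)[OF \<epsilon>, of \<alpha> m n] Ide_Comp[OF H[of m]] by (simp add: const_functor_def)
qed

end

locale homotopical_monad = model_category \<kappa> M + monad M T \<eta> \<mu>
  for \<kappa> :: "'k rel" and M :: "('o, 'm) mcat" and T :: "('o, 'm, 'o, 'm) functr" and \<eta> \<mu> :: "'o \<Rightarrow> 'm" +
  assumes T_weq: "w \<in> weq M \<Longrightarrow> onAr T w \<in> weq M"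
begin

lemma T_Ob: "X \<in> Ob M \<Longrightarrow> onOb T X \<in> Ob M"
  and T_Hom: "f \<in> Hom M X Y \<Longrightarrow> onAr T f \<in> Hom M (onOb T X) (onOb T Y)"
  and T_Ide: "X \<in> Ob M \<Longrightarrow> onAr T (Ide M X) = Ide M (onOb T X)"
  and T_comp: "\<lbrakk>f \<in> Hom M X Y; g \<in> Hom M Y Z\<rbrakk> \<Longrightarrow> onAr T (g \<odot> f) = onAr T g \<odot> onAr T f"
  using functor_T unfolding is_functor_def Hom_def by auto

lemma unit_Hom: "X \<in> Ob M \<Longrightarrow> \<eta> X \<in> Hom M X (onOb T X)"
  and unit_nat: "f \<in> Hom M X Y \<Longrightarrow> \<eta> Y \<odot> f = onAr T f \<odot> \<eta> X"
  using unit unfolding nat_trans_def id_functor_def Hom_def by auto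

lemma functor_T_comp:
  assumes A: "is_functor Simplex M A"
  shows "is_functor Simplex M (comp_functor T A)"
proof (rule functorI)
  note F = functorD[OF A]
  fix n show "onOb (comp_functor T A) n \<in> Ob M" "onAr (comp_functor T A) (Ide Simplex n) = Ide M (onOb (comp_functor T A) n)"
    using T_Ob[OF F(1)] T_Ide[OF F(1)] F(3) by (simp_all add: comp_functor_def)
next
  note F = functorD[OF A]
  fix m n \<alpha> assume \<alpha>: "\<alpha> \<in> Hom Simplex m n"
  show "onAr (comp_functor T A) \<alpha> \<in> Hom M (onOb (comp_functor T A) m) (onOb (comp_functor T A) n)"
    using T_Hom[OF F(2)[OF \<alpha>]] by (simp add: comp_functor_def)
  fix l \<beta> assume \<beta>: "\<beta> \<in> Hom Simplex n l"
  show "onAr (comp_functor T A) (\<beta> \<star> \<alpha>) = onAr (comp_functor T A) \<beta> \<odot> onAr (comp_functor T A) \<alpha>"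
    using T_comp[OF F(2)[OF \<alpha>] F(2)[OF \<beta>]] F(4)[OF \<alpha> \<beta>] by (simp add: comp_functor_def)
qed

lemma nat_T_comp:
  assumes G: "nat_trans Simplex M A B G" and A: "is_functor Simplex M A" and B: "is_functor Simplex M B"
  shows "nat_trans Simplex M (comp_functor T A) (comp_functor T B) (\<lambda>n. onAr T (G n))"
proof (rule natI)
  note GN = natD[OF G]
  show "onAr T (G n) \<in> Hom M (onOb (comp_functor T A) n) (onOb (comp_functor T B) n)" for n
    using T_Hom[OF GN(1)] by (simp add: comp_functor_def)
  fix m n \<alpha> assume \<alpha>: "\<alpha> \<in> Hom Simplex m n"
  show "onAr (comp_functor T B) \<alpha> \<odot> onAr T (G m) = onAr T (G n) \<odot> onAr (comp_functor T A) \<alpha>"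
    using T_comp[OF GN(1) functorD(2)[OF B \<alpha>]] T_comp[OF functorD(2)[OF A \<alpha>] GN(1)] GN(2)[OF \<alpha>]
    by (simp add: comp_functor_def)
qed

lemma nat_unit_comp:
  assumes A: "is_functor Simplex M A"
  shows "nat_trans Simplex M A (comp_functor T A) (\<lambda>n. \<eta> (onOb A n))"
  by (rule natI) (use unit_Hom[OF functorD(1)[OF A]] unit_nat[OF functorD(2)[OF A]] in \<open>simp_all add: comp_functor_def\<close>)

text \<open>As \<open>T\<close> preserves weak equivalences, \<open>comp_functor T A\<close> is
  weakly equivalent to \<open>onOb T Y\<close> in every degree, but it need not be Reedy cofibrant.
  Its replacement \<open>C\<close> is, because \<open>A\<close> is Reedy cofibrant and the relative
  latching maps of \<open>j\<close> are cofibrations.\<close>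

lemma monad_resolution:
  assumes res: "cosimplicial_resolution M Y A \<epsilon>"
  obtains C j c where "is_functor Simplex M C" "nat_trans Simplex M A C j" "nat_trans Simplex M C (comp_functor T A) c"
    "\<And>n. c n \<odot> j n = \<eta> (onOb A n)" "\<And>n. rel_cof A C j n" "\<And>n. rel_fib (comp_functor T A) C c n"
    "cosimplicial_resolution M (onOb T Y) C (\<lambda>n. onAr T (\<epsilon> n) \<odot> c n)"
proof -
  note RA = cosimplicial_resolutionD(1)[OF res] and A = cosimplicial_resolutionD(2)[OF res]
    and \<epsilon>H = cosimplicial_resolutionD(3)[OF res] and w = cosimplicial_resolutionD(4)[OF res]
    and \<epsilon>N = cosimplicial_resolutionD(5)[OF res]
  note TA = functor_T_comp[OF A] and Y = Hom_Ob(2)[OF \<epsilon>H]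
  obtain C j c where C: "is_functor Simplex M C" "nat_trans Simplex M A C j" "nat_trans Simplex M C (comp_functor T A) c"
    "\<And>n. c n \<odot> j n = \<eta> (onOb A n)" "\<And>n. rel_cof A C j n" "\<And>n. rel_fib (comp_functor T A) C c n"
    by (rule Reedy_factorization[OF A TA nat_unit_comp[OF A]]) (rule that; (assumption | blast))
  have RC: "Reedy_cofibrant M C"
    by (rule Reedy_cofibrantI[OF C(1)])
      (rule rel_cof_extends_boundary[OF A C(1,2,5) Reedy_cofibrant_extends[OF RA]])
  have cH: "c n \<in> Hom M (onOb C n) (onOb T (onOb A n))" for n using natD(1)[OF C(3), of n] by (simp add: comp_functor_def)
  have "nat_trans Simplex M C (const_functor M (onOb T Y)) (\<lambda>n. onAr T (\<epsilon> n) \<odot> c n)"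
  proof (rule natI)
    show H: "onAr T (\<epsilon> n) \<odot> c n \<in> Hom M (onOb C n) (onOb (const_functor M (onOb T Y)) n)" for n
      using Comp_Hom[OF cH T_Hom[OF \<epsilon>H]] by (simp add: const_functor_def)
    fix m n \<alpha> assume \<alpha>: "\<alpha> \<in> Hom Simplex m n"
    have "onAr T (\<epsilon> m) \<odot> c m = onAr T (\<epsilon> n) \<odot> onAr T (onAr A \<alpha>) \<odot> c m"
      using T_comp[OF functorD(2)[OF A \<alpha>] \<epsilon>H] \<epsilon>N[OF \<alpha>] by simp
    also have "\<dots> = onAr T (\<epsilon> n) \<odot> (onAr T (onAr A \<alpha>) \<odot> c m)"
      by (rule Comp_assoc[OF cH T_Hom[OF functorD(2)[OF A \<alpha>]] T_Hom[OF \<epsilon>H]])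
    also have "\<dots> = onAr T (\<epsilon> n) \<odot> (c n \<odot> onAr C \<alpha>)" using natD(2)[OF C(3) \<alpha>] by (simp add: comp_functor_def)
    also have "\<dots> = onAr T (\<epsilon> n) \<odot> c n \<odot> onAr C \<alpha>"
      by (rule Comp_assoc[OF functorD(2)[OF C(1) \<alpha>] cH T_Hom[OF \<epsilon>H], symmetric])
    finally show "onAr (const_functor M (onOb T Y)) \<alpha> \<odot> (onAr T (\<epsilon> m) \<odot> c m) = onAr T (\<epsilon> n) \<odot> c n \<odot> onAr C \<alpha>"
      using Ide_Comp[of "onAr T (\<epsilon> m) \<odot> c m" "onOb C m" "onOb T Y"] H[of m] by (simp add: const_functor_def)
  qed
  moreover have "onAr T (\<epsilon> n) \<odot> c n \<in> weq M" for n
    using weq_comp[OF cH T_Hom[OF \<epsilon>H] _ T_weq[OF w]] rel_fib_tfib[OF C(1) TA C(3,6)] by simp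
  ultimately have "cosimplicial_resolution M (onOb T Y) C (\<lambda>n. onAr T (\<epsilon> n) \<odot> c n)"
    using RC T_Ob[OF Y] by (simp add: cosimplicial_resolution_def)
  with C that show thesis by blast
qed

text \<open>
  For a resolution \<open>A\<close>, factor \<open>\<eta>: A \<rightarrow> TA\<close> as \<open>A \<rightarrow> C \<rightarrow> TA\<close>, so that \<open>C\<close> resolves the image under
  \<open>T\<close>. Then \<open>x \<mapsto> \<alpha> \<cdot> Tx\<close> followed by restriction to \<open>A\<close> is composition with the weak equivalence
  \<open>\<alpha> \<cdot> \<eta>\<close>, and \<open>map(g, N)\<close> is a homotopy retract of \<open>map(Tg, N)\<close>.
\<close>

lemma map_weq_from_T:
  assumes g: "g \<in> Ar M" and Tg: "map_weq M (onAr T g) N" and N: "fibrant M N"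
    and \<alpha>: "\<alpha> \<in> Hom M (onOb T N) N" "\<alpha> \<odot> \<eta> N \<in> weq M"
  shows "map_weq M g N"
  unfolding map_weq_def
proof (intro allI impI)
  fix A B G R r assume res: "resolution_of_map M g A B G" and r: "fibrant_approximation M N R r"
  obtain \<epsilon> \<delta> where \<epsilon>: "cosimplicial_resolution M (Dom M g) A \<epsilon>" and \<delta>: "cosimplicial_resolution M (Cod M g) B \<delta>"
    and G: "nat_trans Simplex M A B G" and sq: "\<And>n. \<delta> n \<odot> G n = g \<odot> \<epsilon> n"
    using res unfolding resolution_of_map_def by blast
  have gH: "g \<in> Hom M (Dom M g) (Cod M g)" using g by (simp add: Hom_def)
  note RA = cosimplicial_resolutionD(1)[OF \<epsilon>] and A = cosimplicial_resolutionD(2)[OF \<epsilon>]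
    and RB = cosimplicial_resolutionD(1)[OF \<delta>] and B = cosimplicial_resolutionD(2)[OF \<delta>]
    and \<epsilon>H = cosimplicial_resolutionD(3)[OF \<epsilon>] and \<delta>H = cosimplicial_resolutionD(3)[OF \<delta>]
  note GN = natD[OF G] and NOb = Hom_Ob(2)[OF \<alpha>(1)]
  have r: "r \<in> Hom M N R" "r \<in> weq M" "fibrant M R" using r by (auto simp: fibrant_approximation_def)
  obtain C j c where C: "is_functor Simplex M C" "nat_trans Simplex M A C j" "nat_trans Simplex M C (comp_functor T A) c"
    "\<And>n. c n \<odot> j n = \<eta> (onOb A n)" "\<And>n. rel_cof A C j n" "\<And>n. rel_fib (comp_functor T A) C c n"
    "cosimplicial_resolution M (onOb T (Dom M g)) C (\<lambda>n. onAr T (\<epsilon> n) \<odot> c n)"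
    by (rule monad_resolution[OF \<epsilon>]) (rule that; (assumption | blast))
  obtain D k d where D: "is_functor Simplex M D" "nat_trans Simplex M B D k" "nat_trans Simplex M D (comp_functor T B) d"
    "\<And>n. d n \<odot> k n = \<eta> (onOb B n)" "\<And>n. rel_cof B D k n" "\<And>n. rel_fib (comp_functor T B) D d n"
    "cosimplicial_resolution M (onOb T (Cod M g)) D (\<lambda>n. onAr T (\<delta> n) \<odot> d n)"
    by (rule monad_resolution[OF \<delta>]) (rule that; (assumption | blast))
  note TA = functor_T_comp[OF A] and TB = functor_T_comp[OF B]
  have cH: "c n \<in> Hom M (onOb C n) (onOb T (onOb A n))" and dH: "d n \<in> Hom M (onOb D n) (onOb T (onOb B n))" for n
    using natD(1)[OF C(3), of n] natD(1)[OF D(3), of n] by (simp_all add: comp_functor_def)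
  have cN: "onAr T (onAr A \<theta>) \<odot> c m = c n \<odot> onAr C \<theta>" and dN: "onAr T (onAr B \<theta>) \<odot> d m = d n \<odot> onAr D \<theta>"
    if "\<theta> \<in> Hom Simplex m n" for m n \<theta>
    using natD(2)[OF C(3) that] natD(2)[OF D(3) that] by (simp_all add: comp_functor_def)
  note jN = natD[OF C(2)] and kN = natD[OF D(2)]
  \<comment> \<open>Naturality of the unit makes the square from \<open>j\<close> to
    \<open>d\<close> commute. Its lift \<open>H\<close> is a resolution of \<open>onAr T g\<close>
    compatible with \<open>G\<close>.\<close>
  have eq: "d n \<odot> (k n \<odot> G n) = (onAr T (G n) \<odot> c n) \<odot> j n" for n
    using Comp_assoc[OF GN(1) kN(1) dH] Comp_assoc[OF jN(1) cH T_Hom[OF GN(1)]] C(4) D(4) unit_nat[OF GN(1)] by simp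
  obtain H where H: "nat_trans Simplex M C D H" "\<And>n. H n \<odot> j n = k n \<odot> G n" "\<And>n. d n \<odot> H n = onAr T (G n) \<odot> c n"
    by (rule Reedy_lifting[OF A C(1) D(1) TB C(2) D(3) nat_comp[OF G D(2) A B D(1)]
      nat_comp[OF C(3) nat_T_comp[OF G A B] C(1) TA TB] eq C(5) D(6)]) (rule that; (assumption | blast))
  note HN = natD[OF H(1)]
  have Tdc: "Dom M (onAr T g) = onOb T (Dom M g)" "Cod M (onAr T g) = onOb T (Cod M g)"
    using T_Hom[OF gH] by (simp_all add: Hom_def)
  have "onAr T (\<delta> n) \<odot> d n \<odot> H n = onAr T g \<odot> (onAr T (\<epsilon> n) \<odot> c n)" for n
    using Comp_assoc[OF cH T_Hom[OF GN(1)] T_Hom[OF \<delta>H], symmetric] Comp_assoc[OF HN(1) dH T_Hom[OF \<delta>H]] H(3)[of n]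
      Comp_assoc[OF cH T_Hom[OF \<epsilon>H] T_Hom[OF gH]] T_comp[OF GN(1) \<delta>H, of n, symmetric] T_comp[OF \<epsilon>H gH, of n] sq[of n] by simp
  then have "resolution_of_map M (onAr T g) C D H"
    unfolding resolution_of_map_def Tdc using C(7) D(7) H(1) by blast
  then have F: "sset_weq (map_complex M D R) (map_complex M C R) (\<lambda>n x. x \<odot> H n)"
    using Tg r unfolding map_weq_def fibrant_approximation_def by blast
  define \<rho> where "\<rho> = r \<odot> \<alpha>"
  have \<rho>: "\<rho> \<in> Hom M (onOb T N) R" unfolding \<rho>_def by (rule Comp_Hom[OF \<alpha>(1) r(1)])
  define e where "e = r \<odot> (\<alpha> \<odot> \<eta> N)"
  have e: "e \<in> Hom M N R" "e \<in> weq M" "\<rho> \<odot> \<eta> N = e"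
    unfolding e_def \<rho>_def using Comp_Hom[OF Comp_Hom[OF unit_Hom[OF NOb] \<alpha>(1)] r(1)]
      weq_comp[OF Comp_Hom[OF unit_Hom[OF NOb] \<alpha>(1)] r(1) \<alpha>(2) r(2)] Comp_assoc[OF unit_Hom[OF NOb] \<alpha>(1) r(1)] by simp_all
  have ss: "simplicial_set (map_complex M A' Z)" if "is_functor Simplex M A'" for A' Z
    by (rule simplicial_set_map_complex[OF that])
  let ?K = "map_complex M"
  \<comment> \<open>Apply \<open>T\<close>, compose with \<open>\<rho>\<close> and restrict along
    \<open>c\<close>. A further restriction along \<open>j\<close> turns this into composition with
    \<open>e\<close>, since \<open>c n \<odot> j n\<close> is the unit and the unit is
    natural.\<close>
  let ?\<phi> = "\<lambda>c n x. \<rho> \<odot> onAr T x \<odot> c n"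
  have \<phi>: "simplicial_map (?K A' N) (?K C' R) (?\<phi> c')"
    if A': "is_functor Simplex M A'" and C': "is_functor Simplex M C'"
      and c': "\<And>n. c' n \<in> Hom M (onOb C' n) (onOb T (onOb A' n))"
        "\<And>m n \<theta>. \<theta> \<in> Hom Simplex m n \<Longrightarrow> onAr T (onAr A' \<theta>) \<odot> c' m = c' n \<odot> onAr C' \<theta>" for A' C' c'
    unfolding simplicial_map_def
  proof (intro conjI allI ballI impI)
    fix n x assume "x \<in> simp (?K A' N) n"
    then have x: "x \<in> Hom M (onOb A' n) N" by (simp add: map_complex_def)
    note Tx = T_Hom[OF x] and \<rho>x = Comp_Hom[OF T_Hom[OF x] \<rho>]
    show "?\<phi> c' n x \<in> simp (?K C' R) n" using Comp_Hom[OF c'(1) \<rho>x] by (simp add: map_complex_def)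
    fix m \<theta> assume \<theta>: "\<theta> \<in> Hom Simplex m n"
    note A\<theta> = functorD(2)[OF A' \<theta>] and C\<theta> = functorD(2)[OF C' \<theta>]
    have "\<rho> \<odot> onAr T (x \<odot> onAr A' \<theta>) \<odot> c' m = \<rho> \<odot> onAr T x \<odot> (onAr T (onAr A' \<theta>) \<odot> c' m)"
      using T_comp[OF A\<theta> x] Comp_assoc[OF T_Hom[OF A\<theta>] Tx \<rho>] Comp_assoc[OF c'(1) T_Hom[OF A\<theta>] \<rho>x] by simp
    also have "\<dots> = \<rho> \<odot> onAr T x \<odot> c' n \<odot> onAr C' \<theta>" using c'(2)[OF \<theta>] Comp_assoc[OF C\<theta> c'(1) \<rho>x] by simp
    finally show "?\<phi> c' m (act (?K A' N) \<theta> x) = act (?K C' R) \<theta> (?\<phi> c' n x)" by (simp add: map_complex_def)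
  qed
  note \<phi>A = \<phi>[OF A C(1) cH cN] and \<phi>B = \<phi>[OF B D(1) dH dN]
  note \<psi>A = simplicial_map_precomp[OF A C(1,2), of R] and \<psi>B = simplicial_map_precomp[OF B D(1,2), of R]
  note fN = simplicial_map_precomp[OF A B G, of N] and fR = simplicial_map_precomp[OF A B G, of R]
    and FH = simplicial_map_precomp[OF C(1) D(1) H(1), of R]
  have retr: "homotopy_equivalence (realization (?K A' N)) (realization (?K A' R))
      (realization_map (?K A' R) (\<lambda>n x. x \<odot> j' n) \<circ> realization_map (?K C' R) (?\<phi> c'))"
    if RA': "Reedy_cofibrant M A'" and C': "is_functor Simplex M C'"
      and \<phi>': "simplicial_map (?K A' N) (?K C' R) (?\<phi> c')" and j': "nat_trans Simplex M A' C' j'"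
      and c': "\<And>n. c' n \<in> Hom M (onOb C' n) (onOb T (onOb A' n))" "\<And>n. c' n \<odot> j' n = \<eta> (onOb A' n)" for A' C' c' j'
  proof (rule homotopy_equivalence_cong[OF homotopy_equivalence_postcomp[OF RA' e(1,2) N r(3)]])
    have A': "is_functor Simplex M A'" using RA' by (simp add: Reedy_cofibrant_def)
    note \<psi>' = simplicial_map_precomp[OF A' C' j', of R]
    fix z assume z: "z \<in> topspace (realization (?K A' N))"
    have "realization_map (?K A' R) (\<lambda>n x. e \<odot> x) z = realization_map (?K A' R) (\<lambda>n x. ?\<phi> c' n x \<odot> j' n) z"
    proof (rule realization_map_cong[OF ss[OF A'] simplicial_map_postcomp[OF A' e(1)] _ z])
      fix n x assume "x \<in> simp (?K A' N) n"
      then have x: "x \<in> Hom M (onOb A' n) N" by (simp add: map_complex_def)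
      note UA = unit_Hom[OF functorD(1)[OF A'], of n]
      have "?\<phi> c' n x \<odot> j' n = \<rho> \<odot> onAr T x \<odot> \<eta> (onOb A' n)"
        using Comp_assoc[OF natD(1)[OF j'] c'(1) Comp_Hom[OF T_Hom[OF x] \<rho>]] c'(2) by simp
      also have "\<dots> = \<rho> \<odot> (\<eta> N \<odot> x)" using Comp_assoc[OF UA T_Hom[OF x] \<rho>] unit_nat[OF x] by simp
      also have "\<dots> = e \<odot> x" using Comp_assoc[OF x unit_Hom[OF NOb] \<rho>] e(3) by simp
      finally show "e \<odot> x = ?\<phi> c' n x \<odot> j' n" by simp
    qed
    also have "\<dots> = realization_map (?K A' R) (\<lambda>n x. x \<odot> j' n) (realization_map (?K C' R) (?\<phi> c') z)"
      by (rule realization_map_comp[OF ss[OF A'] ss[OF C'] \<phi>' \<psi>' z])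
    finally show "realization_map (?K A' R) (\<lambda>n x. e \<odot> x) z =
      (realization_map (?K A' R) (\<lambda>n x. x \<odot> j' n) \<circ> realization_map (?K C' R) (?\<phi> c')) z" by simp
  qed
  note cm = continuous_map_realization_map
  have "homotopy_equivalence (realization (?K B R)) (realization (?K A R)) (realization_map (?K A R) (\<lambda>n x. x \<odot> G n))"
  proof (rule homotopy_equivalence_zigzag[OF cm[OF ss[OF B] fN] cm[OF ss[OF B] fR] cm[OF ss[OF A] \<phi>A] cm[OF ss[OF B] \<phi>B]
        cm[OF ss[OF C(1)] \<psi>A] cm[OF ss[OF D(1)] \<psi>B] _ _ _ retr[OF RA C(1) \<phi>A C(2) cH C(4)] retr[OF RB D(1) \<phi>B D(2) dH D(4)]])
    show "homotopy_equivalence (realization (?K D R)) (realization (?K C R)) (realization_map (?K C R) (\<lambda>n x. x \<odot> H n))"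
      using F by (simp add: sset_weq_def)
    show "realization_map (?K C R) (\<lambda>n x. x \<odot> H n) (realization_map (?K D R) (?\<phi> d) z) =
      realization_map (?K C R) (?\<phi> c) (realization_map (?K A N) (\<lambda>n x. x \<odot> G n) z)"
      if z: "z \<in> topspace (realization (?K B N))" for z
    proof -
      have "realization_map (?K C R) (\<lambda>n x. ?\<phi> d n x \<odot> H n) z = realization_map (?K C R) (\<lambda>n x. ?\<phi> c n (x \<odot> G n)) z"
      proof (rule realization_map_cong[OF ss[OF B] simplicial_map_comp[OF \<phi>B FH] _ z])
        fix n x assume "x \<in> simp (?K B N) n"
        then have x: "x \<in> Hom M (onOb B n) N" by (simp add: map_complex_def)
        note \<rho>x = Comp_Hom[OF T_Hom[OF x] \<rho>]
        show "?\<phi> d n x \<odot> H n = ?\<phi> c n (x \<odot> G n)"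
          using Comp_assoc[OF HN(1) dH \<rho>x] H(3) Comp_assoc[OF cH T_Hom[OF GN(1)] \<rho>x] T_comp[OF GN(1) x]
            Comp_assoc[OF T_Hom[OF GN(1)] T_Hom[OF x] \<rho>] by simp
      qed
      then show ?thesis
        by (simp only: realization_map_comp[OF ss[OF B] ss[OF D(1)] \<phi>B FH z] realization_map_comp[OF ss[OF B] ss[OF A] fN \<phi>A z])
    qed
    show "realization_map (?K A R) (\<lambda>n x. x \<odot> G n) (realization_map (?K B R) (\<lambda>n x. x \<odot> k n) z) =
      realization_map (?K A R) (\<lambda>n x. x \<odot> j n) (realization_map (?K C R) (\<lambda>n x. x \<odot> H n) z)"
      if z: "z \<in> topspace (realization (?K D R))" for z
    proof -
      have "realization_map (?K A R) (\<lambda>n x. x \<odot> k n \<odot> G n) z = realization_map (?K A R) (\<lambda>n x. x \<odot> H n \<odot> j n) z"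
      proof (rule realization_map_cong[OF ss[OF D(1)] simplicial_map_comp[OF \<psi>B fR] _ z])
        fix n x assume "x \<in> simp (?K D R) n"
        then have x: "x \<in> Hom M (onOb D n) R" by (simp add: map_complex_def)
        show "x \<odot> k n \<odot> G n = x \<odot> H n \<odot> j n"
          using Comp_assoc[OF GN(1) kN(1) x] Comp_assoc[OF jN(1) HN(1) x] H(2) by simp
      qed
      then show ?thesis
        by (simp only: realization_map_comp[OF ss[OF D(1)] ss[OF B] \<psi>B fR z] realization_map_comp[OF ss[OF D(1)] ss[OF C(1)] FH \<psi>A z])
    qed
  qed
  then show "sset_weq (?K B R) (?K A R) (\<lambda>n x. x \<odot> G n)" using ss[OF A] ss[OF B] fR by (simp add: sset_weq_def)
qed


text \<open>Cofibrancy of both \<open>Q\<close> and \<open>N\<close> is what allows the hypothesis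
  on \<open>T\<close> to be applied to \<open>j\<close>; this is the reason for replacing
  \<open>X\<close> and the localization map. The localized structure enters as some
  \<open>M'\<close> with the cofibrations of \<open>M\<close> and a larger class of weak
  equivalences.\<close>

lemma algebra_localization:
  assumes alg: "algebra_up_to_homotopy M T \<eta> \<mu> X a"
    and T_cof: "\<And>A. cofibrant M A \<Longrightarrow> cofibrant M (onOb T A)"
    and M': "model_category \<kappa> M'" "M' = M\<lparr>weq := W', fib := F'\<rparr>" and W': "weq M \<subseteq> W'"
    and T_W': "\<And>g. \<lbrakk>g \<in> W'; g \<in> Ar M; cofibrant M (Dom M g); cofibrant M (Cod M g)\<rbrakk> \<Longrightarrow> onAr T g \<in> W'"
    and l: "l \<in> Hom M X L" "l \<in> W'" and L: "fibrant M' L" "fibrant M L"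
  obtains Q q N j n \<alpha> where "q \<in> Hom M Q X" "q \<in> tfib" "j \<in> Hom M Q N" "j \<in> cof M" "j \<in> W'"
    "n \<in> Hom M N L" "n \<in> tfib" "fibrant M' N" "fibrant M N" "\<alpha> \<in> Hom M (onOb T N) N" "\<alpha> \<odot> \<eta> N \<in> weq M"
proof -
  interpret M': model_category \<kappa> M' by (rule M'(1))
  have M'_eq: "Hom M' = Hom M" "Comp M' = Comp M" "weq M' = W'" "cof M' = cof M"
    by (simp_all add: M'(2) Hom_def[abs_def])
  have tfib_eq: "M'.tfib = tfib" by (rule same_tfib[OF model_category_axioms M'])
  have X: "X \<in> Ob M" by (rule Hom_Ob(1)[OF l(1)])
  obtain Q q where q: "q \<in> Hom M Q X" "q \<in> tfib" and Q: "cofibrant M Q" by (rule cofibrant_replacement[OF X])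
  obtain N j n where j: "j \<in> Hom M Q N" "n \<in> Hom M N L" "j \<in> cof M" "n \<in> tfib" "n \<odot> j = l \<odot> q"
    by (rule factor_cof_obtain[OF Comp_Hom[OF q(1) l(1)]])
  have N: "cofibrant M N" by (rule cofibrant_cof[OF Q j(3,1)])
  have nfib: "n \<in> fib M" "n \<in> fib M'" using j(4) tfib_eq by auto
  have Nf: "fibrant M' N" "fibrant M N"
    using M'.fibrant_fib[OF L(1) nfib(2)] fibrant_fib[OF L(2) nfib(1) j(2)] j(2) by (simp_all add: M'_eq)
  have nW: "n \<in> weq M" "n \<in> W'" and qW: "q \<in> weq M" "q \<in> W'" using j(4) q(2) W' by auto
  have "l \<odot> q \<in> W'" using M'.weq_comp[of q Q X l L] q(1) l qW by (simp add: M'_eq)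
  then have jW: "j \<in> W'" using M'.weq_right[of j Q N n L] j nW by (simp add: M'_eq)
  have Ob: "Q \<in> Ob M" "N \<in> Ob M" "L \<in> Ob M" using Hom_Ob j(1,2) by blast+
  note TQ = T_Hom[OF q(1)] and Tj = T_Hom[OF j(1)]
  have TjW: "onAr T j \<in> W'" using T_W'[OF jW] j(1) Q N by (simp add: Hom_def)
  obtain zs where zs: "is_path M (onOb T X) zs X" "path_eq X X (Fwd (\<eta> X) # zs) []"
    by (rule algebra_path[OF alg unit_Hom[OF X]])
  \<comment> \<open>From \<open>X\<close> to \<open>N\<close> there is only a zigzag, through the
    localization \<open>L\<close> and back along the weak equivalence \<open>n\<close>.\<close>
  let ?tl = "[Fwd l, Bwd n]"
  have tl: "is_path M X ?tl N"
    using is_path_append[of X "[Fwd l]" "[Bwd n]" N] path_Fwd[OF l(1)] path_Bwd[OF j(2) nW(1)] by auto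
  have ztl: "is_path M (onOb T X) (zs @ ?tl) N" unfolding is_path_append using zs(1) tl by blast
  have "is_path M (onOb T Q) ([Fwd (onAr T q)] @ (zs @ ?tl)) N"
    unfolding is_path_append[of "onOb T Q"] using path_Fwd[OF TQ] ztl by blast
  \<comment> \<open>Cofibrancy of \<open>onOb T Q\<close> and fibrancy of \<open>N\<close> turn the
    zigzag that contains the algebra structure into an arrow.\<close>
  then obtain b where b: "b \<in> Hom M (onOb T Q) N" "path_eq (onOb T Q) N ([Fwd (onAr T q)] @ (zs @ ?tl)) [Fwd b]"
    by (rule path_representable[OF T_cof[OF Q] Nf(2)])
  have "path_eq Q N [Fwd (b \<odot> \<eta> Q)] [Fwd (\<eta> Q), Fwd b]" by (rule path_eq_sym[OF path_eq_comp[OF unit_Hom[OF Ob(1)] b(1)]])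
  also have "path_eq Q N [Fwd (\<eta> Q), Fwd b] ([Fwd (\<eta> Q), Fwd (onAr T q)] @ (zs @ ?tl))"
    using path_eq_append[OF path_eq_sym[OF b(2)] path_Fwd[OF unit_Hom[OF Ob(1)]], of "[]" N] Ob(2) by simp
  also have "path_eq Q N ([Fwd (\<eta> Q), Fwd (onAr T q)] @ (zs @ ?tl)) ([Fwd q, Fwd (\<eta> X)] @ (zs @ ?tl))"
  proof -
    have "path_eq Q (onOb T X) [Fwd (\<eta> Q), Fwd (onAr T q)] [Fwd (\<eta> X \<odot> q)]"
      using path_eq_comp[OF unit_Hom[OF Ob(1)] TQ] unit_nat[OF q(1)] by simp
    also have "path_eq Q (onOb T X) [Fwd (\<eta> X \<odot> q)] [Fwd q, Fwd (\<eta> X)]"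
      by (rule path_eq_sym[OF path_eq_comp[OF q(1) unit_Hom[OF X]]])
    finally show ?thesis using path_eq_append[of Q "onOb T X" _ _ Q "[]" "zs @ ?tl" N] ztl Ob(1) by force
  qed
  also have "path_eq Q N ([Fwd q, Fwd (\<eta> X)] @ (zs @ ?tl)) ([Fwd q] @ ?tl)"
    using path_eq_append[OF zs(2) path_Fwd[OF q(1)] tl] by simp
  also have "path_eq Q N ([Fwd q] @ ?tl) ([Fwd j, Fwd n, Bwd n])"
  proof -
    have "path_eq Q L [Fwd q, Fwd l] [Fwd (n \<odot> j)]" using path_eq_comp[OF q(1) l(1)] j(5) by simp
    also have "path_eq Q L [Fwd (n \<odot> j)] [Fwd j, Fwd n]" by (rule path_eq_sym[OF path_eq_comp[OF j(1,2)]])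
    finally show ?thesis using path_eq_append[of Q L _ _ Q "[]" "[Bwd n]" N] path_Bwd[OF j(2) nW(1)] Ob(1) by force
  qed
  also have "path_eq Q N [Fwd j, Fwd n, Bwd n] [Fwd j]"
    using path_eq_append[OF path_eq_Fwd_Bwd[OF j(2) nW(1)] path_Fwd[OF j(1)], of "[]" N] Ob(2) by simp
  finally have b\<eta>: "path_eq Q N [Fwd (b \<odot> \<eta> Q)] [Fwd j]" .
  \<comment> \<open>\<open>onAr T j\<close> need not be a cofibration, so \<open>b\<close> is
    extended along the cofibration \<open>c\<close> instead. A section \<open>s\<close> of
    \<open>w\<close>, which exists because \<open>onOb T N\<close> is cofibrant, brings the
    extension back to \<open>onOb T N\<close>; hence \<open>\<alpha> \<odot> onAr T j\<close> is
    compared with \<open>b\<close> as a zigzag.\<close>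
  obtain E c w where c: "c \<in> Hom M (onOb T Q) E" "w \<in> Hom M E (onOb T N)" "c \<in> cof M" "w \<in> tfib" "w \<odot> c = onAr T j"
    by (rule factor_cof_obtain[OF Tj])
  have "w \<in> W'" using c(4) W' by blast
  then have cW: "c \<in> W'" using M'.weq_right[of c "onOb T Q" E w "onOb T N"] c TjW by (simp add: M'_eq)
  obtain b' where b': "b' \<in> Hom M E N" "b' \<odot> c = b"
    using Nf(1) c(1,3) cW b(1) unfolding M'.fibrant_iff M'_eq by blast
  obtain s where s: "s \<in> Hom M (onOb T N) E" "w \<odot> s = Ide M (onOb T N)"
    by (rule cofibrant_lift[OF T_cof[OF N] c(4,2) Ide_Hom[OF T_Ob[OF Ob(2)]]])
  define \<alpha> where "\<alpha> = b' \<odot> s"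
  have \<alpha>: "\<alpha> \<in> Hom M (onOb T N) N" unfolding \<alpha>_def by (rule Comp_Hom[OF s(1) b'(1)])
  have wW: "w \<in> weq M" using c(4) by simp
  have "path_eq (onOb T Q) N [Fwd (\<alpha> \<odot> onAr T j)] [Fwd b]"
  proof -
    have sT: "s \<odot> onAr T j \<in> Hom M (onOb T Q) E" "\<alpha> \<odot> onAr T j = b' \<odot> (s \<odot> onAr T j)"
      unfolding \<alpha>_def by (rule Comp_Hom[OF Tj s(1)], rule Comp_assoc[OF Tj s(1) b'(1)])
    have "path_eq (onOb T Q) E [Fwd (s \<odot> onAr T j)] [Fwd (onAr T j), Fwd s]"
      by (rule path_eq_sym[OF path_eq_comp[OF Tj s(1)]])
    also have "path_eq (onOb T Q) E [Fwd (onAr T j), Fwd s] [Fwd c, Fwd w, Fwd s]"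
      using path_eq_append[OF path_eq_sym[OF path_eq_comp[OF c(1,2)]], of "onOb T Q" "[]" "[Fwd s]" E]
        c(5) T_Ob[OF Ob(1)] path_Fwd[OF s(1)] by force
    also have "path_eq (onOb T Q) E [Fwd c, Fwd w, Fwd s] [Fwd c]"
      using path_eq_append[OF path_eq_inverse[OF s(1) c(2) s(2) wW] path_Fwd[OF c(1)], of "[]" E] Hom_Ob(2)[OF c(1)] by simp
    finally have *: "path_eq (onOb T Q) E [Fwd (s \<odot> onAr T j)] [Fwd c]" .
    have "path_eq (onOb T Q) N [Fwd (\<alpha> \<odot> onAr T j)] [Fwd (s \<odot> onAr T j), Fwd b']"
      unfolding sT(2) by (rule path_eq_sym[OF path_eq_comp[OF sT(1) b'(1)]])
    also have "path_eq (onOb T Q) N [Fwd (s \<odot> onAr T j), Fwd b'] [Fwd c, Fwd b']"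
      using path_eq_append[OF *, of "onOb T Q" "[]" "[Fwd b']" N] T_Ob[OF Ob(1)] path_Fwd[OF b'(1)] by force
    also have "path_eq (onOb T Q) N [Fwd c, Fwd b'] [Fwd b]" using path_eq_comp[OF c(1) b'(1)] b'(2) by simp
    finally show ?thesis .
  qed
  then have "path_eq Q N [Fwd (\<eta> Q), Fwd (\<alpha> \<odot> onAr T j)] [Fwd (\<eta> Q), Fwd b]"
    using path_eq_append[of "onOb T Q" N _ _ Q "[Fwd (\<eta> Q)]" "[]" N] path_Fwd[OF unit_Hom[OF Ob(1)]] Ob(2) by force
  also have "path_eq Q N [Fwd (\<eta> Q), Fwd b] [Fwd (b \<odot> \<eta> Q)]" by (rule path_eq_comp[OF unit_Hom[OF Ob(1)] b(1)])
  also note b\<eta>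
  finally have 1: "path_eq Q N [Fwd (\<eta> Q), Fwd (\<alpha> \<odot> onAr T j)] [Fwd j]" .
  note uN = unit_Hom[OF Ob(2)] and uQ = unit_Hom[OF Ob(1)]
  have e: "\<alpha> \<odot> \<eta> N \<in> Hom M N N" by (rule Comp_Hom[OF uN \<alpha>])
  have "\<alpha> \<odot> \<eta> N \<odot> j = \<alpha> \<odot> onAr T j \<odot> \<eta> Q"
    using Comp_assoc[OF j(1) uN \<alpha>] Comp_assoc[OF uQ Tj \<alpha>] unit_nat[OF j(1)] by simp
  then have "path_eq Q N [Fwd (\<alpha> \<odot> \<eta> N \<odot> j)] [Fwd j]"
    using path_eq_trans[OF path_eq_sym[OF path_eq_comp[OF uQ Comp_Hom[OF Tj \<alpha>]]] 1] by simp
  \<comment> \<open>The equality with \<open>j\<close> is available in the homotopy category of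
    \<open>M\<close>, and membership in \<open>W'\<close> is all that has to be inferred from
    it.\<close>
  then have "\<alpha> \<odot> \<eta> N \<odot> j \<in> W'"
    by (rule path_eq_detects_weq[OF Q Comp_Hom[OF j(1) e] j(1) _ M' W' jW])
  then have "\<alpha> \<odot> \<eta> N \<in> W'" using M'.weq_left[of j Q N "\<alpha> \<odot> \<eta> N" N] j(1) e jW by (simp add: M'_eq)
  then have "\<alpha> \<odot> \<eta> N \<in> weq M"
    by (intro weq_between_local[OF model_category_axioms M' e _ Nf(1) Nf(1)]) (simp add: M'_eq)
  then show thesis by (rule that[OF q j(1,3) jW j(2,4) Nf \<alpha>])
qed

end

section \<open>Localizations\<close>

context model_category begin

text \<open>A resolution of \<open>w\<close> becomes a resolution of the identity of its codomain
  when the augmentation of its source is composed with \<open>w\<close>. Identities are weak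
  equivalences in the localized model structure, so the property passes to \<open>w\<close>.\<close>

lemma weq_f_equivalences:
  assumes B: "model_category \<kappa> (Bousfield M g)"
  shows "weq M \<subseteq> f_equivalences M g"
proof
  interpret B: model_category \<kappa> "Bousfield M g" by (rule B)
  fix w assume w: "w \<in> weq M"
  have wAr: "w \<in> Ar M" using w weq_Ar by blast
  then have wH: "w \<in> Hom M (Dom M w) (Cod M w)" by (simp add: Hom_def)
  note Y = Hom_Ob(2)[OF wH]
  have "Ide M (Cod M w) \<in> f_equivalences M g" using B.Ide_weq[of "Cod M w"] Y by (simp add: Bousfield_def)
  then have Id: "map_weq M (Ide M (Cod M w)) Z" if "f_local M g Z" for Z
    using that by (simp add: f_equivalences_def)
  have "resolution_of_map M (Ide M (Cod M w)) A B G" if res: "resolution_of_map M w A B G" for A B G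
  proof -
    obtain \<epsilon> \<delta> where \<epsilon>: "cosimplicial_resolution M (Dom M w) A \<epsilon>" and \<delta>: "cosimplicial_resolution M (Cod M w) B \<delta>"
      and G: "nat_trans Simplex M A B G" and sq: "\<And>n. \<delta> n \<odot> G n = w \<odot> \<epsilon> n"
      using res unfolding resolution_of_map_def by blast
    note E = cosimplicial_resolutionD[OF \<epsilon>]
    have H: "w \<odot> \<epsilon> n \<in> Hom M (onOb A n) (Cod M w)" for n by (rule Comp_Hom[OF E(3) wH])
    have "nat_trans Simplex M A (const_functor M (Cod M w)) (\<lambda>n. w \<odot> \<epsilon> n)"
    proof (rule natI)
      fix m n \<alpha> assume \<alpha>: "\<alpha> \<in> Hom Simplex m n"
      show "onAr (const_functor M (Cod M w)) \<alpha> \<odot> (w \<odot> \<epsilon> m) = w \<odot> \<epsilon> n \<odot> onAr A \<alpha>"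
        using Ide_Comp[OF H[of m]] E(5)[OF \<alpha>] Comp_assoc[OF functorD(2)[OF E(2) \<alpha>] E(3) wH] by (simp add: const_functor_def)
    qed (use H in \<open>simp add: const_functor_def\<close>)
    moreover have "w \<odot> \<epsilon> n \<in> weq M" for n by (rule weq_comp[OF E(3) wH E(4) w])
    ultimately have "cosimplicial_resolution M (Cod M w) A (\<lambda>n. w \<odot> \<epsilon> n)"
      using E(1) Y by (simp add: cosimplicial_resolution_def)
    moreover have "Ide M (Cod M w) \<odot> (w \<odot> \<epsilon> n) = w \<odot> \<epsilon> n" for n by (rule Ide_Comp[OF H])
    ultimately show ?thesis
      using \<delta> G sq Ide_Ar[OF Y] unfolding resolution_of_map_def by metis
  qed
  with Id have "map_weq M w Z" if "f_local M g Z" for Z using that unfolding map_weq_def by blast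
  with wAr show "w \<in> f_equivalences M g" by (simp add: f_equivalences_def)
qed

end

theorem theorem10p2:
  fixes \<kappa> :: "'k rel" and M :: "('o, 'm) mcat"
    and T :: "('o, 'm, 'o, 'm) functr" and \<eta> \<mu> :: "'o \<Rightarrow> 'm"
    and f l l' :: 'm and X L L' :: 'o
  assumes "model_category \<kappa> M"
    and "monad M T \<eta> \<mu>"
    and "\<And>w. w \<in> weq M \<Longrightarrow> onAr T w \<in> weq M"
    and "\<And>A. cofibrant M A \<Longrightarrow> cofibrant M (onOb T A)"
    and "f \<in> Ar M" and "cofibrant M (Dom M f)" and "cofibrant M (Cod M f)"
    and "localization_exists \<kappa> M f"
    and "localization_exists \<kappa> M (onAr T f)"
    and "preserves_equivalences_between_cofibrants M T f"
    and "preserves_equivalences_between_cofibrants M T (onAr T f)"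
    and "\<exists>a. algebra_up_to_homotopy M T \<eta> \<mu> X a"
    and "f_localization M f X L l"
    and "f_localization M (onAr T f) X L' l'"
  shows "weakly_equivalent M L L'"
proof -
  interpret homotopical_monad \<kappa> M T \<eta> \<mu>
    by (intro homotopical_monad.intro homotopical_monad_axioms.intro assms(1,2,3))
  let ?W = "f_equivalences M f" and ?W' = "f_equivalences M (onAr T f)"
  have Mf: "model_category \<kappa> (Bousfield M f)" and Mf': "model_category \<kappa> (Bousfield M (onAr T f))"
    and fibf: "\<And>Y. fibrant (Bousfield M f) Y \<longleftrightarrow> fibrant M Y \<and> f_local M f Y"
    and fibf': "\<And>Y. fibrant (Bousfield M (onAr T f)) Y \<longleftrightarrow> fibrant M Y \<and> f_local M (onAr T f) Y"
    using assms(8,9) unfolding localization_exists_def by blast+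
  have eq: "Hom (Bousfield M g) = Hom M" "Comp (Bousfield M g) = Comp M" "weq (Bousfield M g) = f_equivalences M g"
    "cof (Bousfield M g) = cof M" for g
    by (simp_all add: Bousfield_def Hom_def[abs_def])
  have "f \<in> ?W" using assms(5) by (simp add: f_equivalences_def f_local_def)
  then have "onAr T f \<in> ?W"
    using assms(6,7,10) unfolding preserves_equivalences_between_cofibrants_def by blast
  then have "f_local M f Y \<Longrightarrow> f_local M (onAr T f) Y" for Y by (simp add: f_equivalences_def f_local_def)
  then have WW: "?W' \<subseteq> ?W" by (auto simp: f_equivalences_def)
  have l: "l \<in> Hom M X L" "l \<in> ?W" "fibrant (Bousfield M f) L"
    and l': "l' \<in> Hom M X L'" "l' \<in> ?W'" "fibrant (Bousfield M (onAr T f)) L'"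
    using assms(13,14) by (auto simp: f_localization_def eq)
  obtain a where alg: "algebra_up_to_homotopy M T \<eta> \<mu> X a" using assms(12) by blast
  have T_W': "onAr T g \<in> ?W'" if "g \<in> ?W'" "g \<in> Ar M" "cofibrant M (Dom M g)" "cofibrant M (Cod M g)" for g
    using assms(11) that unfolding preserves_equivalences_between_cofibrants_def by blast
  have L'f: "fibrant M L'" using l'(3) fibf' by blast
  obtain Q q N j n \<alpha> where N: "q \<in> Hom M Q X" "q \<in> tfib" "j \<in> Hom M Q N" "j \<in> cof M" "j \<in> ?W'"
    "n \<in> Hom M N L'" "n \<in> tfib" "fibrant (Bousfield M (onAr T f)) N" "fibrant M N"
    "\<alpha> \<in> Hom M (onOb T N) N" "\<alpha> \<odot> \<eta> N \<in> weq M"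
    by (rule algebra_localization[OF alg assms(4) Mf' Bousfield_def weq_f_equivalences[OF Mf'] T_W' l'(1,2,3) L'f])
  have "map_weq M (onAr T f) N" using N(8) fibf' by (simp add: f_local_def)
  then have "map_weq M f N" by (rule map_weq_from_T[OF assms(5) _ N(9,10,11)])
  then have Nf: "fibrant (Bousfield M f) N" using N(9) Hom_Ob(1)[OF N(6)] fibf by (simp add: f_local_def)
  interpret B: model_category \<kappa> "Bousfield M f" by (rule Mf)
  have jW: "j \<in> ?W" using N(5) WW by blast
  have qW: "q \<in> ?W" using N(2) weq_f_equivalences[OF Mf] by blast
  have lq: "l \<odot> q \<in> Hom M Q L" "l \<odot> q \<in> ?W"
    using Comp_Hom[OF N(1) l(1)] B.weq_comp[of q Q X l L] N(1) l(1,2) qW by (simp_all add: eq)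
  \<comment> \<open>\<open>j\<close> is a trivial cofibration of the \<open>f\<close>-localized
    structure and \<open>L\<close> is fibrant there, so \<open>l \<odot> q\<close> extends along
    \<open>j\<close>. The extension is a map between \<open>f\<close>-local fibrant objects, to
    which the local Whitehead theorem applies.\<close>
  obtain h where h: "h \<in> Hom M N L" "h \<odot> j = l \<odot> q"
    using l(3) N(3,4) jW lq(1) unfolding B.fibrant_iff eq by blast
  have "h \<in> ?W" using B.weq_left[of j Q N h L] N(3) h jW lq(2) by (simp add: eq)
  then have hw: "h \<in> weq M"
    by (intro weq_between_local[OF assms(1) Mf Bousfield_def h(1) _ Nf l(3)]) (simp add: eq)
  let ?R = "\<lambda>A B. \<exists>w. w \<in> Hom M A B \<and> w \<in> weq M"
  have "equivclp ?R L N" using h(1) hw by (intro converse_r_into_equivclp) blast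
  moreover have "equivclp ?R N L'" using N(6,7) by (intro r_into_equivclp) blast
  ultimately have "equivclp ?R L L'" by (rule equivclp_trans)
  then show ?thesis using Hom_Ob(2)[OF l(1)] Hom_Ob(2)[OF l'(1)] by (simp add: weakly_equivalent_def)
qed

end
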